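(* For any (coloured symmetric) set-operad $P$ the category of discrete decomposition spaces (2-Segal presheaves) over $\mathrm{Tw}(P)$ is equivalent to the category of decomposition morphisms over $P$.
   Context: Operads are coloured symmetric operads in sets with identity operations; morphisms of operads may change colours. **Twisted arrow category $\mathrm{Tw}(P)$** of a $C$-coloured operad $P$. Objects: operations of $P$. A morphism with source $p\in P(c_1,\dots,c_n;c_0)$ is (uniquely) a tuple $f=(q_0;q_1,\dots,q_n;\lambda)$, where $q_0\in P$ has arity $m_0\ge 1$ and first input colour $c_0$, $q_i\in P$ ($1\le i\le n$) has arity $m_i\ge 0$ and output colour $c_i$, and $\lambda$ is a bijection from the set of leaves $\{(i,k):1\le i\le n,1\le k\le m_i\}\cup\{(0,k):2\le k\le m_0\}$ onto $\{1,\dots,N\}$ with $k\mapsto\lambda(i,k)$ increasing for each fixed $i$. The target is the operation $t$ with $t(x_1,\dots,x_N)=q_0\bigl(p(q_1(x_{\lambda(1,1)},\dots,x_{\lambda(1,m_1)}),\dots,q_n(x_{\lambda(n,1)},\dots)),x_{\lambda(0,2)},\dots,x_{\lambda(0,m_0)}\bigr)$. The composite of $f:p\to t$ with $g=(r_0;r_1,\dots,r_N;\mu):t\to u$ has upper vertices $q_i(r_{\lambda(i,1)},\dots,r_{\lambda(i,m_i)})$ and lower vertex $r_0\circ_1 q_0(\mathrm{id},r_{\lambda(0,2)},\dots,r_{\lambda(0,m_0)})$, with leaves numbered by $\mu$, and with inputs of each vertex (other than the first input of the lower one) then permuted so that the numbers increase. A morphism of operads $f:P_1\to P$ induces a functor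 $f_*:\mathrm{Tw}(P_1)\to\mathrm{Tw}(P)$ in the obvious way. The morphism $f$ is *upper* if $q_0$ is an identity operation, and *lower* if $q_1,\dots,q_n$ are identity operations and $\lambda(1,1)<\lambda(2,1)<\dots<\lambda(n,1)$. Active morphisms are composites of upper morphisms and isomorphisms; inert morphisms are composites of lower morphisms and isomorphisms. Any active morphism and inert morphism with a common source have a pushout in $\mathrm{Tw}(P)$. **Discrete decomposition space (2-Segal presheaf)** over $\mathrm{Tw}(P)$: a presheaf of sets $X$ on $\mathrm{Tw}(P)$ that sends the pushout square of any pair $(f,g)$ of maps with common source, $f$ active and $g$ inert, to a pullback square. Morphisms are morphisms of presheaves. **Decomposition morphism:** a morphism of operads $f:P_1\to P$ such that $f_*:\mathrm{Tw}(P_1)\to\mathrm{Tw}(P)$ is a discrete fibration. The category of decomposition morphisms over $P$ has decomposition morphisms $P_1\to P$ as objects and morphisms of operads over $P$ as morphisms. *)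

theory Defs
  imports Main "HOL-Library.FuncSet"
begin

section \<open>Categories\<close>

text \<open>\<open>Compose C g f\<close> is the composite \<open>g \<circ> f\<close>, meaningful when \<open>Dom C g = Cod C f\<close>.\<close>

record ('a, 'm) category =
  Obj :: "'a set"
  Arr :: "'m set"
  Dom :: "'m \<Rightarrow> 'a"
  Cod :: "'m \<Rightarrow> 'a"
  Ident :: "'a \<Rightarrow> 'm"
  Compose :: "'m \<Rightarrow> 'm \<Rightarrow> 'm"

locale category =
  fixes C :: "('a, 'm) category"
  assumes dom_obj: "f \<in> Arr C \<Longrightarrow> Dom C f \<in> Obj C"
    and cod_obj: "f \<in> Arr C \<Longrightarrow> Cod C f \<in> Obj C"
    and ident_arr: "x \<in> Obj C \<Longrightarrow> Ident C x \<in> Arr C"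
    and dom_ident: "x \<in> Obj C \<Longrightarrow> Dom C (Ident C x) = x"
    and cod_ident: "x \<in> Obj C \<Longrightarrow> Cod C (Ident C x) = x"
    and compose_arr: "\<lbrakk>f \<in> Arr C; g \<in> Arr C; Dom C g = Cod C f\<rbrakk> \<Longrightarrow> Compose C g f \<in> Arr C"
    and dom_compose: "\<lbrakk>f \<in> Arr C; g \<in> Arr C; Dom C g = Cod C f\<rbrakk>
      \<Longrightarrow> Dom C (Compose C g f) = Dom C f"
    and cod_compose: "\<lbrakk>f \<in> Arr C; g \<in> Arr C; Dom C g = Cod C f\<rbrakk>
      \<Longrightarrow> Cod C (Compose C g f) = Cod C g"
    and compose_ident_right: "f \<in> Arr C \<Longrightarrow> Compose C f (Ident C (Dom C f)) = f"
    and compose_ident_left: "f \<in> Arr C \<Longrightarrow> Compose C (Ident C (Cod C f)) f = f"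
    and compose_assoc: "\<lbrakk>f \<in> Arr C; g \<in> Arr C; h \<in> Arr C; Dom C g = Cod C f; Dom C h = Cod C g\<rbrakk>
      \<Longrightarrow> Compose C h (Compose C g f) = Compose C (Compose C h g) f"

definition full_subcategory :: "('a, 'm) category \<Rightarrow> 'a set \<Rightarrow> ('a, 'm) category" where
  "full_subcategory C S = C\<lparr>Obj := Obj C \<inter> S, Arr := {f \<in> Arr C. Dom C f \<in> S \<and> Cod C f \<in> S}\<rparr>"

definition iso :: "('a, 'm) category \<Rightarrow> 'm \<Rightarrow> bool" where
  "iso C f \<longleftrightarrow> f \<in> Arr C \<and>
    (\<exists>g \<in> Arr C. Dom C g = Cod C f \<and> Cod C g = Dom C f \<and>
      Compose C g f = Ident C (Dom C f) \<and> Compose C f g = Ident C (Cod C f))"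

inductive_set composites :: "('a, 'm) category \<Rightarrow> 'm set \<Rightarrow> 'm set"
  for C :: "('a, 'm) category" and S :: "'m set" where
  base: "f \<in> S \<Longrightarrow> f \<in> composites C S"
| step: "\<lbrakk>f \<in> composites C S; g \<in> composites C S; Dom C g = Cod C f\<rbrakk>
    \<Longrightarrow> Compose C g f \<in> composites C S"

text \<open>The square with sides \<open>f : a \<rightarrow> b\<close>, \<open>g : a \<rightarrow> c\<close>, \<open>h : b \<rightarrow> d\<close>, \<open>k : c \<rightarrow> d\<close>.\<close>

definition commuting_square :: "('a, 'm) category \<Rightarrow> 'm \<Rightarrow> 'm \<Rightarrow> 'm \<Rightarrow> 'm \<Rightarrow> bool" where
  "commuting_square C f g h k \<longleftrightarrow> {f, g, h, k} \<subseteq> Arr C \<and>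
    Dom C f = Dom C g \<and> Dom C h = Cod C f \<and> Dom C k = Cod C g \<and> Cod C h = Cod C k \<and>
    Compose C h f = Compose C k g"

definition pushout_square :: "('a, 'm) category \<Rightarrow> 'm \<Rightarrow> 'm \<Rightarrow> 'm \<Rightarrow> 'm \<Rightarrow> bool" where
  "pushout_square C f g h k \<longleftrightarrow> commuting_square C f g h k \<and>
    (\<forall>h' k'. commuting_square C f g h' k' \<longrightarrow>
      (\<exists>!u. u \<in> Arr C \<and> Dom C u = Cod C h \<and> Cod C u = Cod C h' \<and>
        Compose C u h = h' \<and> Compose C u k = k'))"

definition functor_between ::
  "('a, 'm) category \<Rightarrow> ('b, 'n) category \<Rightarrow> ('a \<Rightarrow> 'b) \<Rightarrow> ('m \<Rightarrow> 'n) \<Rightarrow> bool" where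
  "functor_between C D Fo Fm \<longleftrightarrow>
    (\<forall>x \<in> Obj C. Fo x \<in> Obj D \<and> Fm (Ident C x) = Ident D (Fo x)) \<and>
    (\<forall>f \<in> Arr C. Fm f \<in> Arr D \<and> Dom D (Fm f) = Fo (Dom C f) \<and> Cod D (Fm f) = Fo (Cod C f)) \<and>
    (\<forall>f \<in> Arr C. \<forall>g \<in> Arr C. Dom C g = Cod C f \<longrightarrow> Fm (Compose C g f) = Compose D (Fm g) (Fm f))"

definition natural_iso ::
  "('a, 'm) category \<Rightarrow> ('b, 'n) category \<Rightarrow> ('a \<Rightarrow> 'b) \<Rightarrow> ('m \<Rightarrow> 'n) \<Rightarrow> ('a \<Rightarrow> 'b) \<Rightarrow> ('m \<Rightarrow> 'n) \<Rightarrow>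
    ('a \<Rightarrow> 'n) \<Rightarrow> bool" where
  "natural_iso C D Fo Fm Go Gm \<tau> \<longleftrightarrow>
    (\<forall>x \<in> Obj C. iso D (\<tau> x) \<and> Dom D (\<tau> x) = Fo x \<and> Cod D (\<tau> x) = Go x) \<and>
    (\<forall>f \<in> Arr C. Compose D (\<tau> (Cod C f)) (Fm f) = Compose D (Gm f) (\<tau> (Dom C f)))"

definition equivalent_categories :: "('a, 'm) category \<Rightarrow> ('b, 'n) category \<Rightarrow> bool" where
  "equivalent_categories C D \<longleftrightarrow> category C \<and> category D \<and>
    (\<exists>Fo Fm Go Gm \<eta> \<epsilon>.
      functor_between C D Fo Fm \<and> functor_between D C Go Gm \<and>
      natural_iso C C id id (Go \<circ> Fo) (Gm \<circ> Fm) \<eta> \<and>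
      natural_iso D D (Fo \<circ> Go) (Fm \<circ> Gm) id id \<epsilon>)"

definition discrete_fibration ::
  "('a, 'm) category \<Rightarrow> ('b, 'n) category \<Rightarrow> ('a \<Rightarrow> 'b) \<Rightarrow> ('m \<Rightarrow> 'n) \<Rightarrow> bool" where
  "discrete_fibration E B Fo Fm \<longleftrightarrow> functor_between E B Fo Fm \<and>
    (\<forall>e \<in> Obj E. \<forall>f \<in> Arr B. Cod B f = Fo e \<longrightarrow>
      (\<exists>!g. g \<in> Arr E \<and> Cod E g = e \<and> Fm g = f))"


section \<open>Presheaves\<close>

text \<open>A type \<open>'u\<close> plays the role of the universe of small sets: a small set is a set of elements
  of \<open>'u\<close>, which for infinite \<open>'u\<close> means, up to bijection, a set of cardinality at most that of
  \<open>'u\<close>.  Presheaves take values in such sets.  The values of the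
  two fields outside objects, arrows and sections are irrelevant: presheaves that differ only there
  are isomorphic in the category below.  Morphisms, on the other hand, must be extensional
  (\<open>\<Pi>\<^sub>E\<close>), since otherwise one morphism would be represented many times.\<close>

record ('a, 'm, 'u) presheaf =
  Sect :: "'a \<Rightarrow> 'u set"
  Restr :: "'m \<Rightarrow> 'u \<Rightarrow> 'u"

type_synonym ('a, 'm, 'u) presheaf_arr =
  "('a, 'm, 'u) presheaf \<times> ('a, 'm, 'u) presheaf \<times> ('a \<Rightarrow> 'u \<Rightarrow> 'u)"

definition presheaf_on :: "('a, 'm) category \<Rightarrow> ('a, 'm, 'u) presheaf \<Rightarrow> bool" where
  "presheaf_on C X \<longleftrightarrow>
    (\<forall>f \<in> Arr C. Restr X f \<in> Sect X (Cod C f) \<rightarrow> Sect X (Dom C f)) \<and>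
    (\<forall>a \<in> Obj C. \<forall>x \<in> Sect X a. Restr X (Ident C a) x = x) \<and>
    (\<forall>f \<in> Arr C. \<forall>g \<in> Arr C. Dom C g = Cod C f \<longrightarrow>
      (\<forall>x \<in> Sect X (Cod C g). Restr X (Compose C g f) x = Restr X f (Restr X g x)))"

definition presheaf_maps ::
  "('a, 'm) category \<Rightarrow> ('a, 'm, 'u) presheaf \<Rightarrow> ('a, 'm, 'u) presheaf \<Rightarrow> ('a \<Rightarrow> 'u \<Rightarrow> 'u) set" where
  "presheaf_maps C X Y = {\<alpha> \<in> (\<Pi>\<^sub>E a \<in> Obj C. Sect X a \<rightarrow>\<^sub>E Sect Y a).
    \<forall>f \<in> Arr C. \<forall>x \<in> Sect X (Cod C f). \<alpha> (Dom C f) (Restr X f x) = Restr Y f (\<alpha> (Cod C f) x)}"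

definition presheaf_category ::
  "('a, 'm) category \<Rightarrow> (('a, 'm, 'u) presheaf, ('a, 'm, 'u) presheaf_arr) category" where
  "presheaf_category C =
    \<lparr>Obj = {X. presheaf_on C X},
     Arr = {(X, Y, \<alpha>). presheaf_on C X \<and> presheaf_on C Y \<and> \<alpha> \<in> presheaf_maps C X Y},
     Dom = (\<lambda>(X, Y, \<alpha>). X),
     Cod = (\<lambda>(X, Y, \<alpha>). Y),
     Ident = (\<lambda>X. (X, X, \<lambda>a \<in> Obj C. \<lambda>x \<in> Sect X a. x)),
     Compose = (\<lambda>(Y', Z, \<beta>) (X, Y, \<alpha>). (X, Z, \<lambda>a \<in> Obj C. compose (Sect X a) (\<beta> a) (\<alpha> a)))\<rparr>"


section \<open>Coloured symmetric operads\<close>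

text \<open>\<open>perm_list n xs\<close>: the list \<open>xs\<close> is a permutation \<open>k \<mapsto> xs ! k\<close> of \<open>{0..<n}\<close>.\<close>

definition perm_list :: "nat \<Rightarrow> nat list \<Rightarrow> bool" where
  "perm_list n xs \<longleftrightarrow> distinct xs \<and> set xs = {..<n}"

text \<open>Operations of all profiles form the one set \<open>Ops P\<close>; an operation \<open>p\<close> belongs to
  \<open>P(c\<^sub>1, \<dots>, c\<^sub>n; c\<^sub>0)\<close> if \<open>in_colours P p = [c\<^sub>1, \<dots>, c\<^sub>n]\<close> and \<open>out_colour P p = c\<^sub>0\<close>.
  Positions are counted from \<open>0\<close>.  \<open>Subst P p [q\<^sub>1, \<dots>, q\<^sub>n]\<close> is \<open>p(q\<^sub>1(\<dots>), \<dots>, q\<^sub>n(\<dots>))\<close>, with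
  the inputs in the order in which they are written.  The symmetric group action is
  \<open>(Act P p xs)(x\<^sub>0, \<dots>, x\<^sub>n\<^sub>-\<^sub>1) = p(x\<^bsub>xs!0\<^esub>, \<dots>, x\<^bsub>xs!(n-1)\<^esub>)\<close>, a left action.\<close>

record ('c, 'o) operad =
  Colours :: "'c set"
  Ops :: "'o set"
  in_colours :: "'o \<Rightarrow> 'c list"
  out_colour :: "'o \<Rightarrow> 'c"
  Unit :: "'c \<Rightarrow> 'o"
  Subst :: "'o \<Rightarrow> 'o list \<Rightarrow> 'o"
  Act :: "'o \<Rightarrow> nat list \<Rightarrow> 'o"

abbreviation arity :: "('c, 'o) operad \<Rightarrow> 'o \<Rightarrow> nat" where
  "arity P p \<equiv> length (in_colours P p)"

definition substitutable :: "('c, 'o) operad \<Rightarrow> 'o \<Rightarrow> 'o list \<Rightarrow> bool" where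
  "substitutable P p qs \<longleftrightarrow> p \<in> Ops P \<and> set qs \<subseteq> Ops P \<and> map (out_colour P) qs = in_colours P p"

text \<open>The position in \<open>p(q\<^sub>0(\<dots>), q\<^sub>1(\<dots>), \<dots>)\<close> of the first input of \<open>q\<^sub>i\<close>.\<close>

definition offset :: "('c, 'o) operad \<Rightarrow> 'o list \<Rightarrow> nat \<Rightarrow> nat" where
  "offset P qs i = sum_list (map (arity P) (take i qs))"

locale operad =
  fixes P :: "('c, 'o) operad"
  assumes inputs_colours: "p \<in> Ops P \<Longrightarrow> set (in_colours P p) \<subseteq> Colours P"
    and output_colour: "p \<in> Ops P \<Longrightarrow> out_colour P p \<in> Colours P"
    and Unit_op: "c \<in> Colours P \<Longrightarrow> Unit P c \<in> Ops P"
    and Unit_inputs: "c \<in> Colours P \<Longrightarrow> in_colours P (Unit P c) = [c]"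
    and Unit_output: "c \<in> Colours P \<Longrightarrow> out_colour P (Unit P c) = c"
    and Subst_op: "substitutable P p qs \<Longrightarrow> Subst P p qs \<in> Ops P"
    and Subst_inputs: "substitutable P p qs \<Longrightarrow> in_colours P (Subst P p qs) = concat (map (in_colours P) qs)"
    and Subst_output: "substitutable P p qs \<Longrightarrow> out_colour P (Subst P p qs) = out_colour P p"
    and Unit_Subst: "p \<in> Ops P \<Longrightarrow> Subst P (Unit P (out_colour P p)) [p] = p"
    and Subst_Unit: "p \<in> Ops P \<Longrightarrow> Subst P p (map (Unit P) (in_colours P p)) = p"
    and Subst_assoc: "\<lbrakk>substitutable P p qs; list_all2 (substitutable P) qs rss\<rbrakk>
      \<Longrightarrow> Subst P (Subst P p qs) (concat rss) = Subst P p (map2 (Subst P) qs rss)"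
    and Act_op: "\<lbrakk>p \<in> Ops P; perm_list (arity P p) xs\<rbrakk> \<Longrightarrow> Act P p xs \<in> Ops P"
    and Act_arity: "\<lbrakk>p \<in> Ops P; perm_list (arity P p) xs\<rbrakk> \<Longrightarrow> arity P (Act P p xs) = arity P p"
    and Act_inputs: "\<lbrakk>p \<in> Ops P; perm_list (arity P p) xs; k < arity P p\<rbrakk>
      \<Longrightarrow> in_colours P (Act P p xs) ! (xs ! k) = in_colours P p ! k"
    and Act_output: "\<lbrakk>p \<in> Ops P; perm_list (arity P p) xs\<rbrakk> \<Longrightarrow> out_colour P (Act P p xs) = out_colour P p"
    and Act_id: "p \<in> Ops P \<Longrightarrow> Act P p [0..<arity P p] = p"
    and Act_Act: "\<lbrakk>p \<in> Ops P; perm_list (arity P p) xs; perm_list (arity P p) ys\<rbrakk>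
      \<Longrightarrow> Act P (Act P p xs) ys = Act P p (map ((!) ys) xs)"
    and Subst_Act_outer:
      "\<lbrakk>p \<in> Ops P; perm_list (arity P p) xs; substitutable P (Act P p xs) qs\<rbrakk>
      \<Longrightarrow> Subst P (Act P p xs) qs =
        Act P (Subst P p (map ((!) qs) xs))
          (concat (map (\<lambda>i. [offset P qs i ..< offset P qs (Suc i)]) xs))"
    and Subst_Act_inner:
      "\<lbrakk>substitutable P p qs; list_all2 (\<lambda>q ys. perm_list (arity P q) ys) qs yss\<rbrakk>
      \<Longrightarrow> Subst P p (map2 (Act P) qs yss) =
        Act P (Subst P p qs)
          (concat (map2 (\<lambda>i ys. map ((+) (offset P qs i)) ys) [0..<length qs] yss))"

record ('c, 'o, 'd, 'p) operad_map =
  col_map :: "'c \<Rightarrow> 'd"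
  op_map :: "'o \<Rightarrow> 'p"

definition operad_maps :: "('c, 'o) operad \<Rightarrow> ('d, 'p) operad \<Rightarrow> ('c, 'o, 'd, 'p) operad_map set" where
  "operad_maps P Q = {f.
    col_map f \<in> Colours P \<rightarrow>\<^sub>E Colours Q \<and>
    op_map f \<in> Ops P \<rightarrow>\<^sub>E Ops Q \<and>
    (\<forall>p \<in> Ops P. in_colours Q (op_map f p) = map (col_map f) (in_colours P p)) \<and>
    (\<forall>p \<in> Ops P. out_colour Q (op_map f p) = col_map f (out_colour P p)) \<and>
    (\<forall>c \<in> Colours P. op_map f (Unit P c) = Unit Q (col_map f c)) \<and>
    (\<forall>p qs. substitutable P p qs \<longrightarrow>
      op_map f (Subst P p qs) = Subst Q (op_map f p) (map (op_map f) qs)) \<and>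
    (\<forall>p \<in> Ops P. \<forall>xs. perm_list (arity P p) xs \<longrightarrow> op_map f (Act P p xs) = Act Q (op_map f p) xs)}"

definition operad_map_id :: "('c, 'o) operad \<Rightarrow> ('c, 'o, 'c, 'o) operad_map" where
  "operad_map_id P = \<lparr>col_map = (\<lambda>c \<in> Colours P. c), op_map = (\<lambda>p \<in> Ops P. p)\<rparr>"

definition operad_map_comp :: "('c, 'o) operad \<Rightarrow> ('d, 'p, 'e, 'q) operad_map \<Rightarrow>
    ('c, 'o, 'd, 'p) operad_map \<Rightarrow> ('c, 'o, 'e, 'q) operad_map" where
  "operad_map_comp P g f =
    \<lparr>col_map = compose (Colours P) (col_map g) (col_map f),
     op_map = compose (Ops P) (op_map g) (op_map f)\<rparr>"

text \<open>Operads over \<open>P\<close> are small: their colours and their operations are elements of \<open>'u\<close>.\<close>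

type_synonym ('c, 'o, 'u) operad_over = "('u, 'u) operad \<times> ('u, 'u, 'c, 'o) operad_map"

type_synonym ('c, 'o, 'u) operad_over_arr =
  "('c, 'o, 'u) operad_over \<times> ('c, 'o, 'u) operad_over \<times> ('u, 'u, 'u, 'u) operad_map"

definition operads_over ::
  "('c, 'o) operad \<Rightarrow> (('c, 'o, 'u) operad_over, ('c, 'o, 'u) operad_over_arr) category" where
  "operads_over P =
    \<lparr>Obj = {(Q, f). operad Q \<and> f \<in> operad_maps Q P},
     Arr = {((Q, f), (R, g), h).
       operad Q \<and> f \<in> operad_maps Q P \<and> operad R \<and> g \<in> operad_maps R P \<and>
       h \<in> operad_maps Q R \<and> operad_map_comp Q g h = f},
     Dom = (\<lambda>(A, B, h). A),
     Cod = (\<lambda>(A, B, h). B),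
     Ident = (\<lambda>A. (A, A, operad_map_id (fst A))),
     Compose = (\<lambda>(B', D, k) (A, B, h). (A, D, operad_map_comp (fst A) k h))\<rparr>"


section \<open>The twisted arrow category of an operad\<close>

text \<open>An arrow \<open>(q\<^sub>0; q\<^sub>1, \<dots>, q\<^sub>n; \<lambda>)\<close> with source \<open>p\<close>: \<open>lower\<close> is \<open>q\<^sub>0\<close> and \<open>uppers\<close> is
  \<open>[q\<^sub>1, \<dots>, q\<^sub>n]\<close>.  The bijection \<open>\<lambda>\<close> is recorded by its values, \<open>lower_leaves\<close> being
  \<open>[\<lambda>(0,2), \<dots>, \<lambda>(0,m\<^sub>0)]\<close> and the \<open>i\<close>-th entry of \<open>upper_leaves\<close> being
  \<open>[\<lambda>(i,1), \<dots>, \<lambda>(i,m\<^sub>i)]\<close>, except that leaves are numbered from \<open>0\<close> instead of \<open>1\<close>.\<close>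

record 'o tw_arr =
  source :: 'o
  lower :: 'o
  uppers :: "'o list"
  lower_leaves :: "nat list"
  upper_leaves :: "nat list list"

definition tw_arrows :: "('c, 'o) operad \<Rightarrow> 'o tw_arr set" where
  "tw_arrows P = {f.
    source f \<in> Ops P \<and>
    lower f \<in> Ops P \<and> in_colours P (lower f) \<noteq> [] \<and> hd (in_colours P (lower f)) = out_colour P (source f) \<and>
    set (uppers f) \<subseteq> Ops P \<and> map (out_colour P) (uppers f) = in_colours P (source f) \<and>
    length (lower_leaves f) = arity P (lower f) - 1 \<and>
    map length (upper_leaves f) = map (arity P) (uppers f) \<and>
    perm_list (length (concat (upper_leaves f)) + length (lower_leaves f))
      (concat (upper_leaves f) @ lower_leaves f) \<and>
    sorted_wrt (<) (lower_leaves f) \<and> (\<forall>ls \<in> set (upper_leaves f). sorted_wrt (<) ls)}"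

text \<open>\<open>subst_first P r s\<close> is the partial composite \<open>r \<circ>\<^sub>1 s\<close>.\<close>

definition subst_first :: "('c, 'o) operad \<Rightarrow> 'o \<Rightarrow> 'o \<Rightarrow> 'o" where
  "subst_first P r s = Subst P r (s # map (Unit P) (tl (in_colours P r)))"

definition tw_target :: "('c, 'o) operad \<Rightarrow> 'o tw_arr \<Rightarrow> 'o" where
  "tw_target P f = Act P (subst_first P (lower f) (Subst P (source f) (uppers f)))
    (concat (upper_leaves f) @ lower_leaves f)"

definition tw_ident :: "('c, 'o) operad \<Rightarrow> 'o \<Rightarrow> 'o tw_arr" where
  "tw_ident P p =
    \<lparr>source = p, lower = Unit P (out_colour P p), uppers = map (Unit P) (in_colours P p),
     lower_leaves = [], upper_leaves = map (\<lambda>i. [i]) [0..<arity P p]\<rparr>"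

text \<open>If the inputs of \<open>q\<close> carry the pairwise distinct numbers \<open>ls\<close>, then \<open>Act P q (ranks ls)\<close> is
  \<open>q\<close> with its inputs permuted so that their numbers increase, i.e. become \<open>sort ls\<close>.\<close>

definition ranks :: "nat list \<Rightarrow> nat list" where
  "ranks ls = map (\<lambda>l. card {l' \<in> set ls. l' < l}) ls"

text \<open>\<open>tw_compose P g f\<close> is the composite of \<open>f = (q\<^sub>0; q\<^sub>1, \<dots>, q\<^sub>n; \<lambda>)\<close> followed by
  \<open>g = (r\<^sub>0; r\<^sub>1, \<dots>, r\<^sub>N; \<mu>)\<close>.  The leaf of \<open>f\<close> with number \<open>l\<close> receives \<open>r\<^sub>l\<close>, the leaves of
  which have numbers \<open>upper_leaves g ! l\<close>.\<close>

definition tw_compose :: "('c, 'o) operad \<Rightarrow> 'o tw_arr \<Rightarrow> 'o tw_arr \<Rightarrow> 'o tw_arr" where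
  "tw_compose P g f =
    (let grafted = (\<lambda>ls. map ((!) (uppers g)) ls);
         numbers = (\<lambda>ls. concat (map ((!) (upper_leaves g)) ls));
         lower_numbers = numbers (lower_leaves f) @ lower_leaves g
     in
      \<lparr>source = source f,
       lower = Act P
         (subst_first P (lower g)
           (Subst P (lower f) (Unit P (out_colour P (source f)) # grafted (lower_leaves f))))
         (0 # map Suc (ranks lower_numbers)),
       uppers = map2 (\<lambda>q ls. Act P (Subst P q (grafted ls)) (ranks (numbers ls)))
         (uppers f) (upper_leaves f),
       lower_leaves = sort lower_numbers,
       upper_leaves = map (\<lambda>ls. sort (numbers ls)) (upper_leaves f)\<rparr>)"

definition Tw :: "('c, 'o) operad \<Rightarrow> ('o, 'o tw_arr) category" where
  "Tw P = \<lparr>Obj = Ops P, Arr = tw_arrows P, Dom = source, Cod = tw_target P,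
     Ident = tw_ident P, Compose = tw_compose P\<rparr>"

definition tw_map :: "('c, 'o, 'd, 'p) operad_map \<Rightarrow> 'o tw_arr \<Rightarrow> 'p tw_arr" where
  "tw_map F f =
    \<lparr>source = op_map F (source f), lower = op_map F (lower f), uppers = map (op_map F) (uppers f),
     lower_leaves = lower_leaves f, upper_leaves = upper_leaves f\<rparr>"

definition upper_arrows :: "('c, 'o) operad \<Rightarrow> 'o tw_arr set" where
  "upper_arrows P = {f \<in> tw_arrows P. lower f \<in> Unit P ` Colours P}"

definition lower_arrows :: "('c, 'o) operad \<Rightarrow> 'o tw_arr set" where
  "lower_arrows P = {f \<in> tw_arrows P. set (uppers f) \<subseteq> Unit P ` Colours P \<and>
    sorted_wrt (<) (map hd (upper_leaves f))}"

definition active_arrows :: "('c, 'o) operad \<Rightarrow> 'o tw_arr set" where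
  "active_arrows P = composites (Tw P) (upper_arrows P \<union> {f. iso (Tw P) f})"

definition inert_arrows :: "('c, 'o) operad \<Rightarrow> 'o tw_arr set" where
  "inert_arrows P = composites (Tw P) (lower_arrows P \<union> {f. iso (Tw P) f})"


section \<open>Decomposition spaces and decomposition morphisms\<close>

definition sends_to_pullback :: "('a, 'm) category \<Rightarrow> ('a, 'm, 'u) presheaf \<Rightarrow>
    'm \<Rightarrow> 'm \<Rightarrow> 'm \<Rightarrow> 'm \<Rightarrow> bool" where
  "sends_to_pullback C X f g h k \<longleftrightarrow>
    bij_betw (\<lambda>z. (Restr X h z, Restr X k z)) (Sect X (Cod C h))
      {(x, y). x \<in> Sect X (Cod C f) \<and> y \<in> Sect X (Cod C g) \<and> Restr X f x = Restr X g y}"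

definition decomposition_space :: "('c, 'o) operad \<Rightarrow> ('o, 'o tw_arr, 'u) presheaf \<Rightarrow> bool" where
  "decomposition_space P X \<longleftrightarrow> presheaf_on (Tw P) X \<and>
    (\<forall>f \<in> active_arrows P. \<forall>g \<in> inert_arrows P. \<forall>h k.
      pushout_square (Tw P) f g h k \<longrightarrow> sends_to_pullback (Tw P) X f g h k)"

definition decomposition_spaces :: "('c, 'o) operad \<Rightarrow>
    (('o, 'o tw_arr, 'u) presheaf, ('o, 'o tw_arr, 'u) presheaf_arr) category" where
  "decomposition_spaces P = full_subcategory (presheaf_category (Tw P)) {X. decomposition_space P X}"

definition decomposition_morphism ::
  "('d, 'p) operad \<Rightarrow> ('c, 'o) operad \<Rightarrow> ('d, 'p, 'c, 'o) operad_map \<Rightarrow> bool" where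
  "decomposition_morphism Q P f \<longleftrightarrow> f \<in> operad_maps Q P \<and>
    discrete_fibration (Tw Q) (Tw P) (op_map f) (tw_map f)"

definition decomposition_morphisms :: "('c, 'o) operad \<Rightarrow>
    (('c, 'o, 'u) operad_over, ('c, 'o, 'u) operad_over_arr) category" where
  "decomposition_morphisms P =
    full_subcategory (operads_over P) {(Q, f). decomposition_morphism Q P f}"

end

theory Submission
  imports Defs "HOL-Library.Multiset"
begin

text \<open>A decomposition morphism \<open>F : Q \<rightarrow> P\<close> is sent to the presheaf of its fibres on operations, restriction
  being given by the sources of the unique lifts of arrows. Lifts of active and inert arrows are
  active and inert, and the pushout in \<open>Tw Q\<close> of two such lifts provides the unique element asked
  for by the pullback condition. Every arrow of \<open>Tw P\<close> is composed of elementary arrows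
  \<open>p \<rightarrow> p(q\<^sub>1, \<dots>, q\<^sub>n)\<close>, \<open>q\<^sub>i \<rightarrow> p(q\<^sub>1, \<dots>, q\<^sub>n)\<close> and \<open>p \<rightarrow> p\<sigma>\<close>, so the operad structure of \<open>Q\<close>
  can be read off from the restrictions along these; hence the functor is full and faithful.
  Conversely, a decomposition space \<open>X\<close> is the fibre presheaf of the operad whose operations are the
  elements of \<open>X\<close>: iterated pushouts show that an element over \<open>p(q\<^sub>1, \<dots>, q\<^sub>n)\<close> is the same as
  elements over \<open>p, q\<^sub>1, \<dots>, q\<^sub>n\<close> with matching restrictions to units, and this defines the
  composition; its axioms are relations between composites of elementary arrows. All relations in
  \<open>Tw P\<close> are verified by viewing an arrow as a tuple of terms of the free algebra on labels, which
  turns composition into substitution.\<close>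

text \<open>\<open>tw_compose\<close> sorts the leaf numbers at every vertex and permutes the
  operations accordingly, so a direct proof of associativity would be a calculation with block
  permutations. Terms divide these out: an orbit with pairwise distinct labels has exactly one
  member with increasing labels, so an arrow is recovered from its terms (\<open>arrow_eqI\<close>,
  \<open>arrow_exists\<close>). The lower vertex becomes a context, a term with one occurrence of a
  label reserved for the source.

  Active and inert arrows are given as closures under composition. What is used of them is that the
  lower vertex of an active arrow and the upper vertices of an inert one are invertible unary terms.
  This is enough to build pushouts in \<open>Tw Q\<close>, where lifted squares have to be
  completed. In the other direction the pullback condition is applied to the pushouts that graft one
  operation on one input; general composites follow by induction.

  The sections of a presheaf over different operations may intersect, whereas the operations of an
  operad form one set. Hence elements have to be tagged with the operation below them inside
  \<open>'u\<close>, and \<open>'u\<close> must be large enough for that.\<close>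

abbreviation "src \<equiv> source"
abbreviation "ul \<equiv> upper_leaves"
abbreviation "ll \<equiv> lower_leaves"

section \<open>Permutations of positions\<close>

lemma perm_list_length: "perm_list n xs \<Longrightarrow> length xs = n" unfolding perm_list_def by (metis card_lessThan distinct_card)

lemma perm_list_nth_less: "perm_list n xs \<Longrightarrow> k < n \<Longrightarrow> xs ! k < n"
  by (metis lessThan_iff nth_mem perm_list_def perm_list_length)

lemma perm_list_mem_less: "perm_list n xs \<Longrightarrow> k \<in> set xs \<Longrightarrow> k < n" by (simp add: perm_list_def)

lemma perm_list_ex_index: "perm_list n xs \<Longrightarrow> j < n \<Longrightarrow> \<exists>k<n. xs ! k = j"
  by (metis in_set_conv_nth lessThan_iff perm_list_def perm_list_length)

lemma perm_list_upt [simp]: "perm_list n [0..<n]" by (auto simp: perm_list_def)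

lemma perm_listI: "length xs = n \<Longrightarrow> set xs = {..<n} \<Longrightarrow> perm_list n xs" by (simp add: perm_list_def card_distinct)

lemma perm_list_comp:
  assumes "perm_list n xs" "perm_list n ys"
  shows "perm_list n (map ((!) ys) xs)"
proof -
  have "set ys = (!) ys ` {..<n}" using perm_list_length[OF assms(2)] by (auto simp: set_conv_nth image_iff)
  then show ?thesis using assms perm_list_length[OF assms(1)] by (intro perm_listI) (auto simp: perm_list_def)
qed

text \<open>\<open>ys\<close> is \<open>zs\<close> composed with the inverse \<open>ix\<close> of
  \<open>xs\<close>. This solves for the second permutation in \<open>Act_Act\<close>, so that an
  orbit can be described from any of its members.\<close>

lemma perm_list_factor:
  assumes "perm_list n xs" "perm_list n zs"
  obtains ys where "perm_list n ys" "map ((!) ys) xs = zs"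
proof -
  define ix where "ix j = (SOME k. k < n \<and> xs ! k = j)" for j
  have ix: "ix j < n \<and> xs ! ix j = j" if "j < n" for j unfolding ix_def by (rule someI_ex) (use perm_list_ex_index[OF assms(1) that] in blast)
  have ix2: "ix (xs ! k) = k" if "k < n" for k using ix[OF perm_list_nth_less[OF assms(1) that]] assms(1) that
    by (metis nth_eq_iff_index_eq perm_list_def perm_list_length)
  define ys where "ys = map (\<lambda>j. zs ! ix j) [0..<n]"
  have eq: "map ((!) ys) xs = zs" using perm_list_length[OF assms(1)] perm_list_length[OF assms(2)] perm_list_nth_less[OF assms(1)]
    by (auto intro!: nth_equalityI simp: ys_def ix2)
  have "perm_list n ys"
  proof (rule perm_listI)
    show "length ys = n" by (simp add: ys_def)
    show "set ys = {..<n}"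
    proof
      show "set ys \<subseteq> {..<n}" using ix perm_list_nth_less[OF assms(2)] by (auto simp: ys_def)
      show "{..<n} \<subseteq> set ys"
      proof
        fix j assume "j \<in> {..<n}"
        then obtain k where k: "k < n" "zs ! k = j" using perm_list_ex_index[OF assms(2)] by auto
        then have "ys ! (xs ! k) = j" using perm_list_nth_less[OF assms(1) k(1)] by (simp add: ys_def ix2)
        then show "j \<in> set ys" using perm_list_nth_less[OF assms(1) k(1)] by (metis \<open>length ys = n\<close> nth_mem)
      qed
    qed
  qed
  with eq that show ?thesis by blast
qed

lemma map_nth_perm_cancel:
  assumes "perm_list n xs" "length as = n" "length bs = n" "map ((!) as) xs = map ((!) bs) xs"
  shows "as = bs"
proof (rule nth_equalityI)
  show "length as = length bs" using assms by simp
  fix j assume "j < length as"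
  then obtain k where "k < n" "xs ! k = j" using perm_list_ex_index assms by blast
  then show "as ! j = bs ! j" using assms perm_list_length[OF assms(1)] by (metis nth_map)
qed

text \<open>Multisets forget the order, so a concatenation of blocks can be recognised as a
  permutation without computing an inverse.\<close>

lemma perm_list_mset: "perm_list n xs \<longleftrightarrow> mset xs = mset [0..<n]"
proof
  assume "perm_list n xs"
  then have "distinct xs" "set xs = set [0..<n]" unfolding perm_list_def atLeast_upt by blast+
  then show "mset xs = mset [0..<n]" using set_eq_iff_mset_eq_distinct distinct_upt by blast
next
  assume m: "mset xs = mset [0..<n]"
  have "set xs = {..<n}" using mset_eq_setD[OF m] unfolding atLeast_upt .
  moreover have "distinct xs" using mset_eq_imp_distinct_iff[OF m] by simp
  ultimately show "perm_list n xs" by (simp add: perm_list_def)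
qed

lemma mset_map_nth_perm:
  assumes "perm_list n xs" "length as = n"
  shows "mset (map ((!) as) xs) = mset as"
proof -
  have "mset (map ((!) as) xs) = image_mset ((!) as) (mset [0..<n])" using assms by (simp only: mset_map perm_list_mset)
  also have "\<dots> = mset (map ((!) as) [0..<n])" by (simp only: mset_map)
  also have "\<dots> = mset as" using assms(2) by (simp only: map_nth flip: assms(2))
  finally show ?thesis .
qed

lemma length_concat_perm:
  assumes "perm_list n xs" "length ass = n"
  shows "length (concat (map ((!) ass) xs)) = length (concat ass)"
proof -
  have c: "length (concat bss) = sum_mset (image_mset length (mset bss))" for bss :: "'a list list" by (induction bss) auto
  show ?thesis unfolding c mset_map_nth_perm[OF assms] ..
qed

lemma obtain_perm_of_mset_eq:
  assumes m: "mset as = mset bs" and d: "distinct as"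
  obtains xs where "perm_list (length as) xs" "map ((!) as) xs = bs"
proof -
  have s: "set as = set bs" using mset_eq_setD[OF m] .
  have db: "distinct bs" using mset_eq_imp_distinct_iff[OF m] d by blast
  have l: "length as = length bs" using mset_eq_length[OF m] .
  have "\<forall>b \<in> set bs. \<exists>k. k < length as \<and> as ! k = b" unfolding s[symmetric] by (simp add: in_set_conv_nth)
  then obtain ix where ix: "\<forall>b \<in> set bs. ix b < length as \<and> as ! ix b = b" by metis
  then have e: "map ((!) as) (map ix bs) = bs" by (simp add: map_idI)
  have "inj_on ix (set bs)" using ix by (metis inj_onI)
  then have "distinct (map ix bs)" using db by (simp add: distinct_map)
  moreover have sub: "set (map ix bs) \<subseteq> {..<length as}" using ix by auto
  ultimately have "set (map ix bs) = {..<length as}" using card_subset_eq[OF finite_lessThan sub] distinct_card[of "map ix bs"] l by simp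
  then have "perm_list (length as) (map ix bs)" by (intro perm_listI) (simp_all add: l)
  with e that show ?thesis by blast
qed

section \<open>Terms\<close>

text \<open>Elements of the free algebra on coloured labels: the classes of pairs of an operation and
  a list of coloured labels under the simultaneous permutation action. The empty set plays the role of an
  undefined term; all operations on terms are strict in it, so that most equations between terms
  hold without typing hypotheses.\<close>

datatype ('c, 'o) trm = Trm "('o \<times> ('c \<times> nat) list) set"

context operad
begin

abbreviation "ar \<equiv> arity P"
abbreviation "ins \<equiv> in_colours P"
abbreviation "out \<equiv> out_colour P"
abbreviation "sub \<equiv> substitutable P"
abbreviation "arrs \<equiv> tw_arrows P"
abbreviation "tgt \<equiv> tw_target P"
abbreviation "cmp \<equiv> tw_compose P"

text \<open>An orbit written from one of its points. Acting by \<open>xs\<close> moves input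
  \<open>k\<close> of \<open>q\<close> to position \<open>xs ! k\<close>, so the new label list must
  carry there what \<open>ls\<close> has at \<open>k\<close>. With orbits as plain sets of pairs,
  equality of terms is equality of sets and no quotient has to be formed.\<close>

definition cls :: "'o \<Rightarrow> ('c \<times> nat) list \<Rightarrow> ('c, 'o) trm" where
  "cls q ls = Trm {(Act P q xs, ls') | xs ls'.
    perm_list (ar q) xs \<and> length ls' = ar q \<and> map ((!) ls') xs = ls}"

end

abbreviation undefined_term :: "('c, 'o) trm" where
  "undefined_term \<equiv> Trm {}"

context operad
begin

definition labelled :: "'o \<times> ('c \<times> nat) list \<Rightarrow> bool" where
  "labelled r \<longleftrightarrow> fst r \<in> Ops P \<and> map fst (snd r) = ins (fst r)"

abbreviation "labs \<equiv> list_all2 (\<lambda>q ls. labelled (q, ls))"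
abbreviation "clss qs lss \<equiv> map2 (\<lambda>q ls. cls q (zip (ins q) ls)) qs lss"

definition is_term :: "('c, 'o) trm \<Rightarrow> bool" where
  "is_term T \<longleftrightarrow> (\<exists>r. labelled r \<and> T = cls (fst r) (snd r))"

definition rep :: "('c, 'o) trm \<Rightarrow> 'o \<times> ('c \<times> nat) list" where
  "rep T = (SOME r. labelled r \<and> T = cls (fst r) (snd r))"

definition outc :: "('c, 'o) trm \<Rightarrow> 'c" where
  "outc T = out (fst (rep T))"

definition clab :: "('c, 'o) trm \<Rightarrow> ('c \<times> nat) multiset" where
  "clab T = (if is_term T then mset (snd (rep T)) else {#})"

text \<open>The action of operations on terms, computed with the representatives chosen by
  \<open>rep\<close>; \<open>appl_cls\<close> shows that the choice is immaterial.\<close>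

definition appl :: "'o \<Rightarrow> ('c, 'o) trm list
    \<Rightarrow> ('c, 'o) trm" where
  "appl p ts = (if p \<in> Ops P \<and> (\<forall>t \<in> set ts. is_term t) \<and> map outc ts = ins p
    then cls (Subst P p (map (fst \<circ> rep) ts)) (concat (map (snd \<circ> rep) ts)) else undefined_term)"

definition bind :: "('c \<times> nat \<Rightarrow> ('c, 'o) trm)
    \<Rightarrow> ('c, 'o) trm \<Rightarrow> ('c, 'o) trm" where
  "bind \<sigma> T = (if is_term T then appl (fst (rep T)) (map \<sigma> (snd (rep T))) else undefined_term)"

definition var :: "'c \<times> nat \<Rightarrow> ('c, 'o) trm" where
  "var x = cls (Unit P (fst x)) [x]"

end

section \<open>Blocks of positions in a composite operation\<close>

lemma nth_concat_offset:
  assumes "i < length xss" "j < length (xss ! i)"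
  shows "concat xss ! (sum_list (map length (take i xss)) + j) = xss ! i ! j" using assms
proof (induction xss arbitrary: i)
  case (Cons xs xss)
  then show ?case by (cases i) (auto simp: nth_append)
qed simp

lemma offset_nth_concat:
  assumes "map length lss = map (arity P) qs" "i < length qs" "j < arity P (qs ! i)"
  shows "concat lss ! (offset P qs i + j) = lss ! i ! j"
proof -
  have l: "length lss = length qs" using assms(1) by (metis length_map)
  have "map (arity P) (take i qs) = map length (take i lss)" using assms(1) by (metis take_map)
  moreover have "length (lss ! i) = arity P (qs ! i)" using assms l by (metis nth_map)
  ultimately show ?thesis using nth_concat_offset[of i lss j] assms l by (simp add: offset_def)
qed

lemma offset_Suc: "i < length qs \<Longrightarrow> offset P qs (Suc i) = offset P qs i + arity P (qs ! i)"
  by (simp add: offset_def take_Suc_conv_app_nth)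

lemma offset_length: "offset P qs (length qs) = length (concat (map (in_colours P) qs))" by (simp add: offset_def length_concat comp_def)

lemma offset_le:
  assumes "i < length qs" 
  shows "offset P qs i + arity P (qs ! i) \<le> length (concat (map (in_colours P) qs))"
proof -
  have "map (arity P) qs = map (arity P) (take (Suc i) qs) @ map (arity P) (drop (Suc i) qs)" by (metis append_take_drop_id map_append)
  then have "sum_list (map (arity P) qs) = offset P qs (Suc i) + sum_list (map (arity P) (drop (Suc i) qs))" by (simp add: offset_def)
  then show ?thesis using offset_Suc[OF assms, of P] by (simp add: length_concat comp_def)
qed

lemma map_block_concat:
  assumes "map length lss = map (arity P) qs" "i < length qs"
  shows "map ((!) (concat lss)) [offset P qs i ..< offset P qs (Suc i)] = lss ! i"
proof -
  have "length (lss ! i) = arity P (qs ! i)" using assms by (metis nth_map length_map)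
  then show ?thesis by (intro nth_equalityI) (auto simp: offset_Suc assms offset_nth_concat[OF assms])
qed

lemma perm_list_set_map: "perm_list n xs \<Longrightarrow> length as = n \<Longrightarrow> set (map ((!) as) xs) = set as"
  by (metis mset_map_nth_perm set_mset_mset)

lemma upt_blocks: "concat (map (\<lambda>i. [offset P qs i ..< offset P qs (Suc i)]) [0..<k]) = [0..<offset P qs k]"
  if "k \<le> length qs" using that
proof (induction k)
  case 0 then show ?case by (simp add: offset_def)
next
  case (Suc k)
  then show ?case by (simp add: offset_Suc upt_add_eq_append[of 0])
qed

text \<open>The blocks of a composite tile an initial segment of the naturals
  (\<open>upt_blocks\<close>), and listing them in another order does not change the multiset of
  their entries.\<close>

lemma perm_list_outer:
  assumes "perm_list (length qs) xs" 
  shows "perm_list (length (concat (map (in_colours P) qs)))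
    (concat (map (\<lambda>i. [offset P qs i ..< offset P qs (Suc i)]) xs))"
proof -
  let ?b = "\<lambda>i. [offset P qs i ..< offset P qs (Suc i)]"
  have m: "mset xs = mset [0..<length qs]" using assms perm_list_mset by blast
  have c: "mset (concat (map ?b zs)) = sum_mset (image_mset (mset \<circ> ?b) (mset zs))" for zs by (induction zs) auto
  have "mset (concat (map ?b xs)) = mset (concat (map ?b [0..<length qs]))" unfolding c m ..
  also have "\<dots> = mset [0..<length (concat (map (in_colours P) qs))]" using upt_blocks[of "length qs" qs P] offset_length[of P qs] by simp
  finally show ?thesis by (simp only: perm_list_mset)
qed

lemma perm_list_inner:
  assumes "list_all2 (\<lambda>q ys. perm_list (arity P q) ys) qs yss"
  shows "perm_list (length (concat (map (in_colours P) qs)))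
    (concat (map2 (\<lambda>i ys. map ((+) (offset P qs i)) ys) [0..<length qs] yss))"
proof -
  have l: "length yss = length qs" using assms by (simp add: list_all2_lengthD)
  let ?b = "\<lambda>i. [offset P qs i ..< offset P qs (Suc i)]"
  have "mset (map ((+) (offset P qs i)) (yss ! i)) = mset (?b i)" if "i < length qs" for i
  proof -
    have "perm_list (arity P (qs ! i)) (yss ! i)" using assms that by (simp add: list_all2_conv_all_nth)
    then have "mset (yss ! i) = mset [0..<arity P (qs ! i)]" by (simp only: perm_list_mset)
    then have "mset (map ((+) (offset P qs i)) (yss ! i)) = mset (map ((+) (offset P qs i)) [0..<arity P (qs ! i)])" by (simp only: mset_map)
    also have "map ((+) (offset P qs i)) [0..<arity P (qs ! i)] = ?b i" by (auto simp: offset_Suc that intro: nth_equalityI)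
    finally show ?thesis .
  qed
  then have "map mset (map2 (\<lambda>i ys. map ((+) (offset P qs i)) ys) [0..<length qs] yss)
     = map mset (map ?b [0..<length qs])"
    using l by (intro nth_equalityI) auto
  then have "mset (concat (map2 (\<lambda>i ys. map ((+) (offset P qs i)) ys) [0..<length qs] yss))
     = mset (concat (map ?b [0..<length qs]))"
    by (simp only: mset_concat)
  also have "\<dots> = mset [0..<length (concat (map (in_colours P) qs))]" using upt_blocks[of "length qs" qs P] offset_length[of P qs] by simp
  finally show ?thesis by (simp only: perm_list_mset)
qed

section \<open>Application of operations to terms is well defined, associative and
  equivariant\<close>

context operad
begin

text \<open>Both orbits are indexed by permutations: \<open>ys\<close> on the left corresponds to
  \<open>xs\<close> followed by \<open>ys\<close> on the right, and \<open>perm_list_factor\<close>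
  inverts this correspondence.\<close>

lemma cls_Act:
  assumes q: "q \<in> Ops P" and xs: "perm_list (ar q) xs" and l: "length ls = ar q"
  shows "cls (Act P q xs) ls = cls q (map ((!) ls) xs)"
proof -
  have ar: "ar (Act P q xs) = ar q" using q xs Act_arity by blast
  define C where "C q ls = {(Act P q xs, ls') | xs ls'.
    perm_list (ar q) xs \<and> length ls' = ar q \<and> map ((!) ls') xs = ls}" for q and ls :: "('c \<times> nat) list"
  have comp: "map ((!) l'') (map ((!) ys) xs) = map ((!) (map ((!) l'') ys)) xs"
    if "perm_list (ar q) ys" for ys and l'' :: "('c \<times> nat) list"
    using that xs by (auto simp: perm_list_length[OF that] dest: perm_list_mem_less)
  have "C (Act P q xs) ls = C q (map ((!) ls) xs)"
  proof (intro set_eqI iffI)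
    fix z assume "z \<in> C (Act P q xs) ls"
    then obtain ys l'' where z: "z = (Act P (Act P q xs) ys, l'')" "perm_list (ar q) ys"
      "length l'' = ar q" "map ((!) l'') ys = ls" unfolding C_def ar by auto
    then show "z \<in> C q (map ((!) ls) xs)" unfolding C_def using comp[OF z(2), of l''] perm_list_comp[OF xs z(2)] Act_Act[OF q xs z(2)] by auto
  next
    fix z assume "z \<in> C q (map ((!) ls) xs)"
    then obtain zs l'' where z: "z = (Act P q zs, l'')" "perm_list (ar q) zs"
      "length l'' = ar q" "map ((!) l'') zs = map ((!) ls) xs" unfolding C_def by auto
    obtain ys where ys: "perm_list (ar q) ys" "map ((!) ys) xs = zs" using perm_list_factor[OF xs z(2)] .
    have "map ((!) (map ((!) l'') ys)) xs = map ((!) ls) xs" using comp[OF ys(1), of l''] ys z by simp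
    then have "map ((!) l'') ys = ls" using map_nth_perm_cancel[OF xs _ l] perm_list_length[OF ys(1)] by simp
    then show "z \<in> C (Act P q xs) ls" unfolding C_def ar using ys z Act_Act[OF q xs ys(1)] by (intro CollectI exI[of _ ys] exI[of _ l'']) auto
  qed
  then show ?thesis by (simp add: cls_def C_def)
qed

lemma mem_cls: "q \<in> Ops P \<Longrightarrow> length ls = ar q \<Longrightarrow> (q, ls) \<in> (case cls q ls of Trm S \<Rightarrow> S)"
  unfolding cls_def trm.case using Act_id[of q] perm_list_upt[of "ar q"] map_nth[of ls] by force

text \<open>An orbit contains the pair it was formed from (\<open>mem_cls\<close>, by
  \<open>Act_id\<close>), so equal orbits exhibit a permutation between their
  representatives.\<close>

lemma cls_eqD:
  assumes "labelled (q, ls)" "labelled (q', ls')" "cls q ls = cls q' ls'"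
  obtains xs where "perm_list (ar q') xs" "q = Act P q' xs" "ls' = map ((!) ls) xs"
    "ar q = ar q'"
proof -
  have "length ls = ar q" using assms(1) by (metis labelled_def fst_conv length_map snd_conv)
  then have "(q, ls) \<in> (case cls q' ls' of Trm S \<Rightarrow> S)" using assms mem_cls[of q ls] by (simp add: labelled_def)
  then obtain xs where "perm_list (ar q') xs" "q = Act P q' xs" "ls' = map ((!) ls) xs" unfolding cls_def by auto
  moreover from this have "ar q = ar q'" using assms(2) by (simp add: Act_arity labelled_def)
  ultimately show ?thesis using that by blast
qed

lemma labelled_length: "labelled r \<Longrightarrow> length (snd r) = ar (fst r)" unfolding labelled_def by (metis length_map)

lemma labelled_Act:
  assumes "q \<in> Ops P" "perm_list (ar q) xs" "length ls = ar q"
  shows "labelled (Act P q xs, ls) \<longleftrightarrow> labelled (q, map ((!) ls) xs)"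
proof -
  have "map fst (map ((!) ls) xs) = map ((!) (map fst ls)) xs" using assms by (auto dest: perm_list_mem_less)
  moreover have "map ((!) (ins (Act P q xs))) xs = ins q" using assms Act_inputs perm_list_length by (intro nth_equalityI) auto
  moreover have "map ((!) (map fst ls)) xs = map ((!) (ins (Act P q xs))) xs
      \<longleftrightarrow> map fst ls = ins (Act P q xs)"
    using map_nth_perm_cancel[OF assms(2), of "map fst ls" "ins (Act P q xs)"]
      assms Act_arity[OF assms(1,2)] by auto
  ultimately show ?thesis using Act_op[OF assms(1,2)] assms(1) by (simp add: labelled_def del: map_map)
qed

lemma rep:
  assumes "is_term T"
  shows "labelled (rep T)" "cls (fst (rep T)) (snd (rep T)) = T"
proof -
  have "labelled (rep T) \<and> T = cls (fst (rep T)) (snd (rep T))" using assms unfolding is_term_def rep_def by (rule someI_ex)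
  then show "labelled (rep T)" "cls (fst (rep T)) (snd (rep T)) = T" by simp_all
qed

lemma is_term_cls [intro]: "labelled (q, ls) \<Longrightarrow> is_term (cls q ls)" unfolding is_term_def by (metis fst_conv snd_conv)

lemma rep_cls:
  assumes "labelled (q, ls)"
  obtains q' ls' xs where "rep (cls q ls) = (q', ls')" "labelled (q', ls')"
    "perm_list (ar q') xs" "q = Act P q' xs" "ls' = map ((!) ls) xs" "ar q = ar q'"
proof -
  have "is_term (cls q ls)" using assms by blast
  note r = rep[OF this]
  obtain q' ls' where e: "rep (cls q ls) = (q', ls')" by fastforce
  with r assms have "cls q ls = cls q' ls'" "labelled (q', ls')" by auto
  then show ?thesis using cls_eqD[OF assms] that e by metis
qed

lemma outc_cls:
  assumes "labelled (q, ls)" shows "outc (cls q ls) = out q"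
proof -
  obtain q' ls' xs where r: "rep (cls q ls) = (q', ls')" "labelled (q', ls')"
    "perm_list (ar q') xs" "q = Act P q' xs" using rep_cls[OF assms] by metis
  then show ?thesis by (simp add: outc_def Act_output labelled_def)
qed

lemma clab_cls: 
  assumes "labelled (q, ls)" shows "clab (cls q ls) = mset ls"
proof -
  have l: "length ls = ar q" using labelled_length[OF assms] by simp
  obtain q' ls' xs where r: "rep (cls q ls) = (q', ls')"
    "perm_list (ar q') xs" "ls' = map ((!) ls) xs" "ar q = ar q'" using rep_cls[OF assms] by metis
  then have "mset ls' = mset ls" using l mset_map_nth_perm by metis
  then show ?thesis using is_term_cls[OF assms] r(1) by (simp add: clab_def)
qed

lemma is_termE:
  assumes "is_term T" 
  obtains q ls where "labelled (q, ls)" "T = cls q ls" using assms that[of "fst r" "snd r" for r] unfolding is_term_def by auto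

lemma not_is_term_empty [simp]: "\<not> is_term undefined_term"
  using mem_cls labelled_length unfolding is_term_def labelled_def by (metis empty_iff trm.case)

lemma outc_colour: "is_term T \<Longrightarrow> outc T \<in> Colours P" by (elim is_termE) (auto simp: outc_cls labelled_def output_colour)

lemma clab_colour: "x \<in># clab T \<Longrightarrow> fst x \<in> Colours P"
proof (cases "is_term T")
  case True
  assume "x \<in># clab T"
  with True show ?thesis by (elim is_termE) (auto simp: clab_cls labelled_def dest!: inputs_colours, metis image_eqI set_map subsetD fst_conv)
qed (simp add: clab_def)

definition ok :: "'o \<Rightarrow> ('c, 'o) trm list \<Rightarrow> bool" where
  "ok p ts \<longleftrightarrow> p \<in> Ops P \<and> (\<forall>t \<in> set ts. is_term t) \<and> map outc ts = ins p"

lemma okE: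
  assumes "ok p ts"
  obtains qs lss where "ts = map2 cls qs lss" "labs qs lss"
    "sub p qs"
proof -
  define qs where "qs = map (fst \<circ> rep) ts"
  define lss where "lss = map (snd \<circ> rep) ts"
  have t: "is_term t" if "t \<in> set ts" for t using assms that by (simp add: ok_def)
  have 1: "ts = map2 cls qs lss" using rep(2)[OF t] by (intro nth_equalityI) (auto simp: qs_def lss_def case_prod_unfold)
  have 2: "labs qs lss" using rep(1)[OF t] by (auto simp: qs_def lss_def list_all2_conv_all_nth)
  have "map out qs = ins p" using assms by (auto simp: qs_def ok_def outc_def[abs_def] comp_def)
  then have "sub p qs" using assms rep(1)[OF t] by (auto simp: substitutable_def qs_def ok_def labelled_def)
  with 1 2 that show ?thesis by blast
qed

lemma ok_cls:
  assumes "labs qs lss" "sub p qs"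
  shows "ok p (map2 cls qs lss)"
proof -
  have l: "length qs = length lss" using assms by (simp add: list_all2_lengthD)
  have "map outc (map2 cls qs lss) = map out qs" using assms l by (intro nth_equalityI) (auto simp: outc_cls list_all2_conv_all_nth)
  then show ?thesis using assms l by (auto simp: ok_def substitutable_def set_conv_nth list_all2_conv_all_nth intro!: is_term_cls)
qed

lemma appl_not_ok: "\<not> ok p ts \<Longrightarrow> appl p ts = undefined_term" by (auto simp: appl_def ok_def)

text \<open>Well-definedness of application. The given representatives arise from the chosen ones by
  permuting the inputs of each single operation; \<open>Subst_Act_inner\<close> collects these
  permutations in one block permutation of the composite, which \<open>cls_Act\<close> moves over to
  the labels.\<close>

lemma appl_cls:
  assumes lab: "labs qs lss" and sub: "sub p qs"
  shows "appl p (map2 cls qs lss) = cls (Subst P p qs) (concat lss)"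
    "labelled (Subst P p qs, concat lss)"
proof -
  have l: "length qs = length lss" using lab by (simp add: list_all2_lengthD)
  let ?ts = "map2 cls qs lss"
  define qs' where "qs' = map (fst \<circ> rep) ?ts"
  define lss' where "lss' = map (snd \<circ> rep) ?ts"
  have l': "length qs' = length lss" "length lss' = length lss" using l by (simp_all add: qs'_def lss'_def)
  have "\<exists>xs. perm_list (ar (qs' ! i)) xs \<and> qs ! i = Act P (qs' ! i) xs \<and> 
       lss' ! i = map ((!) (lss ! i)) xs \<and> ar (qs ! i) = ar (qs' ! i) \<and> labelled (qs' ! i, lss' ! i)" if "i < length qs" for i
  proof -
    have "qs' ! i = fst (rep (cls (qs ! i) (lss ! i)))" "lss' ! i = snd (rep (cls (qs ! i) (lss ! i)))"
      using l that by (simp_all add: qs'_def lss'_def)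
    then show ?thesis using rep_cls[OF list_all2_nthD[OF lab that]] by (metis fst_conv snd_conv)
  qed
  then obtain X where X: "\<And>i. i < length qs \<Longrightarrow> perm_list (ar (qs' ! i)) (X i) \<and> qs ! i = Act P (qs' ! i) (X i) \<and> 
       lss' ! i = map ((!) (lss ! i)) (X i) \<and> ar (qs ! i) = ar (qs' ! i) \<and> labelled (qs' ! i, lss' ! i)"
    by metis
  define yss where "yss = map X [0..<length qs]"
  have qs: "qs = map2 (Act P) qs' yss" using X l l' by (intro nth_equalityI) (auto simp: yss_def)
  have ys: "list_all2 (\<lambda>q ys. perm_list (ar q) ys) qs' yss" using X l l' by (auto simp: list_all2_conv_all_nth yss_def)
  have outs: "map out qs' = map out qs"  using X l l' by (intro nth_equalityI) (simp_all add: labelled_def, metis Act_output)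
  have sub': "sub p qs'" using sub outs X l l' unfolding substitutable_def by (auto simp: set_conv_nth labelled_def)
  have ar: "map length lss = map ar qs" using lab l by (intro nth_equalityI) (auto dest!: list_all2_nthD labelled_length)
  have ar': "map ar qs = map ar qs'"
  proof (rule nth_equalityI)
    fix i assume "i < length (map ar qs)"
    then have i: "i < length qs" "i < length qs'" using l l' by simp_all
    then have "ar (qs ! i) = ar (qs' ! i)" using X by blast
    then show "map ar qs ! i = map ar qs' ! i" using i by simp
  qed (simp add: l l')
  let ?B = "concat (map2 (\<lambda>i ys. map ((+) (offset P qs' i)) ys) [0..<length qs'] yss)"
  have lenc: "length (concat lss) = ar (Subst P p qs')"
    using arg_cong[OF trans[OF ar ar'], of sum_list] by (simp add: Subst_inputs[OF sub'] length_concat comp_def)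
  have B: "perm_list (ar (Subst P p qs')) ?B" using perm_list_inner[OF ys] by (simp add: Subst_inputs[OF sub'] length_concat comp_def)
  have "map ((!) (concat lss)) ?B = concat lss'"
  proof -
    have "map ((!) (concat lss)) (map ((+) (offset P qs' i)) (yss ! i)) = lss' ! i" if "i < length qs" for i
    proof -
      have "map ((!) (concat lss)) (map ((+) (offset P qs' i)) (X i)) = map ((!) (lss ! i)) (X i)"
        using X[OF that] offset_nth_concat[OF trans[OF ar ar'], of i] that l l' by (simp, metis perm_list_mem_less)
      then show ?thesis using X[OF that] that by (simp add: yss_def)
    qed
    then have "map (map ((!) (concat lss))) (map2 (\<lambda>i ys. map ((+) (offset P qs' i)) ys) [0..<length qs'] yss) = lss'"
      using l l' by (intro nth_equalityI) (simp_all add: yss_def)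
    then show ?thesis by (simp only: map_concat)
  qed
  moreover have "Subst P p qs = Act P (Subst P p qs') ?B"  using Subst_Act_inner[OF sub' ys] qs by metis
  ultimately have "cls (Subst P p qs) (concat lss) = cls (Subst P p qs') (concat lss')" using cls_Act[OF Subst_op[OF sub'] B lenc] by metis
  then show "appl p ?ts = cls (Subst P p qs) (concat lss)" using ok_cls[OF lab sub] unfolding appl_def ok_def qs'_def lss'_def by simp
  have "map fst (concat lss) = concat (map ins qs)"
  proof -
    have "map (map fst) lss = map ins qs" using lab l by (simp add: list_all2_conv_all_nth labelled_def list_eq_iff_nth_eq[of "map (map fst) lss"])
    then show ?thesis by (simp only: map_concat)
  qed
  then show "labelled (Subst P p qs, concat lss)" using Subst_op[OF sub] Subst_inputs[OF sub] by (simp add: labelled_def)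
qed

lemma ok_is_term: "is_term (appl p ts) \<longleftrightarrow> ok p ts" by (metis appl_cls appl_not_ok is_term_cls not_is_term_empty okE)

lemma outc_appl: "ok p ts \<Longrightarrow> outc (appl p ts) = out p" by (elim okE) (auto simp: appl_cls outc_cls Subst_output)

lemma clab_appl: "ok p ts \<Longrightarrow> clab (appl p ts) = sum_list (map clab ts)"
proof (elim okE)
  fix qs lss
  assume h: "ts = map2 cls qs lss" "labs qs lss" "sub p qs"
  then have "map clab ts = map mset lss" by (intro nth_equalityI) (auto simp: clab_cls list_all2_conv_all_nth)
  with h show ?thesis by (simp add: appl_cls clab_cls mset_concat)
qed

text \<open>\<open>Subst_assoc\<close> for terms. No typing of \<open>tss\<close> is assumed, so the
  two sides must also be shown to be undefined together; the assumption on lengths allows the type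
  equation for the concatenation to be split into blocks.\<close>

lemma appl_assoc:
  assumes sub: "sub p qs" and len: "map length tss = map ar qs"
  shows "appl (Subst P p qs) (concat tss) = appl p (map2 appl qs tss)"
proof -
  have l: "length tss = length qs" using len by (metis length_map)
  have okc: "ok (Subst P p qs) (concat tss) \<longleftrightarrow> (\<forall>i<length qs. ok (qs ! i) (tss ! i))"
  proof -
    have "map outc (concat tss) = ins (Subst P p qs) \<longleftrightarrow> map (map outc) tss = map ins qs"
      unfolding Subst_inputs[OF sub] map_concat using l by (intro concat_eq_concat_iff) (auto simp: set_zip, metis l len nth_map)
    also have "\<dots> \<longleftrightarrow> (\<forall>i<length qs. map outc (tss ! i) = ins (qs ! i))"
      using l by (auto simp: list_eq_iff_nth_eq[of "map (map outc) tss"])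
    finally show ?thesis using sub Subst_op[OF sub] l unfolding ok_def by (auto simp: substitutable_def set_conv_nth[of tss] set_conv_nth[of qs])
  qed
  show ?thesis
  proof (cases "\<forall>i<length qs. ok (qs ! i) (tss ! i)")
    case False
    then have 1: "appl (Subst P p qs) (concat tss) = undefined_term" using okc appl_not_ok by blast
    from False obtain i where "i < length qs" "\<not> ok (qs ! i) (tss ! i)" by blast
    then have "map2 appl qs tss ! i = undefined_term" "i < length (map2 appl qs tss)" using l by (auto simp: appl_not_ok)
    then have "\<not> ok p (map2 appl qs tss)" unfolding ok_def by (metis not_is_term_empty nth_mem)
    then show ?thesis using 1 appl_not_ok by metis
  next
    case True
    then have "\<forall>i<length qs. \<exists>rs lss. tss ! i = map2 cls rs lss \<and> 
       labs rs lss \<and> sub (qs ! i) rs"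
      by (metis okE)
    then obtain R L where RL: "\<And>i. i < length qs \<Longrightarrow> tss ! i = map2 cls (R i) (L i) \<and> 
       labs (R i) (L i) \<and> sub (qs ! i) (R i)"
      by metis
    define rss where "rss = map R [0..<length qs]"
    define lsss where "lsss = map L [0..<length qs]"
    have lRL: "length (R i) = length (L i)" if "i < length qs" for i  using RL[OF that] by (metis list_all2_lengthD)
    have ct: "concat tss = map2 cls (concat rss) (concat lsss)"
    proof -
      have "tss = map2 (map2 cls) rss lsss" using RL l by (intro nth_equalityI) (auto simp: rss_def lsss_def)
      moreover have "list_all2 (\<lambda>rs ls. length rs = length ls) rss lsss" using lRL by (auto simp: rss_def lsss_def list_all2_conv_all_nth)
      then have "concat (map2 (map2 cls) rss lsss) = map2 cls (concat rss) (concat lsss)" by (induction rule: list_all2_induct) auto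
      ultimately show ?thesis by metis
    qed
    have la: "labs (concat rss) (concat lsss)" using RL by (intro concat_transfer[THEN rel_funD]) (auto simp: rss_def lsss_def list_all2_conv_all_nth)
    have s2: "list_all2 sub qs rss" using RL by (auto simp: rss_def list_all2_conv_all_nth)
    have "map (map out) rss = map ins qs" using RL  by (intro nth_equalityI) (auto simp: rss_def substitutable_def)
    then have s3: "sub (Subst P p qs) (concat rss)" using sub Subst_op[OF sub] Subst_inputs[OF sub] RL
      unfolding substitutable_def rss_def by (fastforce simp: map_concat)
    have s4: "sub p (map2 (Subst P) qs rss)"
    proof -
      have "map out (map2 (Subst P) qs rss) = map out qs" using s2 by (intro nth_equalityI) (auto simp: list_all2_conv_all_nth Subst_output)
      moreover have "set (map2 (Subst P) qs rss) \<subseteq> Ops P" using s2 by (auto simp: list_all2_conv_all_nth set_zip Subst_op)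
      ultimately show ?thesis using sub unfolding substitutable_def by metis
    qed
    have la2: "labs (map2 (Subst P) qs rss) (map concat lsss)" using RL appl_cls(2) by (auto simp: rss_def lsss_def list_all2_conv_all_nth)
    have "map2 appl qs tss = map2 cls (map2 (Subst P) qs rss) (map concat lsss)"
      using RL l appl_cls(1) by (intro nth_equalityI) (auto simp: rss_def lsss_def)
    then have "appl p (map2 appl qs tss) = cls (Subst P p (map2 (Subst P) qs rss)) (concat (map concat lsss))" using appl_cls[OF la2 s4] by simp
    moreover have "concat (map concat lsss) = concat (concat lsss)" by (induction lsss) auto
    ultimately show ?thesis using appl_cls[OF la s3] ct Subst_assoc[OF sub s2] by simp
  qed
qed

text \<open>Counterpart of \<open>appl_cls\<close> for the operation that is applied:
  \<open>Subst_Act_outer\<close> turns its permutation into one of blocks, which acts on the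
  concatenated labels. By this, \<open>bind\<close> does not depend on representatives.\<close>

lemma appl_Act:
  assumes p: "p \<in> Ops P" and xs: "perm_list (ar p) xs" and len: "length ts = ar p"
  shows "appl (Act P p xs) ts = appl p (map ((!) ts) xs)"
proof -
  have okc: "ok (Act P p xs) ts \<longleftrightarrow> ok p (map ((!) ts) xs)"
  proof -
    have "map ((!) (ins (Act P p xs))) xs = ins p" using assms Act_inputs perm_list_length by (intro nth_equalityI) auto
    moreover have "map outc (map ((!) ts) xs) = map ((!) (map outc ts)) xs" using assms by (auto dest: perm_list_mem_less)
    ultimately have "map outc (map ((!) ts) xs) = ins p \<longleftrightarrow> map outc ts = ins (Act P p xs)"
      using map_nth_perm_cancel[OF xs, of "map outc ts" "ins (Act P p xs)"] len Act_arity[OF p xs] by (metis length_map)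
    then show ?thesis using perm_list_set_map[OF xs len] p Act_op[OF p xs] by (auto simp: ok_def)
  qed
  show ?thesis
  proof (cases "ok (Act P p xs) ts")
    case False
    then show ?thesis using okc appl_not_ok by metis
  next
    case True
    then obtain qs lss where t: "ts = map2 cls qs lss" "labs qs lss"
      "sub (Act P p xs) qs" by (elim okE)
    have l: "length qs = ar p" "length lss = ar p" using t len by (auto simp: list_all2_lengthD)
    have ar: "map length lss = map ar qs" using t(2) l by (intro nth_equalityI) (auto dest!: list_all2_nthD labelled_length)
    have m1: "map ((!) ts) xs = map2 cls (map ((!) qs) xs) (map ((!) lss) xs)"
      using xs l by (intro nth_equalityI) (auto simp: t(1) perm_list_length perm_list_nth_less)
    have la: "labs (map ((!) qs) xs) (map ((!) lss) xs)" using t(2) xs l by (auto simp: list_all2_conv_all_nth perm_list_length perm_list_nth_less)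
    have sub: "sub p (map ((!) qs) xs)"
    proof -
      have "map out (map ((!) qs) xs) = map ((!) (map out qs)) xs" using xs l by (auto dest: perm_list_mem_less)
      also have "\<dots> = ins p" using t(3) assms Act_inputs perm_list_length unfolding substitutable_def by (intro nth_equalityI) auto
      finally show ?thesis using p t(3) perm_list_set_map[OF xs l(1)] unfolding substitutable_def by simp
    qed
    let ?B = "concat (map (\<lambda>i. [offset P qs i ..< offset P qs (Suc i)]) xs)"
    have B: "perm_list (ar (Subst P p (map ((!) qs) xs))) ?B"
    proof -
      have "length (concat (map ins (map ((!) qs) xs))) = length (concat (map ins qs))"
      proof -
        have "map ins (map ((!) qs) xs) = map ((!) (map ins qs)) xs" using l(1) perm_list_mem_less[OF xs] by simp
        then show ?thesis using length_concat_perm[OF xs, of "map ins qs"] l(1) by (simp del: map_map)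
      qed
      then show ?thesis using perm_list_outer[of qs xs P] xs l by (simp add: Subst_inputs[OF sub])
    qed
    have lenc: "length (concat lss) = ar (Subst P p (map ((!) qs) xs))"
    proof -
      have "length (concat lss) = length (concat (map ((!) lss) xs))" using length_concat_perm[OF xs l(2)] by simp
      then show ?thesis using labelled_length[OF appl_cls(2)[OF la sub]] by simp
    qed
    have "map ((!) (concat lss)) ?B = concat (map ((!) lss) xs)"
      unfolding map_concat using map_block_concat[OF ar] perm_list_mem_less[OF xs] l by (auto intro!: arg_cong[of _ _ concat])
    then have "cls (Subst P (Act P p xs) qs) (concat lss) = cls (Subst P p (map ((!) qs) xs)) (concat (map ((!) lss) xs))"
      using cls_Act[OF Subst_op[OF sub] B lenc] Subst_Act_outer[OF p xs t(3)] by simp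
    then show ?thesis using appl_cls(1)[OF t(2,3)] appl_cls(1)[OF la sub] m1 t(1) by simp
  qed
qed

end

section \<open>Substitution into terms and into contexts\<close>

definition shiftl :: "'c \<times> nat \<Rightarrow> 'c \<times> nat" where
  "shiftl x = (fst x, Suc (snd x))"

text \<open>In contexts the label \<open>0\<close> stands for the hole, so the leaf \<open>l\<close> becomes the label \<open>Suc l\<close>.\<close>

definition ctxsub :: "'t \<Rightarrow> ('c \<times> nat \<Rightarrow> 't) \<Rightarrow> 'c \<times> nat \<Rightarrow> 't" where
  "ctxsub S \<sigma> x = (case snd x of 0 \<Rightarrow> S | Suc l \<Rightarrow> \<sigma> (fst x, l))"

lemma shiftl_simps [simp]: "fst (shiftl x) = fst x" "snd (shiftl x) = Suc (snd x)" by (simp_all add: shiftl_def)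

lemma ctxsub_simps [simp]: "ctxsub S \<sigma> (c, 0) = S" "ctxsub S \<sigma> (shiftl x) = \<sigma> x"
  "ctxsub S \<sigma> (c, Suc l) = \<sigma> (c, l)" by (simp_all add: ctxsub_def)

lemma ctxsub_0: "snd x = 0 \<Longrightarrow> ctxsub S \<sigma> x = S" by (simp add: ctxsub_def)

lemma label_cases: "snd x = 0 \<or> (\<exists>y. x = shiftl y)" by (cases x; cases "snd x") (auto simp: shiftl_def)

lemma shiftl_inj: "shiftl x = shiftl y \<longleftrightarrow> x = y" by (cases x; cases y) (simp add: shiftl_def)

lemma map_zip_Suc: "map shiftl (zip cs ls) = zip cs (map Suc ls)" by (simp add: zip_map2 shiftl_def) (simp add: case_prod_unfold)

context operad
begin

abbreviation "svar \<equiv> \<lambda>x. var (shiftl x)"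

text \<open>Frees the label \<open>0\<close>, so that a term can stand beside the hole of a
  context.\<close>

definition shift :: "('c, 'o) trm \<Rightarrow> ('c, 'o) trm" where
  "shift T = bind svar T"

definition stdl :: "'o \<Rightarrow> ('c \<times> nat) list" where
  "stdl t = zip (ins t) [0..<ar t]"

text \<open>The operation \<open>t\<close> with its inputs numbered in their own order. By
  \<open>std_inj\<close> nothing is lost, so operations, in particular targets of arrows, can be
  compared as terms.\<close>

definition std :: "'o \<Rightarrow> ('c, 'o) trm" where
  "std t = cls t (stdl t)"

lemma length_stdl [simp]: "length (stdl t) = ar t" by (simp add: stdl_def)

lemma nth_stdl [simp]: "i < ar t \<Longrightarrow> stdl t ! i = (ins t ! i, i)" by (simp add: stdl_def)

lemma snd_stdl: "map snd (stdl t) = [0..<ar t]" by (simp add: stdl_def)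

lemma fst_stdl: "map fst (stdl t) = ins t" by (simp add: stdl_def)

lemma distinct_stdl [simp]: "distinct (stdl t)" by (simp add: stdl_def distinct_zipI2)

lemma map_sel_stdl: "length Vs = ar t \<Longrightarrow> map (\<lambda>x. Vs ! snd x) (stdl t) = Vs" by (intro nth_equalityI) simp_all

lemma bind_cls:
  assumes "labelled (q, ls)"
  shows "bind \<sigma> (cls q ls) = appl q (map \<sigma> ls)"
proof -
  obtain q' ls' xs where r: "rep (cls q ls) = (q', ls')" "labelled (q', ls')"
    "perm_list (ar q') xs" "q = Act P q' xs" "ls' = map ((!) ls) xs" "ar q = ar q'" by (rule rep_cls[OF assms])
  have l: "length ls = ar q'" using labelled_length[OF assms] r(6) by simp
  have "bind \<sigma> (cls q ls) = appl q' (map \<sigma> ls')" using is_term_cls[OF assms] r(1) by (simp add: bind_def)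
  also have "map \<sigma> ls' = map ((!) (map \<sigma> ls)) xs" using perm_list_mem_less[OF r(3)] l by (simp add: r(5))
  also have "appl q' \<dots> = appl q (map \<sigma> ls)" using r(2,3,4) l by (simp add: appl_Act labelled_def)
  finally show ?thesis .
qed

lemma bind_undefined [simp]: "bind \<sigma> undefined_term = undefined_term" by (simp add: bind_def)

lemma not_term: "\<not> is_term T \<Longrightarrow> bind \<sigma> T = undefined_term" by (simp add: bind_def)

lemma bind_undef_or_term: "is_term (bind \<sigma> T) \<or> bind \<sigma> T = undefined_term" unfolding bind_def using appl_not_ok ok_is_term by auto

lemma is_term_bindD: "is_term (bind \<sigma> T) \<Longrightarrow> is_term T"
  using not_term[of T \<sigma>] not_is_term_empty by (cases "is_term T") auto

lemma outc_bind: "is_term (bind \<sigma> T) \<Longrightarrow> outc (bind \<sigma> T) = outc T"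
proof -
  assume a: "is_term (bind \<sigma> T)"
  then obtain q ls where "labelled (q, ls)" "T = cls q ls" using is_term_bindD is_termE by metis
  then show ?thesis using a by (simp add: bind_cls ok_is_term outc_appl outc_cls)
qed

text \<open>An instance of \<open>appl_assoc\<close> when \<open>p\<close> fits the arguments. No
  typing is required, because substitution preserves output colours: if the substituted arguments
  fit \<open>p\<close>, so did the original ones, and otherwise both sides are undefined.\<close>

lemma bind_appl: "bind \<sigma> (appl p ts) = appl p (map (bind \<sigma>) ts)"
proof (cases "ok p ts")
  case True
  then obtain qs lss where t: "ts = map2 cls qs lss" "labs qs lss"
    "sub p qs" by (rule okE)
  have l: "length qs = length lss" using t(2) by (rule list_all2_lengthD)
  have "bind \<sigma> (appl p ts) = appl (Subst P p qs) (concat (map (map \<sigma>) lss))"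
    using appl_cls[OF t(2,3)] bind_cls t(1) by (simp add: map_concat)
  also have "\<dots> = appl p (map2 appl qs (map (map \<sigma>) lss))"
    using t(2) l by (intro appl_assoc t(3)) (simp add: list_eq_iff_nth_eq list_all2_conv_all_nth labelled_length[simplified, of "(_, _)", simplified])
  also have "map2 appl qs (map (map \<sigma>) lss) = map (bind \<sigma>) ts"
    using t(2) l by (intro nth_equalityI) (simp_all add: t(1) list_all2_conv_all_nth bind_cls)
  finally show ?thesis .
next
  case False
  have "\<not> ok p (map (bind \<sigma>) ts)"
  proof
    assume o: "ok p (map (bind \<sigma>) ts)"
    then have t: "is_term (bind \<sigma> t)" if "t \<in> set ts" for t using that by (simp add: ok_def)
    then have "map outc (map (bind \<sigma>) ts) = map outc ts" using outc_bind by simp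
    then show False using False o is_term_bindD[OF t] unfolding ok_def by metis
  qed
  then show ?thesis using False by (simp add: appl_not_ok)
qed

lemma labelled_var: "fst x \<in> Colours P \<Longrightarrow> labelled (Unit P (fst x), [x])" by (simp add: labelled_def Unit_op Unit_inputs)

lemma var_simps [simp]:
  assumes "fst x \<in> Colours P"
  shows "is_term (var x)" "outc (var x) = fst x" "clab (var x) = {#x#}"
  using is_term_cls[OF labelled_var[OF assms]] outc_cls[OF labelled_var[OF assms]]
    clab_cls[OF labelled_var[OF assms]] assms by (simp_all add: var_def Unit_output)

lemma appl_Unit: "is_term t \<Longrightarrow> outc t = c \<Longrightarrow> appl (Unit P c) [t] = t"
proof -
  assume a: "is_term t" "outc t = c"
  then obtain q ls where q: "labelled (q, ls)" "t = cls q ls" by (rule_tac is_termE)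
  then have c: "c = out q" "q \<in> Ops P" using a by (simp_all add: outc_cls labelled_def)
  then have s: "sub (Unit P c) [q]" by (simp add: substitutable_def Unit_op Unit_inputs output_colour)
  show ?thesis using appl_cls(1)[OF _ s, of "[ls]"] q c by (simp add: Unit_Subst)
qed

text \<open>Application of a unit thus serves as a type test; \<open>bind_cong_Unit\<close> uses it
  to compare substitutions that differ only in ill-typed values.\<close>

lemma appl_Unit_eq: "c \<in> Colours P \<Longrightarrow> appl (Unit P c) [t] = (if is_term t \<and> outc t = c then t else undefined_term)"
  using appl_Unit[of t c] by (auto intro!: appl_not_ok simp: ok_def Unit_inputs)

lemma bind_var:
  assumes "fst x \<in> Colours P" "is_term (\<sigma> x)" "outc (\<sigma> x) = fst x"
  shows "bind \<sigma> (var x) = \<sigma> x" using bind_cls[OF labelled_var[OF assms(1)], of \<sigma>] appl_Unit[OF assms(2,3)] by (simp add: var_def)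

lemma labelled_colour: "labelled (q, ls) \<Longrightarrow> x \<in> set ls \<Longrightarrow> fst x \<in> Colours P"
  using inputs_colours[of q] arg_cong[of "map fst ls" "ins q" set] unfolding labelled_def fst_conv snd_conv set_map by blast

lemma appl_vars: 
  assumes "labelled (q, ls)" shows "appl q (map var ls) = cls q ls"
proof -
  have m: "map (Unit P) (ins q) = map (\<lambda>x. Unit P (fst x)) ls"
  proof -
    have "ins q = map fst ls" using assms by (simp add: labelled_def)
    then show ?thesis by simp
  qed
  have s: "sub q (map (\<lambda>x. Unit P (fst x)) ls)" unfolding m[symmetric] using assms inputs_colours[of q]
    by (auto simp: substitutable_def labelled_def Unit_op Unit_output subsetD intro!: map_idI)
  have e: "map var ls = map2 cls (map (\<lambda>x. Unit P (fst x)) ls) (map (\<lambda>x. [x]) ls)" by (intro nth_equalityI) (simp_all add: var_def)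
  have c: "concat (map (\<lambda>x. [x]) ls) = ls" by (induction ls) auto
  have la: "labs (map (\<lambda>x. Unit P (fst x)) ls) (map (\<lambda>x. [x]) ls)"
    using labelled_var labelled_colour[OF assms] by (simp add: list_all2_conv_all_nth)
  show ?thesis unfolding e appl_cls(1)[OF la s] c using Subst_Unit[of q] m assms by (simp add: labelled_def)
qed

lemma bind_bind: "bind \<tau> (bind \<sigma> T) = bind (\<lambda>x. bind \<tau> (\<sigma> x)) T"
proof (cases "is_term T")
  case True
  then obtain q ls where "labelled (q, ls)" "T = cls q ls" by (rule is_termE)
  then show ?thesis by (simp add: bind_cls bind_appl comp_def)
qed (simp add: not_term)

lemma bind_ident: "is_term T \<Longrightarrow> bind var T = T" by (metis appl_vars bind_cls is_termE)

lemma bind_cong: "(\<And>x. x \<in># clab T \<Longrightarrow> \<sigma> x = \<tau> x) \<Longrightarrow> bind \<sigma> T = bind \<tau> T"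
proof (cases "is_term T")
  case True
  assume a: "\<And>x. x \<in># clab T \<Longrightarrow> \<sigma> x = \<tau> x"
  obtain q ls where q: "labelled (q, ls)" "T = cls q ls" using True by (rule is_termE)
  then have "map \<sigma> ls = map \<tau> ls" using a by (simp add: clab_cls)
  then show ?thesis by (simp only: q bind_cls)
qed (simp add: not_term)

lemma is_term_bind:
  "is_term (bind \<sigma> T) \<longleftrightarrow> is_term T \<and> (\<forall>x \<in># clab T. is_term (\<sigma> x) \<and> outc (\<sigma> x) = fst x)"
proof (cases "is_term T")
  case True
  then obtain q ls where q: "labelled (q, ls)" "T = cls q ls" by (rule is_termE)
  then have "map (outc \<circ> \<sigma>) ls = ins q \<longleftrightarrow> (\<forall>x \<in> set ls. outc (\<sigma> x) = fst x)"
    using map_eq_conv[of "outc \<circ> \<sigma>" ls fst] by (auto simp: labelled_def)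
  then show ?thesis using q True by (auto simp: bind_cls ok_is_term ok_def clab_cls labelled_def)
qed (auto dest: is_term_bindD)

lemma clab_bind:
  assumes "is_term (bind \<sigma> T)"
  shows "clab (bind \<sigma> T) = (\<Sum>x\<in>#clab T. clab (\<sigma> x))"
proof -
  obtain q ls where q: "labelled (q, ls)" "T = cls q ls" using is_term_bindD[OF assms] by (rule is_termE)
  then show ?thesis using assms by (simp add: bind_cls ok_is_term clab_appl clab_cls comp_def sum_mset_sum_list flip: mset_map)
qed

text \<open>Distinct labels have trivial stabilizer: the permutation relating two representatives
  with the same labels must fix every position.\<close>

lemma cls_inj:
  assumes "labelled (q, ls)" "labelled (q', ls)" "distinct ls" "cls q ls = cls q' ls"
  shows "q = q'"
proof -
  obtain xs where xs: "perm_list (ar q') xs" "q = Act P q' xs" "ls = map ((!) ls) xs" using cls_eqD[OF assms(1,2,4)] by metis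
  have l: "length ls = ar q'" using labelled_length[OF assms(2)] by simp
  have "xs ! k = k" if "k < ar q'" for k
  proof -
    have "ls ! k = ls ! (xs ! k)" using xs(1,3) that perm_list_length[OF xs(1)] by (metis nth_map)
    then show ?thesis using assms(3) that perm_list_nth_less[OF xs(1) that] l by (simp add: nth_eq_iff_index_eq)
  qed
  then have "xs = [0..<ar q']" using perm_list_length[OF xs(1)] by (intro nth_equalityI) simp_all
  then show ?thesis using xs(2) Act_id assms(2) by (simp add: labelled_def)
qed

lemma cls_reorder:
  assumes "is_term T" "clab T = mset ls" "distinct ls"
  obtains q where "labelled (q, ls)" "T = cls q ls"
proof -
  obtain q0 ls0 where q: "labelled (q0, ls0)" "T = cls q0 ls0" using assms(1) by (rule is_termE)
  then have "mset ls = mset ls0" using assms(2) by (simp add: clab_cls)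
  then obtain xs where xs: "perm_list (length ls) xs" "map ((!) ls) xs = ls0" using obtain_perm_of_mset_eq assms(3) by metis
  have l: "length ls = ar q0" "q0 \<in> Ops P" using labelled_length[OF q(1)] perm_list_length[OF xs(1)] xs(2) q(1) by (auto simp: labelled_def)
  have "cls (Act P q0 xs) ls = T" using cls_Act[OF l(2) _ l(1)] xs q l by simp
  moreover have "labelled (Act P q0 xs, ls)" using labelled_Act[OF l(2) _ l(1)] xs q l by simp
  ultimately show ?thesis using that by blast
qed

text \<open>Increasing numbers select one representative of an orbit. The condition in
  \<open>tw_arrows\<close> that leaf numbers increase at each vertex is exactly this normal
  form.\<close>

lemma cls_sorted_inj:
  assumes "labelled (q, ls)" "labelled (q', ls')" "cls q ls = cls q' ls'"
    "sorted_wrt (<) (map snd ls)" "sorted_wrt (<) (map snd ls')"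
  shows "q = q' \<and> ls = ls'"
proof -
  have s: "sorted (map snd ls)" "sorted (map snd ls')" "distinct (map snd ls)" "distinct (map snd ls')"
    using assms(4,5) by (simp_all add: strict_sorted_iff)
  have "mset ls = mset ls'" using assms(1-3) by (metis clab_cls)
  then have "set ls = set ls'" by (rule mset_eq_setD)
  then have "ls = ls'" using s map_sorted_distinct_set_unique[of snd ls ls'] by (simp add: distinct_map)
  then show ?thesis using cls_inj assms s(3)[unfolded distinct_map] by blast
qed

lemma labelled_stdl: "t \<in> Ops P \<Longrightarrow> labelled (t, stdl t)" by (simp add: labelled_def fst_stdl)

lemma std_simps [simp]:
  assumes "t \<in> Ops P"
  shows "is_term (std t)" "outc (std t) = out t" "clab (std t) = mset (stdl t)"
    "bind \<sigma> (std t) = appl t (map \<sigma> (stdl t))"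
    "appl t (map var (stdl t)) = std t" using labelled_stdl[OF assms] by (auto simp: std_def is_term_cls outc_cls clab_cls bind_cls appl_vars)

lemma std_inj: "s \<in> Ops P \<Longrightarrow> t \<in> Ops P \<Longrightarrow> std s = std t \<Longrightarrow> s = t"
  using cls_sorted_inj[OF labelled_stdl labelled_stdl, of s t] by (simp add: std_def snd_stdl)

lemma bind_sel_std:
  "t \<in> Ops P \<Longrightarrow> length Vs = ar t \<Longrightarrow> bind (\<lambda>x. Vs ! snd x) (std t) = appl t Vs" by (simp add: map_sel_stdl)

lemma bind_ctxsub: "bind \<tau> (bind (ctxsub S \<sigma>) C) = bind (ctxsub (bind \<tau> S) (\<lambda>x. bind \<tau> (\<sigma> x))) C"
  unfolding bind_bind by (intro arg_cong2[of _ _ _ _ "bind"] ext) (simp_all add: ctxsub_def split: nat.split)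

text \<open>The label \<open>0\<close> does not occur in a shifted term, so what is put into the
  hole is irrelevant.\<close>

lemma bind_shift: "bind (ctxsub S \<sigma>) (shift T) = bind \<sigma> T"
proof (cases "\<forall>x \<in># clab T. is_term (\<sigma> x) \<and> outc (\<sigma> x) = fst x")
  case True
  then show ?thesis unfolding shift_def bind_bind by (intro bind_cong) (simp add: bind_var clab_colour)
next
  \<comment> \<open>A value \<open>\<sigma> x\<close> of the wrong type makes both sides undefined:
    on the left already the substitution into the variable \<open>var (shiftl x)\<close>
    fails.\<close>
  case False
  have "\<not> is_term (bind (ctxsub S \<sigma>) (var (shiftl x)))" if "x \<in># clab T" "\<not> (is_term (\<sigma> x) \<and> outc (\<sigma> x) = fst x)" for x
    using that clab_colour[OF that(1)] by (simp add: is_term_bind)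
  with False have "\<not> is_term (bind (ctxsub S \<sigma>) (shift T))" "\<not> is_term (bind \<sigma> T)"
    unfolding shift_def bind_bind is_term_bind by blast+
  then show ?thesis by (metis bind_undef_or_term)
qed

abbreviation "lolab f \<equiv> zip (ins (lower f)) (0 # map Suc (ll f))"

section \<open>Arrows as pairs of terms\<close>

text \<open>The first input, which receives the source, is labelled \<open>0\<close>; raising the
  other leaf numbers by one keeps them apart from it and preserves their order.\<close>

definition lo :: "'o tw_arr \<Rightarrow> ('c, 'o) trm" where
  "lo f = cls (lower f) (lolab f)"

definition up :: "'o tw_arr \<Rightarrow> ('c, 'o) trm list" where
  "up f = clss (uppers f) (ul f)"

end

definition simple_mset :: "'a multiset \<Rightarrow> bool" where
  "simple_mset M \<longleftrightarrow> (\<forall>x. count M x \<le> 1)"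

lemma simple_mset_mset: "simple_mset (mset xs) \<longleftrightarrow> distinct xs"
proof
  assume s: "simple_mset (mset xs)"
  have "count (mset xs) a = (if a \<in> set xs then 1 else 0)" for a
    using s[unfolded simple_mset_def, rule_format, of a] count_mset_0_iff[of xs a] by (auto simp: le_Suc_eq)
  then show "distinct xs" by (simp add: distinct_count_atmost_1)
qed (simp add: simple_mset_def distinct_count_atmost_1)

lemma simple_mset_mono: "M \<subseteq># N \<Longrightarrow> simple_mset N \<Longrightarrow> simple_mset M"
  unfolding simple_mset_def by (meson mset_subset_eq_count order_trans)

lemma simple_mset_Suc: "simple_mset M \<Longrightarrow> simple_mset (add_mset 0 (image_mset Suc M))"
proof -
  assume s: "simple_mset M"
  obtain xs where "M = mset xs" by (metis ex_mset)
  then show ?thesis using s simple_mset_mset[of "0 # map Suc xs"] by (simp add: simple_mset_mset distinct_map)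
qed

lemma mem_sum_list_mset: "t \<in> set ts \<Longrightarrow> x \<in># f t \<Longrightarrow> x \<in># sum_list (map f ts)" by (induction ts) auto

context operad
begin

text \<open>Linearity is demanded of the hole alone. That the other labels occur once is forced in
  \<open>arrow_exists\<close> by the standard term of the target.\<close>

definition hole_lin :: "'c \<Rightarrow> ('c, 'o) trm \<Rightarrow> bool" where
  "hole_lin c C \<longleftrightarrow> is_term C \<and> filter_mset (\<lambda>x. snd x = 0) (clab C) = {#(c, 0)#}"

end

lemma concat_map2_zip: "map length as = map length bs \<Longrightarrow> concat (map2 zip as bs) = zip (concat as) (concat bs)"
proof (induction as arbitrary: bs)
  case (Cons a as)
  then obtain b bs' where "bs = b # bs'" by (cases bs) auto
  with Cons show ?case by simp
qed simp

lemma card_less_nth_sorted: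
  fixes xs :: "nat list"
  assumes "sorted_wrt (<) xs" "i < length xs"
  shows "card {l \<in> set xs. l < xs ! i} = i"
proof -
  have "{l \<in> set xs. l < xs ! i} = (!) xs ` {..<i}"
  proof
    show "{l \<in> set xs. l < xs ! i} \<subseteq> (!) xs ` {..<i}"
    proof
      fix l assume "l \<in> {l \<in> set xs. l < xs ! i}"
      then obtain j where j: "j < length xs" "l = xs ! j" "xs ! j < xs ! i" by (auto simp: in_set_conv_nth)
      have "j < i"
      proof (rule ccontr)
        assume "\<not> j < i"
        then have "i = j \<or> i < j" by auto
        then show False using j sorted_wrt_nth_less[OF assms(1), of i j] by auto
      qed
      then show "l \<in> (!) xs ` {..<i}" using j by blast
    qed
    show "(!) xs ` {..<i} \<subseteq> {l \<in> set xs. l < xs ! i}" using assms sorted_wrt_nth_less[OF assms(1)] by auto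
  qed
  moreover have "inj_on ((!) xs) {..<i}" using assms by (intro inj_onI) (simp add: nth_eq_iff_index_eq strict_sorted_iff)
  ultimately show ?thesis by (simp add: card_image)
qed

lemma strict_sorted_sort: "distinct ns \<Longrightarrow> sorted_wrt (<) (sort ns)" by (simp add: strict_sorted_iff)

lemma nth_sort_rank:
  assumes "distinct ns" "(l :: nat) \<in> set ns"
  shows "sort ns ! card {l' \<in> set ns. l' < l} = l" "card {l' \<in> set ns. l' < l} < length ns"
proof -
  obtain i where i: "i < length ns" "sort ns ! i = l" using assms(2) by (metis in_set_conv_nth length_sort set_sort)
  then have "card {l' \<in> set ns. l' < l} = i" using card_less_nth_sorted[OF strict_sorted_sort[OF assms(1)], of i] by simp
  then show "sort ns ! card {l' \<in> set ns. l' < l} = l" "card {l' \<in> set ns. l' < l} < length ns" using i by simp_all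
qed

lemma sort_nth_ranks: "distinct ns \<Longrightarrow> map ((!) (sort ns)) (ranks ns) = ns" by (simp add: ranks_def nth_sort_rank map_idI)

lemma perm_list_ranks: "distinct ns \<Longrightarrow> perm_list (length ns) (ranks ns)"
proof -
  assume d: "distinct ns"
  have l: "length (ranks ns) = length ns" by (simp add: ranks_def)
  have "distinct (ranks ns)" using sort_nth_ranks[OF d] d by (metis distinct_map)
  moreover have "set (ranks ns) \<subseteq> {..<length ns}" using nth_sort_rank(2)[OF d] by (auto simp: ranks_def)
  ultimately have "set (ranks ns) = {..<length ns}" using card_subset_eq[of "{..<length ns}" "set (ranks ns)"] distinct_card[of "ranks ns"] l by simp
  then show ?thesis using l by (rule_tac perm_listI)
qed

text \<open>\<open>tw_compose\<close> keeps the first input of the lower vertex in place and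
  permutes the rest. As the hole has the least label \<open>0\<close>, this is the same as sorting
  all labels of the context.\<close>

lemma ranks_0_Suc: "ranks (0 # map Suc ns) = 0 # map Suc (ranks ns)"
proof -
  have "card {l' \<in> set (0 # map Suc ns). l' < Suc l} = Suc (card {l' \<in> set ns. l' < l})" for l
  proof -
    have "{l' \<in> set (0 # map Suc ns). l' < Suc l} = insert 0 (Suc ` {l' \<in> set ns. l' < l})" by auto
    then show ?thesis by (simp add: card_image)
  qed
  then show ?thesis by (simp add: ranks_def)
qed

lemma sort_0_Suc: "sort (0 # map Suc ns) = 0 # map Suc (sort ns)"
  by (rule properties_for_sort) (simp_all add: sorted_map mono_iff_le_Suc sorted_wrt_map)

context operad
begin

lemma mset_stdl_snd: "image_mset snd (mset (stdl t)) = mset [0..<ar t]" by (simp add: snd_stdl flip: mset_map del: mset_upt)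

lemma labelled_zip: "q \<in> Ops P \<Longrightarrow> length ls = ar q \<Longrightarrow> labelled (q, zip (ins q) ls)" by (simp add: labelled_def)

lemma shift_cls: 
  assumes "labelled (q, ls)" shows "shift (cls q ls) = cls q (map shiftl ls)"
proof -
  have "labelled (q, map shiftl ls)" using assms by (simp add: labelled_def comp_def)
  then show ?thesis using appl_vars[of q "map shiftl ls"] assms by (simp add: shift_def bind_cls comp_def)
qed

lemma is_term_shift [simp]: "is_term (shift T) \<longleftrightarrow> is_term T" by (auto simp: shift_def is_term_bind clab_colour)

lemma outc_shift: "is_term T \<Longrightarrow> outc (shift T) = outc T" using is_term_shift unfolding shift_def by (simp add: outc_bind)

lemma clab_shift: "clab (shift T) = image_mset shiftl (clab T)"
proof (cases "is_term T")
  case True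
  then obtain q ls where q: "labelled (q, ls)" "T = cls q ls" by (rule is_termE)
  then have "labelled (q, map shiftl ls)" by (simp add: labelled_def comp_def)
  then show ?thesis using q by (simp add: shift_cls clab_cls)
next
  case False
  then have "\<not> is_term (shift T)" by simp
  with False show ?thesis by (simp add: clab_def)
qed

lemma std_Act:
  assumes "q \<in> Ops P" "perm_list (ar q) xs"
  shows "std (Act P q xs) = cls q (zip (ins q) xs)"
proof -
  have ar: "ar (Act P q xs) = ar q" using assms Act_arity by blast
  have "map ((!) (stdl (Act P q xs))) xs = zip (ins q) xs" using ar perm_list_length[OF assms(2)] perm_list_nth_less[OF assms(2)] Act_inputs[OF assms]
    by (intro nth_equalityI) simp_all
  then show ?thesis using cls_Act[OF assms, of "stdl (Act P q xs)"] ar by (simp add: std_def)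
qed

text \<open>Sorting the numbers while permuting the operation by \<open>ranks\<close> is a move
  inside one orbit, since \<open>ranks ns\<close> records where each number goes under
  sorting.\<close>

lemma cls_ranks:
  assumes "q \<in> Ops P" "distinct ns" "length ns = ar q"
  shows "cls (Act P q (ranks ns)) (zip (ins (Act P q (ranks ns))) (sort ns)) = cls q (zip (ins q) ns)"
proof -
  have xs: "perm_list (ar q) (ranks ns)" using perm_list_ranks[OF assms(2)] assms(3) by simp
  let ?L = "zip (ins (Act P q (ranks ns))) (sort ns)"
  have ar: "ar (Act P q (ranks ns)) = ar q" using assms(1) xs Act_arity by blast
  have "sort ns ! (ranks ns ! k) = ns ! k" if "k < ar q" for k using sort_nth_ranks[OF assms(2)] that perm_list_length[OF xs] by (metis nth_map)
  then have "map ((!) ?L) (ranks ns) = zip (ins q) ns" using ar assms(3) perm_list_length[OF xs] perm_list_nth_less[OF xs] Act_inputs[OF assms(1) xs]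
    by (intro nth_equalityI) simp_all
  then show ?thesis using cls_Act[OF assms(1) xs, of ?L] ar assms(3) by simp
qed

lemma hole_lin_decomp:
  assumes "hole_lin c C"
  obtains M where "clab C = add_mset (c, 0) (image_mset shiftl M)" "is_term C" "c \<in> Colours P"
    "\<And>x. x \<in># M \<Longrightarrow> fst x \<in> Colours P"
proof -
  define N where "N = filter_mset (\<lambda>x. snd x \<noteq> 0) (clab C)"
  define M where "M = image_mset (\<lambda>x. (fst x, snd x - 1)) N"
  have "image_mset shiftl M = N" unfolding M_def multiset.map_comp by (rule multiset.map_ident_strong) (auto simp: shiftl_def N_def)
  then have c: "clab C = add_mset (c, 0) (image_mset shiftl M)"
    using assms multiset_partition[of "clab C" "\<lambda>x. snd x = 0"] by (simp add: hole_lin_def N_def)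
  moreover have "c \<in> Colours P" using clab_colour[of "(c, 0)" C] c by simp
  moreover have "fst x \<in> Colours P" if "x \<in># M" for x using clab_colour[of "shiftl x" C] c that by auto
  ultimately show ?thesis using that assms by (simp add: hole_lin_def)
qed

text \<open>The normal form of a term with distinct numbers. Only the numbers are kept, as the
  colours of the labels are those of the inputs of the operation.\<close>

lemma sorted_form:
  assumes "is_term T" "simple_mset (image_mset snd (clab T))"
  obtains q ls where "q \<in> Ops P" "length ls = ar q" "T = cls q (zip (ins q) ls)"
    "sorted_wrt (<) ls" "mset ls = image_mset snd (clab T)"
proof -
  obtain q0 ls0 where q: "labelled (q0, ls0)" "T = cls q0 ls0" using assms(1) by (rule is_termE)
  define ls1 where "ls1 = sort_key snd ls0"
  have m: "clab T = mset ls1" using q by (simp add: clab_cls ls1_def)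
  have d: "distinct (map snd ls1)" using assms(2) unfolding m mset_map[symmetric] simple_mset_mset .
  then obtain q' where q': "labelled (q', ls1)" "T = cls q' ls1" using cls_reorder[OF assms(1) m] by (metis distinct_map)
  have z: "zip (ins q') (map snd ls1) = ls1" using q'(1) by (metis labelled_def fst_conv snd_conv zip_map_fst_snd)
  show ?thesis
  proof (rule that[of q' "map snd ls1"])
    show "q' \<in> Ops P" using q' by (simp add: labelled_def)
    show "length (map snd ls1) = ar q'" using labelled_length[OF q'(1)] by simp
    show "T = cls q' (zip (ins q') (map snd ls1))" using q' z by simp
    show "sorted_wrt (<) (map snd ls1)" using d by (simp add: strict_sorted_iff ls1_def)
    show "mset (map snd ls1) = image_mset snd (clab T)" by (simp add: m)
  qed
qed

lemma arrow_basic: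
  assumes f: "f \<in> arrs"
  shows "src f \<in> Ops P" "length (up f) = ar (src f)"
    "labelled (lower f, zip (ins (lower f)) (0 # map Suc (ll f)))"
    "list_all2 (\<lambda>q ls. labelled (q, zip (ins q) ls)) (uppers f) (ul f)"
    "sub (src f) (uppers f)"
    "length (uppers f) = ar (src f)" "length (ul f) = ar (src f)"
    "appl (src f) (up f) = cls (Subst P (src f) (uppers f))
       (zip (ins (Subst P (src f) (uppers f))) (concat (ul f)))"
    "is_term (appl (src f) (up f))"
proof -
  let ?A = "Subst P (src f) (uppers f)"
  from f have 1: "src f \<in> Ops P" and 2: "lower f \<in> Ops P" "ins (lower f) \<noteq> []"
    "length (ll f) = ar (lower f) - 1"
    and 3: "set (uppers f) \<subseteq> Ops P" "map out (uppers f) = ins (src f)"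
    and 4: "map length (ul f) = map ar (uppers f)" by (simp_all add: tw_arrows_def)
  show "src f \<in> Ops P" by fact
  have l: "length (uppers f) = ar (src f)" using 3(2) by (metis length_map)
  have l2: "length (ul f) = ar (src f)" using 4 l by (metis length_map)
  show "length (uppers f) = ar (src f)" "length (ul f) = ar (src f)" by fact+
  show "length (up f) = ar (src f)" using l l2 by (simp add: up_def)
  show "labelled (lower f, zip (ins (lower f)) (0 # map Suc (ll f)))" using 2 by (intro labelled_zip) (simp_all add: Suc_diff_1)
  have al: "length (ul f ! i) = ar (uppers f ! i)" if "i < ar (src f)" for i using 4 that l l2 by (metis nth_map)
  show la: "list_all2 (\<lambda>q ls. labelled (q, zip (ins q) ls)) (uppers f) (ul f)"
    using 3(1) l l2 al nth_mem by (auto simp: list_all2_conv_all_nth intro!: labelled_zip) 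
  show s: "sub (src f) (uppers f)" using 1 3 by (simp add: substitutable_def)
  let ?lss = "map2 zip (map ins (uppers f)) (ul f)"
  have u: "up f = map2 cls (uppers f) ?lss" using l l2 by (intro nth_equalityI) (simp_all add: up_def)
  have la': "labs (uppers f) ?lss" using la by (simp add: list_all2_conv_all_nth)
  have "concat ?lss = zip (ins ?A) (concat (ul f))" using 4 by (subst concat_map2_zip) (simp_all add: Subst_inputs[OF s] comp_def)
  with appl_cls[OF la' s] show "appl (src f) (up f) = cls ?A
       (zip (ins ?A) (concat (ul f)))"
       "is_term (appl (src f) (up f))" by (simp_all add: u is_term_cls)
qed

text \<open>\<open>tw_target\<close> fills all inputs of the lower vertex but the first with units;
  as terms these are variables, so the result is the context with the rest of the arrow in its hole.
  The final permutation becomes the numbering of the leaves by \<open>std_Act\<close>.\<close>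

lemma arrow_target:
  assumes f: "f \<in> arrs"
  shows "tgt f \<in> Ops P"
    "bind (ctxsub (appl (src f) (up f)) var) (lo f) = std (tgt f)"
proof -
  let ?B = "concat (ul f) @ ll f"
  note b = arrow_basic[OF f]
  let ?s1 = "Subst P (src f) (uppers f)"
  let ?A = "appl (src f) (up f)"
  from f have 2: "lower f \<in> Ops P" "ins (lower f) \<noteq> []" "hd (ins (lower f)) = out (src f)"
    "length (ll f) = ar (lower f) - 1"
    and 4: "map length (ul f) = map ar (uppers f)"
    and pl: "perm_list (length (concat (ul f)) + length (ll f))
      ?B"
    unfolding tw_arrows_def by blast+
  then obtain cs where cs: "ins (lower f) = out (src f) # cs" "length cs = length (ll f)" by (cases "ins (lower f)") auto
  have csC: "set cs \<subseteq> Colours P" using inputs_colours[OF 2(1)] cs by simp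
  let ?qs = "?s1 # map (Unit P) cs"
  have s: "sub (lower f) ?qs" using 2(1) cs csC Subst_op[OF b(5)] Subst_output[OF b(5)]
    by (auto simp: substitutable_def Unit_op Unit_output subset_iff intro!: map_idI)
  have s0: "subst_first P (lower f) ?s1 = Subst P (lower f) ?qs" by (simp add: subst_first_def cs)
  have "concat (map ins (map (Unit P) cs)) = cs" using csC by (induction cs) (auto simp: Unit_inputs)
  then have i0: "ins (Subst P (lower f) ?qs) = ins ?s1 @ cs" by (simp add: Subst_inputs[OF s])
  have l1: "length (concat (ul f)) = ar ?s1" using arg_cong[OF 4, of sum_list] by (simp add: Subst_inputs[OF b(5)] length_concat comp_def)
  have pl': "perm_list (ar (Subst P (lower f) ?qs)) ?B" using pl l1 cs by (simp add: i0)
  show "tgt f \<in> Ops P" unfolding tw_target_def s0 using Act_op[OF Subst_op[OF s] pl'] .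
  let ?l0 = "zip (ins ?s1) (concat (ul f))"
  have lab0: "labelled (?s1, ?l0)" using Subst_op[OF b(5)] l1 by (intro labelled_zip) auto
  have "bind (ctxsub ?A var) (lo f) = appl (lower f) (map (ctxsub ?A var) (lolab f))" unfolding lo_def by (rule bind_cls[OF b(3)])
  also have "map (ctxsub ?A var) (lolab f)
      = ?A # map var (zip cs (ll f))"
    by (simp add: cs flip: map_zip_Suc)
  also have "\<dots> = map2 cls ?qs (?l0 # map (\<lambda>x. [x]) (zip cs (ll f)))"
    using cs by (intro nth_equalityI) (auto simp: b(8) nth_Cons var_def split: nat.split)
  also have "appl (lower f) \<dots> = cls (Subst P (lower f) ?qs) (concat (?l0 # map (\<lambda>x. [x]) (zip cs (ll f))))"
  proof (rule appl_cls(1)[OF _ s])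
    have "labelled (Unit P (cs ! i), [(cs ! i, ll f ! i)])" if "i < length cs" for i
      using labelled_var[of "(cs ! i, ll f ! i)"] csC nth_mem[OF that] by auto
    then show "labs ?qs (?l0 # map (\<lambda>x. [x]) (zip cs (ll f)))"
      using lab0 cs(2) by (simp add: list_all2_conv_all_nth nth_Cons split: nat.split)
  qed
  also have "concat (?l0 # map (\<lambda>x. [x]) (zip cs (ll f))) = zip (ins (Subst P (lower f) ?qs)) ?B"
  proof -
    have "concat (map (\<lambda>x. [x]) xs) = xs" for xs :: "'z list" by (induction xs) auto
    then show ?thesis using l1 by (simp add: i0 zip_append)
  qed
  also have "cls (Subst P (lower f) ?qs) \<dots> = std (tgt f)" unfolding tw_target_def s0 using std_Act[OF Subst_op[OF s] pl'] by simp
  finally show "bind (ctxsub ?A var) (lo f) = std (tgt f)" .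
qed

lemma arrow_lo:
  assumes f: "f \<in> arrs"
  shows "is_term (lo f)" "outc (lo f) = out (lower f)"
    "clab (lo f) = mset (lolab f)"
    "hole_lin (out (src f)) (lo f)"
    "outc (lo f) = out (tgt f)"
proof -
  note b = arrow_basic[OF f]
  show 1: "is_term (lo f)" "outc (lo f) = out (lower f)"
    "clab (lo f) = mset (lolab f)" using b(3) by (simp_all add: lo_def is_term_cls outc_cls clab_cls)
  from f obtain cs where cs: "ins (lower f) = out (src f) # cs" by (cases "ins (lower f)") (auto simp: tw_arrows_def)
  have "filter (\<lambda>x. snd x = 0) (zip cs (map Suc (ll f))) = []" by (auto simp: filter_empty_conv dest!: set_zip_rightD)
  then show "hole_lin (out (src f)) (lo f)" using 1 by (simp add: hole_lin_def cs flip: mset_filter)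
  show "outc (lo f) = out (tgt f)" using outc_bind[of "ctxsub (appl (src f) (up f)) var" "lo f"] arrow_target[OF f] by simp
qed

text \<open>The hole occurs exactly once, so the labels of \<open>A\<close> are counted once, and a
  well-typed result forces \<open>A\<close> to have the type of the hole.\<close>

lemma total_clab:
  assumes "hole_lin c C" "is_term (bind (ctxsub A var) C)" "clab C = add_mset (c, 0) (image_mset shiftl M)"
  shows "clab (bind (ctxsub A var) C) = clab A + M" "is_term A" "outc A = c"
proof -
  obtain M' where M': "clab C = add_mset (c, 0) (image_mset shiftl M')" "\<And>x. x \<in># M' \<Longrightarrow> fst x \<in> Colours P"
    using hole_lin_decomp[OF assms(1)] by metis
  have "inj shiftl" by (simp add: inj_def shiftl_inj)
  then have "inj (image_mset shiftl)" by (rule multiset.inj_map)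
  moreover have "image_mset shiftl M' = image_mset shiftl M" using assms(3) M'(1) by simp
  ultimately have eq: "M' = M" by (rule injD)
  then have "image_mset (clab \<circ> var) M = image_mset (\<lambda>x. {#x#}) M" using M'(2) by (intro image_mset_cong) simp
  then show "clab (bind (ctxsub A var) C) = clab A + M" using clab_bind[OF assms(2)] by (simp add: assms(3) multiset.map_comp comp_def)
  show "is_term A" "outc A = c" using assms(2) unfolding is_term_bind assms(3) by auto
qed

text \<open>The two sides of \<open>arrow_target\<close> have the same labels, so each leaf is an
  input of the target, with its colour. This is what makes grafting along a following arrow well
  typed.\<close>

lemma arrow_leaves:
  assumes f: "f \<in> arrs"
  shows "\<And>U x. U \<in> set (up f) \<Longrightarrow> x \<in># clab U \<Longrightarrow> x \<in> set (stdl (tgt f))"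
    "\<And>x. shiftl x \<in># clab (lo f) \<Longrightarrow> x \<in> set (stdl (tgt f))"
    "\<And>x. x \<in># clab (appl (src f) (up f)) \<Longrightarrow> x \<in> set (stdl (tgt f))"
proof -
  let ?A = "appl (src f) (up f)"
  obtain M where M: "clab (lo f) = add_mset (out (src f), 0) (image_mset shiftl M)" using hole_lin_decomp[OF arrow_lo(4)[OF f]] by metis
  have t: "is_term (bind (ctxsub ?A var) (lo f))" using arrow_target[OF f] by simp
  have c: "mset (stdl (tgt f)) = clab ?A + M" using total_clab(1)[OF arrow_lo(4)[OF f] t M] arrow_target[OF f] by simp
  have ok: "ok (src f) (up f)" using arrow_basic(9)[OF f] ok_is_term by blast
  show 3: "x \<in> set (stdl (tgt f))" if "x \<in># clab ?A" for x using that by (metis c set_mset_mset mset_subset_eq_add_left mset_subset_eqD)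
  show "x \<in> set (stdl (tgt f))" if "U \<in> set (up f)" "x \<in># clab U" for U x
  proof (rule 3)
    have "x \<in># sum_list (map clab (up f))" using that by (rule mem_sum_list_mset)
    then show "x \<in># clab ?A" by (simp add: clab_appl[OF ok])
  qed
  show "x \<in> set (stdl (tgt f))" if "shiftl x \<in># clab (lo f)" for x
  proof -
    have "x \<in># M" using that M by (auto simp: shiftl_inj shiftl_def)
    then show ?thesis by (metis c set_mset_mset mset_subset_eq_add_right mset_subset_eqD)
  qed
qed

lemma arrow_up:
  assumes f: "f \<in> arrs" and i: "i < ar (src f)"
  shows "is_term (up f ! i)" "outc (up f ! i) = ins (src f) ! i"
proof -
  have "ok (src f) (up f)" using arrow_basic(9)[OF f] ok_is_term by blast
  then show "is_term (up f ! i)" "outc (up f ! i) = ins (src f) ! i" using i arrow_basic(2)[OF f] unfolding ok_def by (auto, metis nth_map)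
qed

text \<open>Leaf numbers increase at every vertex, also with \<open>0\<close> put in front of the
  lower ones, so \<open>cls_sorted_inj\<close> recovers operations and numbers from the
  terms.\<close>

lemma arrow_eqI:
  assumes f: "f \<in> arrs" and g: "g \<in> arrs"
    and eq: "src f = src g" "lo f = lo g" "up f = up g"
  shows "f = g"
proof -
  note bf = arrow_basic[OF f] and bg = arrow_basic[OF g]
  have s: "sorted_wrt (<) (ll h)" "\<forall>ls\<in>set (ul h). sorted_wrt (<) ls" if "h \<in> arrs" for h using that by (simp_all add: tw_arrows_def)
  have len: "length (0 # map Suc (ll h)) = ar (lower h)" if "h \<in> arrs" for h using that by (cases "ins (lower h)") (simp_all add: tw_arrows_def)
  have "lower f = lower g \<and> zip (ins (lower f)) (0 # map Suc (ll f)) = zip (ins (lower g)) (0 # map Suc (ll g))"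
    using eq(2) s[OF f] s[OF g] len[OF f] len[OF g] by (intro cls_sorted_inj bf(3) bg(3)) (simp_all add: lo_def sorted_wrt_map del: zip_Cons_Cons)
  then have 1: "lower f = lower g" "ll f = ll g" using len[OF f] len[OF g] by (auto dest!: arg_cong[of _ _ "map snd"] simp del: zip_Cons_Cons)
  have 2: "uppers f ! i = uppers g ! i \<and> ul f ! i = ul g ! i" if i: "i < ar (src f)" for i
  proof -
    have e: "cls (uppers f ! i) (zip (ins (uppers f ! i)) (ul f ! i)) = cls (uppers g ! i) (zip (ins (uppers g ! i)) (ul g ! i))"
    proof -
      have "up h ! i = cls (uppers h ! i) (zip (ins (uppers h ! i)) (ul h ! i))" if "h \<in> arrs" "i < ar (src h)" for h
        using that arrow_basic(6,7)[OF that(1)] by (simp add: up_def)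
      then show ?thesis using f g i eq by metis
    qed
    have l: "length (ul h ! i) = ar (uppers h ! i)" if "h \<in> arrs" "i < ar (src h)" for h
      using that arrow_basic(6,7)[OF that(1)] by (simp add: tw_arrows_def) (metis nth_map)
    have lf: "length (ul f ! i) = ar (uppers f ! i)" "length (ul g ! i) = ar (uppers g ! i)" using l f g eq(1) i by simp_all
    have "uppers f ! i = uppers g ! i \<and> zip (ins (uppers f ! i)) (ul f ! i) = zip (ins (uppers g ! i)) (ul g ! i)"
      using e i eq(1) bf(4,6,7) bg(4,6,7) s(2)[OF f] s(2)[OF g] lf by (intro cls_sorted_inj) (simp_all add: list_all2_conv_all_nth)
    then show ?thesis using lf by (metis map_snd_zip)
  qed
  have "uppers f = uppers g" "ul f = ul g" using 2 bf(6,7) bg(6,7) eq(1) by (auto intro!: nth_equalityI)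
  with 1 eq(1) show ?thesis by simp
qed

text \<open>Converse of \<open>arrow_target\<close>. The numbers in \<open>std t\<close> are
  distinct, hence so are those at each vertex, which therefore has an increasing representative
  (\<open>sorted_form\<close>). Counting all labels together yields that the leaf numbering is a
  bijection.\<close>

lemma arrow_exists:
  assumes p: "p \<in> Ops P" and t: "t \<in> Ops P" and C: "hole_lin (out p) C"
    and tot: "bind (ctxsub (appl p Us) var) C = std t"
  obtains f where "f \<in> arrs" "src f = p" "lo f = C" "up f = Us" "tgt f = t"
proof -
  let ?c = "out p"
  obtain M where M: "clab C = add_mset (?c, 0) (image_mset shiftl M)" "is_term C" using hole_lin_decomp[OF C] by metis
  have "is_term (bind (ctxsub (appl p Us) var) C)" using t by (simp add: tot)
  note tc = total_clab[OF C this M(1), unfolded tot]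
  have ok: "ok p Us" using tc(2) ok_is_term by blast
  have sum: "mset (stdl t) = sum_list (map clab Us) + M" using tc(1) clab_appl[OF ok] t by simp
  have sumn: "mset [0..<ar t] = sum_list (map (\<lambda>U. image_mset snd (clab U)) Us) + image_mset snd M"
  proof -
    have "image_mset snd (sum_list (map clab Us)) = sum_list (map (\<lambda>U. image_mset snd (clab U)) Us)" for Us by (induction Us) simp_all
    then show ?thesis using arg_cong[OF sum, of "image_mset snd"] mset_stdl_snd[of t] by simp
  qed
  have dU: "simple_mset (image_mset snd (clab U))" if "U \<in> set Us" for U
  proof -
    have "image_mset snd (clab U) \<subseteq># sum_list (map (\<lambda>U. image_mset snd (clab U)) Us)"
      using that by (induction Us) (auto intro: subset_mset.order_trans[OF _ mset_subset_eq_add_right])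
    then have "image_mset snd (clab U) \<subseteq># mset [0..<ar t]" unfolding sumn by (rule subset_mset.order_trans) simp
    then show ?thesis using simple_mset_mono distinct_upt simple_mset_mset by metis
  qed
  have dM: "simple_mset (image_mset snd M)"
    using simple_mset_mono[of "image_mset snd M" "mset [0..<ar t]"] sumn simple_mset_mset by (metis distinct_upt mset_subset_eq_add_right)
  have cC: "image_mset snd (clab C) = add_mset 0 (image_mset Suc (image_mset snd M))" by (simp add: M multiset.map_comp comp_def)
  have "simple_mset (image_mset snd (clab C))" unfolding cC using dM by (rule simple_mset_Suc)
  then obtain q0 ls where q0: "q0 \<in> Ops P" "length ls = ar q0" "C = cls q0 (zip (ins q0) ls)"
    "sorted_wrt (<) ls" "mset ls = image_mset snd (clab C)" using sorted_form[OF M(2)] by metis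
  \<comment> \<open>The hole has the least label, so in increasing order it comes first, as the
    lower vertex of an arrow requires.\<close>
  have "0 \<in> set ls" using q0(5) cC by (metis set_mset_mset union_single_eq_member)
  then obtain ls' where ls': "ls = 0 # ls'" using q0(4) by (cases ls) auto
  define ls0 where "ls0 = map (\<lambda>x. x - 1) ls'"
  have ls: "ls = 0 # map Suc ls0" using ls' q0(4) by (auto simp: ls0_def intro!: map_idI[symmetric])
  have "\<forall>U \<in> set Us. \<exists>q ls. q \<in> Ops P \<and> length ls = ar q \<and> U = cls q (zip (ins q) ls) \<and>
    sorted_wrt (<) ls \<and> mset ls = image_mset snd (clab U)"
    using sorted_form dU ok unfolding ok_def by metis
  then obtain Q L where QL: "\<And>U. U \<in> set Us \<Longrightarrow> Q U \<in> Ops P \<and> length (L U) = ar (Q U) \<and> U = cls (Q U) (zip (ins (Q U)) (L U)) \<and>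
    sorted_wrt (<) (L U) \<and> mset (L U) = image_mset snd (clab U)" by metis
  define f where "f = \<lparr>source = p, lower = q0, uppers = map Q Us, lower_leaves = ls0, upper_leaves = map L Us\<rparr>"
  have up: "up f = Us" using QL by (simp add: f_def up_def map_idI zip_map1 zip_map2 comp_def zip_same_conv_map)
  have lo: "lo f = C" using q0 ls by (simp add: f_def lo_def)
  obtain c cs where cs: "ins q0 = c # cs" using q0(2) ls by (cases "ins q0") auto
  have "clab C = mset (zip (ins q0) ls)" using q0 labelled_zip by (simp add: clab_cls)
  then have "(c, 0) \<in># clab C" by (simp add: cs ls)
  then have cc: "c = ?c" using M by (auto simp: shiftl_def)
  have "image_mset Suc (mset ls0) = image_mset Suc (image_mset snd M)" using q0(5) unfolding cC ls by simp
  then have m0: "mset ls0 = image_mset snd M" by (metis inj_Suc multiset.inj_map injD)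
  have mm: "mset (concat (map L Us) @ ls0) = mset [0..<ar t]"
  proof -
    have "mset (concat (map L Us)) = sum_list (map (\<lambda>U. image_mset snd (clab U)) Us)"
      using QL by (simp add: mset_concat comp_def cong: map_cong)
    then show ?thesis using sumn m0 by simp
  qed
  have outs: "map out (map Q Us) = ins p"
  proof -
    have "out (Q U) = outc U" if "U \<in> set Us" for U using QL[OF that] labelled_zip outc_cls by metis
    then show ?thesis using ok by (simp add: ok_def cong: map_cong)
  qed
  have n: "length (concat (map L Us)) + length ls0 = ar t" using mset_eq_length[OF mm] by simp
  have "f \<in> arrs" unfolding tw_arrows_def mem_Collect_eq
  proof (intro conjI)
    show "perm_list (length (concat (ul f)) + length (ll f)) (concat (ul f) @ ll f)" unfolding perm_list_mset using mm n by (simp add: f_def)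
    show "sorted_wrt (<) (ll f)" using q0(4) ls by (simp add: f_def sorted_wrt_map)
  qed (use p q0 QL cs cc ls outs in \<open>auto simp: f_def\<close>)
  moreover from this have "tgt f = t" using arrow_target[of f] tot lo up t std_inj by (simp add: f_def)
  ultimately show ?thesis using that[of f] lo up by (simp add: f_def)
qed

section \<open>Composition of arrows as substitution\<close>

definition graft :: "'o tw_arr \<Rightarrow> 'c \<times> nat \<Rightarrow> ('c, 'o) trm" where
  "graft g x = up g ! snd x"

abbreviation "sgraft g \<equiv> \<lambda>x. shift (graft g x)"

text \<open>The composite of the lower vertex of \<open>g\<close> with that of \<open>f\<close>
  after grafting; the variable labelled \<open>0\<close> plays the part of the identity operation in
  the first input of the lower vertex of \<open>f\<close>.\<close>

definition comp_lo :: "'o tw_arr \<Rightarrow> 'o tw_arr \<Rightarrow> ('c, 'o) trm" where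
  "comp_lo g f = bind (ctxsub
     (bind (ctxsub (var (out (src f), 0)) (sgraft g)) (lo f))
     svar) (lo g)"

lemma graft_std:
  assumes "g \<in> arrs" "x \<in> set (stdl (src g))"
  shows "is_term (graft g x)" "outc (graft g x) = fst x"
proof -
  obtain i where i: "i < ar (src g)" "x = (ins (src g) ! i, i)" using assms(2) by (metis in_set_conv_nth length_stdl nth_stdl)
  then show "is_term (graft g x)" "outc (graft g x) = fst x" using arrow_up[OF assms(1) i(1)] by (simp_all add: graft_def)
qed

lemma bind_graft_std: "g \<in> arrs \<Longrightarrow> bind (graft g) (std (src g)) = appl (src g) (up g)"
  unfolding graft_def[abs_def] by (rule bind_sel_std) (simp_all add: arrow_basic(1,2))

lemma arrow_total_colour: "f \<in> arrs \<Longrightarrow> outc (appl (src f) (up f)) = out (src f)"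
  using arrow_basic(9)[of f] by (simp add: ok_is_term outc_appl)

lemma bind_ctxsub_cong:
  assumes "\<And>x. shiftl x \<in># clab C \<Longrightarrow> \<sigma> x = \<tau> x"
  shows "bind (ctxsub S \<sigma>) C = bind (ctxsub S \<tau>) C"
proof (rule bind_cong)
  fix x assume x: "x \<in># clab C"
  from label_cases[of x] show "ctxsub S \<sigma> x = ctxsub S \<tau> x" using assms x by (auto simp: ctxsub_0)
qed

lemma shiftl_colour: "shiftl x \<in># clab C \<Longrightarrow> fst x \<in> Colours P" using clab_colour[of "shiftl x" C] by simp

lemma source_colour: "f \<in> arrs \<Longrightarrow> out (src f) \<in> Colours P" by (simp add: arrow_basic output_colour)

lemma bind_var_eq: "fst x \<in> Colours P \<Longrightarrow> bind \<sigma> (var x) = appl (Unit P (fst x)) [\<sigma> x]"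
  using bind_cls[OF labelled_var, of x \<sigma>] by (simp add: var_def)

lemma appl_Unit_idem: "c \<in> Colours P \<Longrightarrow> appl (Unit P c) [appl (Unit P c) [t]] = appl (Unit P c) [t]" by (simp add: appl_Unit_eq)

text \<open>A substitution acts through its values on variables, where a unit tests their type;
  values that fail the test may therefore differ. With \<open>bind_cong\<close> alone,
  \<open>comp_lo_eq\<close> would need typing assumptions on \<open>A\<close> and
  \<open>\<sigma>\<close>.\<close>

lemma bind_cong_Unit:
  assumes "\<And>x. x \<in># clab T \<Longrightarrow> appl (Unit P (fst x)) [\<sigma> x] = appl (Unit P (fst x)) [\<tau> x]"
  shows "bind \<sigma> T = bind \<tau> T"
proof (cases "is_term T")
  case True
  have "bind \<sigma> T = bind (\<lambda>x. bind \<sigma> (var x)) T" for \<sigma> using bind_bind[of \<sigma> "var" T] bind_ident[OF True] by simp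
  moreover have "bind (\<lambda>x. bind \<sigma> (var x)) T = bind (\<lambda>x. bind \<tau> (var x)) T"
    by (rule bind_cong) (simp add: bind_var_eq clab_colour assms)
  ultimately show ?thesis by metis
qed (simp add: not_term)

lemma shift_var: "fst x \<in> Colours P \<Longrightarrow> shift (var x) = var (shiftl x)" by (simp add: shift_def bind_var)

lemma hole_lin_zero: "hole_lin c C \<Longrightarrow> x \<in># clab C \<Longrightarrow> snd x = 0 \<Longrightarrow> x = (c, 0)"
proof -
  assume a: "hole_lin c C" "x \<in># clab C" "snd x = 0"
  then have x: "x \<in># filter_mset (\<lambda>x. snd x = 0) (clab C)" by simp
  have "filter_mset (\<lambda>x. snd x = 0) (clab C) = {#(c, 0)#}" using a(1) by (simp add: hole_lin_def)
  then show ?thesis using x by (metis set_mset_single singletonD)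
qed

text \<open>Kept general in \<open>A\<close> and \<open>\<sigma>\<close>, since it is applied with
  variables to compute targets, with shifted terms for associativity, and with the inverse of a
  lower vertex for pushouts.\<close>

lemma comp_lo_eq:
  assumes f: "f \<in> arrs"
  shows "bind (ctxsub A \<sigma>) (comp_lo g f) =
    bind (ctxsub (bind (ctxsub A (\<lambda>x. bind \<sigma> (graft g x))) (lo f)) \<sigma>) (lo g)"
proof -
  have "bind (ctxsub (bind (ctxsub A \<sigma>) (var (out (src f), 0))) (\<lambda>x. bind \<sigma> (graft g x))) (lo f)
    = bind (ctxsub A (\<lambda>x. bind \<sigma> (graft g x))) (lo f)"
  proof (rule bind_cong_Unit)
    fix x assume x: "x \<in># clab (lo f)"
    from label_cases[of x] show "appl (Unit P (fst x)) [ctxsub (bind (ctxsub A \<sigma>) (var (out (src f), 0))) (\<lambda>x. bind \<sigma> (graft g x)) x]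
      = appl (Unit P (fst x)) [ctxsub A (\<lambda>x. bind \<sigma> (graft g x)) x]"
      using hole_lin_zero[OF arrow_lo(4)[OF f] x] source_colour[OF f] by (auto simp: bind_var_eq appl_Unit_idem)
  qed
  moreover have "appl (Unit P (fst x)) [bind (ctxsub A \<sigma>) (var (shiftl x))] = appl (Unit P (fst x)) [\<sigma> x]"
    if "fst x \<in> Colours P" for x using that by (simp add: bind_var_eq appl_Unit_idem)
  ultimately show ?thesis unfolding comp_lo_def bind_ctxsub bind_shift
    by (intro bind_cong_Unit) (metis (no_types, lifting) clab_colour ctxsub_0 ctxsub_simps(2) label_cases shiftl_simps(1))
qed

lemma clab_ctx:
  assumes C: "clab C = add_mset (c, 0) (image_mset shiftl M)" and t: "is_term (bind (ctxsub X \<sigma>) C)"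
  shows "clab (bind (ctxsub X \<sigma>) C) = clab X + (\<Sum>x\<in>#M. clab (\<sigma> x))"
  unfolding clab_bind[OF t] C by (simp add: multiset.map_comp comp_def)

lemma filter_sum_mset: "filter_mset p (\<Sum>x\<in>#M. h x) = (\<Sum>x\<in>#M. filter_mset p (h x))" by (induction M) auto

text \<open>By \<open>arrow_leaves\<close> the lower leaves of \<open>f\<close> are inputs of
  \<open>src g\<close>, so that grafting is well typed; of the labels \<open>0\<close> only the hole
  of \<open>f\<close> survives, because all grafted terms are shifted and the hole of
  \<open>lo g\<close> is filled.\<close>

lemma hole_lin_comp:
  assumes f: "f \<in> arrs" and g: "g \<in> arrs" and fg: "src g = tgt f"
  shows "hole_lin (out (src f)) (comp_lo g f)" "outc (comp_lo g f) = out (tgt g)"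
proof -
  let ?c = "out (src f)"
  let ?X = "bind (ctxsub (var (?c, 0)) (sgraft g)) (lo f)"
  have gt: "is_term (graft g x)" "outc (graft g x) = fst x" if "shiftl x \<in># clab (lo f)" for x
    using graft_std[OF g, of x] arrow_leaves(2)[OF f that] fg by simp_all
  have X: "is_term ?X" unfolding is_term_bind
  proof (intro conjI ballI)
    show "is_term (lo f)" using arrow_lo[OF f] by simp
    fix x assume x: "x \<in># clab (lo f)"
    from label_cases[of x] show "is_term (ctxsub (var (?c, 0)) (sgraft g) x)"
      "outc (ctxsub (var (?c, 0)) (sgraft g) x) = fst x"
      using hole_lin_zero[OF arrow_lo(4)[OF f] x] source_colour[OF f] gt x by (auto simp: outc_shift)
  qed
  have oX: "outc ?X = out (src g)" using outc_bind[OF X] arrow_lo(5)[OF f] fg by simp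
  have C: "is_term (comp_lo g f)" unfolding comp_lo_def is_term_bind
  proof (intro conjI ballI)
    show "is_term (lo g)" using arrow_lo[OF g] by simp
    fix x assume x: "x \<in># clab (lo g)"
    from label_cases[of x] show "is_term (ctxsub ?X svar x)"
      "outc (ctxsub ?X svar x) = fst x" using hole_lin_zero[OF arrow_lo(4)[OF g] x] X oX clab_colour[OF x] by auto
  qed
  show "outc (comp_lo g f) = out (tgt g)" using outc_bind C arrow_lo(5)[OF g] unfolding comp_lo_def by metis
  obtain M where M: "clab (lo g) = add_mset (out (src g), 0) (image_mset shiftl M)" "\<And>x. x \<in># M \<Longrightarrow> fst x \<in> Colours P"
    using hole_lin_decomp[OF arrow_lo(4)[OF g]] by metis
  obtain N where N: "clab (lo f) = add_mset (?c, 0) (image_mset shiftl N)" "\<And>x. x \<in># N \<Longrightarrow> fst x \<in> Colours P"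
    using hole_lin_decomp[OF arrow_lo(4)[OF f]] by metis
  have z: "filter_mset (\<lambda>x. snd x = 0) (image_mset shiftl K) = {#}" for K :: "('c \<times> nat) multiset" by (induction K) auto
  have zM: "(\<Sum>x\<in>#M. filter_mset (\<lambda>x. snd x = 0) (clab (var (shiftl x)))) = {#}" using M(2) by (simp add: sum_mset.neutral)
  have "filter_mset (\<lambda>x. snd x = 0) (clab ?X) = {#(?c, 0)#}"
    unfolding clab_ctx[OF N(1) X] using source_colour[OF f] by (simp add: filter_sum_mset clab_shift z)
  then have "filter_mset (\<lambda>x. snd x = 0) (clab (comp_lo g f)) = {#(?c, 0)#}"
    unfolding comp_lo_def clab_ctx[OF M(1) C[unfolded comp_lo_def]] by (simp add: filter_sum_mset zM)
  then show "hole_lin ?c (comp_lo g f)" using C by (simp add: hole_lin_def)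
qed

text \<open>The substituted terms satisfy the hypothesis of \<open>arrow_exists\<close>: two uses of
  \<open>arrow_target\<close>, for \<open>f\<close> and then for \<open>g\<close>, lead to the
  standard term of \<open>tgt g\<close>.\<close>

lemma comp_exists:
  assumes f: "f \<in> arrs" and g: "g \<in> arrs" and fg: "src g = tgt f"
  obtains e where "e \<in> arrs" "src e = src f" "lo e = comp_lo g f"
    "up e = map (bind (graft g)) (up f)" "tgt e = tgt g"
proof (rule arrow_exists)
  show "src f \<in> Ops P" "tgt g \<in> Ops P" using arrow_basic[OF f] arrow_target[OF g] by simp_all
  show "hole_lin (out (src f)) (comp_lo g f)" using hole_lin_comp[OF assms] by simp
  have 1: "bind (ctxsub (bind (graft g) A) (\<lambda>x. bind var (graft g x))) (lo f)
    = bind (graft g) (bind (ctxsub A var) (lo f))" for A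
    unfolding bind_ctxsub
  proof (rule bind_ctxsub_cong)
    fix x assume x: "shiftl x \<in># clab (lo f)"
    then have "is_term (graft g x)" "outc (graft g x) = fst x" using graft_std[OF g, of x] arrow_leaves(2)[OF f x] fg by simp_all
    then show "bind var (graft g x) = bind (graft g) (var x)" using shiftl_colour[OF x] by (simp add: bind_ident bind_var)
  qed
  show "bind (ctxsub (appl (src f) (map (bind (graft g)) (up f))) var) (comp_lo g f) = std (tgt g)"
    unfolding comp_lo_eq[OF f] bind_appl[symmetric] 1 arrow_target(2)[OF f] fg[symmetric] bind_graft_std[OF g] by (rule arrow_target(2)[OF g])
qed

text \<open>From a representative with arbitrary distinct numbers the increasing one is computed by
  exactly the formulas with \<open>ranks\<close> and \<open>sort\<close> that occur in
  \<open>tw_compose\<close>.\<close>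

lemma sorted_cls_unique:
  assumes "cls q (zip (ins q) ns) = cls q' (zip (ins q') ls)"
    "q \<in> Ops P" "length ns = ar q" "q' \<in> Ops P" "length ls = ar q'" "sorted_wrt (<) ls"
  shows "q' = Act P q (ranks ns)" "ls = sort ns"
proof -
  let ?z = "zip (ins q) ns" and ?z' = "zip (ins q') ls"
  have la: "labelled (q, ?z)" "labelled (q', ?z')" using labelled_zip assms by simp_all
  then have "mset ?z = mset ?z'" using assms(1) by (metis clab_cls)
  then have "mset (map snd ?z) = mset (map snd ?z')" by (simp only: mset_map)
  then have m: "mset ns = mset ls" using assms by simp
  have d: "distinct ns" using mset_eq_imp_distinct_iff[OF m] assms(6) by (simp add: strict_sorted_iff)
  show s: "ls = sort ns" using m assms(6) by (simp add: properties_for_sort strict_sorted_iff)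
  have pr: "perm_list (ar q) (ranks ns)" using perm_list_ranks[OF d] assms(3) by simp
  let ?w = "zip (ins (Act P q (ranks ns))) (sort ns)"
  have "cls (Act P q (ranks ns)) ?w = cls q' ?z'" using cls_ranks[OF assms(2) d assms(3)] assms(1) by simp
  moreover have "labelled (Act P q (ranks ns), ?w)" using assms(2,3) pr by (intro labelled_zip) (simp_all add: Act_op Act_arity)
  ultimately show "q' = Act P q (ranks ns)"
    using cls_sorted_inj[of "Act P q (ranks ns)" ?w q' ?z'] la(2) assms(3,5,6) strict_sorted_sort[OF d] Act_arity[OF assms(2) pr] by simp
qed

lemma appl_cls_zip:
  assumes s: "sub p qs" and l: "map length lss = map ar qs"
  shows "appl p (clss qs lss)
      = cls (Subst P p qs) (zip (ins (Subst P p qs)) (concat lss))"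
    "length (concat lss) = ar (Subst P p qs)"
proof -
  let ?A = "map2 zip (map ins qs) lss"
  have len: "length lss = length qs" using l by (metis length_map)
  have la: "labs qs ?A"
  proof -
    have "length (lss ! i) = ar (qs ! i)" if "i < length qs" for i using l len that by (metis nth_map)
    moreover have "qs ! i \<in> Ops P" if "i < length qs" for i using s that by (auto simp: substitutable_def)
    ultimately show ?thesis using len by (auto simp: list_all2_conv_all_nth intro!: labelled_zip)
  qed
  have e: "clss qs lss = map2 cls qs ?A" using len by (intro nth_equalityI) simp_all
  have c: "concat ?A = zip (ins (Subst P p qs)) (concat lss)" using l by (subst concat_map2_zip) (simp_all add: Subst_inputs[OF s] comp_def)
  show "appl p (clss qs lss)
      = cls (Subst P p qs) (zip (ins (Subst P p qs)) (concat lss))"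
    unfolding e appl_cls(1)[OF la s] c ..
  show "length (concat lss) = ar (Subst P p qs)" using arg_cong[OF l, of sum_list] by (simp add: Subst_inputs[OF s] length_concat comp_def)
qed

lemma up_nth:
  "f \<in> arrs \<Longrightarrow> i < ar (src f) \<Longrightarrow>
    up f ! i = cls (uppers f ! i) (zip (ins (uppers f ! i)) (ul f ! i)) \<and>
    uppers f ! i \<in> Ops P \<and> length (ul f ! i) = ar (uppers f ! i) \<and>
    out (uppers f ! i) = ins (src f) ! i"
proof -
  assume f: "f \<in> arrs" and i: "i < ar (src f)"
  note b = arrow_basic(6,7)[OF f]
  have "map length (ul f) = map ar (uppers f)" "set (uppers f) \<subseteq> Ops P"
    "map out (uppers f) = ins (src f)" using f by (simp_all add: tw_arrows_def)
  then have "length (ul f ! i) = ar (uppers f ! i)" "uppers f ! i \<in> Ops P"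
    "out (uppers f ! i) = ins (src f) ! i" using b i by (metis nth_map, metis nth_mem subsetD, metis nth_map)
  then show ?thesis using b i by (simp add: up_def)
qed

text \<open>Vertex by vertex, the formulas of \<open>tw_compose\<close> give the increasing
  representatives of the substituted terms, which is the arrow \<open>e\<close> of
  \<open>comp_exists\<close>. From here on composition is substitution and the formulas stay
  folded.\<close>

lemma tw_compose_props:
  assumes f: "f \<in> arrs" and g: "g \<in> arrs" and fg: "src g = tgt f"
  shows "cmp g f \<in> arrs" "src (cmp g f) = src f"
    "lo (cmp g f) = comp_lo g f"
    "up (cmp g f) = map (bind (graft g)) (up f)"
    "tgt (cmp g f) = tgt g"
proof -
  obtain e where e: "e \<in> arrs" "src e = src f" "lo e = comp_lo g f"
    "up e = map (bind (graft g)) (up f)" "tgt e = tgt g" using comp_exists[OF assms] by metis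
  let ?h = "cmp g f"
  let ?c = "out (src f)"
  define grafted where "grafted ls = map ((!) (uppers g)) ls" for ls
  define numbers where "numbers ls = concat (map ((!) (ul g)) ls)" for ls
  define ln where "ln = numbers (ll f) @ ll g"
  note bf = arrow_basic[OF f] and bg = arrow_basic[OF g] and be = arrow_basic[OF e(1)]
  have sorted_e: "sorted_wrt (<) (ll e)" "\<forall>ls\<in>set (ul e). sorted_wrt (<) ls" using e(1) by (simp_all add: tw_arrows_def)
  have graft_cls: "graft g (ins (src g) ! l, l) = cls (uppers g ! l) (zip (ins (uppers g ! l)) (ul g ! l))"
    if "l < ar (src g)" for l using up_nth[OF g that] by (simp add: graft_def)
  have list: "map (graft g) (zip cs ls) = clss (grafted ls) (map ((!) (ul g)) ls)"
    "map out (grafted ls) = cs" "set (grafted ls) \<subseteq> Ops P" "map length (map ((!) (ul g)) ls) = map ar (grafted ls)"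
    if "set (zip cs ls) \<subseteq> set (stdl (src g))" "length cs = length ls" for cs ls
  proof -
    have x: "ls ! j < ar (src g) \<and> cs ! j = ins (src g) ! (ls ! j)" if "j < length ls" for j
    proof -
      have "(cs ! j, ls ! j) \<in> set (stdl (src g))" using that \<open>length cs = length ls\<close> \<open>set (zip cs ls) \<subseteq> _\<close>
        by (metis length_zip min_less_iff_conj nth_mem nth_zip subsetD)
      then obtain i where "i < ar (src g)" "(cs ! j, ls ! j) = stdl (src g) ! i" by (metis in_set_conv_nth length_stdl)
      then show ?thesis by simp
    qed
    show "map (graft g) (zip cs ls) = clss (grafted ls) (map ((!) (ul g)) ls)"
      using x graft_cls that(2) by (intro nth_equalityI) (simp_all add: grafted_def)
    show "map out (grafted ls) = cs" using x up_nth[OF g] that(2) by (intro nth_equalityI) (simp_all add: grafted_def)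
    show "set (grafted ls) \<subseteq> Ops P" using x up_nth[OF g] by (auto simp: grafted_def set_conv_nth)
    show "map length (map ((!) (ul g)) ls) = map ar (grafted ls)" using x up_nth[OF g] by (intro nth_equalityI) (simp_all add: grafted_def)
  qed
  \<comment> \<open>Substitution at upper vertex \<open>i\<close> gives a composite with unsorted
    numbers, while \<open>e\<close> stores the increasing representative of the same term.\<close>
  have U: "uppers e ! i = Act P (Subst P (uppers f ! i) (grafted (ul f ! i))) (ranks (numbers (ul f ! i)))"
    "ul e ! i = sort (numbers (ul f ! i))" if i: "i < ar (src f)" for i
  proof -
    let ?q = "uppers f ! i" and ?ls = "ul f ! i"
    have u: "up f ! i = cls ?q (zip (ins ?q) ?ls)" "?q \<in> Ops P" "length ?ls = ar ?q" using up_nth[OF f i] by simp_all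
    have la: "labelled (?q, zip (ins ?q) ?ls)" using u by (simp add: labelled_zip)
    have sub: "set (zip (ins ?q) ?ls) \<subseteq> set (stdl (src g))"
    proof
      fix x assume "x \<in> set (zip (ins ?q) ?ls)"
      then have "x \<in># clab (up f ! i)" using u la by (simp add: clab_cls)
      moreover have "up f ! i \<in> set (up f)" using i bf(2) by simp
      ultimately show "x \<in> set (stdl (src g))" using arrow_leaves(1)[OF f] fg by simp
    qed
    note l = list[OF sub u(3)[symmetric]]
    have s: "sub ?q (grafted ?ls)" using u(2) l by (simp add: substitutable_def)
    have "up e ! i = bind (graft g) (up f ! i)" using e(4) i bf(2) by simp
    also have "\<dots> = appl ?q (map (graft g) (zip (ins ?q) ?ls))" unfolding u(1) by (rule bind_cls[OF la])
    also have "\<dots> = cls (Subst P ?q (grafted ?ls)) (zip (ins (Subst P ?q (grafted ?ls))) (numbers ?ls))"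
      unfolding l(1) numbers_def by (rule appl_cls_zip(1)[OF s l(4)])
    finally have eq: "cls (Subst P ?q (grafted ?ls)) (zip (ins (Subst P ?q (grafted ?ls))) (numbers ?ls))
      = cls (uppers e ! i) (zip (ins (uppers e ! i)) (ul e ! i))"
      using up_nth[OF e(1)] i e(2) by simp
    have lnn: "length (numbers ?ls) = ar (Subst P ?q (grafted ?ls))" unfolding numbers_def by (rule appl_cls_zip(2)[OF s l(4)])
    have so: "sorted_wrt (<) (ul e ! i)" using sorted_e(2) be(7) i e(2) by simp
    show "uppers e ! i = Act P (Subst P (uppers f ! i) (grafted (ul f ! i))) (ranks (numbers (ul f ! i)))"
      "ul e ! i = sort (numbers (ul f ! i))" using sorted_cls_unique[OF eq Subst_op[OF s] lnn _ _ so] up_nth[OF e(1), of i] i e(2) by auto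
  qed
  have uh: "uppers ?h = map2 (\<lambda>q ls. Act P (Subst P q (grafted ls)) (ranks (numbers ls))) (uppers f) (ul f)"
    "ul ?h = map (\<lambda>ls. sort (numbers ls)) (ul f)"
    "lower ?h = Act P (subst_first P (lower g) (Subst P (lower f) (Unit P ?c # grafted (ll f)))) (0 # map Suc (ranks ln))"
    "ll ?h = sort ln" "src ?h = src f" by (simp_all add: tw_compose_def grafted_def[abs_def] numbers_def[abs_def] ln_def Let_def)
  have 1: "uppers ?h = uppers e" "ul ?h = ul e" using U bf(6,7) be(6,7) e(2) by (auto simp: uh intro!: nth_equalityI)
  have low_cs: "\<exists>cs. ins (lower h) = out (src h) # cs \<and> length cs = length (ll h)"
    if "h \<in> arrs" for h using that by (cases "ins (lower h)") (auto simp: tw_arrows_def)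
  obtain cf where cf: "ins (lower f) = ?c # cf" "length cf = length (ll f)" using low_cs[OF f] by blast
  obtain cg where cg: "ins (lower g) = out (src g) # cg" "length cg = length (ll g)" using low_cs[OF g] by blast
  have lops: "lower f \<in> Ops P" "lower g \<in> Ops P" "lower e \<in> Ops P" using f g e(1) by (simp_all add: tw_arrows_def)
  have cgC: "set cg \<subseteq> Colours P" using inputs_colours[OF lops(2)] cg by simp
  have sub: "set (zip cf (ll f)) \<subseteq> set (stdl (src g))"
  proof
    fix x assume "x \<in> set (zip cf (ll f))"
    then have "shiftl x \<in># clab (lo f)" using arrow_lo(3)[OF f] cf(1) by (simp add: flip: map_zip_Suc)
    then show "x \<in> set (stdl (src g))" using arrow_leaves(2)[OF f] fg by simp
  qed
  note l = list[OF sub cf(2)]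
  let ?q1 = "Subst P (lower f) (Unit P ?c # grafted (ll f))"
  let ?q = "Subst P (lower g) (?q1 # map (Unit P) cg)"
  \<comment> \<open>Labels after grafting on the lower vertex of \<open>f\<close>: the unit in the
    first place carries the hole \<open>0\<close>, the grafted operations carry shifted
    numbers.\<close>
  let ?n1 = "[0] # map (map Suc) (map ((!) (ul g)) (ll f))"
  have s1: "sub (lower f) (Unit P ?c # grafted (ll f))" using lops l(2,3) cf source_colour[OF f] by (simp add: substitutable_def Unit_op Unit_output)
  have l1: "map length ?n1 = map ar (Unit P ?c # grafted (ll f))" using l(4) source_colour[OF f] by (simp add: Unit_inputs comp_def)
  have s2: "sub (lower g) (?q1 # map (Unit P) cg)"
  proof -
    have "out (lower f) = out (src g)" using arrow_lo(2,5)[OF f] fg by simp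
    then show ?thesis using lops cg cgC Subst_op[OF s1] Subst_output[OF s1]
      by (auto simp: substitutable_def Unit_op Unit_output subset_iff intro!: map_idI)
  qed
  have "bind (ctxsub (var (?c, 0)) (sgraft g)) (lo f)
    = appl (lower f) (map (ctxsub (var (?c, 0)) (sgraft g)) (lolab f))"
    unfolding lo_def by (rule bind_cls[OF bf(3)])
  also have "map (ctxsub (var (?c, 0)) (sgraft g)) (lolab f)
    = var (?c, 0) # map shift (map (graft g) (zip cf (ll f)))"
    by (simp add: cf(1) flip: map_zip_Suc)
  also have "\<dots> = clss (Unit P ?c # grafted (ll f)) ?n1"
  proof -
    have "shift (cls (grafted (ll f) ! i) (zip (ins (grafted (ll f) ! i)) (ul g ! (ll f ! i))))
       = cls (grafted (ll f) ! i) (zip (ins (grafted (ll f) ! i)) (map Suc (ul g ! (ll f ! i))))"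
      if i: "i < length (ll f)" for i
    proof -
      have "length (ul g ! (ll f ! i)) = ar (grafted (ll f) ! i)" using arg_cong[OF l(4), of "\<lambda>xs. xs ! i"] i by (simp add: grafted_def)
      moreover have "grafted (ll f) ! i \<in> Ops P" using l(3) i by (metis grafted_def length_map nth_mem subsetD)
      ultimately show ?thesis by (simp add: shift_cls labelled_zip map_zip_Suc)
    qed
    then have "map shift (map (graft g) (zip cf (ll f))) =
      clss (grafted (ll f)) (map (map Suc) (map ((!) (ul g)) (ll f)))"
      unfolding l(1) by (intro nth_equalityI) (simp_all add: grafted_def)
    then show ?thesis using source_colour[OF f] by (simp add: var_def Unit_inputs)
  qed
  also have "appl (lower f) \<dots> = cls ?q1 (zip (ins ?q1) (concat ?n1))" by (rule appl_cls_zip(1)[OF s1 l1])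
  finally have X: "bind (ctxsub (var (?c, 0)) (sgraft g)) (lo f) = cls ?q1 (zip (ins ?q1) (concat ?n1))" .
  let ?n2 = "concat ?n1 # map (\<lambda>l. [Suc l]) (ll g)"
  have l2: "map length ?n2 = map ar (?q1 # map (Unit P) cg)"
    using appl_cls_zip(2)[OF s1 l1] cgC cg(2) by (auto simp: Unit_inputs subset_iff intro!: nth_equalityI)
  have "comp_lo g f = appl (lower g) (map (ctxsub (cls ?q1 (zip (ins ?q1) (concat ?n1))) svar) (lolab g))"
    unfolding comp_lo_def X lo_def[of g] by (rule bind_cls[OF bg(3)])
  also have "map (ctxsub (cls ?q1 (zip (ins ?q1) (concat ?n1))) svar) (lolab g)
     = clss (?q1 # map (Unit P) cg) ?n2"
  proof -
    have "map svar (zip cg (ll g)) = clss (map (Unit P) cg) (map (\<lambda>l. [Suc l]) (ll g))"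
      using cgC cg(2) by (intro nth_equalityI) (auto simp: var_def shiftl_def Unit_inputs subset_iff)
    then show ?thesis by (simp add: cg(1) comp_def flip: map_zip_Suc)
  qed
  also have "appl (lower g) \<dots> = cls ?q (zip (ins ?q) (concat ?n2))" by (rule appl_cls_zip(1)[OF s2 l2])
  also have "concat ?n2 = 0 # map Suc ln"
  proof -
    have "concat (map (\<lambda>l. [Suc l]) xs) = map Suc xs" for xs by (induction xs) auto
    then show ?thesis by (simp add: ln_def numbers_def map_concat comp_def)
  qed
  finally have eq: "cls ?q (zip (ins ?q) (0 # map Suc ln)) = cls (lower e) (lolab e)" using e(3) by (simp add: lo_def)
  have lenq: "length (0 # map Suc ln) = ar ?q"
  proof -
    have "concat (map (\<lambda>l. [Suc l]) xs) = map Suc xs" for xs by (induction xs) auto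
    then have "concat ?n2 = 0 # map Suc ln" by (simp add: ln_def numbers_def map_concat comp_def)
    then show ?thesis using appl_cls_zip(2)[OF s2 l2] by simp
  qed
  have lene: "length (0 # map Suc (ll e)) = ar (lower e)" using low_cs[OF e(1)] by auto
  have se: "sorted_wrt (<) (0 # map Suc (ll e))" using sorted_e(1) by (simp add: sorted_wrt_map)
  have sq: "subst_first P (lower g) ?q1 = ?q" by (simp add: subst_first_def cg(1))
  have "lower e = Act P ?q (ranks (0 # map Suc ln))" "0 # map Suc (ll e) = sort (0 # map Suc ln)"
    using sorted_cls_unique[OF eq Subst_op[OF s2] lenq lops(3) lene se] by blast+
  then have 2: "lower ?h = lower e" "ll ?h = ll e" unfolding uh sq ranks_0_Suc sort_0_Suc by (simp_all add: inj_map_eq_map)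
  have "?h = e" using 1 2 uh(5) e(2) by simp
  then show "cmp g f \<in> arrs" "src (cmp g f) = src f"
    "lo (cmp g f) = comp_lo g f"
    "up (cmp g f) = map (bind (graft g)) (up f)"
    "tgt (cmp g f) = tgt g" using e by simp_all
qed

definition is_arr :: "'o tw_arr \<Rightarrow> 'o \<Rightarrow> ('c, 'o) trm \<Rightarrow> ('c, 'o) trm list \<Rightarrow> 'o \<Rightarrow> bool" where
  "is_arr f p C Us t \<longleftrightarrow> f \<in> arrs \<and> src f = p \<and> lo f = C \<and> up f = Us \<and> tgt f = t"

text \<open>Arrows are built by prescribing their terms; by \<open>arrow_eqI\<close> at most one
  arrow can be meant.\<close>

definition tarr :: "'o \<Rightarrow> ('c, 'o) trm \<Rightarrow> ('c, 'o) trm list \<Rightarrow> 'o tw_arr" where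
  "tarr p C Us = (SOME f. f \<in> arrs \<and> src f = p \<and> lo f = C \<and> up f = Us)"

definition hole :: "'o \<Rightarrow> ('c, 'o) trm" where
  "hole p = var (out p, 0)"

lemma is_arr_refl: "f \<in> arrs \<Longrightarrow> is_arr f (src f) (lo f) (up f) (tgt f)" by (simp add: is_arr_def)

lemma is_arr_unique: "is_arr f p C Us t \<Longrightarrow> is_arr g p C Us t' \<Longrightarrow> f = g"
  unfolding is_arr_def by (rule arrow_eqI) simp_all

lemma tarr:
  assumes "p \<in> Ops P" "t \<in> Ops P" "hole_lin (out p) C"
    "bind (ctxsub (appl p Us) var) C = std t"
  shows "is_arr (tarr p C Us) p C Us t"
proof -
  obtain f where f: "f \<in> arrs" "src f = p" "lo f = C" "up f = Us" "tgt f = t" using arrow_exists[OF assms] by metis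
  then have "\<exists>f. f \<in> arrs \<and> src f = p \<and> lo f = C \<and> up f = Us" by blast
  then have t: "tarr p C Us \<in> arrs \<and> src (tarr p C Us) = p \<and> lo (tarr p C Us) = C \<and> up (tarr p C Us) = Us"
    unfolding tarr_def by (rule someI_ex)
  have "tarr p C Us = f" by (rule arrow_eqI) (simp_all only: f t)
  then show ?thesis using f by (simp only: is_arr_def)
qed

lemma is_arr_compose:
  assumes "is_arr f p C Us t" "is_arr g t D Vs u"
  shows "is_arr (cmp g f) p (comp_lo g f) (map (bind (graft g)) Us) u" using assms tw_compose_props[of f g] by (simp add: is_arr_def)

lemma comp_lo_hole:
  assumes f: "f \<in> arrs" and g: "g \<in> arrs" and fg: "src g = tgt f"
    and h: "lo f = hole (src f)"
  shows "comp_lo g f = lo g"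
proof -
  let ?c = "out (src f)"
  have c: "?c = out (src g)" using arrow_lo(5)[OF f] source_colour[OF f] fg h by (simp add: hole_def)
  have 1: "bind (ctxsub (var (?c, 0)) (sgraft g)) (lo f) = var (?c, 0)" unfolding h hole_def using source_colour[OF f] by (subst bind_var) simp_all
  have "comp_lo g f = bind var (lo g)" unfolding comp_lo_def 1
  proof (rule bind_cong)
    fix x assume x: "x \<in># clab (lo g)"
    from label_cases[of x] show "ctxsub (var (?c, 0)) svar x = var x" using hole_lin_zero[OF arrow_lo(4)[OF g] x] c by auto
  qed
  then show ?thesis using arrow_lo(1)[OF g] by (simp add: bind_ident)
qed

lemma comp_lo_hole_right:
  assumes f: "f \<in> arrs" and g: "g \<in> arrs" and fg: "src g = tgt f"
    and h: "lo g = hole (src g)"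
  shows "comp_lo g f = bind (ctxsub (hole (src f)) (sgraft g)) (lo f)"
proof -
  let ?X = "bind (ctxsub (var (out (src f), 0)) (sgraft g)) (lo f)"
  have "is_term (comp_lo g f)" using hole_lin_comp(1)[OF f g fg] by (simp add: hole_lin_def)
  then have "\<forall>x \<in># clab (var (out (src g), 0)). is_term (ctxsub ?X svar x)
      \<and> outc (ctxsub ?X svar x) = fst x"
    unfolding comp_lo_def h hole_def is_term_bind[of "ctxsub ?X svar"] by blast
  then have "is_term ?X \<and> outc ?X = out (src g)" using source_colour[OF g] by simp
  then show ?thesis unfolding comp_lo_def h hole_def using source_colour[OF g] by (subst bind_var) simp_all
qed

lemma is_arr_ident: "p \<in> Ops P \<Longrightarrow> is_arr (tw_ident P p) p (hole p) (map var (stdl p)) p"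
proof -
  let ?A = "uppers (tw_ident P p)"
  assume p: "p \<in> Ops P"
  have c: "out p \<in> Colours P" and ci: "set (ins p) \<subseteq> Colours P" using p by (simp_all add: output_colour inputs_colours)
  have [simp]: "Unit P (ins p ! i) \<in> Ops P" "ins (Unit P (ins p ! i)) = [ins p ! i]"
     "out (Unit P (ins p ! i)) = ins p ! i" if "i < ar p" for i using ci that by (auto simp: Unit_op Unit_inputs Unit_output subset_iff)
  have cc: "concat (map (\<lambda>i. [i]) xs) = xs" for xs :: "nat list" by (induction xs) auto
  have a: "tw_ident P p \<in> arrs" unfolding tw_arrows_def mem_Collect_eq
  proof (intro conjI)
    show "map length (ul (tw_ident P p)) = map ar ?A" by (auto simp: tw_ident_def intro!: nth_equalityI)
    show "map out ?A = ins (src (tw_ident P p))" by (auto simp: tw_ident_def intro!: nth_equalityI)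
    show "set ?A \<subseteq> Ops P" using ci by (auto simp: tw_ident_def Unit_op)
  qed (use c p in \<open>auto simp: tw_ident_def Unit_op Unit_inputs cc\<close>)
  have l: "lo (tw_ident P p) = hole p" using c by (simp add: lo_def tw_ident_def hole_def var_def Unit_inputs)
  have u: "up (tw_ident P p) = map var (stdl p)" by (auto simp: up_def tw_ident_def var_def intro!: nth_equalityI)
  have s: "src (tw_ident P p) = p" by (simp add: tw_ident_def)
  have "bind (ctxsub (std p) var) (hole p) = std p" unfolding hole_def using c p by (subst bind_var) simp_all
  then have "std (tgt (tw_ident P p)) = std p" using arrow_target(2)[OF a] p by (simp add: l u s)
  then have "tgt (tw_ident P p) = p" using std_inj arrow_target(1)[OF a] p by blast
  then show ?thesis using a l u s by (simp add: is_arr_def)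
qed

text \<open>Arrows are compared by \<open>arrow_eqI\<close>. The identity laws then say that
  substituting variables changes nothing and that substituting into a variable gives the value;
  associativity is \<open>bind_bind\<close>, for the upper vertices directly and for the lower one
  through \<open>comp_lo_eq\<close>.\<close>

lemma tw_category: "category (Tw P)"
proof -
  have id: "tw_ident P p \<in> arrs" "src (tw_ident P p) = p" "lo (tw_ident P p) = hole p"
    "up (tw_ident P p) = map var (stdl p)" "tgt (tw_ident P p) = p" if "p \<in> Ops P" for p using is_arr_ident[OF that] by (simp_all add: is_arr_def)
  have src: "src f \<in> Ops P" if "f \<in> arrs" for f using arrow_basic(1)[OF that] .
  have right: "cmp f (tw_ident P (src f)) = f" if f: "f \<in> arrs" for f
  proof (rule arrow_eqI[OF _ f])
    note i = id[OF src[OF f]]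
    note c = tw_compose_props[OF i(1) f i(5)[symmetric]]
    show "cmp f (tw_ident P (src f)) \<in> arrs" "src (cmp f (tw_ident P (src f))) = src f" using c i by simp_all
    show "lo (cmp f (tw_ident P (src f))) = lo f" using comp_lo_hole[OF i(1) f] c(3) i by simp
    have "map (bind (graft f)) (map var (stdl (src f))) = up f"
    proof (rule nth_equalityI)
      fix j assume "j < length (map (bind (graft f)) (map var (stdl (src f))))"
      then have j: "j < ar (src f)" by simp
      have "ins (src f) ! j \<in> Colours P" using inputs_colours[OF src[OF f]] j by auto
      then have "bind (graft f) (var (ins (src f) ! j, j)) = graft f (ins (src f) ! j, j)"
        using arrow_up[OF f j] by (intro bind_var) (simp_all add: graft_def)
      then show "map (bind (graft f)) (map var (stdl (src f))) ! j = up f ! j" using j by (simp add: graft_def)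
    qed (simp add: arrow_basic(2)[OF f])
    then show "up (cmp f (tw_ident P (src f))) = up f" using c(4) i by simp
  qed
  have left: "cmp (tw_ident P (tgt f)) f = f" if f: "f \<in> arrs" for f
  proof (rule arrow_eqI[OF _ f])
    note i = id[OF arrow_target(1)[OF f]]
    note c = tw_compose_props[OF f i(1) i(2)]
    have gr: "graft (tw_ident P (tgt f)) x = var x" if "x \<in> set (stdl (tgt f))" for x using that i(4) by (auto simp: graft_def in_set_conv_nth)
    show "cmp (tw_ident P (tgt f)) f \<in> arrs" "src (cmp (tw_ident P (tgt f)) f) = src f" using c by simp_all
    have "bind (ctxsub (hole (src f)) (\<lambda>x. shift (graft (tw_ident P (tgt f)) x))) (lo f) = bind var (lo f)"
    proof (rule bind_cong)
      fix x assume x: "x \<in># clab (lo f)"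
      from label_cases[of x] show "ctxsub (hole (src f)) (\<lambda>x. shift (graft (tw_ident P (tgt f)) x)) x = var x"
        using hole_lin_zero[OF arrow_lo(4)[OF f] x] gr arrow_leaves(2)[OF f] x shiftl_colour[of _ "lo f"] by (auto simp: shift_var hole_def)
    qed
    then show "lo (cmp (tw_ident P (tgt f)) f) = lo f" using comp_lo_hole_right[OF f i(1) i(2)] c(3) i arrow_lo(1)[OF f] by (simp add: bind_ident)
    have "bind (graft (tw_ident P (tgt f))) U = U" if "U \<in> set (up f)" for U
    proof -
      have "is_term U" using that arrow_up(1)[OF f] arrow_basic(2)[OF f] by (auto simp: in_set_conv_nth)
      moreover have "bind (graft (tw_ident P (tgt f))) U = bind var U" using gr arrow_leaves(1)[OF f that] by (intro bind_cong) simp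
      ultimately show ?thesis by (simp add: bind_ident)
    qed
    then show "up (cmp (tw_ident P (tgt f)) f) = up f" using c(4) by (simp add: map_idI)
  qed
  have assoc: "cmp h (cmp g f) = cmp (cmp h g) f"
    if f: "f \<in> arrs" and g: "g \<in> arrs" and h: "h \<in> arrs" and fg: "src g = tgt f"
      and gh: "src h = tgt g" for f g h
  proof (rule arrow_eqI)
    note gf = tw_compose_props[OF f g fg] and hg = tw_compose_props[OF g h gh]
    have 1: "src h = tgt (cmp g f)" using gf gh by simp
    have 2: "src (cmp h g) = tgt f" using hg fg by simp
    note l = tw_compose_props[OF gf(1) h 1] and r = tw_compose_props[OF f hg(1) 2]
    show "cmp h (cmp g f) \<in> arrs" "cmp (cmp h g) f \<in> arrs"
      "src (cmp h (cmp g f)) = src (cmp (cmp h g) f)" using l r gf by simp_all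
    have gr: "graft (cmp h g) x = bind (graft h) (graft g x)" if "x \<in> set (stdl (src g))" for x
      using that hg(4) arrow_basic(2)[OF g] by (auto simp: graft_def in_set_conv_nth)
    show "up (cmp h (cmp g f)) = up (cmp (cmp h g) f)"
    proof -
      have "bind (graft h) (bind (graft g) U) = bind (graft (cmp h g)) U" if "U \<in> set (up f)" for U
        unfolding bind_bind using gr arrow_leaves(1)[OF f that] fg by (intro bind_cong) simp
      then show ?thesis by (simp add: l r gf)
    qed
    have "bind (ctxsub (var (out (src f), 0)) (\<lambda>x. shift (graft (cmp h g) x))) (lo f) =
       bind (ctxsub (var (out (src f), 0)) (\<lambda>x. bind (sgraft h) (graft g x))) (lo f)"
      using gr arrow_leaves(2)[OF f] fg by (intro bind_ctxsub_cong) (simp add: shift_def bind_bind)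
    then have "comp_lo h (cmp g f) = comp_lo (cmp h g) f" unfolding comp_lo_def[of h "cmp g f"] gf(2,3) comp_lo_eq[OF f]
      unfolding comp_lo_def[of "cmp h g" f] hg(3) comp_lo_eq[OF g] by (simp add: shift_def)
    then show "lo (cmp h (cmp g f)) = lo (cmp (cmp h g) f)" using l r by simp
  qed
  show ?thesis by unfold_locales (simp_all add: Tw_def left right assoc id src arrow_target(1) tw_compose_props(1,2,5))
qed

end

lemma map_apfst_zip: "map (apfst f) (zip xs ys) = zip (map f xs) ys" by (rule nth_equalityI) simp_all

section \<open>Functoriality\<close>

text \<open>The induced map of free algebras, computed on the chosen representative;
  \<open>tmap_cls\<close> shows that any other would do.\<close>

definition tmap :: "('c, 'o) operad \<Rightarrow> ('d, 'p) operad \<Rightarrow> ('c, 'o, 'd, 'p) operad_map \<Rightarrow> ('c, 'o) trm \<Rightarrow> ('d, 'p) trm" where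
  "tmap Q P F T = operad.cls P (op_map F (fst (operad.rep Q T))) (map (apfst (col_map F)) (snd (operad.rep Q T)))"

locale operad_morphism = Q: operad Q + P: operad P
  for Q :: "('c, 'o) operad" and P :: "('d, 'p) operad" +
  fixes F :: "('c, 'o, 'd, 'p) operad_map"
  assumes F: "F \<in> operad_maps Q P"
begin

lemma F_Op: "p \<in> Ops Q \<Longrightarrow> op_map F p \<in> Ops P" 
  and F_Col: "c \<in> Colours Q \<Longrightarrow> col_map F c \<in> Colours P" using F by (auto simp: operad_maps_def)

lemma F_simps:
  "p \<in> Ops Q \<Longrightarrow> P.ins (op_map F p) = map (col_map F) (Q.ins p)"
  "p \<in> Ops Q \<Longrightarrow> P.out (op_map F p) = col_map F (Q.out p)"
  "c \<in> Colours Q \<Longrightarrow> op_map F (Unit Q c) = Unit P (col_map F c)"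
  "Q.sub p qs \<Longrightarrow> op_map F (Subst Q p qs) = Subst P (op_map F p) (map (op_map F) qs)"
  "p \<in> Ops Q \<Longrightarrow> perm_list (arity Q p) xs \<Longrightarrow> op_map F (Act Q p xs) = Act P (op_map F p) xs"
  using F unfolding operad_maps_def mem_Collect_eq by (elim conjE; simp)+

lemma F_arity: "p \<in> Ops Q \<Longrightarrow> arity P (op_map F p) = arity Q p" by (simp add: F_simps)

lemma F_outs: "set qs \<subseteq> Ops Q \<Longrightarrow> map P.out (map (op_map F) qs) = map (col_map F) (map Q.out qs)" by (auto simp: F_simps)

lemma F_labelled: "Q.labelled (q, ls) \<Longrightarrow> P.labelled (op_map F q, map (apfst (col_map F)) ls)"
  by (auto simp: Q.labelled_def P.labelled_def F_Op F_simps comp_def)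
     (metis (no_types, lifting) list.map_comp comp_def map_eq_conv)

lemma F_substitutable: "Q.sub p qs \<Longrightarrow> P.sub (op_map F p) (map (op_map F) qs)"
proof -
  assume s: "Q.sub p qs"
  then have "set qs \<subseteq> Ops Q" by (simp add: substitutable_def)
  from F_outs[OF this] s show ?thesis by (auto simp: substitutable_def F_Op F_simps simp del: map_map)
qed

lemma tmap_cls:
  assumes "Q.labelled (q, ls)"
  shows "tmap Q P F (Q.cls q ls) = P.cls (op_map F q) (map (apfst (col_map F)) ls)"
proof -
  let ?A = "map (apfst (col_map F)) ls"
  obtain q' ls' xs where r: "Q.rep (Q.cls q ls) = (q', ls')" "Q.labelled (q', ls')"
    "perm_list (arity Q q') xs" "q = Act Q q' xs" "ls' = map ((!) ls) xs" "arity Q q = arity Q q'" by (rule Q.rep_cls[OF assms])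
  have q': "q' \<in> Ops Q" using r by (simp add: Q.labelled_def P.labelled_def)
  have l: "length ls = arity Q q'" using Q.labelled_length[OF assms] r(6) by simp
  have "map ((!) ?A) xs = map (apfst (col_map F)) ls'" using perm_list_mem_less[OF r(3)] l by (simp add: r(5))
  moreover have "P.cls (Act P (op_map F q') xs) ?A = P.cls (op_map F q') (map ((!) ?A) xs)"
    using q' r(3) l by (intro P.cls_Act) (simp_all add: F_Op F_arity)
  ultimately show ?thesis using r(1,3,4) q' by (simp add: tmap_def F_simps del: map_map)
qed

lemma tmap_term:
  assumes "Q.is_term T"
  shows "P.is_term (tmap Q P F T)" "P.outc (tmap Q P F T) = col_map F (Q.outc T)"
    "P.clab (tmap Q P F T) = image_mset (apfst (col_map F)) (Q.clab T)"
proof -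
  obtain q ls where q: "Q.labelled (q, ls)" "T = Q.cls q ls" using assms by (rule Q.is_termE)
  then show "P.is_term (tmap Q P F T)" "P.outc (tmap Q P F T) = col_map F (Q.outc T)"
    "P.clab (tmap Q P F T) = image_mset (apfst (col_map F)) (Q.clab T)" using F_labelled[OF q(1)]
    by (auto simp: tmap_cls P.is_term_cls P.outc_cls Q.outc_cls P.clab_cls Q.clab_cls F_simps Q.labelled_def P.labelled_def)
qed

lemma tmap_appl:
  assumes "Q.ok p ts"
  shows "tmap Q P F (Q.appl p ts) = P.appl (op_map F p) (map (tmap Q P F) ts)"
proof -
  obtain qs lss where t: "ts = map2 Q.cls qs lss" "list_all2 (\<lambda>q ls. Q.labelled (q, ls)) qs lss"
    "Q.sub p qs" using assms by (rule Q.okE)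
  have l: "length qs = length lss" using t(2) by (rule list_all2_lengthD)
  have la: "list_all2 (\<lambda>q ls. P.labelled (q, ls)) (map (op_map F) qs) (map (map (apfst (col_map F))) lss)"
    using t(2) F_labelled by (simp add: list_all2_conv_all_nth)
  have "map (tmap Q P F) ts = map2 P.cls (map (op_map F) qs) (map (map (apfst (col_map F))) lss)"
    using t(2) l by (intro nth_equalityI) (simp_all add: t(1) list_all2_conv_all_nth tmap_cls)
  then show ?thesis using P.appl_cls(1)[OF la F_substitutable[OF t(3)]] Q.appl_cls[OF t(2,3)] t by (simp add: tmap_cls F_simps map_concat)
qed

lemma tmap_var: "fst x \<in> Colours Q \<Longrightarrow> tmap Q P F (Q.var x) = P.var (apfst (col_map F) x)"
  using tmap_cls[OF Q.labelled_var, of x] by (simp add: Q.var_def P.var_def F_simps)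

text \<open>Definedness in \<open>Q\<close> has to be assumed: \<open>col_map F\<close> may identify
  colours, so an ill-typed substitution in \<open>Q\<close> can become well typed in
  \<open>P\<close>.\<close>

lemma tmap_bind:
  assumes "Q.is_term (Q.bind \<sigma> T)" "\<And>x. x \<in># Q.clab T \<Longrightarrow> \<sigma>' (apfst (col_map F) x) = tmap Q P F (\<sigma> x)"
  shows "tmap Q P F (Q.bind \<sigma> T) = P.bind \<sigma>' (tmap Q P F T)"
proof -
  obtain q ls where q: "Q.labelled (q, ls)" "T = Q.cls q ls" using Q.is_term_bindD[OF assms(1)] by (rule Q.is_termE)
  have ok: "Q.ok q (map \<sigma> ls)" using assms(1) q by (simp add: Q.bind_cls Q.ok_is_term)
  have m: "map \<sigma>' (map (apfst (col_map F)) ls) = map (tmap Q P F) (map \<sigma> ls)" using assms(2) q by (simp add: Q.clab_cls)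
  show ?thesis using tmap_appl[OF ok] q m P.bind_cls[OF F_labelled[OF q(1)], of \<sigma>'] by (simp add: Q.bind_cls tmap_cls del: map_map)
qed

lemma tmap_shift: "Q.is_term T \<Longrightarrow> tmap Q P F (Q.shift T) = P.shift (tmap Q P F T)"
  using Q.is_term_shift[of T] unfolding Q.shift_def P.shift_def by (intro tmap_bind) (auto simp: tmap_var Q.clab_colour shiftl_def)

text \<open>Targets are compared as standard terms: \<open>tmap\<close> commutes with the
  substitution in \<open>arrow_target\<close>, and \<open>P.std_inj\<close> concludes.\<close>

lemma tw_map_arrow:
  assumes f: "f \<in> Q.arrs"
  shows "tw_map F f \<in> P.arrs" "src (tw_map F f) = op_map F (src f)"
    "P.lo (tw_map F f) = tmap Q P F (Q.lo f)" "P.up (tw_map F f) = map (tmap Q P F) (Q.up f)"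
    "P.tgt (tw_map F f) = op_map F (Q.tgt f)"
proof -
  let ?A = "Q.appl (src f) (Q.up f)"
  note b = Q.arrow_basic[OF f]
  have fa: "src f \<in> Ops Q" "lower f \<in> Ops Q" "Q.ins (lower f) \<noteq> []" "hd (Q.ins (lower f)) = Q.out (src f)"
    "set (uppers f) \<subseteq> Ops Q" "map Q.out (uppers f) = Q.ins (src f)"
    "length (ll f) = arity Q (lower f) - 1"
    "map length (ul f) = map (arity Q) (uppers f)" using f by (simp_all add: tw_arrows_def)
  have "map P.out (map (op_map F) (uppers f)) = map (col_map F) (map Q.out (uppers f))" by (rule F_outs[OF fa(5)])
  moreover have "map (arity P) (map (op_map F) (uppers f)) = map (arity Q) (uppers f)" using fa(5) by (auto simp: F_simps subset_iff)
  ultimately show a: "tw_map F f \<in> P.arrs" using f by (auto simp: tw_arrows_def tw_map_def F_Op F_simps hd_map simp del: map_map)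
  show s: "src (tw_map F f) = op_map F (src f)" by (simp add: tw_map_def)
  show l: "P.lo (tw_map F f) = tmap Q P F (Q.lo f)" using b(3) fa(2) by (simp add: Q.lo_def P.lo_def tmap_cls tw_map_def F_simps map_apfst_zip)
  have "tmap Q P F (Q.cls (uppers f ! i) (zip (Q.ins (uppers f ! i)) (ul f ! i))) =
      P.cls (op_map F (uppers f ! i)) (zip (P.ins (op_map F (uppers f ! i))) (ul f ! i))" if "i < arity Q (src f)" for i
    using b(4,6) that Q.up_nth[OF f that] by (simp add: tmap_cls list_all2_conv_all_nth F_simps map_apfst_zip)
  then show u: "P.up (tw_map F f) = map (tmap Q P F) (Q.up f)" using b(6,7) by (intro nth_equalityI) (simp_all add: Q.up_def P.up_def tw_map_def)
  have oks: "Q.ok (src f) (Q.up f)" using b(9) Q.ok_is_term by blast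
  have st: "tmap Q P F (Q.std t) = P.std (op_map F t)" if "t \<in> Ops Q" for t
    using that Q.labelled_stdl[OF that] by (simp add: Q.std_def P.std_def tmap_cls Q.stdl_def P.stdl_def F_simps map_apfst_zip)
  have "P.std (P.tgt (tw_map F f)) = P.bind (ctxsub (tmap Q P F ?A) P.var) (tmap Q P F (Q.lo f))"
    using P.arrow_target(2)[OF a] by (simp add: s l u tmap_appl[OF oks])
  also have "\<dots> = tmap Q P F (Q.bind (ctxsub ?A Q.var) (Q.lo f))"
  proof (rule tmap_bind[symmetric])
    show "Q.is_term (Q.bind (ctxsub ?A Q.var) (Q.lo f))" using Q.arrow_target[OF f] by simp
    fix x assume x: "x \<in># Q.clab (Q.lo f)"
    show "ctxsub (tmap Q P F ?A) P.var (apfst (col_map F) x) =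
       tmap Q P F (ctxsub ?A Q.var x)"
      using Q.clab_colour[OF x] by (cases x) (simp add: ctxsub_def tmap_var split: nat.split)
  qed
  also have "\<dots> = P.std (op_map F (Q.tgt f))" using Q.arrow_target[OF f] st by simp
  finally show "P.tgt (tw_map F f) = op_map F (Q.tgt f)" using P.std_inj P.arrow_target(1)[OF a] F_Op[OF Q.arrow_target(1)[OF f]] by blast
qed

lemma tw_map_ident: "p \<in> Ops Q \<Longrightarrow> tw_map F (tw_ident Q p) = tw_ident P (op_map F p)"
  using Q.inputs_colours[of p] Q.output_colour[of p] by (simp add: tw_map_def tw_ident_def F_simps subset_iff)

text \<open>Both sides have the same terms, by \<open>tmap_bind\<close> for each substitution in the
  composite.\<close>

lemma tw_map_compose:
  assumes f: "f \<in> Q.arrs" and g: "g \<in> Q.arrs" and fg: "src g = Q.tgt f"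
  shows "tw_map F (Q.cmp g f) = P.cmp (tw_map F g) (tw_map F f)"
proof (rule P.arrow_eqI)
  note c = Q.tw_compose_props[OF assms]
  note mf = tw_map_arrow[OF f] and mg = tw_map_arrow[OF g] and mc = tw_map_arrow[OF c(1)]
  have fg': "src (tw_map F g) = P.tgt (tw_map F f)" using mf mg fg by simp
  note c' = P.tw_compose_props[OF mf(1) mg(1) fg']
  show "tw_map F (Q.cmp g f) \<in> P.arrs" "P.cmp (tw_map F g) (tw_map F f) \<in> P.arrs"
    "src (tw_map F (Q.cmp g f)) = src (P.cmp (tw_map F g) (tw_map F f))" using mc c' c mf by simp_all
  have gr: "P.graft (tw_map F g) (apfst (col_map F) x) = tmap Q P F (Q.graft g x)" if "x \<in> set (Q.stdl (src g))" for x
  proof -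
    from that obtain i where "i < arity Q (src g)" "x = Q.stdl (src g) ! i" by (metis in_set_conv_nth Q.length_stdl)
    then show ?thesis using Q.arrow_basic(2)[OF g] by (simp add: Q.graft_def P.graft_def mg)
  qed
  show "P.up (tw_map F (Q.cmp g f)) = P.up (P.cmp (tw_map F g) (tw_map F f))" unfolding mc(4) c'(4) c(4) mf(4) map_map
  proof (rule map_cong[OF refl], unfold comp_def)
    fix U assume U: "U \<in> set (Q.up f)"
    then obtain i where i: "i < arity Q (src f)" "U = Q.up f ! i" using Q.arrow_basic(2)[OF f] by (metis in_set_conv_nth)
    show "tmap Q P F (Q.bind (Q.graft g) U) = P.bind (P.graft (tw_map F g)) (tmap Q P F U)"
    proof (rule tmap_bind)
      show "Q.is_term (Q.bind (Q.graft g) U)" using Q.arrow_up(1)[OF c(1)] i Q.arrow_basic(2)[OF f] c(2,4) by (metis nth_map)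
      show "P.graft (tw_map F g) (apfst (col_map F) x) = tmap Q P F (Q.graft g x)" if "x \<in># Q.clab U" for x
        using gr Q.arrow_leaves(1)[OF f U that] fg by simp
    qed
  qed
  show "P.lo (tw_map F (Q.cmp g f)) = P.lo (P.cmp (tw_map F g) (tw_map F f))"
  proof -
    let ?c = "Q.out (src f)"
    have cc: "?c \<in> Colours Q" using Q.source_colour[OF f] .
    let ?X = "Q.bind (ctxsub (Q.var (?c, 0)) (\<lambda>x. Q.shift (Q.graft g x))) (Q.lo f)"
    have tc: "Q.is_term (Q.comp_lo g f)" using Q.hole_lin_comp(1)[OF assms] by (simp add: Q.hole_lin_def P.hole_lin_def)
    \<comment> \<open>The label of the hole occurs in \<open>lo g\<close>, so a well-typed result
      forces the term put there to be well typed.\<close>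
    have X: "Q.is_term ?X"
    proof -
      have "(Q.out (src g), 0) \<in># Q.clab (Q.lo g)" using Q.hole_lin_decomp[OF Q.arrow_lo(4)[OF g]] by (metis union_single_eq_member)
      then have "Q.is_term (ctxsub ?X (\<lambda>x. Q.var (shiftl x)) (Q.out (src g), 0))"
        using tc unfolding Q.comp_lo_def P.comp_lo_def Q.is_term_bind by blast
      then show ?thesis by simp
    qed
    have 1: "tmap Q P F ?X = P.bind (ctxsub (P.var (col_map F ?c, 0)) (\<lambda>x. P.shift (P.graft (tw_map F g) x))) (tmap Q P F (Q.lo f))"
    proof (rule tmap_bind[OF X])
      fix x assume x: "x \<in># Q.clab (Q.lo f)"
      show "ctxsub (P.var (col_map F ?c, 0)) (\<lambda>x. P.shift (P.graft (tw_map F g) x)) (apfst (col_map F) x)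
        = tmap Q P F (ctxsub (Q.var (?c, 0)) (\<lambda>x. Q.shift (Q.graft g x)) x)"
      proof (cases "snd x = 0")
        case True
        then show ?thesis using cc by (simp add: ctxsub_0 tmap_var)
      next
        case False
        then obtain y where y: "x = shiftl y" using label_cases[of x] by metis
        then have ys: "y \<in> set (Q.stdl (src g))" using Q.arrow_leaves(2)[OF f] x fg by simp
        have e: "apfst (col_map F) (shiftl y) = shiftl (apfst (col_map F) y)" by (simp add: shiftl_def)
        show ?thesis unfolding y e using gr[OF ys] Q.graft_std[OF g ys] by (simp add: tmap_shift)
      qed
    qed
    have "tmap Q P F (Q.comp_lo g f) = P.bind (ctxsub (tmap Q P F ?X) (\<lambda>x. P.var (shiftl x))) (tmap Q P F (Q.lo g))"
      unfolding Q.comp_lo_def P.comp_lo_def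
    proof (rule tmap_bind)
      show "Q.is_term (Q.bind (ctxsub ?X (\<lambda>x. Q.var (shiftl x))) (Q.lo g))" using tc by (simp add: Q.comp_lo_def P.comp_lo_def)
      fix x assume x: "x \<in># Q.clab (Q.lo g)"
      show "ctxsub (tmap Q P F ?X) (\<lambda>x. P.var (shiftl x)) (apfst (col_map F) x) = tmap Q P F (ctxsub ?X (\<lambda>x. Q.var (shiftl x)) x)"
        using Q.clab_colour[OF x] by (cases x) (simp add: ctxsub_def tmap_var shiftl_def split: nat.split)
    qed
    also have "\<dots> = P.comp_lo (tw_map F g) (tw_map F f)"
      unfolding 1 Q.comp_lo_def P.comp_lo_def mf(2,3) mg(3) using Q.arrow_basic(1)[OF f] by (simp add: F_simps)
    finally show ?thesis by (simp add: mc(3) c(3) c'(3))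
  qed
qed

lemma tw_functor: "functor_between (Tw Q) (Tw P) (op_map F) (tw_map F)" unfolding functor_between_def
proof (intro conjI ballI impI)
  fix p assume "p \<in> Obj (Tw Q)"
  then show "op_map F p \<in> Obj (Tw P)" "tw_map F (Ident (Tw Q) p) = Ident (Tw P) (op_map F p)" by (simp_all add: Tw_def F_Op tw_map_ident)
next
  fix f assume "f \<in> Arr (Tw Q)"
  then have f: "f \<in> Q.arrs" by (simp add: Tw_def)
  show "tw_map F f \<in> Arr (Tw P)" "Dom (Tw P) (tw_map F f) = op_map F (Dom (Tw Q) f)"
    "Cod (Tw P) (tw_map F f) = op_map F (Cod (Tw Q) f)" using tw_map_arrow[OF f] by (simp_all add: Tw_def)
  fix g assume "g \<in> Arr (Tw Q)" "Dom (Tw Q) g = Cod (Tw Q) f"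
  then show "tw_map F (Compose (Tw Q) g f) = Compose (Tw P) (tw_map F g) (tw_map F f)" using tw_map_compose[OF f, of g] by (simp add: Tw_def)
qed

end

section \<open>Pushouts\<close>

context operad
begin

text \<open>Mutually inverse unary terms, \<open>T\<close> with label \<open>x\<close> and
  \<open>T'\<close> with label \<open>y\<close> (see \<open>invtD\<close>). As each has a single
  label, substitution of a constant expresses composition.\<close>

definition invt :: "('c, 'o) trm \<Rightarrow> ('c, 'o) trm \<Rightarrow> 'c \<times> nat \<Rightarrow> 'c \<times> nat \<Rightarrow> bool" where
  "invt T T' x y \<longleftrightarrow> fst x \<in> Colours P \<and> fst y \<in> Colours P \<and>
    bind (\<lambda>_. T') T = var y \<and> bind (\<lambda>_. T) T' = var x"

text \<open>Unlike the classes of active and inert arrows, which are defined as closures, these two are given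
  by conditions on a single arrow.\<close>

definition active_like :: "'o tw_arr \<Rightarrow> bool" where
  "active_like f \<longleftrightarrow> f \<in> arrs \<and>
    (\<exists>K. invt (lo f) K (out (src f), 0) (out (tgt f), 0))"

definition inert_like :: "'o tw_arr \<Rightarrow> bool" where
  "inert_like g \<longleftrightarrow> g \<in> arrs \<and>
    (\<forall>i < ar (src g). \<exists>R x. invt (up g ! i) R x (ins (src g) ! i, 0))"

lemma stdlE:
  assumes "x \<in> set (stdl t)"
  obtains i where "i < ar t" "x = (ins t ! i, i)" using assms by (metis in_set_conv_nth length_stdl nth_stdl)

end

lemma map_map_of_zip:
  assumes "length xs = length ys" "distinct xs"
  shows "map (\<lambda>x. the (map_of (zip xs ys) x)) xs = ys" using assms by (intro nth_equalityI) (simp_all add: map_of_zip_nth)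

lemma sum_mset_single_nonempty:
  assumes "(\<Sum>x\<in>#A. h x) = {#y#}" "\<And>x. x \<in># A \<Longrightarrow> h x \<noteq> {#}"
  obtains x where "A = {#x#}" "h x = {#y#}"
proof -
  obtain x B where A: "A = add_mset x B" using assms(1) by (cases A) auto
  have "B = {#}"
  proof (rule ccontr)
    assume "B \<noteq> {#}"
    then obtain z B' where B: "B = add_mset z B'" by (meson multiset_cases)
    then have "h x + h z \<subseteq># {#y#}" using assms(1) A by (metis image_mset_add_mset mset_subset_eq_add_left sum_mset.insert add.assoc)
    then have "size (h x + h z) \<le> 1" using size_mset_mono by fastforce
    then have "size (h x) + size (h z) \<le> 1" by simp
    moreover have "size (h x) \<noteq> 0" "size (h z) \<noteq> 0" using assms(2) A B by auto
    ultimately show False by linarith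
  qed
  then show ?thesis using that A assms(1) by simp
qed

context operad
begin

text \<open>The labels of a composite are counted with multiplicity, so a single label in both
  composites leaves room for only one in each factor.\<close>

lemma invtD:
  assumes "invt T T' x y"
  shows "is_term T" "is_term T'" "clab T = {#x#}" "clab T' = {#y#}" "outc T = fst y" "outc T' = fst x"
proof -
  have c: "fst x \<in> Colours P" "fst y \<in> Colours P" and e: "bind (\<lambda>_. T') T = var y" "bind (\<lambda>_. T) T' = var x"
    using assms by (simp_all add: invt_def)
  have t: "is_term (bind (\<lambda>_. T') T)" "is_term (bind (\<lambda>_. T) T')" using c e by simp_all
  show T: "is_term T" "is_term T'" using t is_term_bindD by blast+
  show "outc T = fst y" "outc T' = fst x" using outc_bind[OF t(1)] outc_bind[OF t(2)] c e by simp_all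
  have s: "(\<Sum>_\<in>#clab T. clab T') = {#y#}" "(\<Sum>_\<in>#clab T'. clab T) = {#x#}"
    using clab_bind[OF t(1)] clab_bind[OF t(2)] c e by simp_all
  have ne: "clab T \<noteq> {#}" "clab T' \<noteq> {#}" using s by auto
  show "clab T = {#x#}" "clab T' = {#y#}" using sum_mset_single_nonempty[OF s(1)] sum_mset_single_nonempty[OF s(2)] ne by metis+
qed

lemma bind_single: "clab T = {#x#} \<Longrightarrow> bind \<sigma> T = bind (\<lambda>_. \<sigma> x) T" by (rule bind_cong) simp

lemma bind_const_var: "fst x \<in> Colours P \<Longrightarrow> is_term T \<Longrightarrow> outc T = fst x \<Longrightarrow> bind (\<lambda>_. T) (var x) = T"
  by (rule bind_var)

lemma invt_comp:
  assumes T: "invt T T' x y" and S: "invt S S' y' z" and yy: "fst y = fst y'"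
  shows "invt (bind (\<lambda>_. T) S) (bind (\<lambda>_. S') T') x z"
proof -
  note t = invtD[OF T] and s = invtD[OF S]
  have "bind (\<lambda>_. bind (\<lambda>_. S') T') (bind (\<lambda>_. T) S) = bind (\<lambda>_. bind (\<lambda>_. S') (bind (\<lambda>_. T') T)) S"
    by (simp add: bind_bind)
  also have "\<dots> = var z" using T S yy s by (simp add: invt_def bind_const_var)
  finally have 1: "bind (\<lambda>_. bind (\<lambda>_. S') T') (bind (\<lambda>_. T) S) = var z" .
  have "bind (\<lambda>_. bind (\<lambda>_. T) S) (bind (\<lambda>_. S') T') = bind (\<lambda>_. bind (\<lambda>_. T) (bind (\<lambda>_. S) S')) T'"
    by (simp add: bind_bind)
  also have "\<dots> = var x" using T S yy t by (simp add: invt_def bind_const_var)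
  finally show ?thesis using 1 T S by (simp add: invt_def)
qed

lemma invt_var: "fst x \<in> Colours P \<Longrightarrow> fst y = fst x \<Longrightarrow> invt (var x) (var y) x y"
  by (simp add: invt_def bind_const_var)

lemma arrow_clab_total:
  assumes f: "f \<in> arrs"
  obtains M where "clab (lo f) = add_mset (out (src f), 0) (image_mset shiftl M)"
    "mset (stdl (tgt f)) = sum_list (map clab (up f)) + M"
    "\<And>x. x \<in># M \<Longrightarrow> fst x \<in> Colours P"
proof -
  obtain M where M: "clab (lo f) = add_mset (out (src f), 0) (image_mset shiftl M)"
    "\<And>x. x \<in># M \<Longrightarrow> fst x \<in> Colours P" using hole_lin_decomp[OF arrow_lo(4)[OF f]] by metis
  have t: "is_term (bind (ctxsub (appl (src f) (up f)) var) (lo f))" using arrow_target[OF f] by simp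
  have ok: "ok (src f) (up f)" using arrow_basic(9)[OF f] ok_is_term by blast
  have "mset (stdl (tgt f)) = sum_list (map clab (up f)) + M"
    using total_clab(1)[OF arrow_lo(4)[OF f] t M(1)] arrow_target[OF f] clab_appl[OF ok] by simp
  then show ?thesis using that M by blast
qed

lemma stdl_colour: "t \<in> Ops P \<Longrightarrow> x \<in> set (stdl t) \<Longrightarrow> fst x \<in> Colours P"
  using labelled_colour[OF labelled_stdl] by blast

lemma up_eq_map_graft: "f \<in> arrs \<Longrightarrow> up f = map (graft f) (stdl (src f))"
  unfolding graft_def using map_sel_stdl arrow_basic(2) by metis

lemma bind_graft_cong:
  assumes "f \<in> arrs" "U \<in> set (up f)" "\<And>x. x \<in> set (stdl (tgt f)) \<Longrightarrow> \<sigma> x = \<tau> x"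
  shows "bind \<sigma> U = bind \<tau> U" using assms arrow_leaves(1)[OF assms(1,2)] by (intro bind_cong) simp

lemma target_std: "f \<in> arrs \<Longrightarrow> lo f = hole (src f) \<Longrightarrow> appl (src f) (up f) = std (tgt f)
   \<and> out (src f) = out (tgt f)"
proof -
  assume f: "f \<in> arrs" and h: "lo f = hole (src f)"
  have "bind (ctxsub (appl (src f) (up f)) var) (hole (src f)) = appl (src f) (up f)"
    unfolding hole_def using source_colour[OF f] arrow_basic(9)[OF f] arrow_total_colour[OF f] by (subst bind_var) simp_all
  then show ?thesis using arrow_target(2)[OF f] h arrow_lo(5)[OF f] source_colour[OF f] by (simp add: hole_def)
qed

lemma lo_ident:
  assumes g: "g \<in> arrs"
  shows "bind (ctxsub (hole (src g)) svar) (lo g) = lo g"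
proof -
  have "bind (ctxsub (hole (src g)) svar) (lo g) = bind var (lo g)"
  proof (rule bind_cong)
    fix x assume x: "x \<in># clab (lo g)"
    from label_cases[of x] show "ctxsub (hole (src g)) svar x = var x" using hole_lin_zero[OF arrow_lo(4)[OF g] x] by (auto simp: hole_def)
  qed
  then show ?thesis using arrow_lo(1)[OF g] by (simp add: bind_ident)
qed

text \<open>Each leaf of the common target is either a leaf of \<open>h\<close>, or the leaf of a
  variable that \<open>k\<close> grafts on a lower leaf of \<open>g\<close>. A comparison arrow is
  prescribed on the former by \<open>h'\<close> and on the latter by \<open>k'\<close>, and its
  lower vertex has to be that of \<open>k'\<close>, because the lower vertex of \<open>k\<close> is
  the bare hole.\<close>

theorem pushout_criterion:
  assumes f: "active_like f" and g: "inert_like g"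
    and h: "h \<in> arrs" and k: "k \<in> arrs"
    and fg: "src f = src g" and fh: "src h = tgt f" and gk: "src k = tgt g"
    and hk: "tgt h = tgt k"
    and comm: "cmp h f = cmp k g"
    and lok: "lo k = hole (src k)"
    and hv: "up h = map var hv" "\<And>x. x \<in> set hv \<Longrightarrow> fst x \<in> Colours P"
    and kv: "\<And>y. shiftl y \<in># clab (lo g) \<Longrightarrow> \<exists>z. fst z \<in> Colours P \<and> graft k y = var z"
  shows "pushout_square (Tw P) f g h k"
proof -
  have f': "f \<in> arrs" and g': "g \<in> arrs" using f g by (simp_all add: active_like_def inert_like_def)
  let ?p = "src f" and ?t = "src h" and ?s = "src k" and ?u = "tgt k"
  let ?c = "out ?p"
  have ops: "?t \<in> Ops P" "?s \<in> Ops P" "?u \<in> Ops P" "?p \<in> Ops P" using arrow_basic(1) arrow_target(1) f' h k by blast+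
  \<comment> \<open>The inverse of the lower vertex of \<open>f\<close>; put into the hole of an
    equation between lower vertices, it cancels \<open>lo f\<close>.\<close>
  obtain K where K: "invt (lo f) K (?c, 0) (out ?t, 0)" using f fh by (auto simp: active_like_def)
  note Kp = invtD[OF K]
  have Kf: "bind (ctxsub K \<sigma>) (lo f) = hole ?t" for \<sigma>
    using bind_single[OF Kp(3), of "ctxsub K \<sigma>"] K by (simp add: invt_def hole_def)
  have Kh: "bind (ctxsub K \<sigma>) (hole ?p) = K" for \<sigma>
    using bind_single[of "hole ?p" "(?c,0)" "ctxsub K \<sigma>"] source_colour[OF f'] Kp by (simp add: hole_def bind_const_var)
  obtain M where M: "clab (lo g) = add_mset (?c, 0) (image_mset shiftl M)"
    "mset (stdl ?s) = sum_list (map clab (up g)) + M" "\<And>x. x \<in># M \<Longrightarrow> fst x \<in> Colours P"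
    using arrow_clab_total[OF g'] gk fg by metis
  obtain yv where yv: "M = mset yv" by (metis ex_mset)
  have ylo: "shiftl y \<in># clab (lo g) \<longleftrightarrow> y \<in> set yv" for y using M(1) yv by (auto simp: shiftl_inj) (simp add: shiftl_def)
  have ys: "y \<in> set (stdl ?s)" if "y \<in> set yv" for y using that M(2) yv by (metis set_mset_mset union_iff)
  have "\<forall>y \<in> set yv. \<exists>z. fst z \<in> Colours P \<and> graft k y = var z" using kv ylo by blast
  then obtain Z where Z: "\<And>y. y \<in> set yv \<Longrightarrow> fst (Z y) \<in> Colours P \<and> graft k y = var (Z y)" by metis
  define kl where "kl = map Z yv"
  have pk: "std ?u = appl ?s (up k)" "out ?s = out ?u" using target_std[OF k lok] by simp_all
  have lo_kg: "comp_lo k g = bind (ctxsub (hole ?p) (sgraft k)) (lo g)" using comp_lo_hole_right[OF g' k gk lok] fg by simp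
  have hf_kg: "comp_lo h f = comp_lo k g" "map (bind (graft h)) (up f) = map (bind (graft k)) (up g)"
    using tw_compose_props[OF f' h fh] tw_compose_props[OF g' k gk] comm by simp_all
  \<comment> \<open>Cancelling \<open>lo f\<close> from the commuting square shows that
    \<open>lo h\<close> is \<open>lo g\<close> with \<open>K\<close> in its hole and with the upper
    vertices of \<open>k\<close> grafted on its leaves.\<close>
  have L: "bind (ctxsub (hole ?t) \<sigma>) (lo h) = bind (ctxsub K (\<lambda>y. bind \<sigma> (graft k y))) (lo g)" for \<sigma>
  proof -
    have "bind (ctxsub K \<sigma>) (comp_lo h f) = bind (ctxsub (hole ?t) \<sigma>) (lo h)" unfolding comp_lo_eq[OF f'] Kf ..
    moreover have "bind (ctxsub K \<sigma>) (comp_lo k g) = bind (ctxsub K (\<lambda>y. bind \<sigma> (graft k y))) (lo g)"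
      unfolding lo_kg bind_ctxsub Kh bind_shift ..
    ultimately show ?thesis using hf_kg(1) by simp
  qed
  have kl_col: "fst (Z y) = fst y" if "y \<in> set yv" for y using graft_std(2)[OF k ys[OF that]] Z[OF that] by simp
  \<comment> \<open>As the inputs of \<open>?u\<close> are distinct, this makes the two kinds of
    leaves disjoint and lets every leaf occur once, so that values on them can be chosen
    freely.\<close>
  have labels: "mset (stdl ?u) = mset (hv @ kl)"
  proof -
    obtain N where N: "clab (lo h) = add_mset (out ?t, 0) (image_mset shiftl N)"
      "mset (stdl ?u) = sum_list (map clab (up h)) + N" using arrow_clab_total[OF h] hk by metis
    have "sum_list (map clab (map var xs)) = mset xs" if "\<forall>x \<in> set xs. fst x \<in> Colours P" for xs using that by (induction xs) auto
    then have 1: "mset (stdl ?u) = mset hv + N" using N(2) hv by simp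
    have 2: "lo h = bind (ctxsub K (\<lambda>y. shift (graft k y))) (lo g)"
      using L[of "\<lambda>x. var (shiftl x)"] lo_ident[OF h] by (simp add: shift_def)
    have "clab (lo h) = clab K + (\<Sum>y\<in>#M. clab (shift (graft k y)))"
      using clab_ctx[OF M(1), of K "\<lambda>y. shift (graft k y)"] 2 arrow_lo(1)[OF h] by simp
    also have "(\<Sum>y\<in>#M. clab (shift (graft k y))) = (\<Sum>y\<in>#M. {#shiftl (Z y)#})"
      using Z yv by (intro arg_cong[of _ _ sum_mset] image_mset_cong) (simp add: clab_shift)
    also have "\<dots> = image_mset shiftl (mset kl)" by (simp add: kl_def yv multiset.map_comp comp_def)
    finally have "image_mset shiftl N = image_mset shiftl (mset kl)" using N(1) Kp(4) by simp
    moreover have "inj (image_mset (shiftl :: 'c \<times> nat \<Rightarrow> _))" by (rule multiset.inj_map) (simp add: inj_def shiftl_inj)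
    ultimately have "N = mset kl" by (simp add: inj_eq)
    with 1 show ?thesis by simp
  qed
  have dist: "distinct (hv @ kl)" using mset_eq_imp_distinct_iff[OF labels] by simp
  have setu: "set (stdl ?u) = set (hv @ kl)" by (rule mset_eq_setD[OF labels])
  have lhv: "length hv = ar ?t" using hv(1) arrow_basic(2)[OF h] by (metis length_map)
  have sq: "commuting_square (Tw P) f g h k" using f' g' h k fg fh gk hk comm by (simp add: commuting_square_def Tw_def)
  have univ: "\<exists>!w. w \<in> arrs \<and> src w = tgt h \<and> tgt w = tgt h' \<and>
      cmp w h = h' \<and> cmp w k = k'"
    if h': "h' \<in> arrs" and k': "k' \<in> arrs" and fh': "src h' = tgt f" and gk': "src k' = tgt g"
      and hk': "tgt h' = tgt k'" and comm': "cmp h' f = cmp k' g" for h' k'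
  proof -
    have th: "src h' = ?t" and sk: "src k' = ?s" using fh fh' gk gk' by simp_all
    \<comment> \<open>The forced values of the comparison arrow, tabulated along the list
      \<open>hv @ kl\<close> of all leaves of \<open>?u\<close>.\<close>
    define \<omega> where "\<omega> = (\<lambda>x. the (map_of (zip (hv @ kl) (up h' @ map (graft k') yv)) x))"
    have "map \<omega> (hv @ kl) = up h' @ map (graft k') yv"
      unfolding \<omega>_def using dist by (intro map_map_of_zip) (simp_all add: lhv kl_def arrow_basic(2)[OF h'] th)
    then have om: "map \<omega> hv = up h'" "map \<omega> kl = map (graft k') yv" using lhv arrow_basic(2)[OF h'] th by simp_all
    have hf_kg': "comp_lo h' f = comp_lo k' g" "map (bind (graft h')) (up f) = map (bind (graft k')) (up g)"
      using tw_compose_props[OF f' h' fh'] tw_compose_props[OF g' k' gk'] comm' by simp_all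
    have A: "bind \<omega> (graft h x) = graft h' x" if xt: "x \<in> set (stdl ?t)" for x
    proof -
      obtain i where i: "i < ar ?t" "x = (ins ?t ! i, i)" using xt by (rule stdlE)
      have il: "i < length hv" using i(1) lhv by (simp only:)
      have gx: "graft h x = up h ! i" "graft h' x = up h' ! i" by (simp_all only: graft_def i(2) snd_conv)
      have e: "graft h x = var (hv ! i)" using nth_map[OF il, of "var"] by (simp only: gx hv(1))
      have o: "\<omega> (hv ! i) = graft h' x" using nth_map[OF il, of \<omega>] by (simp only: gx om(1))
      have c: "fst (hv ! i) \<in> Colours P" using hv(2) nth_mem[OF il] by blast
      have "fst (hv ! i) = fst x" using graft_std(2)[OF h xt] e c by simp
      then show ?thesis unfolding e using o graft_std[OF h', of x] xt th c by (subst bind_var) simp_all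
    qed
    have C: "bind \<omega> (graft k y) = graft k' y" if "y \<in> set yv" for y
    proof -
      have "\<omega> (Z y) = graft k' y" using om(2) that by (simp add: kl_def)
      then show ?thesis using Z[OF that] kl_col[OF that] graft_std[OF k', of y] ys[OF that] sk by (simp add: bind_var)
    qed
    \<comment> \<open>At a leaf of an upper vertex of \<open>g\<close> this vertex has an inverse
      \<open>R\<close>, so the value of \<open>k\<close> there is recovered from \<open>h\<close>
      and \<open>f\<close> through the commuting square, and likewise for \<open>k'\<close>. Only
      the lower leaves of \<open>g\<close> had to be prescribed.\<close>
    have B: "bind \<omega> (graft k x) = graft k' x" if x: "x \<in> set (stdl ?s)" for x
    proof (cases "x \<in> set yv")
      case True then show ?thesis by (rule C)
    next
      case False
      have "x \<in># sum_list (map clab (up g)) + M" using x M(2) by (metis set_mset_mset)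
      then have "x \<in># sum_list (map clab (up g))" using False yv by auto
      then obtain j where j: "j < ar ?p" "x \<in># clab (up g ! j)"
      proof -
        have "x \<in># sum_list (map clab Us) \<Longrightarrow> \<exists>U \<in> set Us. x \<in># clab U" for Us by (induction Us) auto
        then show ?thesis using that \<open>x \<in># sum_list (map clab (up g))\<close> arrow_basic(2)[OF g'] fg by (metis in_set_conv_nth)
      qed
      obtain R x' where R: "invt (up g ! j) R x' (ins ?p ! j, 0)" using g j fg by (auto simp: inert_like_def)
      have x': "x' = x" using invtD(3)[OF R] j(2) by simp
      have xc: "fst x \<in> Colours P" using stdl_colour[OF ops(2) x] .
      have gen: "graft q x = bind (\<lambda>_. bind (graft q) (up g ! j)) R" if q: "q \<in> arrs" "src q = ?s" for q
      proof -
        have "graft q x = bind (graft q) (var x)" using graft_std[OF q(1), of x] x q(2) xc by (simp add: bind_var)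
        also have "var x = bind (\<lambda>_. up g ! j) R" using R x' by (simp add: invt_def)
        finally show ?thesis by (simp add: bind_bind)
      qed
      have lf: "length (up f) = ar ?p" "length (up g) = ar ?p" using arrow_basic(2) f' g' fg by simp_all
      have e: "bind (graft k) (up g ! j) = bind (graft h) (up f ! j)"
        "bind (graft k') (up g ! j) = bind (graft h') (up f ! j)" using hf_kg(2) hf_kg'(2) j(1) lf by (metis nth_map)+
      have "bind \<omega> (graft k x) = bind (\<lambda>_. bind (\<lambda>x. bind \<omega> (graft h x)) (up f ! j)) R"
        unfolding gen[OF k refl] e(1) by (simp add: bind_bind)
      also have "bind (\<lambda>x. bind \<omega> (graft h x)) (up f ! j) = bind (graft h') (up f ! j)"
        using A j(1) lf fh by (intro bind_graft_cong[OF f']) simp_all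
      also have "bind (\<lambda>_. bind (graft h') (up f ! j)) R = graft k' x" unfolding gen[OF k' sk] e(2) ..
      finally show ?thesis .
    qed
    have upk: "map (bind \<omega>) (up k) = up k'" unfolding up_eq_map_graft[OF k] up_eq_map_graft[OF k'] sk using B by simp
    have uph: "map (bind \<omega>) (up h) = up h'" unfolding up_eq_map_graft[OF h] up_eq_map_graft[OF h'] th using A by simp
    have tot: "appl ?u (map \<omega> (stdl ?u)) = appl ?s (up k')" using arg_cong[OF pk(1), of "bind \<omega>"] ops(3) by (simp add: bind_appl upk)
    have "is_arr (tarr ?u (lo k') (map \<omega> (stdl ?u))) ?u (lo k') (map \<omega> (stdl ?u)) (tgt k')"
    proof (rule tarr)
      show "hole_lin (out ?u) (lo k')" using arrow_lo(4)[OF k'] sk pk(2) by simp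
      show "bind (ctxsub (appl ?u (map \<omega> (stdl ?u))) var) (lo k') = std (tgt k')" unfolding tot using arrow_target(2)[OF k'] sk by simp
    qed (use ops arrow_target(1)[OF k'] in auto)
    then obtain w where w: "w \<in> arrs" "src w = ?u" "lo w = lo k'" "up w = map \<omega> (stdl ?u)"
      "tgt w = tgt k'" by (auto simp: is_arr_def)
    have gw: "graft w x = \<omega> x" if "x \<in> set (stdl ?u)" for x using that w(4) by (auto simp: graft_def in_set_conv_nth)
    have wk: "cmp w k = k'"
    proof (rule arrow_eqI[OF _ k'])
      note c = tw_compose_props[OF k w(1) w(2)]
      show "cmp w k \<in> arrs" "src (cmp w k) = src k'" using c sk by simp_all
      show "lo (cmp w k) = lo k'" using c(3) comp_lo_hole[OF k w(1) w(2) lok] w(3) by simp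
      have "map (bind (graft w)) (up k) = map (bind \<omega>) (up k)" using gw by (intro map_cong[OF refl] bind_graft_cong[OF k]) simp_all
      then show "up (cmp w k) = up k'" using c(4) upk by simp
    qed
    have wh: "cmp w h = h'"
    proof (rule arrow_eqI[OF _ h'])
      have wh0: "src w = tgt h" using w(2) hk by simp
      note c = tw_compose_props[OF h w(1) wh0]
      show "cmp w h \<in> arrs" "src (cmp w h) = src h'" using c th by simp_all
      have "map (bind (graft w)) (up h) = map (bind \<omega>) (up h)" using gw hk by (intro map_cong[OF refl] bind_graft_cong[OF h]) simp_all
      then show "up (cmp w h) = up h'" using c(4) uph by simp
      let ?\<sigma> = "\<lambda>x. var (shiftl x)"
      \<comment> \<open>For the lower vertex of \<open>cmp w h\<close>, the inverse \<open>K\<close>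
        is put into the square of \<open>h'\<close> and \<open>k'\<close>, again cancelling
        \<open>lo f\<close>.\<close>
      have "lo h' = bind (ctxsub K ?\<sigma>) (comp_lo h' f)" unfolding comp_lo_eq[OF f'] Kf using lo_ident[OF h'] th by simp
      also have "\<dots> = bind (ctxsub (bind (ctxsub K (sgraft k')) (lo g)) ?\<sigma>) (lo k')" unfolding hf_kg'(1) comp_lo_eq[OF g'] shift_def ..
      also have "bind (ctxsub K (sgraft k')) (lo g) = bind (ctxsub (hole ?t) (sgraft w)) (lo h)" unfolding L
      proof (rule bind_ctxsub_cong)
        fix y assume "shiftl y \<in># clab (lo g)"
        then have y: "y \<in> set yv" by (simp add: ylo)
        have zu: "Z y \<in> set (stdl ?u)" unfolding setu using y by (simp add: kl_def)
        have "bind (sgraft w) (graft k y) = shift (graft w (Z y))"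
        proof -
          have "is_term (graft w (Z y))" "outc (graft w (Z y)) = fst (Z y)" using graft_std[OF w(1)] zu w(2) by simp_all
          then show ?thesis using Z[OF y] by (simp add: bind_var outc_shift)
        qed
        also have "graft w (Z y) = graft k' y" using gw[OF zu] om(2) y by (simp add: kl_def)
        finally show "shift (graft k' y) = bind (sgraft w) (graft k y)" ..
      qed
      also have "bind (ctxsub (bind (ctxsub (hole ?t) (sgraft w)) (lo h)) ?\<sigma>) (lo k') = comp_lo w h" by (simp add: comp_lo_def w(3) hole_def)
      finally show "lo (cmp w h) = lo h'" using c(3) by simp
    qed
    show ?thesis
    proof (rule ex1I[of _ w])
      show "w \<in> arrs \<and> src w = tgt h \<and> tgt w = tgt h' \<and> cmp w h = h' \<and> cmp w k = k'" using w wh wk hk hk' by simp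
      fix v assume v: "v \<in> arrs \<and> src v = tgt h \<and> tgt v = tgt h' \<and> cmp v h = h' \<and> cmp v k = k'"
      then have vs: "src v = ?u" "src v = tgt h" and va: "v \<in> arrs" using hk by simp_all
      note ch = tw_compose_props[OF h va vs(2)] and ck = tw_compose_props[OF k va vs(1)]
      have gv: "bind (graft v) (var x) = graft v x" if "x \<in> set (stdl ?u)" for x
        using graft_std[OF va, of x] that vs(1) stdl_colour[OF ops(3) that] by (simp add: bind_var)
      \<comment> \<open>Either kind of leaf appears as a variable in \<open>h\<close> or in
        \<open>k\<close>, so its value under \<open>v\<close> can be read off from
        \<open>cmp v h\<close> or \<open>cmp v k\<close>.\<close>
      have "graft v x = \<omega> x" if x: "x \<in> set (stdl ?u)" for x
      proof (cases "x \<in> set hv")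
        case True
        then obtain i where i: "i < length hv" "x = hv ! i" by (metis in_set_conv_nth)
        have "map (bind (graft v)) (map var hv) = map \<omega> hv" using ch(4) v hv(1) om(1) by simp
        then have "bind (graft v) (var x) = \<omega> x" using i by (metis length_map nth_map)
        then show ?thesis using gv[OF x] by simp
      next
        case False
        then obtain y where y: "y \<in> set yv" "x = Z y" using x setu by (auto simp: kl_def)
        have "up k' = map (bind (graft v)) (up k)" using ck(4) v by simp
        then have "map (graft k') (stdl ?s) = map (\<lambda>x. bind (graft v) (graft k x)) (stdl ?s)"
          using up_eq_map_graft[OF k] up_eq_map_graft[OF k'] sk by (simp add: comp_def)
        then have "graft k' y = bind (graft v) (graft k y)" using ys[OF y(1)] by simp
        then show ?thesis using Z[OF y(1)] gv[OF x] y om(2) by (simp add: kl_def)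
      qed
      then have "up v = up w" unfolding up_eq_map_graft[OF va] w(4) vs(1) by simp
      moreover have "lo v = lo w" using ck(3) v comp_lo_hole[OF k va vs(1) lok] w(3) by simp
      ultimately show "v = w" using arrow_eqI[OF va w(1)] vs(1) w(2) by simp
    qed
  qed
  show ?thesis unfolding pushout_square_def
  proof (intro conjI allI impI)
    show "commuting_square (Tw P) f g h k" by (rule sq)
    fix h' k' assume "commuting_square (Tw P) f g h' k'"
    then have "h' \<in> arrs" "k' \<in> arrs" "src h' = tgt f" "src k' = tgt g"
      "tgt h' = tgt k'" "cmp h' f = cmp k' g" by (simp_all add: commuting_square_def Tw_def)
    from univ[OF this] show "\<exists>!u. u \<in> Arr (Tw P) \<and> Dom (Tw P) u = Cod (Tw P) h \<and> Cod (Tw P) u = Cod (Tw P) h' \<and>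
        Compose (Tw P) u h = h' \<and> Compose (Tw P) u k = k'"
      by (simp add: Tw_def)
  qed
qed

section \<open>Active and inert arrows satisfy the pointwise conditions\<close>

lemma upper_active_like:
  assumes f: "f \<in> upper_arrows P" shows "active_like f"
proof -
  obtain c where c: "f \<in> arrs" "lower f = Unit P c" "c \<in> Colours P" using f by (auto simp: upper_arrows_def)
  have "ll f = []" "out (src f) = c" using c by (auto simp: tw_arrows_def Unit_inputs)
  then have "lo f = var (c, 0)" using c by (simp add: lo_def var_def Unit_inputs)
  moreover have "out (tgt f) = c" using arrow_lo(2,5)[OF c(1)] c by (simp add: Unit_output)
  ultimately show ?thesis using c \<open>out (source f) = c\<close> by (auto simp: active_like_def intro!: exI[of _ "var (c, 0)"] invt_var)
qed

lemma lower_inert_like: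
  assumes f: "f \<in> lower_arrows P" shows "inert_like f" unfolding inert_like_def
proof (intro conjI allI impI)
  show a: "f \<in> arrs" using f by (simp add: lower_arrows_def)
  fix i assume i: "i < ar (src f)"
  note u = up_nth[OF a i]
  have "uppers f ! i \<in> Unit P ` Colours P" using f i arrow_basic(6)[OF a] by (auto simp: lower_arrows_def)
  then obtain c where c: "uppers f ! i = Unit P c" "c \<in> Colours P" by blast
  then have c': "c = ins (src f) ! i" using u by (simp add: Unit_output)
  have "length (ul f ! i) = 1" using u c by (simp add: Unit_inputs)
  then obtain m where m: "ul f ! i = [m]" by (metis One_nat_def length_0_conv length_Suc_conv)
  have "up f ! i = var (c, m)" using u c m by (simp add: var_def Unit_inputs)
  then show "\<exists>R x. invt (up f ! i) R x (ins (src f) ! i, 0)"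
    using c c' by (intro exI[of _ "var (c, 0)"] exI[of _ "(c, m)"]) (auto intro!: invt_var)
qed

lemma comp_lo_single:
  assumes f: "f \<in> arrs" and g: "g \<in> arrs"
    and "clab (lo f) = {#(out (src f), 0)#}"
    and "clab (lo g) = {#(out (src g), 0)#}"
  shows "comp_lo g f = bind (\<lambda>_. lo f) (lo g)"
proof -
  have "bind (ctxsub (var (out (src f), 0)) (sgraft g)) (lo f) = bind var (lo f)" by (rule bind_cong) (simp add: assms(3))
  then show ?thesis using arrow_lo(1)[OF f] bind_single[OF assms(4), of "ctxsub (lo f) svar"] by (simp add: comp_lo_def bind_ident)
qed

lemma bind_nonempty:
  assumes "is_term (bind \<sigma> T)" "clab (bind \<sigma> T) \<noteq> {#}" shows "clab T \<noteq> {#}" using assms clab_bind[OF assms(1)] by auto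

text \<open>Labels are counted in the two composites, which are identities. The lower vertices turn
  out to have no label but the hole and to be inverse to each other; each upper vertex of
  \<open>f\<close> has exactly one leaf, and the upper vertex of \<open>g\<close> grafted there
  inverts it.\<close>

lemma iso_like:
  assumes iso: "iso (Tw P) f"
  shows "active_like f" "inert_like f"
proof -
  obtain g where f: "f \<in> arrs" and g: "g \<in> arrs" and fg: "src g = tgt f" and gf: "tgt g = src f"
    and 1: "cmp g f = tw_ident P (src f)" and 2: "cmp f g = tw_ident P (src g)" using iso by (auto simp: iso_def Tw_def)
  note c1 = tw_compose_props[OF f g fg] and c2 = tw_compose_props[OF g f gf[symmetric]]
  have ops: "src f \<in> Ops P" "src g \<in> Ops P" using f g arrow_basic(1) by blast+
  note id1 = is_arr_ident[OF ops(1)] and id2 = is_arr_ident[OF ops(2)]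
  have lo: "comp_lo g f = hole (src f)" "comp_lo f g = hole (src g)" using c1(3) c2(3) 1 2 id1 id2 by (simp_all add: is_arr_def)
  have up: "map (bind (graft g)) (up f) = map var (stdl (src f))"
    "map (bind (graft f)) (up g) = map var (stdl (src g))" using c1(4) c2(4) 1 2 id1 id2 by (simp_all add: is_arr_def)
  \<comment> \<open>If the composite context is the bare hole, the second context has no further
    leaf, and whatever is grafted on lower leaves of the first has no leaves at all.\<close>
  have aux: "clab (lo b) = {#(out (src b), 0)#} \<and> (\<forall>x. shiftl x \<in># clab (lo a) \<longrightarrow> clab (graft b x) = {#})"
    if ab: "a \<in> arrs" "b \<in> arrs" "comp_lo b a = hole (src a)" for a b
  proof -
    let ?X = "bind (ctxsub (var (out (src a), 0)) (sgraft b)) (lo a)"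
    obtain M where M: "clab (lo b) = add_mset (out (src b), 0) (image_mset shiftl M)" "\<And>x. x \<in># M \<Longrightarrow> fst x \<in> Colours P"
      using hole_lin_decomp[OF arrow_lo(4)[OF ab(2)]] by metis
    obtain N where N: "clab (lo a) = add_mset (out (src a), 0) (image_mset shiftl N)" "\<And>x. x \<in># N \<Longrightarrow> fst x \<in> Colours P"
      using hole_lin_decomp[OF arrow_lo(4)[OF ab(1)]] by metis
    have t: "is_term (bind (ctxsub ?X svar) (lo b))" using ab(3) source_colour[OF ab(1)] unfolding comp_lo_def by (simp add: hole_def)
    have "is_term (ctxsub ?X svar (out (src b), 0))" using t M(1) unfolding is_term_bind[of _ "lo b"] by (metis union_single_eq_member)
    then have X: "is_term ?X" by simp
    have "{#(out (src a), 0)#} = clab (bind (ctxsub ?X svar) (lo b))"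
      using ab(3) source_colour[OF ab(1)] unfolding comp_lo_def by (simp add: hole_def)
    also have "\<dots> = clab ?X + (\<Sum>x\<in>#M. clab (var (shiftl x)))" by (rule clab_ctx[OF M(1) t])
    also have "clab ?X = {#(out (src a), 0)#} + (\<Sum>x\<in>#N. clab (shift (graft b x)))" using clab_ctx[OF N(1) X] source_colour[OF ab(1)] by simp
    finally have z: "(\<Sum>x\<in>#M. clab (var (shiftl x))) = {#}" "(\<Sum>x\<in>#N. clab (shift (graft b x))) = {#}" by auto
    have "M = {#}" using z(1) M(2) by (cases M) auto
    moreover have "clab (graft b x) = {#}" if "x \<in># N" for x using z(2) that by (auto simp: clab_shift dest!: multi_member_split)
    ultimately show ?thesis using M(1) N(1) by (auto simp: shiftl_inj) (simp add: shiftl_def)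
  qed
  have l: "clab (lo g) = {#(out (src g), 0)#}" "clab (lo f) = {#(out (src f), 0)#}" using aux[OF f g lo(1)] aux[OF g f lo(2)] by simp_all
  have "bind (\<lambda>_. lo f) (lo g) = hole (src f)" "bind (\<lambda>_. lo g) (lo f) = hole (src g)"
    using comp_lo_single[OF f g l(2,1)] comp_lo_single[OF g f l] lo by simp_all
  then show "active_like f"
    using f fg source_colour[OF f] source_colour[OF g] by (auto simp: active_like_def invt_def hole_def intro!: exI[of _ "lo g"])
  have ne: "clab (graft g x) \<noteq> {#} \<and> bind (graft f) (graft g x) = var x" if x: "x \<in> set (stdl (src g))" for x
  proof -
    have "map (\<lambda>x. bind (graft f) (graft g x)) (stdl (src g)) = map var (stdl (src g))"
      using up(2) up_eq_map_graft[OF g] by (simp add: comp_def)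
    then have e: "bind (graft f) (graft g x) = var x" using x by simp
    then show ?thesis using bind_nonempty[of "graft f" "graft g x"] stdl_colour[OF ops(2) x] by simp
  qed
  show "inert_like f" unfolding inert_like_def
  proof (intro conjI allI impI f)
    fix i assume i: "i < ar (src f)"
    let ?c = "ins (src f) ! i"
    have c: "?c \<in> Colours P" using inputs_colours[OF ops(1)] i by auto
    have mem: "up f ! i \<in> set (up f)" using i arrow_basic(2)[OF f] by simp
    have e: "bind (graft g) (up f ! i) = var (?c, i)" using up(1) i arrow_basic(2)[OF f] by (metis length_stdl nth_map nth_stdl)
    have t: "is_term (bind (graft g) (up f ! i))" using e c by simp
    have sum: "(\<Sum>x\<in>#clab (up f ! i). clab (graft g x)) = {#(?c, i)#}" using clab_bind[OF t] e c by simp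
    then obtain x where x: "clab (up f ! i) = {#x#}" "clab (graft g x) = {#(?c, i)#}"
      using sum_mset_single_nonempty[OF sum] ne arrow_leaves(1)[OF f mem] fg by metis
    have xs: "x \<in> set (stdl (src g))" using arrow_leaves(1)[OF f mem] x(1) fg by simp
    let ?R = "bind (\<lambda>_. var (?c, 0)) (graft g x)"
    have "bind (\<lambda>_. ?R) (up f ! i) = bind (\<lambda>_. var (?c, 0)) (bind (\<lambda>_. graft g x) (up f ! i))" by (simp add: bind_bind)
    also have "bind (\<lambda>_. graft g x) (up f ! i) = var (?c, i)" using bind_single[OF x(1)] e by metis
    finally have 1: "bind (\<lambda>_. ?R) (up f ! i) = var (?c, 0)" using c by (simp add: bind_const_var)
    have "bind (\<lambda>_. up f ! i) ?R = bind (\<lambda>_. bind (\<lambda>_. up f ! i) (var (?c, 0))) (graft g x)" by (simp add: bind_bind)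
    also have "bind (\<lambda>_. up f ! i) (var (?c, 0)) = up f ! i" using arrow_up[OF f i] c by (simp add: bind_const_var)
    also have "bind (\<lambda>_. up f ! i) (graft g x) = bind (graft f) (graft g x)" using bind_single[OF x(2), of "graft f"] by (simp add: graft_def)
    finally have "bind (\<lambda>_. up f ! i) ?R = var x" using ne[OF xs] by simp
    with 1 show "\<exists>R x. invt (up f ! i) R x (?c, 0)" using c stdl_colour[OF ops(2) xs] by (intro exI[of _ ?R] exI[of _ x]) (simp add: invt_def)
  qed
qed

lemma active_like_comp:
  assumes f: "active_like f" and g: "active_like g" and fg: "src g = tgt f"
  shows "active_like (cmp g f)"
proof -
  have f': "f \<in> arrs" and g': "g \<in> arrs" using f g by (simp_all add: active_like_def)
  obtain K L where K: "invt (lo f) K (out (src f), 0) (out (tgt f), 0)"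
    "invt (lo g) L (out (src g), 0) (out (tgt g), 0)" using f g by (auto simp: active_like_def)
  note c = tw_compose_props[OF f' g' fg]
  have "invt (bind (\<lambda>_. lo f) (lo g)) (bind (\<lambda>_. L) K) (out (src f), 0) (out (tgt g), 0)" by (rule invt_comp[OF K]) (simp add: fg)
  then show ?thesis using c comp_lo_single[OF f' g' invtD(3)[OF K(1)] invtD(3)[OF K(2)]] by (auto simp: active_like_def)
qed

lemma inert_like_comp:
  assumes f: "inert_like f" and g: "inert_like g" and fg: "src g = tgt f"
  shows "inert_like (cmp g f)"
proof -
  have f': "f \<in> arrs" and g': "g \<in> arrs" using f g by (simp_all add: inert_like_def)
  note c = tw_compose_props[OF f' g' fg]
  show ?thesis unfolding inert_like_def
  proof (intro conjI allI impI c(1))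
    fix i assume "i < ar (src (cmp g f))"
    then have i: "i < ar (src f)" using c by simp
    obtain R x where R: "invt (up f ! i) R x (ins (src f) ! i, 0)" using f i by (auto simp: inert_like_def)
    have mem: "up f ! i \<in> set (up f)" using i arrow_basic(2)[OF f'] by simp
    have "x \<in> set (stdl (src g))" using arrow_leaves(1)[OF f' mem] invtD(3)[OF R] fg by simp
    then obtain l where l: "l < ar (src g)" "x = (ins (src g) ! l, l)" by (metis in_set_conv_nth length_stdl nth_stdl)
    obtain S y where S: "invt (up g ! l) S y (ins (src g) ! l, 0)" using g l by (auto simp: inert_like_def)
    have "up (cmp g f) ! i = bind (\<lambda>_. up g ! l) (up f ! i)"
      using c(4) i arrow_basic(2)[OF f'] bind_single[OF invtD(3)[OF R], of "graft g"] l by (simp add: graft_def)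
    then show "\<exists>R x. invt (up (cmp g f) ! i) R x (ins (src (cmp g f)) ! i, 0)" using invt_comp[OF S R] l c(2) by (intro exI) simp
  qed
qed

lemma active_arrows_like: "f \<in> active_arrows P \<Longrightarrow> active_like f" unfolding active_arrows_def
proof (induction rule: composites.induct)
  case (base f) then show ?case using upper_active_like iso_like by blast
next
  case (step f g) then show ?case using active_like_comp[of f g] by (simp add: Tw_def)
qed

lemma inert_arrows_like: "f \<in> inert_arrows P \<Longrightarrow> inert_like f" unfolding inert_arrows_def
proof (induction rule: composites.induct)
  case (base f) then show ?case using lower_inert_like iso_like by blast
next
  case (step f g) then show ?case using inert_like_comp[of f g] by (simp add: Tw_def)
qed

text \<open>The target \<open>u\<close> is \<open>lo g\<close> with the source and upper vertices of
  \<open>f\<close> in its hole. The lower vertex of \<open>f\<close> does not appear in it; being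
  invertible, it is compensated by its inverse in the lower vertex of \<open>h\<close>. The leaves
  of \<open>u\<close> are the inputs of \<open>tgt f\<close>, followed by the lower leaves of
  \<open>g\<close>, renumbered from \<open>ar (tgt f)\<close> on.\<close>

theorem pushout_exists:
  assumes f: "active_like f" and g: "inert_like g" and fg: "src f = src g"
  obtains h k where "pushout_square (Tw P) f g h k"
proof -
  have f': "f \<in> arrs" and g': "g \<in> arrs" using f g by (simp_all add: active_like_def inert_like_def)
  let ?p = "src f" and ?t = "tgt f" and ?s = "tgt g"
  let ?c = "out ?p"
  let ?A = "appl ?p (up f)"
  have ops: "?t \<in> Ops P" "?s \<in> Ops P" "?p \<in> Ops P" using arrow_basic(1) arrow_target(1) f' g' by blast+
  obtain K where K: "invt (lo f) K (?c, 0) (out ?t, 0)" using f by (auto simp: active_like_def)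
  note Kp = invtD[OF K]
  obtain M where M: "clab (lo g) = add_mset (?c, 0) (image_mset shiftl M)"
    "mset (stdl ?s) = sum_list (map clab (up g)) + M" "\<And>x. x \<in># M \<Longrightarrow> fst x \<in> Colours P"
    using arrow_clab_total[OF g'] fg by metis
  obtain yv where yv: "M = mset yv" by (metis ex_mset)
  have ylo: "shiftl y \<in># clab (lo g) \<longleftrightarrow> y \<in> set yv" for y using M(1) yv by (auto simp: shiftl_inj) (simp add: shiftl_def)
  have "\<exists>R x. invt (up g ! i) R x (ins ?p ! i, 0)" if "i < ar ?p" for i using g that fg by (auto simp: inert_like_def)
  then obtain R xf where R: "\<And>i. i < ar ?p \<Longrightarrow> invt (up g ! i) (R i) (xf i) (ins ?p ! i, 0)" by metis
  define xv where "xv = map xf [0..<ar ?p]"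
  have lg: "length (up g) = ar ?p" "length (up f) = ar ?p" using arrow_basic(2) f' g' fg by simp_all
  have "map clab (up g) = map (\<lambda>x. {#x#}) xv" using lg invtD(3)[OF R] by (intro nth_equalityI) (simp_all add: xv_def)
  moreover have "sum_list (map (\<lambda>x. {#x#}) xs) = mset xs" for xs :: "('c \<times> nat) list" by (induction xs) auto
  ultimately have ms: "mset (stdl ?s) = mset (xv @ yv)" using M(2) yv by simp
  have dist: "distinct (xv @ yv)" using mset_eq_imp_distinct_iff[OF ms] by simp
  have sets: "set (stdl ?s) = set (xv @ yv)" by (rule mset_eq_setD[OF ms])
  define nl where "nl = map (\<lambda>j. (fst (yv ! j), ar ?t + j)) [0..<length yv]"
  \<comment> \<open>The upper vertices of \<open>k\<close>: at the leaf of upper vertex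
    \<open>i\<close> of \<open>g\<close>, its inverse \<open>R i\<close> with
    \<open>up f ! i\<close> grafted on it, so that \<open>up g ! i\<close> is cancelled; at lower
    leaves of \<open>g\<close>, the new variables \<open>nl\<close>.\<close>
  define \<kappa> where "\<kappa> = (\<lambda>x. the (map_of (zip (xv @ yv) (map (\<lambda>i. bind (\<lambda>_. up f ! i) (R i)) [0..<ar ?p] @ map var nl)) x))"
  have "map \<kappa> (xv @ yv) = map (\<lambda>i. bind (\<lambda>_. up f ! i) (R i)) [0..<ar ?p] @ map var nl"
    unfolding \<kappa>_def using dist by (intro map_map_of_zip) (simp_all add: xv_def nl_def)
  then have kap: "map \<kappa> xv = map (\<lambda>i. bind (\<lambda>_. up f ! i) (R i)) [0..<ar ?p]" "map \<kappa> yv = map var nl"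
    by (simp_all add: xv_def)
  have kx: "\<kappa> (xf i) = bind (\<lambda>_. up f ! i) (R i)" if "i < ar ?p" for i using kap(1) that by (simp add: xv_def)
  have "\<exists>z. fst z = fst y \<and> \<kappa> y = var z \<and> z \<in> set nl" if y: "y \<in> set yv" for y
  proof -
    obtain j where j: "j < length yv" "y = yv ! j" using y by (metis in_set_conv_nth)
    have "\<kappa> y = var (nl ! j)" using arg_cong[OF kap(2), of "\<lambda>xs. xs ! j"] j by (simp add: nl_def)
    moreover have "fst (nl ! j) = fst y" "nl ! j \<in> set nl" using j by (simp_all add: nl_def)
    ultimately show ?thesis by blast
  qed
  then obtain Z where Z: "\<And>y. y \<in> set yv \<Longrightarrow> fst (Z y) = fst y \<and> \<kappa> y = var (Z y) \<and> Z y \<in> set nl" by metis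
  have ycol: "fst y \<in> Colours P" if "y \<in> set yv" for y using M(3) yv that by simp
  have kup: "bind \<kappa> (up g ! i) = up f ! i" if i: "i < ar ?p" for i
  proof -
    have "bind \<kappa> (up g ! i) = bind (\<lambda>_. up f ! i) (bind (\<lambda>_. R i) (up g ! i))"
      using bind_single[OF invtD(3)[OF R[OF i]], of \<kappa>] by (simp add: kx[OF i] bind_bind)
    also have "\<dots> = up f ! i" using R[OF i] arrow_up[OF f' i] by (simp add: invt_def bind_const_var)
    finally show ?thesis .
  qed
  have kups: "map (bind \<kappa>) (up g) = up f" using kup lg by (intro nth_equalityI) simp_all
  define T where "T = bind (ctxsub ?A \<kappa>) (lo g)"
  have lof: "bind (ctxsub ?A var) (lo f) = bind (\<lambda>_. ?A) (lo f)" using bind_single[OF Kp(3), of "ctxsub ?A var"] by simp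
  have st: "std ?t = bind (\<lambda>_. ?A) (lo f)" using arrow_target(2)[OF f'] lof by simp
  have At: "is_term ?A" "outc ?A = ?c" using arrow_basic(9)[OF f'] arrow_total_colour[OF f'] by simp_all
  have tT: "is_term T" "outc T = out ?s"
  proof -
    show "is_term T" unfolding T_def is_term_bind
    proof (intro conjI ballI)
      show "is_term (lo g)" using arrow_lo[OF g'] by simp
      fix x assume x: "x \<in># clab (lo g)"
      from label_cases[of x] show "is_term (ctxsub ?A \<kappa> x)" "outc (ctxsub ?A \<kappa> x) = fst x"
        using hole_lin_zero[OF arrow_lo(4)[OF g'] x] fg At x ylo Z ycol by auto
    qed
    then show "outc T = out ?s" unfolding T_def using outc_bind arrow_lo(5)[OF g'] by simp
  qed
  \<comment> \<open>The lower vertex of \<open>f\<close> is unary, so it neither adds nor removes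
    leaves.\<close>
  have clA: "clab ?A = mset (stdl ?t)"
  proof -
    have "clab (bind (\<lambda>_. ?A) (lo f)) = clab ?A"
      using clab_bind[of "\<lambda>_. ?A" "lo f"] std_simps(1)[OF ops(1), unfolded st] Kp(3) by simp
    then show ?thesis unfolding st[symmetric] std_simps(3)[OF ops(1)] by (rule sym)
  qed
  have mk: "(\<Sum>y\<in>#M. clab (\<kappa> y)) = mset nl"
  proof -
    have "(\<Sum>y\<in>#M. clab (\<kappa> y)) = sum_list (map clab (map \<kappa> yv))" by (simp add: yv sum_mset_sum_list comp_def flip: mset_map)
    also have "\<dots> = mset nl"
    proof -
      have "sum_list (map clab (map var xs)) = mset xs" if "\<forall>x \<in> set xs. fst x \<in> Colours P" for xs using that by (induction xs) auto
      moreover have "\<forall>x \<in> set nl. fst x \<in> Colours P" using ycol by (auto simp: nl_def)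
      ultimately show ?thesis unfolding kap(2) by blast
    qed
    finally show ?thesis .
  qed
  let ?ls = "stdl ?t @ nl"
  have clT: "clab T = mset ?ls" using clab_ctx[OF M(1), of ?A \<kappa>] tT(1) clA mk by (simp add: T_def)
  have snd_ls: "map snd ?ls = [0..<ar ?t + length yv]"
    by (simp add: snd_stdl nl_def comp_def upt_add_eq_append map_add_upt[of "ar ?t" "length yv", symmetric, unfolded add.commute[of _ "ar ?t"]])
  have dls: "distinct ?ls" using snd_ls distinct_upt by (metis distinct_map)
  obtain u where u: "labelled (u, ?ls)" "T = cls u ?ls" using cls_reorder[OF tT(1) clT dls] .
  have uo: "u \<in> Ops P" using u by (simp add: labelled_def)
  have "stdl u = ?ls"
  proof -
    have lu: "ar u = ar ?t + length yv" using labelled_length[OF u(1)] by (simp add: nl_def)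
    have "stdl u = zip (map fst ?ls) (map snd ?ls)" using u(1) unfolding stdl_def[of u] lu snd_ls by (simp only: labelled_def fst_conv snd_conv)
    then show ?thesis by (simp only: zip_map_fst_snd)
  qed
  then have Tu: "T = std u" using u(2) by (simp add: std_def)
  have ou: "out u = out ?s" using tT(2) Tu uo by simp
  have "is_arr (tarr ?s (hole ?s) (map \<kappa> (stdl ?s))) ?s (hole ?s) (map \<kappa> (stdl ?s)) u"
  proof (rule tarr)
    have oc: "out ?s \<in> Colours P" using ops by (simp add: output_colour)
    show "hole_lin (out ?s) (hole ?s)" using oc by (simp add: hole_lin_def hole_def)
    have "appl ?s (map \<kappa> (stdl ?s)) = bind \<kappa> (bind (ctxsub (appl ?p (up g)) var) (lo g))" using arrow_target(2)[OF g'] fg ops by simp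
    also have "\<dots> = bind (ctxsub ?A (\<lambda>x. bind \<kappa> (var x))) (lo g)" by (simp add: bind_ctxsub bind_appl kups)
    also have "\<dots> = T" unfolding T_def by (rule bind_ctxsub_cong) (use ylo Z ycol in \<open>simp add: bind_var\<close>)
    finally have e: "appl ?s (map \<kappa> (stdl ?s)) = std u" using Tu by simp
    show "bind (ctxsub (appl ?s (map \<kappa> (stdl ?s))) var) (hole ?s) = std u" unfolding e hole_def using oc uo ou by (simp add: bind_var)
  qed (use ops uo in auto)
  then obtain k where k: "k \<in> arrs" "src k = ?s" "lo k = hole ?s" "up k = map \<kappa> (stdl ?s)" "tgt k = u" by (auto simp: is_arr_def)
  \<comment> \<open>The lower vertex of \<open>h\<close>: the inverse \<open>K\<close> in the hole
    of \<open>lo g\<close> will cancel \<open>lo f\<close> in \<open>cmp h f\<close>.\<close>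
  let ?C = "bind (ctxsub K (\<lambda>x. shift (\<kappa> x))) (lo g)"
  have tC: "is_term ?C" unfolding is_term_bind
  proof (intro conjI ballI)
    show "is_term (lo g)" using arrow_lo[OF g'] by simp
    fix x assume x: "x \<in># clab (lo g)"
    from label_cases[of x] show "is_term (ctxsub K (\<lambda>x. shift (\<kappa> x)) x)" "outc (ctxsub K (\<lambda>x. shift (\<kappa> x)) x) = fst x"
      using hole_lin_zero[OF arrow_lo(4)[OF g'] x] fg Kp x ylo Z ycol by (auto simp: outc_shift)
  qed
  have "is_arr (tarr ?t ?C (map var (stdl ?t))) ?t ?C (map var (stdl ?t)) u"
  proof (rule tarr)
    have "(\<Sum>y\<in>#M. clab (shift (\<kappa> y))) = image_mset shiftl (\<Sum>y\<in>#M. clab (\<kappa> y))"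
      unfolding clab_shift by (induction M) auto
    then have "clab ?C = {#(out ?t, 0)#} + image_mset shiftl (mset nl)" using clab_ctx[OF M(1) tC] Kp(4) mk by simp
    moreover have "filter_mset (\<lambda>x. snd x = 0) (image_mset shiftl (mset xs)) = {#}" for xs :: "('c \<times> nat) list" by (induction xs) auto
    ultimately show "hole_lin (out ?t) ?C" using tC by (simp add: hole_lin_def)
    have "bind (ctxsub (std ?t) var) K = bind (\<lambda>_. bind (\<lambda>_. ?A) (lo f)) K"
      using bind_single[OF Kp(4), of "ctxsub (std ?t) var"] st by simp
    also have "\<dots> = bind (\<lambda>_. ?A) (var (?c, 0))" using K by (simp add: bind_bind[symmetric] invt_def)
    also have "\<dots> = ?A" using At outc_colour[OF At(1)] by (simp add: bind_const_var)
    finally have e: "bind (ctxsub (std ?t) var) K = ?A" .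
    have "bind (ctxsub (std ?t) var) ?C = bind (ctxsub ?A (\<lambda>x. bind var (\<kappa> x))) (lo g)" by (simp add: bind_ctxsub e bind_shift)
    also have "\<dots> = T" unfolding T_def by (rule bind_ctxsub_cong) (use ylo Z ycol in \<open>simp add: bind_var\<close>)
    finally show "bind (ctxsub (appl ?t (map var (stdl ?t))) var) ?C = std u" using ops Tu by simp
  qed (use ops uo in auto)
  then obtain h where h: "h \<in> arrs" "src h = ?t" "lo h = ?C" "up h = map var (stdl ?t)" "tgt h = u" by (auto simp: is_arr_def)
  have gk: "graft k x = \<kappa> x" if "x \<in> set (stdl ?s)" for x using that k(4) by (auto simp: graft_def in_set_conv_nth)
  have gh: "graft h x = var x" if "x \<in> set (stdl ?t)" for x using that h(4) by (auto simp: graft_def in_set_conv_nth)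
  have comm: "cmp h f = cmp k g"
  proof (rule arrow_eqI)
    note ch = tw_compose_props[OF f' h(1,2)] and ck = tw_compose_props[OF g' k(1,2)]
    show "cmp h f \<in> arrs" "cmp k g \<in> arrs" "src (cmp h f) = src (cmp k g)" using ch ck fg by simp_all
    have "map (bind (graft h)) (up f) = up f"
    proof (rule map_idI)
      fix U assume U: "U \<in> set (up f)"
      have "is_term U" using U arrow_up(1)[OF f'] lg by (auto simp: in_set_conv_nth)
      moreover have "bind (graft h) U = bind var U" using gh by (rule bind_graft_cong[OF f' U])
      ultimately show "bind (graft h) U = U" by (simp add: bind_ident)
    qed
    moreover have "map (bind (graft k)) (up g) = map (bind \<kappa>) (up g)" using gk by (intro map_cong[OF refl] bind_graft_cong[OF g']) simp_all
    ultimately show "up (cmp h f) = up (cmp k g)" using ch(4) ck(4) kups by simp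
    let ?\<sigma> = "\<lambda>x. var (shiftl x)"
    have X: "bind (ctxsub (var (?c, 0)) (sgraft h)) (lo f) = lo f"
    proof -
      have "bind (ctxsub (var (?c, 0)) (sgraft h)) (lo f) = bind var (lo f)" by (rule bind_cong) (simp add: Kp(3))
      then show ?thesis using Kp(1) by (simp add: bind_ident)
    qed
    have e: "bind (ctxsub (lo f) ?\<sigma>) K = hole ?p" using bind_single[OF Kp(4), of "ctxsub (lo f) ?\<sigma>"] K by (simp add: invt_def hole_def)
    have "comp_lo h f = bind (ctxsub (hole ?p) (\<lambda>x. bind ?\<sigma> (\<kappa> x))) (lo g)"
      unfolding comp_lo_def X h(3) bind_ctxsub e bind_shift ..
    also have "\<dots> = bind (ctxsub (hole ?p) (sgraft k)) (lo g)"
    proof (rule bind_ctxsub_cong)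
      fix x assume "shiftl x \<in># clab (lo g)"
      then have "x \<in> set yv" by (simp add: ylo)
      then have "graft k x = \<kappa> x" using gk sets by simp
      then show "bind ?\<sigma> (\<kappa> x) = shift (graft k x)" by (simp add: shift_def)
    qed
    also have "\<dots> = comp_lo k g" using comp_lo_hole_right[OF g' k(1,2)] k(2,3) fg by simp
    finally show "lo (cmp h f) = lo (cmp k g)" using ch(3) ck(3) by simp
  qed
  have "pushout_square (Tw P) f g h k"
  proof (rule pushout_criterion[OF f g h(1) k(1) fg h(2) k(2) _ comm _ h(4)])
    show "\<exists>z. fst z \<in> Colours P \<and> graft k y = var z" if "shiftl y \<in># clab (lo g)" for y
    proof -
      have y: "y \<in> set yv" using that by (simp add: ylo)
      then have "graft k y = \<kappa> y" using gk sets by simp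
      then show ?thesis using Z[OF y] ycol[OF y] by metis
    qed
  qed (use h k stdl_colour[OF ops(1)] in auto)
  then show ?thesis by (rule that)
qed

end

section \<open>Elementary arrows\<close>

fun split_by :: "nat list \<Rightarrow> 'a list \<Rightarrow> 'a list list" where
  "split_by [] xs = []"
| "split_by (n # ns) xs = take n xs # split_by ns (drop n xs)"

lemma length_split_by [simp]: "length (split_by ns xs) = length ns" by (induction ns arbitrary: xs) auto

lemma concat_split_by: "sum_list ns = length xs \<Longrightarrow> concat (split_by ns xs) = xs"
proof (induction ns arbitrary: xs)
  case (Cons n ns)
  then have "sum_list ns = length (drop n xs)" by simp
  with Cons.IH show ?case by simp
qed simp

lemma map_length_split_by: "sum_list ns = length xs \<Longrightarrow> map length (split_by ns xs) = ns"
proof (induction ns arbitrary: xs)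
  case (Cons n ns)
  then have "sum_list ns = length (drop n xs)" by simp
  with Cons.IH[OF this] Cons.prems show ?case by simp
qed simp

lemma split_by_concat: "map length yss = ns \<Longrightarrow> split_by ns (concat yss) = yss" by (induction yss arbitrary: ns) auto

lemma split_by_map: "split_by ns (map f xs) = map (map f) (split_by ns xs)" by (induction ns arbitrary: xs) (simp_all add: take_map drop_map)

lemma concat_list_update:
  "i < length xss \<Longrightarrow> j < length (xss ! i) \<Longrightarrow>
    (concat xss)[sum_list (map length (take i xss)) + j := v] = concat (xss[i := (xss ! i)[j := v]])"
proof (induction xss arbitrary: i)
  case (Cons xs xss)
  show ?case
  proof (cases i)
    case 0
    then show ?thesis using Cons.prems by (simp add: list_update_append)
  next
    case (Suc i')
    then have "(concat xss)[sum_list (map length (take i' xss)) + j := v] = concat (xss[i' := (xss ! i')[j := v]])" using Cons by simp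
    then show ?thesis using Suc by (simp add: list_update_append add.assoc)
  qed
qed simp

lemma list_all2_concat:
  "list_all2 (\<lambda>xs ys. length xs = length ys) xss yss \<Longrightarrow>
    list_all2 R (concat xss) (concat yss) \<longleftrightarrow> list_all2 (list_all2 R) xss yss"
  by (induction rule: list_all2_induct) (simp_all add: list_all2_append)

context operad
begin

definition ublocks :: "'o \<Rightarrow> 'o list \<Rightarrow> ('c \<times> nat) list list" where
  "ublocks p qs = split_by (map ar qs) (stdl (Subst P p qs))"

definition lowctx :: "'o \<Rightarrow> ('c, 'o) trm list \<Rightarrow> nat \<Rightarrow> 'o \<Rightarrow> ('c, 'o) trm" where
  "lowctx p Ts i q = appl p ((map shift Ts)[i := hole q])"

definition uparr :: "'o \<Rightarrow> 'o list \<Rightarrow> 'o tw_arr" where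
  "uparr p qs = tarr p (hole p) (map2 cls qs (ublocks p qs))"

text \<open>Terms have no order of inputs, so the hole may sit at any input \<open>i\<close> of
  \<open>p\<close>; \<open>tarr\<close> supplies the representative with the hole in front that an
  arrow requires.\<close>

definition lowarr :: "'o \<Rightarrow> 'o list \<Rightarrow> nat \<Rightarrow> 'o tw_arr" where
  "lowarr p qs i = tarr (qs ! i) (lowctx p (map2 cls qs (ublocks p qs)) i (qs ! i))
    (map var (ublocks p qs ! i))"

definition permarr :: "'o \<Rightarrow> nat list \<Rightarrow> 'o tw_arr" where
  "permarr p xs = tarr p (hole p) (map var (map ((!) (stdl (Act P p xs))) xs))"

lemma substitutableD:
  assumes "sub p qs"
  shows "p \<in> Ops P" "length qs = ar p" "\<And>i. i < length qs \<Longrightarrow> qs ! i \<in> Ops P"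
    "\<And>i. i < length qs \<Longrightarrow> out (qs ! i) = ins p ! i"
proof -
  have a: "p \<in> Ops P" "set qs \<subseteq> Ops P" "map out qs = ins p" using assms by (simp_all add: substitutable_def)
  show "p \<in> Ops P" by (rule a)
  show "length qs = ar p" using arg_cong[OF a(3), of length] by simp
  fix i assume i: "i < length qs"
  show "qs ! i \<in> Ops P" using a(2) nth_mem[OF i] by blast
  show "out (qs ! i) = ins p ! i" using arg_cong[OF a(3), of "\<lambda>xs. xs ! i"] i by simp
qed

lemma is_term_hole: "q \<in> Ops P \<Longrightarrow> is_term (hole q) \<and> outc (hole q) = out q
    \<and> clab (hole q) = {#(out q, 0)#}"
  by (simp add: hole_def output_colour)

lemma hole_lin_hole: "q \<in> Ops P \<Longrightarrow> hole_lin (out q) (hole q)" by (simp add: hole_lin_def is_term_hole)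

lemma bind_hole: "q \<in> Ops P \<Longrightarrow> is_term S \<Longrightarrow> outc S = out q \<Longrightarrow> bind (ctxsub S \<sigma>) (hole q) = S"
  unfolding hole_def by (subst bind_var) (simp_all add: output_colour)

lemma bind_lowctx:
  assumes "q \<in> Ops P" "is_term S" "outc S = out q"
  shows "bind (ctxsub S \<sigma>) (lowctx p Ts i q) = appl p ((map (bind \<sigma>) Ts)[i := S])"
  by (simp add: lowctx_def bind_appl map_update bind_hole assms comp_def bind_shift)

lemma ublocks:
  assumes s: "sub p qs"
  shows "concat (ublocks p qs) = stdl (Subst P p qs)" "map length (ublocks p qs) = map ar qs"
    "labs qs (ublocks p qs)" "length (ublocks p qs) = length qs"
    "appl p (map2 cls qs (ublocks p qs)) = std (Subst P p qs)"
proof -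
  have l: "sum_list (map ar qs) = length (stdl (Subst P p qs))" by (simp add: Subst_inputs[OF s] length_concat comp_def)
  show c: "concat (ublocks p qs) = stdl (Subst P p qs)" and m: "map length (ublocks p qs) = map ar qs"
    unfolding ublocks_def using concat_split_by[OF l] map_length_split_by[OF l] by simp_all
  show len: "length (ublocks p qs) = length qs" by (simp add: ublocks_def)
  have "map (map fst) (ublocks p qs) = split_by (map ar qs) (concat (map ins qs))"
    unfolding ublocks_def split_by_map[symmetric] fst_stdl Subst_inputs[OF s] ..
  also have "\<dots> = map ins qs" by (rule split_by_concat) simp
  finally have "map (map fst) (ublocks p qs) = map ins qs" .
  then have "map fst (ublocks p qs ! i) = ins (qs ! i)" if "i < length qs" for i using that len by (metis nth_map)
  then show la: "labs qs (ublocks p qs)" using len substitutableD(3)[OF s] by (simp add: list_all2_conv_all_nth labelled_def)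
  show "appl p (map2 cls qs (ublocks p qs)) = std (Subst P p qs)" using appl_cls(1)[OF la s] c by (simp add: std_def)
qed

lemma ublocks_unique: 
  assumes "concat Bs = stdl (Subst P p qs)" "map length Bs = map ar qs"
  shows "ublocks p qs = Bs" using split_by_concat[OF assms(2)] assms(1) by (simp add: ublocks_def)

lemma uparr:
  assumes s: "sub p qs"
  shows "is_arr (uparr p qs) p (hole p) (map2 cls qs (ublocks p qs)) (Subst P p qs)" unfolding uparr_def
proof (rule tarr)
  have p: "p \<in> Ops P" using substitutableD(1)[OF s] .
  have "is_term (std (Subst P p qs))" "outc (std (Subst P p qs)) = out p" using Subst_op[OF s] Subst_output[OF s] by simp_all
  then show "bind (ctxsub (appl p (map2 cls qs (ublocks p qs))) var) (hole p) = std (Subst P p qs)"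
    unfolding ublocks(5)[OF s] using p by (simp add: bind_hole)
qed (use substitutableD[OF s] Subst_op[OF s] hole_lin_hole in auto)

lemma filter_zero_shift: "filter_mset (\<lambda>x. snd x = 0) (sum_list (map clab (map shift Ts))) = {#}"
proof (induction Ts)
  case (Cons T Ts)
  have "filter_mset (\<lambda>x. snd x = 0) (image_mset shiftl M) = {#}" for M :: "('c \<times> nat) multiset" by (induction M) auto
  with Cons show ?case by (simp add: clab_shift)
qed simp

lemma filter_zero_update:
  "i < length Ts \<Longrightarrow> filter_mset (\<lambda>x. snd x = 0) (sum_list (map clab ((map shift Ts)[i := H])))
     = filter_mset (\<lambda>x. snd x = 0) (clab H)"
proof (induction Ts arbitrary: i)
  case (Cons T Ts)
  show ?case
  proof (cases i)
    case 0
    then show ?thesis using filter_zero_shift[of Ts] by simp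
  next
    case (Suc j)
    then show ?thesis using Cons filter_zero_shift[of "[T]"] by simp
  qed
qed simp

lemma lowarr:
  assumes s: "sub p qs" and i: "i < length qs"
  shows "is_arr (lowarr p qs i) (qs ! i) (lowctx p (map2 cls qs (ublocks p qs)) i (qs ! i))
    (map var (ublocks p qs ! i)) (Subst P p qs)"
  unfolding lowarr_def
proof (rule tarr)
  let ?Ts = "map2 cls qs (ublocks p qs)"
  note u = ublocks[OF s] and d = substitutableD[OF s]
  have q: "qs ! i \<in> Ops P" using d(3)[OF i] .
  have la: "labelled (qs ! j, ublocks p qs ! j)" if "j < length qs" for j using u(3) that by (simp add: list_all2_conv_all_nth)
  have ok: "ok p ?Ts" using ok_cls[OF u(3) s] .
  have ok': "ok p ((map shift ?Ts)[i := hole (qs ! i)])"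
  proof -
    have "map outc ((map shift ?Ts)[i := hole (qs ! i)]) = ins p" using la is_term_hole[OF q] d u(4) i
      by (intro nth_equalityI) (auto simp: nth_list_update outc_shift is_term_cls outc_cls)
    moreover have "\<forall>t \<in> set (map shift ?Ts). is_term t" using ok unfolding ok_def by simp
    then have "\<forall>t \<in> set ((map shift ?Ts)[i := hole (qs ! i)]). is_term t"
      using set_update_subset_insert[of "map shift ?Ts" i "hole (qs ! i)"] is_term_hole[OF q] by blast
    ultimately show ?thesis using d(1) unfolding ok_def by blast
  qed
  then have t: "is_term (lowctx p ?Ts i (qs ! i))" by (simp add: lowctx_def ok_is_term)
  have "clab (lowctx p ?Ts i (qs ! i)) = sum_list (map clab ((map shift ?Ts)[i := hole (qs ! i)]))" unfolding lowctx_def by (rule clab_appl[OF ok'])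
  then show "hole_lin (out (qs ! i)) (lowctx p ?Ts i (qs ! i))"
    using t filter_zero_update[of i ?Ts "hole (qs ! i)"] i u(4) is_term_hole[OF q] by (simp add: hole_lin_def)
  have c: "appl (qs ! i) (map var (ublocks p qs ! i)) = cls (qs ! i) (ublocks p qs ! i)" using la[OF i] by (rule appl_vars)
  have "bind (ctxsub (cls (qs ! i) (ublocks p qs ! i)) var) (lowctx p ?Ts i (qs ! i)) = appl p ((map (bind var) ?Ts)[i := cls (qs ! i) (ublocks p qs ! i)])"
    by (rule bind_lowctx) (use q la[OF i] in \<open>simp_all add: is_term_cls outc_cls\<close>)
  also have "(map (bind var) ?Ts)[i := cls (qs ! i) (ublocks p qs ! i)] = ?Ts"
    using la u(4) i by (intro nth_equalityI) (auto simp: nth_list_update bind_ident is_term_cls)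
  finally show "bind (ctxsub (appl (qs ! i) (map var (ublocks p qs ! i))) var) (lowctx p ?Ts i (qs ! i)) = std (Subst P p qs)"
    unfolding c using u(5) by simp
qed (use substitutableD[OF s] Subst_op[OF s] i in auto)

lemma permarr:
  assumes p: "p \<in> Ops P" and xs: "perm_list (ar p) xs"
  shows "is_arr (permarr p xs) p (hole p) (map var (map ((!) (stdl (Act P p xs))) xs)) (Act P p xs)" unfolding permarr_def
proof (rule tarr)
  have a: "Act P p xs \<in> Ops P" "ar (Act P p xs) = ar p" "out (Act P p xs) = out p" using p xs Act_op Act_arity Act_output by blast+
  have m: "map var (map ((!) (stdl (Act P p xs))) xs) = map ((!) (map var (stdl (Act P p xs)))) xs" using perm_list_mem_less[OF xs] a(2) by simp
  have e: "appl p (map var (map ((!) (stdl (Act P p xs))) xs)) = std (Act P p xs)"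
    unfolding m using appl_Act[OF p xs, of "map var (stdl (Act P p xs))"] a by simp
  show "bind (ctxsub (appl p (map var (map ((!) (stdl (Act P p xs))) xs))) var) (hole p) = std (Act P p xs)"
    unfolding e using a p by (simp add: bind_hole)
qed (use p Act_op[OF p xs] hole_lin_hole in auto)

lemma is_arrD:
  assumes "is_arr f p C Us t"
  shows "f \<in> arrs" "src f = p" "lo f = C" "up f = Us" "tgt f = t" "p \<in> Ops P" "t \<in> Ops P"
    "map (graft f) (stdl p) = Us" "length Us = ar p"
  using assms arrow_basic(1,2)[of f] arrow_target(1)[of f] up_eq_map_graft[of f] unfolding is_arr_def by auto

lemma compose_eqI:
  assumes "is_arr f p C Us t" "is_arr g t D Vs u" "is_arr h p E Ws u"
    "comp_lo g f = E" "map (bind (graft g)) Us = Ws"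
  shows "cmp g f = h" using is_arr_unique[OF is_arr_compose[OF assms(1,2), unfolded assms(4,5)] assms(3)] .

lemma compose_eqI2:
  assumes "is_arr f p C Us t" "is_arr g t D Vs u" "is_arr f' p C' Us' t'" "is_arr g' t' D' Vs' u"
    "comp_lo g f = comp_lo g' f'" "map (bind (graft g)) Us = map (bind (graft g')) Us'"
  shows "cmp g f = cmp g' f'" by (rule compose_eqI[OF assms(1,2) is_arr_compose[OF assms(3,4)] assms(5,6)])

lemma comp_lo_hole_l: "is_arr f p (hole p) Us t \<Longrightarrow> is_arr g t D Vs u \<Longrightarrow> comp_lo g f = D"
  using comp_lo_hole[of f g] by (simp add: is_arr_def)

lemma comp_lo_hole_r: "is_arr f p C Us t \<Longrightarrow> is_arr g t (hole t) Vs u \<Longrightarrow>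
    comp_lo g f = bind (ctxsub (hole p) (sgraft g)) C"
  using comp_lo_hole_right[of f g] by (simp add: is_arr_def)

lemma shift_bind: "bind (\<lambda>x. shift (\<sigma> x)) T = shift (bind \<sigma> T)" by (simp add: shift_def bind_bind)

lemma bind_hole_lowctx:
  assumes "q \<in> Ops P" "r \<in> Ops P" "out r = out q"
  shows "bind (ctxsub (hole r) (\<lambda>x. shift (\<sigma> x))) (lowctx p Ts i q) = lowctx p (map (bind \<sigma>) Ts) i r"
proof -
  have "bind (\<lambda>x. shift (\<sigma> x)) = (\<lambda>T. shift (bind \<sigma> T))" by (rule ext) (rule shift_bind)
  then show ?thesis using bind_lowctx[of q "hole r"] is_term_hole[OF assms(2)] assms by (simp add: lowctx_def comp_def)
qed

text \<open>Cutting into blocks commutes with mapping, so the upper vertices of an arrow out of a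
  composite may be given block by block, as the elementary arrows below need them.\<close>

lemma graft_ublocks:
  assumes "sub p qs" "is_arr g (Subst P p qs) D Vs u" "concat Wss = Vs" "map length Wss = map ar qs"
  shows "map (map (graft g)) (ublocks p qs) = Wss"
  using is_arrD(8)[OF assms(2)] split_by_concat[OF assms(4)] assms(3) by (simp add: ublocks_def flip: split_by_map)

lemma bind_graft_cls: "labelled (q, ls) \<Longrightarrow> map (graft g) ls = Ts \<Longrightarrow> bind (graft g) (cls q ls) = appl q Ts"
  by (simp add: bind_cls)

lemma bind_graft_var:
  assumes "is_arr g t D Vs u" "set ls \<subseteq> set (stdl t)"
  shows "map (bind (graft g)) (map var ls) = map (graft g) ls"
proof -
  note g = is_arrD[OF assms(1)]
  have "bind (graft g) (var x) = graft g x" if "x \<in> set ls" for x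
    using graft_std[OF g(1), of x] stdl_colour[OF g(6), of x] that assms(2) g(2) by (subst bind_var) auto
  then show ?thesis by simp
qed

lemma arr_ident_eqI:
  assumes "is_arr f p C Us t" "C = hole p" "Us = map var (stdl p)"
  shows "f = tw_ident P p" "t = p" using assms is_arr_unique[of f p C Us t "tw_ident P p" p] is_arr_ident[OF is_arrD(6)[OF assms(1)]]
  by (auto simp: is_arr_def)

section \<open>Relations between elementary arrows\<close>

lemma lowarr_Unit:
  assumes p: "p \<in> Ops P"
  shows "lowarr (Unit P (out p)) [p] 0 = tw_ident P p"
proof -
  let ?c = "out p"
  have c: "?c \<in> Colours P" using p by (rule output_colour)
  have s: "sub (Unit P ?c) [p]" using p c by (simp add: substitutable_def Unit_op Unit_inputs)
  have u: "ublocks (Unit P ?c) [p] = [stdl p]" by (rule ublocks_unique) (simp_all add: Unit_Subst p)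
  show ?thesis
  proof (rule arr_ident_eqI(1))
    show "is_arr (lowarr (Unit P ?c) [p] 0) p (lowctx (Unit P ?c) (map2 cls [p] (ublocks (Unit P ?c) [p])) 0 p)
      (map var (ublocks (Unit P ?c) [p] ! 0)) (Subst P (Unit P ?c) [p])" using lowarr[OF s, of 0] by simp
    show "lowctx (Unit P ?c) (map2 cls [p] (ublocks (Unit P ?c) [p])) 0 p = hole p" using is_term_hole[OF p] by (simp add: lowctx_def u appl_Unit)
  qed (simp add: u)
qed

lemma substitutable_Units: "p \<in> Ops P \<Longrightarrow> sub p (map (Unit P) (ins p))"
  using inputs_colours[of p] by (auto simp: substitutable_def Unit_op Unit_output subset_iff intro!: map_idI)

lemma uparr_Units:
  assumes p: "p \<in> Ops P"
  shows "uparr p (map (Unit P) (ins p)) = tw_ident P p"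
proof -
  let ?us = "map (Unit P) (ins p)"
  note s = substitutable_Units[OF p]
  have ar: "ar (Unit P c) = 1" if "c \<in> set (ins p)" for c using that inputs_colours[OF p] Unit_inputs[of c] by auto
  have u: "ublocks p ?us = map (\<lambda>x. [x]) (stdl p)"
  proof (rule ublocks_unique)
    have "concat (map (\<lambda>x. [x]) xs) = xs" for xs :: "('c \<times> nat) list" by (induction xs) auto
    then show "concat (map (\<lambda>x. [x]) (stdl p)) = stdl (Subst P p ?us)" by (simp add: Subst_Unit p)
    show "map length (map (\<lambda>x. [x]) (stdl p)) = map ar ?us" using ar by (intro nth_equalityI) simp_all
  qed
  have "map2 cls ?us (ublocks p ?us) = map var (stdl p)" unfolding u by (intro nth_equalityI) (simp_all add: var_def)
  then show ?thesis using arr_ident_eqI(1)[OF uparr[OF s]] by simp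
qed

lemma nested_substitutable:
  assumes s: "sub p qs" and r: "list_all2 sub qs rss"
  shows "sub (Subst P p qs) (concat rss)" "sub p (map2 (Subst P) qs rss)"
    "Subst P (Subst P p qs) (concat rss) = Subst P p (map2 (Subst P) qs rss)"
proof -
  let ?A = "map2 (Subst P) qs rss"
  have l: "length rss = length qs" using r by (simp add: list_all2_lengthD)
  have "map (map out) rss = map ins qs" using r l by (intro nth_equalityI) (simp_all add: list_all2_conv_all_nth substitutable_def)
  moreover have "\<forall>rs \<in> set rss. set rs \<subseteq> Ops P"
    using r unfolding list_all2_conv_all_nth substitutable_def by (metis in_set_conv_nth)
  ultimately show "sub (Subst P p qs) (concat rss)" using Subst_op[OF s] Subst_inputs[OF s] by (auto simp: substitutable_def map_concat)
  have "map out ?A = map out qs" using r l by (intro nth_equalityI) (simp_all add: list_all2_conv_all_nth Subst_output)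
  moreover have "set ?A \<subseteq> Ops P" using r by (auto simp: list_all2_conv_all_nth set_zip Subst_op)
  ultimately show "sub p ?A" using s unfolding substitutable_def by metis
  show "Subst P (Subst P p qs) (concat rss) = Subst P p ?A" by (rule Subst_assoc[OF s r])
qed

text \<open>Labels of a two-level composite, grouped as \<open>W ! i ! j\<close> for the inputs of \<open>rss ! i ! j\<close>.\<close>

lemma nested_blocks:
  assumes s: "sub p qs" and r: "list_all2 sub qs rss"
  obtains W where "length W = length qs" "\<And>i. i < length qs \<Longrightarrow> map length (W ! i) = map ar (rss ! i)"
    "\<And>i. i < length qs \<Longrightarrow> labs (rss ! i) (W ! i)"
    "ublocks (Subst P p qs) (concat rss) = concat W"
    "ublocks p (map2 (Subst P) qs rss) = map concat W"
    "map length W = map length rss"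
proof -
  let ?A = "map2 (Subst P) qs rss"
  note n = nested_substitutable[OF s r]
  have l: "length rss = length qs" using r by (simp add: list_all2_lengthD)
  let ?B = "ublocks (Subst P p qs) (concat rss)"
  define W where "W = split_by (map length rss) ?B"
  note u = ublocks[OF n(1)]
  have sl: "sum_list (map length rss) = length ?B" using u(4) by (simp add: length_concat)
  have c: "concat W = ?B" and ml: "map length W = map length rss" unfolding W_def using concat_split_by[OF sl] map_length_split_by[OF sl] by simp_all
  have lW: "length W = length qs" using l by (simp add: W_def)
  have lWi: "length (W ! i) = length (rss ! i)" if "i < length qs" for i using ml that lW l by (metis nth_map)
  have la2: "list_all2 (\<lambda>rs ws. length rs = length ws) rss W" using lWi lW l by (simp add: list_all2_conv_all_nth)
  have "list_all2 (labs) rss W" using u(3) list_all2_concat[OF la2] unfolding c[symmetric] by blast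
  then have la: "labs (rss ! i) (W ! i)" if "i < length qs" for i using that l by (simp add: list_all2_conv_all_nth)
  then have m: "map length (W ! i) = map ar (rss ! i)" if "i < length qs" for i
    using that labelled_length lWi[OF that] by (intro nth_equalityI) (fastforce simp: list_all2_conv_all_nth)+
  have "ublocks p ?A = map concat W"
  proof (rule ublocks_unique)
    have "concat (map concat W) = concat (concat W)" by (induction W) auto
    then show "concat (map concat W) = stdl (Subst P p ?A)" using c u(1) n(3) by simp
    show "map length (map concat W) = map ar ?A"
    proof (rule nth_equalityI)
      fix i assume "i < length (map length (map concat W))"
      then have i: "i < length qs" using lW by simp
      have "sub (qs ! i) (rss ! i)" using r i by (simp add: list_all2_conv_all_nth)
      then show "map length (map concat W) ! i = map ar ?A ! i" using m[OF i] i l lW by (simp add: length_concat Subst_inputs comp_def)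
    qed (simp add: lW l)
  qed
  with that lW m la c ml show ?thesis by metis
qed

lemma graft_nested:
  assumes s: "sub p qs" and r: "list_all2 sub qs rss"
    and W: "length W = length qs" "\<And>i. i < length qs \<Longrightarrow> map length (W ! i) = map ar (rss ! i)"
      "ublocks (Subst P p qs) (concat rss) = concat W"
  shows "map (map (graft (uparr (Subst P p qs) (concat rss)))) (ublocks p qs) = map2 (map2 cls) rss W"
proof -
  note n = nested_substitutable[OF s r]
  have l: "length rss = length qs" using r by (simp add: list_all2_lengthD)
  have lWi: "length (W ! i) = length (rss ! i)" if "i < length qs" for i using W(2)[OF that] by (metis length_map)
  have "list_all2 (\<lambda>rs ws. length rs = length ws) rss W" using W(1) l lWi by (simp add: list_all2_conv_all_nth)
  then have "concat (map2 (map2 cls) rss W) = map2 cls (concat rss) (concat W)" by (induction rule: list_all2_induct) auto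
  moreover have "map length (map2 (map2 cls) rss W) = map ar qs"
  proof (rule nth_equalityI)
    fix i assume "i < length (map length (map2 (map2 cls) rss W))"
    then have i: "i < length qs" using W(1) l by simp
    then have "sub (qs ! i) (rss ! i)" using r by (simp add: list_all2_conv_all_nth)
    then show "map length (map2 (map2 cls) rss W) ! i = map ar qs ! i" using i W(1) l lWi[OF i] by (simp add: substitutableD(2))
  qed (simp add: W(1) l)
  ultimately show ?thesis using graft_ublocks[OF s uparr[OF n(1)]] W(3) by simp
qed

text \<open>This relation together with \<open>lowarr_uparr\<close> and \<open>lowarr_lowarr\<close>
  carries the associativity of the operad of elements: they relate the restrictions of an element
  over a two-level composite.\<close>

lemma uparr_uparr:
  assumes s: "sub p qs" and r: "list_all2 sub qs rss"
  shows "cmp (uparr (Subst P p qs) (concat rss)) (uparr p qs) = uparr p (map2 (Subst P) qs rss)"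
proof -
  let ?A = "map2 (Subst P) qs rss"
  let ?B = "map2 cls qs (ublocks p qs)"
  obtain W where W: "length W = length qs" "\<And>i. i < length qs \<Longrightarrow> map length (W ! i) = map ar (rss ! i)"
    "\<And>i. i < length qs \<Longrightarrow> labs (rss ! i) (W ! i)"
    "ublocks (Subst P p qs) (concat rss) = concat W"
    "ublocks p ?A = map concat W" "map length W = map length rss" using nested_blocks[OF s r] by blast
  note n = nested_substitutable[OF s r]
  have l: "length rss = length qs" using r by (simp add: list_all2_lengthD)
  have a3: "is_arr (uparr p ?A) p (hole p) (map2 cls ?A (map concat W)) (Subst P (Subst P p qs) (concat rss))" using uparr[OF n(2)] W(5) n(3) by simp
  note a1 = uparr[OF s] and a2 = uparr[OF n(1)]
  show ?thesis
  proof (rule compose_eqI[OF a1 a2 a3])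
    show "comp_lo (uparr (Subst P p qs) (concat rss)) (uparr p qs) = hole p" using comp_lo_hole_l[OF a1 a2] Subst_output[OF s] by (simp add: hole_def)
    let ?g = "uparr (Subst P p qs) (concat rss)"
    have G: "map (map (graft ?g)) (ublocks p qs) = map2 (map2 cls) rss W" by (rule graft_nested[OF s r W(1,2,4)])
    show "map (bind (graft ?g)) ?B = map2 cls ?A (map concat W)"
    proof (rule nth_equalityI)
      fix i assume "i < length (map (bind (graft ?g)) ?B)"
      then have i: "i < length qs" by simp
      have si: "sub (qs ! i) (rss ! i)" using r i by (simp add: list_all2_conv_all_nth)
      have "map (graft ?g) (ublocks p qs ! i) = map2 cls (rss ! i) (W ! i)"
        using arg_cong[OF G, of "\<lambda>xs. xs ! i"] i ublocks(4)[OF s] W(1) l by simp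
      moreover have "labelled (qs ! i, ublocks p qs ! i)" using ublocks(3)[OF s] i by (simp add: list_all2_conv_all_nth)
      ultimately have "bind (graft ?g) (cls (qs ! i) (ublocks p qs ! i)) = cls (Subst P (qs ! i) (rss ! i)) (concat (W ! i))"
        using appl_cls(1)[OF W(3)[OF i] si] by (simp add: bind_cls)
      then show "map (bind (graft ?g)) ?B ! i = map2 cls ?A (map concat W) ! i" using i W(1) l ublocks(4)[OF s] by simp
    qed (simp add: W(1) l ublocks(4)[OF s])
  qed
qed

text \<open>The operations of \<open>rss ! i\<close> become upper vertices on either route, and
  those of the other blocks end up in the lower vertex, already composed with their
  \<open>qs\<close>.\<close>

lemma lowarr_uparr:
  assumes s: "sub p qs" and r: "list_all2 sub qs rss" and i: "i < length qs"
  shows "cmp (uparr (Subst P p qs) (concat rss)) (lowarr p qs i)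
    = cmp (lowarr p (map2 (Subst P) qs rss) i) (uparr (qs ! i) (rss ! i))"
proof -
  obtain W where W: "length W = length qs" "\<And>i. i < length qs \<Longrightarrow> map length (W ! i) = map ar (rss ! i)"
    "\<And>i. i < length qs \<Longrightarrow> labs (rss ! i) (W ! i)"
    "ublocks (Subst P p qs) (concat rss) = concat W"
    "ublocks p (map2 (Subst P) qs rss) = map concat W" "map length W = map length rss" using nested_blocks[OF s r] by blast
  note n = nested_substitutable[OF s r]
  let ?ss = "map2 (Subst P) qs rss"
  have l: "length rss = length qs" using r by (simp add: list_all2_lengthD)
  have sk: "sub (qs ! k) (rss ! k)" if "k < length qs" for k using r that by (simp add: list_all2_conv_all_nth)
  have iss: "i < length ?ss" "?ss ! i = Subst P (qs ! i) (rss ! i)" using i l by simp_all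
  note a1 = lowarr[OF s i] and a2 = uparr[OF n(1)] and a3 = uparr[OF sk[OF i]]
  note a4 = lowarr[OF n(2) iss(1), unfolded iss(2) W(5)]
  let ?g = "uparr (Subst P p qs) (concat rss)" and ?lw = "lowarr p ?ss i"
  note u = ublocks[OF s]
  have G: "map (map (graft ?g)) (ublocks p qs) = map2 (map2 cls) rss W" by (rule graft_nested[OF s r W(1,2,4)])
  have Gi: "map (graft ?g) (ublocks p qs ! k) = map2 cls (rss ! k) (W ! k)" if "k < length qs" for k
    using arg_cong[OF G, of "\<lambda>xs. xs ! k"] that u(4) W(1) l by simp
  have la: "labelled (qs ! k, ublocks p qs ! k)" if "k < length qs" for k using u(3) that by (simp add: list_all2_conv_all_nth)
  have bG: "bind (graft ?g) (cls (qs ! k) (ublocks p qs ! k)) = cls (?ss ! k) (concat (W ! k))" if "k < length qs" for k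
    using bind_graft_cls[OF la[OF that] Gi[OF that]] appl_cls(1)[OF W(3)[OF that] sk[OF that]] that l by simp
  have sub: "set (ublocks p qs ! i) \<subseteq> set (stdl (Subst P p qs))" using u(1,4) i by (metis concat.simps nth_mem set_concat UN_upper)
  have a2': "is_arr ?g (Subst P p qs) (hole (Subst P p qs)) (map2 cls (concat rss) (concat W)) (Subst P p ?ss)" using a2 W(4) n(3) by simp
  show ?thesis
  proof (rule compose_eqI2[OF a1 a2' a3 a4])
    have cW: "concat (map (map var) (W ! i)) = map var (map concat W ! i)" using i W(1) by (simp add: map_concat)
    have mW: "map length (map (map var) (W ! i)) = map ar (rss ! i)" using W(2)[OF i] by (simp add: comp_def)
    have L: "map (map (graft ?lw)) (ublocks (qs ! i) (rss ! i)) = map (map var) (W ! i)" by (rule graft_ublocks[OF sk[OF i] a4 cW mW])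
    have ui: "length (ublocks (qs ! i) (rss ! i)) = length (rss ! i)" using ublocks(4)[OF sk[OF i]] .
    have lWi: "length (W ! i) = length (rss ! i)" using W(2)[OF i] by (metis length_map)
    have "map (bind (graft ?g)) (map var (ublocks p qs ! i)) = map2 cls (rss ! i) (W ! i)" using bind_graft_var[OF a2' sub] Gi[OF i] by simp
    also have "\<dots> = map (bind (graft ?lw)) (map2 cls (rss ! i) (ublocks (qs ! i) (rss ! i)))"
    proof (rule nth_equalityI)
      fix j assume "j < length (map2 cls (rss ! i) (W ! i))"
      then have j: "j < length (rss ! i)" by simp
      have laj: "labelled (rss ! i ! j, ublocks (qs ! i) (rss ! i) ! j)" using ublocks(3)[OF sk[OF i]] j by (simp add: list_all2_conv_all_nth)
      have "map (graft ?lw) (ublocks (qs ! i) (rss ! i) ! j) = map var (W ! i ! j)" using arg_cong[OF L, of "\<lambda>xs. xs ! j"] j ui lWi by simp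
      then have "bind (graft ?lw) (cls (rss ! i ! j) (ublocks (qs ! i) (rss ! i) ! j)) = appl (rss ! i ! j) (map var (W ! i ! j))"
        by (rule bind_graft_cls[OF laj])
      also have "\<dots> = cls (rss ! i ! j) (W ! i ! j)" using W(3)[OF i] j by (intro appl_vars) (simp add: list_all2_conv_all_nth)
      finally show "map2 cls (rss ! i) (W ! i) ! j = map (bind (graft ?lw)) (map2 cls (rss ! i) (ublocks (qs ! i) (rss ! i))) ! j"
        using j ui lWi by simp
    qed (simp add: lWi ui)
    finally show "map (bind (graft ?g)) (map var (ublocks p qs ! i)) = map (bind (graft ?lw)) (map2 cls (rss ! i) (ublocks (qs ! i) (rss ! i)))" .
    have q: "qs ! i \<in> Ops P" using substitutableD(3)[OF s i] .
    have "comp_lo ?g (lowarr p qs i) = lowctx p (map (bind (graft ?g)) (map2 cls qs (ublocks p qs))) i (qs ! i)"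
      unfolding comp_lo_hole_r[OF a1 a2'] by (rule bind_hole_lowctx[OF q q refl])
    also have "map (bind (graft ?g)) (map2 cls qs (ublocks p qs)) = map2 cls ?ss (map concat W)"
      using bG u(4) l W(1) by (intro nth_equalityI) simp_all
    also have "lowctx p (map2 cls ?ss (map concat W)) i (qs ! i) = lowctx p (map2 cls ?ss (map concat W)) i (Subst P (qs ! i) (rss ! i))"
      using Subst_output[OF sk[OF i]] by (simp add: lowctx_def hole_def)
    also have "\<dots> = comp_lo ?lw (uparr (qs ! i) (rss ! i))" using comp_lo_hole_l[OF a3 a4] ..
    finally show "comp_lo ?g (lowarr p qs i) = comp_lo ?lw (uparr (qs ! i) (rss ! i))" .
  qed
qed

text \<open>Composing the contexts puts the hole at input \<open>j\<close> of the operation at input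
  \<open>i\<close>; \<open>appl_assoc\<close> flattens the two levels, and the hole is then found at
  the position of \<open>rss ! i ! j\<close> in \<open>concat rss\<close>.\<close>

lemma lowarr_lowarr:
  assumes s: "sub p qs" and r: "list_all2 sub qs rss" and i: "i < length qs" and j: "j < length (rss ! i)"
  shows "lowarr (Subst P p qs) (concat rss) (sum_list (map length (take i rss)) + j)
    = cmp (lowarr p (map2 (Subst P) qs rss) i) (lowarr (qs ! i) (rss ! i) j)"
proof -
  obtain W where W: "length W = length qs" "\<And>i. i < length qs \<Longrightarrow> map length (W ! i) = map ar (rss ! i)"
    "\<And>i. i < length qs \<Longrightarrow> labs (rss ! i) (W ! i)"
    "ublocks (Subst P p qs) (concat rss) = concat W"
    "ublocks p (map2 (Subst P) qs rss) = map concat W" "map length W = map length rss" using nested_blocks[OF s r] by blast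
  note n = nested_substitutable[OF s r]
  let ?ss = "map2 (Subst P) qs rss"
  let ?k = "sum_list (map length (take i rss)) + j"
  have l: "length rss = length qs" using r by (simp add: list_all2_lengthD)
  have sk: "sub (qs ! k) (rss ! k)" if "k < length qs" for k using r that by (simp add: list_all2_conv_all_nth)
  have lWk: "length (W ! k) = length (rss ! k)" if "k < length qs" for k using W(2)[OF that] by (metis length_map)
  have iss: "i < length ?ss" "?ss ! i = Subst P (qs ! i) (rss ! i)" using i l by simp_all
  have il: "i < length rss" using i l by simp
  have ck: "concat rss ! ?k = rss ! i ! j" by (rule nth_concat_offset[OF il j])
  have tk: "map length (take i rss) = map length (take i W)" using W(6) by (metis take_map)
  have cW: "concat W ! ?k = W ! i ! j" unfolding tk using i j W(1) lWk[OF i] by (intro nth_concat_offset) simp_all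
  have kl: "?k < length (concat rss)"
  proof -
    have "rss = take i rss @ rss ! i # drop (Suc i) rss" using il by (rule id_take_nth_drop)
    then have "length (concat rss) = sum_list (map length (take i rss)) + (length (rss ! i) + length (concat (drop (Suc i) rss)))"
      by (metis concat.simps(2) concat_append length_append length_concat)
    then show ?thesis using j by simp
  qed
  let ?r = "rss ! i ! j"
  have ro: "?r \<in> Ops P" using substitutableD(3)[OF sk[OF i] j] .
  \<comment> \<open>The inputs of the two-level application, with the hole at \<open>(i, j)\<close>.
    Applied levelwise they give the composite of the two contexts, concatenated they give the
    context of the composite operation.\<close>
  let ?V = "(map2 (\<lambda>rs ws. map shift (map2 cls rs ws)) rss W)[i := (map shift (map2 cls (rss ! i) (W ! i)))[j := hole ?r]]"
  note a1 = lowarr[OF sk[OF i] j]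
  note a2 = lowarr[OF n(2) iss(1), unfolded iss(2) W(5)]
  have a3: "is_arr (lowarr (Subst P p qs) (concat rss) ?k) ?r (lowctx (Subst P p qs) (map2 cls (concat rss) (concat W)) ?k ?r)
     (map var (W ! i ! j)) (Subst P p ?ss)"
    using lowarr[OF n(1) kl] unfolding W(4) ck cW n(3) .
  let ?lw = "lowarr p ?ss i"
  have cWi: "concat (map (map var) (W ! i)) = map var (map concat W ! i)" using i W(1) by (simp add: map_concat)
  have mW: "map length (map (map var) (W ! i)) = map ar (rss ! i)" using W(2)[OF i] by (simp add: comp_def)
  have L: "map (map (graft ?lw)) (ublocks (qs ! i) (rss ! i)) = map (map var) (W ! i)" by (rule graft_ublocks[OF sk[OF i] a2 cWi mW])
  note ui = ublocks[OF sk[OF i]]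
  have Lj: "map (graft ?lw) (ublocks (qs ! i) (rss ! i) ! m) = map var (W ! i ! m)" if "m < length (rss ! i)" for m
    using arg_cong[OF L, of "\<lambda>xs. xs ! m"] that ui(4) lWk[OF i] by simp
  have bL: "map (bind (graft ?lw)) (map2 cls (rss ! i) (ublocks (qs ! i) (rss ! i))) = map2 cls (rss ! i) (W ! i)"
  proof (rule nth_equalityI)
    fix m assume "m < length (map (bind (graft ?lw)) (map2 cls (rss ! i) (ublocks (qs ! i) (rss ! i))))"
    then have m: "m < length (rss ! i)" by simp
    have lam: "labelled (rss ! i ! m, ublocks (qs ! i) (rss ! i) ! m)" using ui(3) m by (simp add: list_all2_conv_all_nth)
    have "appl (rss ! i ! m) (map var (W ! i ! m)) = cls (rss ! i ! m) (W ! i ! m)"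
      using W(3)[OF i] m by (intro appl_vars) (simp add: list_all2_conv_all_nth)
    then show "map (bind (graft ?lw)) (map2 cls (rss ! i) (ublocks (qs ! i) (rss ! i))) ! m = map2 cls (rss ! i) (W ! i) ! m"
      using bind_graft_cls[OF lam Lj[OF m]] m ui(4) lWk[OF i] by simp
  qed (simp add: ui(4) lWk[OF i])
  have "cmp ?lw (lowarr (qs ! i) (rss ! i) j) = lowarr (Subst P p qs) (concat rss) ?k"
  proof (rule compose_eqI[OF a1 a2 a3])
    have sub: "set (ublocks (qs ! i) (rss ! i) ! j) \<subseteq> set (stdl (Subst P (qs ! i) (rss ! i)))"
      using ui(1,4) j by (metis nth_mem set_concat UN_upper)
    show "map (bind (graft ?lw)) (map var (ublocks (qs ! i) (rss ! i) ! j)) = map var (W ! i ! j)" using bind_graft_var[OF a2 sub] Lj[OF j] by simp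
    have shc: "shift (appl (qs ! k) (map2 cls (rss ! k) (W ! k))) = appl (qs ! k) (map shift (map2 cls (rss ! k) (W ! k)))" for k
      by (simp add: shift_def[abs_def] bind_appl)
    let ?D = "lowctx (qs ! i) (map2 cls (rss ! i) (W ! i)) j ?r"
    have inner: "bind (ctxsub (var (out ?r, 0)) (sgraft ?lw)) (lo (lowarr (qs ! i) (rss ! i) j)) = ?D"
      using bind_hole_lowctx[OF ro ro refl, of "graft ?lw" "qs ! i" "map2 cls (rss ! i) (ublocks (qs ! i) (rss ! i))" j] a1
      by (simp only: bL is_arr_def hole_def[of ?r, symmetric])
    have Dt: "is_term ?D \<and> outc ?D = out (Subst P (qs ! i) (rss ! i))"
    proof -
      have f1: "lowarr (qs ! i) (rss ! i) j \<in> arrs" "src (lowarr (qs ! i) (rss ! i) j) = ?r"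
        "tgt (lowarr (qs ! i) (rss ! i) j) = Subst P (qs ! i) (rss ! i)" using a1 by (simp_all add: is_arr_def)
      have g1: "?lw \<in> arrs" "src ?lw = Subst P (qs ! i) (rss ! i)" using a2 by (simp_all add: is_arr_def)
      note hc = hole_lin_comp(1)[OF f1(1) g1(1)]
      have "is_term (comp_lo ?lw (lowarr (qs ! i) (rss ! i) j))" using hc f1 g1 by (simp add: hole_lin_def)
      then have "\<forall>x \<in># clab (lo ?lw). is_term (ctxsub ?D svar x) \<and> outc (ctxsub ?D svar x) = fst x"
        unfolding comp_lo_def f1(2) inner is_term_bind[of _ "lo ?lw"] by blast
      moreover have "(out (src ?lw), 0) \<in># clab (lo ?lw)" using hole_lin_decomp[OF arrow_lo(4)[OF g1(1)]] by (metis union_single_eq_member)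
      ultimately show ?thesis using g1 by fastforce
    qed
    have "comp_lo ?lw (lowarr (qs ! i) (rss ! i) j) = bind (ctxsub ?D svar) (lowctx p (map2 cls ?ss (map concat W)) i (Subst P (qs ! i) (rss ! i)))"
      using a1 a2 inner by (simp add: comp_lo_def is_arr_def)
    also have "\<dots> = appl p ((map shift (map2 cls ?ss (map concat W)))[i := ?D])"
      using Dt Subst_op[OF sk[OF i]] by (subst bind_lowctx) (simp_all add: shift_def[abs_def])
    also have "(map shift (map2 cls ?ss (map concat W)))[i := ?D]
       = map2 appl qs ?V"
    proof (rule nth_equalityI)
      fix k assume "k < length ((map shift (map2 cls ?ss (map concat W)))[i := ?D])"
      then have k: "k < length qs" using l W(1) by simp
      have "shift (cls (?ss ! k) (concat (W ! k))) = appl (qs ! k) (map shift (map2 cls (rss ! k) (W ! k)))"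
        unfolding shc[symmetric] using appl_cls(1)[OF W(3)[OF k] sk[OF k]] k l by simp
      then show "(map shift (map2 cls ?ss (map concat W)))[i := ?D] ! k = map2 appl qs ?V ! k"
        using k l W(1) by (cases "k = i") (simp_all add: lowctx_def)
    qed (simp add: l W(1))
    also have "appl p \<dots> = appl (Subst P p qs) (concat ?V)"
    proof (rule appl_assoc[OF s, symmetric], rule nth_equalityI)
      fix k assume "k < length (map length ?V)"
      then have k: "k < length qs" using l W(1) by simp
      then show "map length ?V ! k = map ar qs ! k"
        using l W(1) lWk[OF k] substitutableD(2)[OF sk[OF k]] by (cases "k = i") simp_all
    qed (simp add: l W(1))
    also have "concat ?V
      = (map shift (map2 cls (concat rss) (concat W)))[?k := hole ?r]"
    proof -
      let ?X = "map2 (\<lambda>rs ws. map shift (map2 cls rs ws)) rss W"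
      have Xi: "?X ! i = map shift (map2 cls (rss ! i) (W ! i))" using i l W(1) by simp
      have "list_all2 (\<lambda>rs ws. length rs = length ws) rss W" using W(1) l lWk by (simp add: list_all2_conv_all_nth)
      then have cX: "concat ?X = map shift (map2 cls (concat rss) (concat W))" by (induction rule: list_all2_induct) auto
      have tX: "map length (take i ?X) = map length (take i rss)" using l W(1) lWk il by (intro nth_equalityI) simp_all
      have "(concat ?X)[sum_list (map length (take i ?X)) + j := hole ?r] = concat (?X[i := (?X ! i)[j := hole ?r]])"
        using i j l W(1) Xi lWk[OF i] by (intro concat_list_update) simp_all
      then show ?thesis unfolding cX tX Xi by simp
    qed
    finally show "comp_lo ?lw (lowarr (qs ! i) (rss ! i) j) = lowctx (Subst P p qs) (map2 cls (concat rss) (concat W)) ?k ?r"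
      by (simp add: lowctx_def)
  qed
  then show ?thesis by simp
qed

lemma permarr_permarr:
  assumes p: "p \<in> Ops P" and xs: "perm_list (ar p) xs" and ys: "perm_list (ar p) ys"
  shows "cmp (permarr (Act P p xs) ys) (permarr p xs) = permarr p (map ((!) ys) xs)"
proof -
  let ?A = "permarr (Act P p xs) ys"
  let ?B = "stdl (Act P p xs)"
  let ?C = "map ((!) (stdl (Act P p (map ((!) ys) xs)))) (map ((!) ys) xs)"
  have a: "Act P p xs \<in> Ops P" "ar (Act P p xs) = ar p" "out (Act P p xs) = out p" using p xs Act_op Act_arity Act_output by blast+
  have ys': "perm_list (ar (Act P p xs)) ys" using ys a by simp
  note a1 = permarr[OF p xs] and a2 = permarr[OF a(1) ys'] and a3 = permarr[OF p perm_list_comp[OF xs ys]]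
  have t: "Act P (Act P p xs) ys = Act P p (map ((!) ys) xs)" by (rule Act_Act[OF p xs ys])
  note a2' = a2[unfolded t]
  show ?thesis
  proof (rule compose_eqI[OF a1 a2' a3])
    show "comp_lo ?A (permarr p xs) = hole p" using comp_lo_hole_l[OF a1 a2] a(3) by (simp add: hole_def)
    have sub: "set (map ((!) ?B) xs) \<subseteq> set ?B"
      using perm_list_mem_less[OF xs] a(2) nth_mem[of _ "stdl (Act P p xs)"] by (auto simp del: nth_stdl)
    have "map (graft ?A) (map ((!) ?B) xs)
      = map ((!) (map (graft ?A) ?B)) xs"
      using perm_list_mem_less[OF xs] a(2) by simp
    also have "\<dots> = map var ?C" unfolding is_arrD(8)[OF a2'] using perm_list_mem_less[OF xs] perm_list_length[OF ys] by simp
    finally show "map (bind (graft ?A)) (map var (map ((!) ?B) xs)) = map var ?C" using bind_graft_var[OF a2 sub] by simp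
  qed
qed

lemma permarr_ident:
  assumes p: "p \<in> Ops P"
  shows "permarr p [0..<ar p] = tw_ident P p"
proof (rule arr_ident_eqI(1)[OF permarr[OF p perm_list_upt] refl])
  show "map var (map ((!) (stdl (Act P p [0..<ar p]))) [0..<ar p]) = map var (stdl p)" unfolding Act_id[OF p] by (metis length_stdl map_nth)
qed

end

abbreviation outer_perm :: "('c, 'o) operad \<Rightarrow> 'o list \<Rightarrow> nat list \<Rightarrow> nat list" where
  "outer_perm P qs xs \<equiv> concat (map (\<lambda>i. [offset P qs i ..< offset P qs (Suc i)]) xs)"

abbreviation inner_perm :: "('c, 'o) operad \<Rightarrow> 'o list \<Rightarrow> nat list list \<Rightarrow> nat list" where
  "inner_perm P qs yss \<equiv> concat (map2 (\<lambda>i ys. map ((+) (offset P qs i)) ys) [0..<length qs] yss)"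

context operad
begin

lemma set_ublocks:
  assumes "sub p qs" "i < length qs" shows "set (ublocks p qs ! i) \<subseteq> set (stdl (Subst P p qs))"
  using ublocks(1,4)[OF assms(1)] assms(2) by (metis nth_mem set_concat UN_upper)

text \<open>Typing, and the effect of the block permutation on the blocks: block \<open>k\<close> of
  the permuted list is block \<open>xs ! k\<close> of the original one. Shared by
  \<open>uparr_outer\<close> and \<open>lowarr_outer\<close>.\<close>

lemma outer:
  assumes p: "p \<in> Ops P" and xs: "perm_list (ar p) xs" and s: "sub (Act P p xs) qs"
  shows "sub p (map ((!) qs) xs)"
    "perm_list (ar (Subst P p (map ((!) qs) xs))) (outer_perm P qs xs)"
    "Subst P (Act P p xs) qs = Act P (Subst P p (map ((!) qs) xs)) (outer_perm P qs xs)"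
    "map (map (graft (permarr (Subst P p (map ((!) qs) xs)) (outer_perm P qs xs)))) (ublocks p (map ((!) qs) xs))
      = map (\<lambda>i. map var (ublocks (Act P p xs) qs ! i)) xs"
proof -
  let ?A = "outer_perm P qs xs"
  note d = substitutableD[OF s]
  have l: "length qs = ar p" using d(2) Act_arity[OF p xs] by simp
  have lx: "length xs = ar p" by (rule perm_list_length[OF xs])
  let ?qs = "map ((!) qs) xs"
  show s': "sub p ?qs"
  proof -
    have "map out ?qs = ins p"
    proof (rule nth_equalityI)
      fix i assume "i < length (map out ?qs)"
      then have i: "i < ar p" using lx by simp
      have "xs ! i < length qs" using perm_list_nth_less[OF xs i] l by simp
      then show "map out ?qs ! i = ins p ! i" using d(4) Act_inputs[OF p xs i] i lx by simp
    qed (simp add: lx)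
    moreover have "set ?qs \<subseteq> Ops P" using d(3) perm_list_mem_less[OF xs] l by auto
    ultimately show ?thesis using p by (simp add: substitutable_def)
  qed
  show B: "perm_list (ar (Subst P p ?qs)) ?A"
  proof -
    have "map ins ?qs = map ((!) (map ins qs)) xs" using l perm_list_mem_less[OF xs] by simp
    then have "ar (Subst P p ?qs) = length (concat (map ins qs))"
      using length_concat_perm[OF xs, of "map ins qs"] l by (simp add: Subst_inputs[OF s'] del: map_map)
    then show ?thesis using perm_list_outer[of qs xs P] xs l by simp
  qed
  show t: "Subst P (Act P p xs) qs = Act P (Subst P p ?qs) ?A" by (rule Subst_Act_outer[OF p xs s])
  note u = ublocks[OF s]
  have blk: "map ((!) (stdl (Subst P (Act P p xs) qs))) [offset P qs i ..< offset P qs (Suc i)] = ublocks (Act P p xs) qs ! i"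
    if "i < length qs" for i unfolding u(1)[symmetric] by (rule map_block_concat[OF u(2) that])
  show "map (map (graft (permarr (Subst P p ?qs) ?A))) (ublocks p ?qs)
      = map (\<lambda>i. map var (ublocks (Act P p xs) qs ! i)) xs"
  proof (rule graft_ublocks[OF s' permarr[OF Subst_op[OF s'] B]])
    have "map ((!) (stdl (Subst P (Act P p xs) qs))) ?A = concat (map (\<lambda>i. ublocks (Act P p xs) qs ! i) xs)"
      unfolding map_concat using blk perm_list_mem_less[OF xs] l by (auto intro!: arg_cong[of _ _ concat])
    then show "concat (map (\<lambda>i. map var (ublocks (Act P p xs) qs ! i)) xs) = map var (map ((!) (stdl (Act P (Subst P p ?qs) ?A))) ?A)"
      unfolding t[symmetric] by (simp add: map_concat comp_def)
    have "length (ublocks (Act P p xs) qs ! i) = ar (qs ! i)" if "i < length qs" for i using u(2,4) that by (metis nth_map)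
    then show "map length (map (\<lambda>i. map var (ublocks (Act P p xs) qs ! i)) xs) = map ar ?qs" using perm_list_mem_less[OF xs] l by simp
  qed
qed

lemma uparr_outer:
  assumes p: "p \<in> Ops P" and xs: "perm_list (ar p) xs" and s: "sub (Act P p xs) qs"
  shows "cmp (permarr (Subst P p (map ((!) qs) xs)) (outer_perm P qs xs)) (uparr p (map ((!) qs) xs))
    = cmp (uparr (Act P p xs) qs) (permarr p xs)"
proof -
  note o = outer[OF assms]
  let ?qs = "map ((!) qs) xs"
  let ?g = "permarr (Subst P p ?qs) (outer_perm P qs xs)"
  have l: "length qs = ar p" using substitutableD(2)[OF s] Act_arity[OF p xs] by simp
  have lx: "length xs = ar p" by (rule perm_list_length[OF xs])
  note a1 = uparr[OF o(1)] and a2 = permarr[OF Subst_op[OF o(1)] o(2), folded o(3)]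
    and a3 = permarr[OF p xs] and a4 = uparr[OF s]
  show ?thesis
  proof (rule compose_eqI2[OF a1 a2 a3 a4])
    show "comp_lo ?g (uparr p ?qs) = comp_lo (uparr (Act P p xs) qs) (permarr p xs)"
      using comp_lo_hole_l[OF a1 a2] comp_lo_hole_l[OF a3 a4] Subst_output[OF o(1)] Act_output[OF p xs] by (simp add: hole_def)
    have sub: "set (map ((!) (stdl (Act P p xs))) xs) \<subseteq> set (stdl (Act P p xs))"
      using perm_list_mem_less[OF xs] Act_arity[OF p xs] nth_mem[of _ "stdl (Act P p xs)"] by (auto simp del: nth_stdl)
    have "map (bind (graft (uparr (Act P p xs) qs))) (map var (map ((!) (stdl (Act P p xs))) xs))
      = map ((!) (map (graft (uparr (Act P p xs) qs)) (stdl (Act P p xs)))) xs"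
      unfolding bind_graft_var[OF a4 sub] using perm_list_mem_less[OF xs] Act_arity[OF p xs] by simp
    also have "\<dots> = map (bind (graft ?g)) (map2 cls ?qs (ublocks p ?qs))" unfolding is_arrD(8)[OF a4]
    proof (rule nth_equalityI)
      fix k assume "k < length (map ((!) (map2 cls qs (ublocks (Act P p xs) qs))) xs)"
      then have k: "k < ar p" using lx by simp
      then have xk: "xs ! k < length qs" using perm_list_nth_less[OF xs] l by simp
      have la: "labelled (?qs ! k, ublocks p ?qs ! k)" using ublocks(3)[OF o(1)] k lx by (simp add: list_all2_conv_all_nth)
      have "map (graft ?g) (ublocks p ?qs ! k) = map var (ublocks (Act P p xs) qs ! (xs ! k))"
        using arg_cong[OF o(4), of "\<lambda>xs. xs ! k"] k lx ublocks(4)[OF o(1)] by simp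
      moreover have "labelled (qs ! (xs ! k), ublocks (Act P p xs) qs ! (xs ! k))" using ublocks(3)[OF s] xk by (simp add: list_all2_conv_all_nth)
      ultimately show "map ((!) (map2 cls qs (ublocks (Act P p xs) qs))) xs ! k = map (bind (graft ?g)) (map2 cls ?qs (ublocks p ?qs)) ! k"
        using bind_graft_cls[OF la] k lx xk ublocks(4)[OF s] ublocks(4)[OF o(1)] by (simp add: appl_vars)
    qed (simp add: lx ublocks(4)[OF o(1)])
    finally show "map (bind (graft ?g)) (map2 cls ?qs (ublocks p ?qs)) = map (bind (graft (uparr (Act P p xs) qs))) (map var (map ((!) (stdl (Act P p xs))) xs))" ..
  qed
qed

lemma lowarr_outer:
  assumes p: "p \<in> Ops P" and xs: "perm_list (ar p) xs" and s: "sub (Act P p xs) qs" and k: "k < ar p"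
  shows "cmp (permarr (Subst P p (map ((!) qs) xs)) (outer_perm P qs xs)) (lowarr p (map ((!) qs) xs) k)
    = lowarr (Act P p xs) qs (xs ! k)"
proof -
  note o = outer[OF p xs s]
  let ?qs = "map ((!) qs) xs"
  let ?g = "permarr (Subst P p ?qs) (outer_perm P qs xs)"
  have l: "length qs = ar p" using substitutableD(2)[OF s] Act_arity[OF p xs] by simp
  have lx: "length xs = ar p" by (rule perm_list_length[OF xs])
  have xk: "xs ! j < length qs" if "j < ar p" for j using perm_list_nth_less[OF xs that] l by simp
  have kq: "k < length ?qs" using k lx by simp
  have qk: "?qs ! k = qs ! (xs ! k)" using k lx by simp
  note u = ublocks[OF o(1)] and v = ublocks[OF s]
  note a1 = lowarr[OF o(1) kq, unfolded qk] and a2 = permarr[OF Subst_op[OF o(1)] o(2), folded o(3)]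
    and a3 = lowarr[OF s xk[OF k]]
  have q: "qs ! (xs ! k) \<in> Ops P" using substitutableD(3)[OF s xk[OF k]] .
  have g: "map (graft ?g) (ublocks p ?qs ! j) = map var (ublocks (Act P p xs) qs ! (xs ! j))" if "j < ar p" for j
    using arg_cong[OF o(4), of "\<lambda>xs. xs ! j"] that lx u(4) by simp
  have bg: "map (bind (graft ?g)) (map2 cls ?qs (ublocks p ?qs)) = map ((!) (map2 cls qs (ublocks (Act P p xs) qs))) xs"
  proof (rule nth_equalityI)
    fix j assume "j < length (map (bind (graft ?g)) (map2 cls ?qs (ublocks p ?qs)))"
    then have j: "j < ar p" using lx by simp
    have la: "labelled (?qs ! j, ublocks p ?qs ! j)" using u(3) j lx by (simp add: list_all2_conv_all_nth)
    have "labelled (qs ! (xs ! j), ublocks (Act P p xs) qs ! (xs ! j))" using v(3) xk[OF j] by (simp add: list_all2_conv_all_nth)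
    then show "map (bind (graft ?g)) (map2 cls ?qs (ublocks p ?qs)) ! j = map ((!) (map2 cls qs (ublocks (Act P p xs) qs))) xs ! j"
      using bind_graft_cls[OF la g[OF j]] j lx xk[OF j] u(4) v(4) by (simp add: appl_vars)
  qed (simp add: lx u(4))
  show ?thesis
  proof (rule compose_eqI[OF a1 a2 a3])
    have "comp_lo ?g (lowarr p ?qs k) = lowctx p (map (bind (graft ?g)) (map2 cls ?qs (ublocks p ?qs))) k (qs ! (xs ! k))"
      unfolding comp_lo_hole_r[OF a1 a2[folded hole_def]] by (rule bind_hole_lowctx[OF q q refl])
    also have "\<dots> = lowctx (Act P p xs) (map2 cls qs (ublocks (Act P p xs) qs)) (xs ! k) (qs ! (xs ! k))"
    proof -
      let ?T = "map shift (map2 cls qs (ublocks (Act P p xs) qs))"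
      have "(map shift (map ((!) (map2 cls qs (ublocks (Act P p xs) qs))) xs))[k := hole (qs ! (xs ! k))]
        = map ((!) (?T[xs ! k := hole (qs ! (xs ! k))])) xs"
      proof (rule nth_equalityI)
        fix j assume "j < length ((map shift (map ((!) (map2 cls qs (ublocks (Act P p xs) qs))) xs))[k := hole (qs ! (xs ! k))])"
        then have j: "j < ar p" using lx by simp
        have ne: "xs ! k \<noteq> xs ! j" if "j \<noteq> k" using xs j k lx that by (simp add: perm_list_def nth_eq_iff_index_eq)
        show "(map shift (map ((!) (map2 cls qs (ublocks (Act P p xs) qs))) xs))[k := hole (qs ! (xs ! k))] ! j
          = map ((!) (?T[xs ! k := hole (qs ! (xs ! k))])) xs ! j"
          using j k lx xk[OF j] v(4) ne by (cases "j = k") simp_all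
      qed simp
      moreover have "length (?T[xs ! k := hole (qs ! (xs ! k))]) = ar p" using l v(4) by simp
      ultimately show ?thesis unfolding lowctx_def bg using appl_Act[OF p xs] by metis
    qed
    finally show "comp_lo ?g (lowarr p ?qs k) = lowctx (Act P p xs) (map2 cls qs (ublocks (Act P p xs) qs)) (xs ! k) (qs ! (xs ! k))" .
    show "map (bind (graft ?g)) (map var (ublocks p ?qs ! k)) = map var (ublocks (Act P p xs) qs ! (xs ! k))"
      using bind_graft_var[OF a2 set_ublocks[OF o(1) kq]] g[OF k] by simp
  qed
qed

lemma inner:
  assumes s: "sub p qs" and ys: "list_all2 (\<lambda>q ys. perm_list (ar q) ys) qs yss"
  shows "sub p (map2 (Act P) qs yss)"
    "perm_list (ar (Subst P p qs)) (inner_perm P qs yss)"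
    "Subst P p (map2 (Act P) qs yss) = Act P (Subst P p qs) (inner_perm P qs yss)"
    "map (map (graft (permarr (Subst P p qs) (inner_perm P qs yss)))) (ublocks p qs)
      = map2 (\<lambda>ls ys. map var (map ((!) ls) ys)) (ublocks p (map2 (Act P) qs yss)) yss"
proof -
  let ?A = "inner_perm P qs yss"
  note d = substitutableD[OF s]
  let ?qs = "map2 (Act P) qs yss"
  have l: "length yss = length qs" using ys by (simp add: list_all2_lengthD)
  have yi: "perm_list (ar (qs ! i)) (yss ! i)" if "i < length qs" for i using ys that by (simp add: list_all2_conv_all_nth)
  have A: "?qs ! i \<in> Ops P" "out (?qs ! i) = out (qs ! i)" "ar (?qs ! i) = ar (qs ! i)"
    if "i < length qs" for i using that l d(3)[OF that] yi[OF that] by (simp_all add: Act_op Act_output Act_arity)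
  show s': "sub p ?qs" unfolding substitutable_def
  proof (intro conjI d(1))
    show "set ?qs \<subseteq> Ops P"
    proof
      fix q assume "q \<in> set ?qs"
      then obtain i where "i < length ?qs" "q = ?qs ! i" by (metis in_set_conv_nth)
      then show "q \<in> Ops P" using A(1)[of i] by simp
    qed
    show "map out ?qs = ins p" using A(2) d(2,4) l by (intro nth_equalityI) simp_all
  qed
  show B: "perm_list (ar (Subst P p qs)) ?A" using perm_list_inner[OF ys] by (simp add: Subst_inputs[OF s])
  show t: "Subst P p ?qs = Act P (Subst P p qs) ?A" by (rule Subst_Act_inner[OF s ys])
  note v = ublocks[OF s']
  have ar: "map ar ?qs = map ar qs" using A(3) l by (intro nth_equalityI) simp_all
  have len: "length (ublocks p ?qs ! i) = ar (qs ! i)" if "i < length qs" for i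
  proof -
    have "length (ublocks p ?qs ! i) = map length (ublocks p ?qs) ! i" using v(4) that l by simp
    then show ?thesis unfolding v(2) ar using that by simp
  qed
  show "map (map (graft (permarr (Subst P p qs) ?A))) (ublocks p qs)
      = map2 (\<lambda>ls ys. map var (map ((!) ls) ys)) (ublocks p ?qs) yss"
  proof (rule graft_ublocks[OF s permarr[OF Subst_op[OF s] B]])
    have "map ((!) (stdl (Subst P p ?qs))) (map ((+) (offset P qs i)) (yss ! i)) = map ((!) (ublocks p ?qs ! i)) (yss ! i)" if i: "i < length qs" for i
      using offset_nth_concat[OF v(2)[unfolded ar] i] perm_list_mem_less[OF yi[OF i]] by (simp add: v(1))
    then have "map (map ((!) (stdl (Subst P p ?qs)))) (map2 (\<lambda>i ys. map ((+) (offset P qs i)) ys) [0..<length qs] yss)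
      = map2 (\<lambda>ls ys. map ((!) ls) ys) (ublocks p ?qs) yss"
      using l v(4) by (intro nth_equalityI) simp_all
    then have "map ((!) (stdl (Subst P p ?qs))) ?A = concat (map2 (\<lambda>ls ys. map ((!) ls) ys) (ublocks p ?qs) yss)" by (simp only: map_concat)
    then have "map var (map ((!) (stdl (Subst P p ?qs))) ?A) = concat (map (map var) (map2 (\<lambda>ls ys. map ((!) ls) ys) (ublocks p ?qs) yss))"
      by (simp only: map_concat)
    also have "map (map var) (map2 (\<lambda>ls ys. map ((!) ls) ys) (ublocks p ?qs) yss) = map2 (\<lambda>ls ys. map var (map ((!) ls) ys)) (ublocks p ?qs) yss"
      by (intro nth_equalityI) simp_all
    finally show "concat (map2 (\<lambda>ls ys. map var (map ((!) ls) ys)) (ublocks p ?qs) yss) = map var (map ((!) (stdl (Act P (Subst P p qs) ?A))) ?A)"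
      unfolding t[symmetric] ..
    show "map length (map2 (\<lambda>ls ys. map var (map ((!) ls) ys)) (ublocks p ?qs) yss) = map ar qs"
      using l v(4) perm_list_length[OF yi] by (intro nth_equalityI) simp_all
  qed
qed

lemma uparr_inner:
  assumes s: "sub p qs" and ys: "list_all2 (\<lambda>q ys. perm_list (ar q) ys) qs yss"
  shows "cmp (permarr (Subst P p qs) (inner_perm P qs yss)) (uparr p qs) = uparr p (map2 (Act P) qs yss)"
    "\<And>i. i < length qs \<Longrightarrow> cmp (permarr (Subst P p qs) (inner_perm P qs yss)) (lowarr p qs i)
      = cmp (lowarr p (map2 (Act P) qs yss) i) (permarr (qs ! i) (yss ! i))"
proof -
  let ?B = "map2 cls qs (ublocks p qs)"
  note o = inner[OF s ys]
  let ?qs = "map2 (Act P) qs yss"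
  let ?g = "permarr (Subst P p qs) (inner_perm P qs yss)"
  have l: "length yss = length qs" using ys by (simp add: list_all2_lengthD)
  have yi: "perm_list (ar (qs ! i)) (yss ! i)" if "i < length qs" for i using ys that by (simp add: list_all2_conv_all_nth)
  note d = substitutableD[OF s]
  note u = ublocks[OF s] and v = ublocks[OF o(1)]
  note a1 = uparr[OF s] and a2 = permarr[OF Subst_op[OF s] o(2), folded o(3)] and a3 = uparr[OF o(1)]
  have g: "map (graft ?g) (ublocks p qs ! i) = map var (map ((!) (ublocks p ?qs ! i)) (yss ! i))" if "i < length qs" for i
    using arg_cong[OF o(4), of "\<lambda>xs. xs ! i"] that l u(4) v(4) by simp
  have lv: "labelled (?qs ! i, ublocks p ?qs ! i)" if "i < length qs" for i using v(3) that l by (simp add: list_all2_conv_all_nth)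
  have lenv: "length (ublocks p ?qs ! i) = ar (qs ! i)" if "i < length qs" for i
    using labelled_length[OF lv[OF that]] that l d(3)[OF that] yi[OF that] by (simp add: Act_arity)
  have bg: "map (bind (graft ?g)) ?B = map2 cls ?qs (ublocks p ?qs)"
  proof (rule nth_equalityI)
    fix i assume "i < length (map (bind (graft ?g)) ?B)"
    then have i: "i < length qs" by simp
    have la: "labelled (qs ! i, ublocks p qs ! i)" using u(3) i by (simp add: list_all2_conv_all_nth)
    have "map var (map ((!) (ublocks p ?qs ! i)) (yss ! i)) = map ((!) (map var (ublocks p ?qs ! i))) (yss ! i)"
      using perm_list_mem_less[OF yi[OF i]] lenv[OF i] by simp
    then have "appl (qs ! i) (map var (map ((!) (ublocks p ?qs ! i)) (yss ! i))) = appl (Act P (qs ! i) (yss ! i)) (map var (ublocks p ?qs ! i))"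
      using appl_Act[OF d(3)[OF i] yi[OF i], of "map var (ublocks p ?qs ! i)"] lenv[OF i] by (simp del: map_map)
    also have "\<dots> = cls (?qs ! i) (ublocks p ?qs ! i)" using appl_vars[OF lv[OF i]] i l by simp
    finally show "map (bind (graft ?g)) ?B ! i = map2 cls ?qs (ublocks p ?qs) ! i" using bind_graft_cls[OF la g[OF i]] i l u(4) v(4) by simp
  qed (simp add: l u(4) v(4))
  show "cmp ?g (uparr p qs) = uparr p ?qs"
  proof (rule compose_eqI[OF a1 a2 a3 _ bg])
    show "comp_lo ?g (uparr p qs) = hole p" using comp_lo_hole_l[OF a1 a2] Subst_output[OF s] by (simp add: hole_def)
  qed
  fix i assume i: "i < length qs"
  have i': "i < length ?qs" "?qs ! i = Act P (qs ! i) (yss ! i)" using i l by simp_all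
  note b1 = lowarr[OF s i] and b3 = permarr[OF d(3)[OF i] yi[OF i]] and b4 = lowarr[OF o(1) i'(1), unfolded i'(2)]
  show "cmp ?g (lowarr p qs i) = cmp (lowarr p ?qs i) (permarr (qs ! i) (yss ! i))"
  proof (rule compose_eqI2[OF b1 a2 b3 b4])
    have "comp_lo ?g (lowarr p qs i) = lowctx p (map2 cls ?qs (ublocks p ?qs)) i (qs ! i)"
      unfolding comp_lo_hole_r[OF b1 a2] bind_hole_lowctx[OF d(3)[OF i] d(3)[OF i] refl] bg ..
    also have "\<dots> = lowctx p (map2 cls ?qs (ublocks p ?qs)) i (Act P (qs ! i) (yss ! i))"
      using Act_output[OF d(3)[OF i] yi[OF i]] by (simp add: lowctx_def hole_def)
    also have "\<dots> = comp_lo (lowarr p ?qs i) (permarr (qs ! i) (yss ! i))" using comp_lo_hole_l[OF b3 b4] ..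
    finally show "comp_lo ?g (lowarr p qs i) = comp_lo (lowarr p ?qs i) (permarr (qs ! i) (yss ! i))" .
    let ?A = "Act P (qs ! i) (yss ! i)"
    have aA: "ar ?A = ar (qs ! i)" using Act_arity[OF d(3)[OF i] yi[OF i]] .
    have sub: "set (map ((!) (stdl ?A)) (yss ! i)) \<subseteq> set (stdl ?A)"
      using perm_list_mem_less[OF yi[OF i]] aA nth_mem[of _ "stdl ?A"] by (auto simp del: nth_stdl)
    have "map (bind (graft (lowarr p ?qs i))) (map var (map ((!) (stdl ?A)) (yss ! i)))
      = map ((!) (map (graft (lowarr p ?qs i)) (stdl ?A))) (yss ! i)"
      unfolding bind_graft_var[OF b4 sub] using perm_list_mem_less[OF yi[OF i]] aA by simp
    also have "\<dots> = map var (map ((!) (ublocks p ?qs ! i)) (yss ! i))"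
      unfolding is_arrD(8)[OF b4] using perm_list_mem_less[OF yi[OF i]] lenv[OF i] by simp
    also have "\<dots> = map (bind (graft ?g)) (map var (ublocks p qs ! i))" unfolding bind_graft_var[OF a2 set_ublocks[OF s i]] g[OF i] ..
    finally show "map (bind (graft ?g)) (map var (ublocks p qs ! i)) = map (bind (graft (lowarr p ?qs i))) (map var (map ((!) (stdl ?A)) (yss ! i)))" ..
  qed
qed

text \<open>With these inputs, \<open>Subst\<close> at the lower vertex is the partial composite in
  \<open>tw_target\<close>.\<close>

definition arr_inner :: "'o tw_arr \<Rightarrow> 'o list" where
  "arr_inner f = Subst P (src f) (uppers f) # map (Unit P) (tl (ins (lower f)))"

abbreviation arr_leaves :: "'o tw_arr \<Rightarrow> nat list" where
  "arr_leaves f \<equiv> concat (ul f) @ ll f"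

text \<open>The three steps in the formula of \<open>tw_target\<close>, read as arrows: substitute
  the upper vertices, graft on the first input of the lower vertex, renumber the leaves. Lifts of
  arbitrary arrows are later assembled from lifts of these factors.\<close>

lemma arr_factor:
  assumes f: "f \<in> arrs"
  shows "sub (src f) (uppers f)" "sub (lower f) (arr_inner f)"
    "perm_list (ar (Subst P (lower f) (arr_inner f))) (arr_leaves f)"
    "tgt f = Act P (Subst P (lower f) (arr_inner f)) (arr_leaves f)"
    "f = cmp (permarr (Subst P (lower f) (arr_inner f)) (arr_leaves f))
      (cmp (lowarr (lower f) (arr_inner f) 0) (uparr (src f) (uppers f)))"
proof -
  let ?A = "map2 cls (arr_inner f) (ublocks (lower f) (arr_inner f))"
  let ?B = "map2 cls (uppers f) (ublocks (src f) (uppers f))"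
  let ?C = "uparr (src f) (uppers f)"
  let ?D = "ublocks (lower f) (arr_inner f) ! 0"
  note b = arrow_basic[OF f]
  show s1: "sub (src f) (uppers f)" by (rule b(5))
  let ?s1 = "Subst P (src f) (uppers f)"
  from f have 2: "lower f \<in> Ops P" "ins (lower f) \<noteq> []" "hd (ins (lower f)) = out (src f)"
    "length (ll f) = ar (lower f) - 1" 
    and 4: "map length (ul f) = map ar (uppers f)"
    and pl: "perm_list (length (concat (ul f)) + length (ll f)) (arr_leaves f)" unfolding tw_arrows_def by blast+
  obtain cs where cs: "ins (lower f) = out (src f) # cs" "length cs = length (ll f)" using 2 by (cases "ins (lower f)") auto
  have csC: "set cs \<subseteq> Colours P" using inputs_colours[OF 2(1)] cs by simp
  have ai: "arr_inner f = ?s1 # map (Unit P) cs" by (simp add: arr_inner_def cs)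
  show s0: "sub (lower f) (arr_inner f)" unfolding ai using 2(1) cs csC Subst_op[OF s1] Subst_output[OF s1]
    by (auto simp: substitutable_def Unit_op Unit_output subset_iff intro!: map_idI)
  let ?s0 = "Subst P (lower f) (arr_inner f)"
  have "concat (map ins (map (Unit P) cs)) = cs" using csC by (induction cs) (auto simp: Unit_inputs)
  then have i0: "ins ?s0 = ins ?s1 @ cs" using Subst_inputs[OF s0] by (simp add: ai)
  have l1: "length (concat (ul f)) = ar ?s1" using arg_cong[OF 4, of sum_list] by (simp add: Subst_inputs[OF s1] length_concat comp_def)
  show p0: "perm_list (ar ?s0) (arr_leaves f)" using pl l1 cs by (simp add: i0)
  show t: "tgt f = Act P ?s0 (arr_leaves f)" by (simp add: tw_target_def subst_first_def arr_inner_def)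
  let ?t = "tgt f"
  have inc: "ins ?t ! (arr_leaves f ! k) = ins ?s0 ! k" if "k < ar ?s0" for k using Act_inputs[OF Subst_op[OF s0] p0 that] t by simp
  have lab: "map ((!) (stdl ?t)) (arr_leaves f) = zip (ins ?s0) (arr_leaves f)"
    using inc perm_list_length[OF p0] perm_list_nth_less[OF p0] Act_arity[OF Subst_op[OF s0] p0]
    by (intro nth_equalityI) (simp_all add: t del: map_append)
  then have lab1: "map ((!) (stdl ?t)) (concat (ul f)) = zip (ins ?s1) (concat (ul f))"
    and lab2: "map ((!) (stdl ?t)) (ll f) = zip cs (ll f)" using l1 cs(2) by (simp_all add: i0 append_eq_append_conv)
  note a1 = uparr[OF s1] and a3 = permarr[OF Subst_op[OF s0] p0, folded t]
  have a2: "is_arr (lowarr (lower f) (arr_inner f) 0) ?s1 (lowctx (lower f) ?A 0 ?s1)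
    (map var ?D) ?s0"
    using lowarr[OF s0, of 0] by (simp add: ai)
  let ?g = "permarr ?s0 (arr_leaves f)" and ?l = "lowarr (lower f) (arr_inner f) 0"
  let ?W = "map var (zip (ins ?s1) (concat (ul f))) # map (\<lambda>x. [var x]) (zip cs (ll f))"
  have G: "map (map (graft ?g)) (ublocks (lower f) (arr_inner f)) = ?W"
  proof (rule graft_ublocks[OF s0 a3])
    have "concat (map (\<lambda>x. [var x]) xs) = map var xs" for xs by (induction xs) auto
    then show "concat ?W = map var (map ((!) (stdl ?t)) (arr_leaves f))" unfolding map_append lab1 lab2 by simp
    show "map length ?W = map ar (arr_inner f)" using l1 csC cs(2) by (auto simp: ai Unit_inputs subset_iff intro!: nth_equalityI)
  qed
  note v = ublocks[OF s0]
  have v4: "length (ublocks (lower f) (?s1 # map (Unit P) cs)) = Suc (length cs)" using v(4) unfolding ai by simp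
  have g0: "map (graft ?g) ?D = map var (zip (ins ?s1) (concat (ul f)))" using arg_cong[OF G, of "\<lambda>xs. xs ! 0"] v(4) by (simp add: ai)
  note a23 = is_arr_compose[OF a2 a3]
  have up23: "map (bind (graft ?g)) (map var ?D) = map var (zip (ins ?s1) (concat (ul f)))"
    using trans[OF bind_graft_var[OF a3 set_ublocks[OF s0, of 0]] g0] by (simp add: ai)
  have s1o: "?s1 \<in> Ops P" using Subst_op[OF s1] .
  have bg: "(map shift (map (bind (graft ?g)) ?A))[0 := hole ?s1]
     = map var (lolab f)"
  proof (rule nth_equalityI)
    fix k assume "k < length ((map shift (map (bind (graft ?g)) ?A))[0 := hole ?s1])"
    then have k: "k < Suc (length cs)" using v(4) by (simp add: ai)
    show "(map shift (map (bind (graft ?g)) ?A))[0 := hole ?s1] ! k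
      = map var (lolab f) ! k"
    proof (cases k)
      case 0
      then show ?thesis using Subst_output[OF s1] v(4) by (simp add: cs hole_def ai)
    next
      case (Suc j)
      then have j: "j < length cs" using k by simp
      have c: "cs ! j \<in> Colours P" using csC j by auto
      have la: "labelled (arr_inner f ! k, ublocks (lower f) (arr_inner f) ! k)" using v(3) k by (simp add: list_all2_conv_all_nth ai)
      have "map (graft ?g) (ublocks (lower f) (arr_inner f) ! k) = [var (cs ! j, ll f ! j)]"
        using arg_cong[OF G, of "\<lambda>xs. xs ! k"] v(4) j cs(2) Suc by (simp add: ai)
      then have "bind (graft ?g) (cls (arr_inner f ! k) (ublocks (lower f) (arr_inner f) ! k)) = appl (arr_inner f ! k) [var (cs ! j, ll f ! j)]"
        by (rule bind_graft_cls[OF la])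
      also have "\<dots> = var (cs ! j, ll f ! j)" using Suc j c by (simp add: ai appl_Unit)
      finally show ?thesis using Suc j cs v(4) c k by (simp add: ai shift_var shiftl_def)
    qed
  qed (simp add: ai cs v4)
  have lo23: "comp_lo ?g ?l = lo f"
  proof -
    have "comp_lo ?g ?l = appl (lower f) (map var (lolab f))"
      unfolding comp_lo_hole_r[OF a2 a3] bind_hole_lowctx[OF s1o s1o refl] unfolding lowctx_def bg ..
    then show ?thesis unfolding lo_def using appl_vars[OF b(3)] by simp
  qed
  note a23' = a23[unfolded up23 lo23]
  have "cmp (cmp ?g ?l) ?C = f"
  proof (rule compose_eqI[OF a1 a23' is_arr_refl[OF f]])
    show "comp_lo (cmp ?g ?l) ?C = lo f" by (rule comp_lo_hole_l[OF a1 a23'])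
    let ?h = "cmp ?g ?l"
    have H: "map (map (graft ?h)) (ublocks (src f) (uppers f)) = map (map var) (map2 (\<lambda>q ls. zip (ins q) ls) (uppers f) (ul f))"
    proof (rule graft_ublocks[OF s1 a23'])
      have "map2 (\<lambda>q ls. zip (ins q) ls) (uppers f) (ul f) = map2 zip (map ins (uppers f)) (ul f)" by (intro nth_equalityI) simp_all
      then have "concat (map2 (\<lambda>q ls. zip (ins q) ls) (uppers f) (ul f)) = zip (ins ?s1) (concat (ul f))"
        using 4 by (simp add: concat_map2_zip Subst_inputs[OF s1] comp_def)
      then show "concat (map (map var) (map2 (\<lambda>q ls. zip (ins q) ls) (uppers f) (ul f))) = map var (zip (ins ?s1) (concat (ul f)))"
        by (simp only: map_concat[symmetric])
      show "map length (map (map var) (map2 (\<lambda>q ls. zip (ins q) ls) (uppers f) (ul f))) = map ar (uppers f)"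
        using up_nth[OF f] b(6,7) by (intro nth_equalityI) simp_all
    qed
    show "map (bind (graft ?h)) ?B = up f"
    proof (rule nth_equalityI)
      fix i assume "i < length (map (bind (graft ?h)) ?B)"
      then have i: "i < ar (src f)" using b(6) by simp
      have la: "labelled (uppers f ! i, ublocks (src f) (uppers f) ! i)" using ublocks(3)[OF s1] i b(6) by (simp add: list_all2_conv_all_nth)
      have la': "labelled (uppers f ! i, zip (ins (uppers f ! i)) (ul f ! i))" using b(4,6) i by (simp add: list_all2_conv_all_nth)
      have "map (graft ?h) (ublocks (src f) (uppers f) ! i) = map var (zip (ins (uppers f ! i)) (ul f ! i))"
        using arg_cong[OF H, of "\<lambda>xs. xs ! i"] i b(6,7) ublocks(4)[OF s1] by simp
      from bind_graft_cls[OF la this] show "map (bind (graft ?h)) ?B ! i = up f ! i"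
        using i b(6) ublocks(4)[OF s1] up_nth[OF f i] appl_vars[OF la'] by simp
    qed (simp add: b(2,6) ublocks(4)[OF s1])
  qed
  moreover have "cmp (cmp ?g ?l) ?C = cmp ?g (cmp ?l ?C)"
    using category.compose_assoc[OF tw_category, of "uparr (src f) (uppers f)" ?l ?g] is_arrD(1,2,5)[OF a1] is_arrD(1,2,5)[OF a2] is_arrD(1,2,5)[OF a3]
    by (simp add: Tw_def)
  ultimately show "f = cmp ?g (cmp ?l ?C)" by simp
qed

end

section \<open>Images of elementary arrows under an operad map\<close>

context operad_morphism
begin

lemma tmap_std_label: "t \<in> Ops Q \<Longrightarrow> P.stdl (op_map F t) = map (apfst (col_map F)) (Q.stdl t)"
  by (simp add: Q.stdl_def P.stdl_def F_simps map_apfst_zip)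

lemma ublocks_map:
  assumes s: "Q.sub p qs"
  shows "P.ublocks (op_map F p) (map (op_map F) qs) = map (map (apfst (col_map F))) (Q.ublocks p qs)"
proof -
  have "map (arity P) (map (op_map F) qs) = map (arity Q) qs" using s by (auto simp: substitutable_def F_arity subset_iff)
  moreover have "Subst P (op_map F p) (map (op_map F) qs) = op_map F (Subst Q p qs)" using s by (simp add: F_simps)
  ultimately show ?thesis unfolding Q.ublocks_def P.ublocks_def using tmap_std_label[OF Q.Subst_op[OF s]] by (simp only: split_by_map)
qed

lemma tmap_hole: "q \<in> Ops Q \<Longrightarrow> tmap Q P F (Q.hole q) = P.hole (op_map F q)"
  unfolding Q.hole_def P.hole_def by (subst tmap_var) (simp_all add: Q.output_colour F_simps)

lemma tmap_blocks:
  assumes s: "Q.sub p qs"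
  shows "map (tmap Q P F) (map2 Q.cls qs (Q.ublocks p qs)) = map2 P.cls (map (op_map F) qs) (P.ublocks (op_map F p) (map (op_map F) qs))"
  unfolding ublocks_map[OF s] using Q.ublocks(3,4)[OF s] by (intro nth_equalityI) (simp_all add: tmap_cls list_all2_conv_all_nth)

lemma tw_map_is_arr:
  assumes "Q.is_arr f p C Us t" "P.is_arr g (op_map F p) (tmap Q P F C) (map (tmap Q P F) Us) u"
  shows "tw_map F f = g" using assms tw_map_arrow[of f] by (intro P.arrow_eqI) (auto simp: Q.is_arr_def P.is_arr_def)

lemma tw_map_uparr:
  assumes s: "Q.sub p qs"
  shows "tw_map F (Q.uparr p qs) = P.uparr (op_map F p) (map (op_map F) qs)"
  using tw_map_is_arr[OF Q.uparr[OF s]] P.uparr[OF F_substitutable[OF s]] tmap_blocks[OF s] tmap_hole Q.substitutableD(1)[OF s] by simp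

lemma tmap_lowctx:
  assumes s: "Q.sub p qs" and i: "i < length qs"
  shows "tmap Q P F (Q.lowctx p (map2 Q.cls qs (Q.ublocks p qs)) i (qs ! i))
    = P.lowctx (op_map F p) (map2 P.cls (map (op_map F) qs) (P.ublocks (op_map F p) (map (op_map F) qs))) i (op_map F (qs ! i))"
proof -
  let ?Ts = "map2 Q.cls qs (Q.ublocks p qs)"
  have q: "qs ! i \<in> Ops Q" by (rule Q.substitutableD(3)[OF s i])
  have t: "Q.is_term (Q.lowctx p ?Ts i (qs ! i))" using Q.lowarr[OF s i] Q.arrow_lo(1) by (metis Q.is_arr_def P.is_arr_def)
  then have ok: "Q.ok p ((map Q.shift ?Ts)[i := Q.hole (qs ! i)])" unfolding Q.lowctx_def P.lowctx_def by (simp only: Q.ok_is_term)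
  have T: "\<forall>T \<in> set ?Ts. Q.is_term T" using Q.ok_cls[OF Q.ublocks(3)[OF s] s] unfolding Q.ok_def by blast
  have "map (tmap Q P F) (map Q.shift Ts) = map P.shift (map (tmap Q P F) Ts)" if "\<forall>T \<in> set Ts. Q.is_term T" for Ts
    using that tmap_shift by simp
  from this[OF T] have "map (tmap Q P F) (map Q.shift ?Ts) = map P.shift (map (tmap Q P F) ?Ts)" .
  then show ?thesis unfolding Q.lowctx_def P.lowctx_def tmap_appl[OF ok] map_update tmap_hole[OF q] tmap_blocks[OF s] by simp
qed

lemma tw_map_lowarr:
  assumes s: "Q.sub p qs" and i: "i < length qs"
  shows "tw_map F (Q.lowarr p qs i) = P.lowarr (op_map F p) (map (op_map F) qs) i"
proof (rule tw_map_is_arr[OF Q.lowarr[OF s i]])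
  have i': "i < length (map (op_map F) qs)" "map (op_map F) qs ! i = op_map F (qs ! i)" using i by simp_all
  have sub: "set (Q.ublocks p qs ! i) \<subseteq> set (Q.stdl (Subst Q p qs))" by (rule Q.set_ublocks[OF s i])
  have "map (tmap Q P F) (map Q.var (Q.ublocks p qs ! i)) = map P.var (P.ublocks (op_map F p) (map (op_map F) qs) ! i)"
  proof -
    have "tmap Q P F (Q.var x) = P.var (apfst (col_map F) x)" if "x \<in> set (Q.ublocks p qs ! i)" for x
      using that sub Q.stdl_colour[OF Q.Subst_op[OF s]] by (intro tmap_var) blast
    then show ?thesis unfolding ublocks_map[OF s] using i Q.ublocks(4)[OF s] by simp
  qed
  then show "P.is_arr (P.lowarr (op_map F p) (map (op_map F) qs) i) (op_map F (qs ! i))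
     (tmap Q P F (Q.lowctx p (map2 Q.cls qs (Q.ublocks p qs)) i (qs ! i)))
     (map (tmap Q P F) (map Q.var (Q.ublocks p qs ! i))) (Subst P (op_map F p) (map (op_map F) qs))"
    using P.lowarr[OF F_substitutable[OF s] i'(1), unfolded i'(2)] tmap_lowctx[OF s i] by simp
qed

lemma tw_map_permarr:
  assumes p: "p \<in> Ops Q" and xs: "perm_list (arity Q p) xs"
  shows "tw_map F (Q.permarr p xs) = P.permarr (op_map F p) xs"
proof (rule tw_map_is_arr[OF Q.permarr[OF p xs]])
  have xs': "perm_list (arity P (op_map F p)) xs" using xs p by (simp add: F_arity)
  have A: "Act Q p xs \<in> Ops Q" "arity Q (Act Q p xs) = arity Q p" using p xs by (simp_all add: Q.Act_op Q.Act_arity)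
  have "tmap Q P F (Q.var (Q.stdl (Act Q p xs) ! k)) = P.var (P.stdl (op_map F (Act Q p xs)) ! k)" if "k < arity Q p" for k
  proof -
    have "fst (Q.stdl (Act Q p xs) ! k) \<in> Colours Q" using A that by (intro Q.stdl_colour[OF A(1)] nth_mem) simp
    then show ?thesis using A that by (simp add: tmap_var F_simps)
  qed
  then have e: "map (tmap Q P F) (map Q.var (map ((!) (Q.stdl (Act Q p xs))) xs)) = map P.var (map ((!) (P.stdl (Act P (op_map F p) xs))) xs)"
    using perm_list_mem_less[OF xs] p xs by (simp add: F_simps)
  show "P.is_arr (P.permarr (op_map F p) xs) (op_map F p) (tmap Q P F (Q.hole p))
     (map (tmap Q P F) (map Q.var (map ((!) (Q.stdl (Act Q p xs))) xs))) (Act P (op_map F p) xs)"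
    unfolding e tmap_hole[OF p] by (rule P.permarr[OF F_Op[OF p] xs'])
qed

end

section \<open>Decomposition morphisms\<close>

definition lift :: "('c, 'o) operad \<Rightarrow> ('d, 'p) operad \<Rightarrow> ('c, 'o, 'd, 'p) operad_map \<Rightarrow> 'p tw_arr \<Rightarrow> 'o \<Rightarrow> 'o tw_arr" where
  "lift Q P F a q = (THE g. g \<in> tw_arrows Q \<and> tw_target Q g = q \<and> tw_map F g = a)"

definition fibre_presheaf :: "('c, 'o) operad \<Rightarrow> ('d, 'p) operad \<Rightarrow> ('c, 'o, 'd, 'p) operad_map \<Rightarrow> ('p, 'p tw_arr, 'o) presheaf" where
  "fibre_presheaf Q P F = \<lparr>Sect = (\<lambda>p. {q \<in> Ops Q. op_map F q = p}), Restr = (\<lambda>a q. src (lift Q P F a q))\<rparr>"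

locale decomposition = operad_morphism +
  assumes fib: "discrete_fibration (Tw Q) (Tw P) (op_map F) (tw_map F)"
begin

abbreviation "lft \<equiv> lift Q P F"
abbreviation "Fib \<equiv> fibre_presheaf Q P F"

lemma lift_ex1: "q \<in> Ops Q \<Longrightarrow> a \<in> P.arrs \<Longrightarrow> P.tgt a = op_map F q \<Longrightarrow>
    \<exists>!g. g \<in> Q.arrs \<and> Q.tgt g = q \<and> tw_map F g = a"
  using fib by (auto simp: discrete_fibration_def Tw_def)

lemma lift:
  assumes "q \<in> Ops Q" "a \<in> P.arrs" "P.tgt a = op_map F q"
  shows "lft a q \<in> Q.arrs" "Q.tgt (lft a q) = q" "tw_map F (lft a q) = a" using theI'[OF lift_ex1[OF assms]] by (simp_all add: lift_def)

lemma lift_unique: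
  assumes g: "g \<in> Q.arrs" and g': "g' \<in> Q.arrs" "tw_map F g = tw_map F g'" "Q.tgt g = Q.tgt g'"
  shows "g = g'"
proof -
  have "P.tgt (tw_map F g) = op_map F (Q.tgt g)" "tw_map F g \<in> P.arrs" using tw_map_arrow[OF g] by simp_all
  from lift_ex1[OF Q.arrow_target(1)[OF g] this(2,1)] show ?thesis using assms by metis
qed

lemma lift_eq: "g \<in> Q.arrs \<Longrightarrow> lft (tw_map F g) (Q.tgt g) = g"
  using lift[of "Q.tgt g" "tw_map F g"] tw_map_arrow[of g] Q.arrow_target(1)[of g] lift_unique by metis

lemma lift_ident: "q \<in> Ops Q \<Longrightarrow> lft (tw_ident P (op_map F q)) q = tw_ident Q q"
  using lift_eq[of "tw_ident Q q"] Q.is_arr_ident[of q] by (simp add: tw_map_ident Q.is_arr_def P.is_arr_def)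

lemma lift_source:
  assumes "q \<in> Ops Q" "a \<in> P.arrs" "P.tgt a = op_map F q"
  shows "src (lft a q) \<in> Ops Q" "op_map F (src (lft a q)) = src a" using lift[OF assms] Q.arrow_basic(1) tw_map_arrow(2) by metis+

lemma lift_compose:
  assumes q: "q \<in> Ops Q" and a: "a \<in> P.arrs" and b: "b \<in> P.arrs" and ab: "src b = P.tgt a"
    and bq: "P.tgt b = op_map F q"
  shows "lft (P.cmp b a) q = Q.cmp (lft b q) (lft a (src (lft b q)))"
proof -
  note lb = lift[OF q b bq] and sb = lift_source[OF q b bq]
  have at: "P.tgt a = op_map F (src (lft b q))" using sb ab by simp
  note la = lift[OF sb(1) a at]
  let ?g = "Q.cmp (lft b q) (lft a (src (lft b q)))"
  note c = Q.tw_compose_props[OF la(1) lb(1) la(2)[symmetric]]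
  have "tw_map F ?g = P.cmp b a" using tw_map_compose[OF la(1) lb(1) la(2)[symmetric]] la lb by simp
  then show ?thesis using lift_eq[OF c(1)] c(5) lb(2) by simp
qed

lemma fibre_simps [simp]:
  "Sect Fib p = {q \<in> Ops Q. op_map F q = p}"
  "Restr Fib a q = src (lft a q)" by (simp_all add: fibre_presheaf_def)

lemma fibre_restr: "g \<in> Q.arrs \<Longrightarrow> tw_map F g = a \<Longrightarrow> Q.tgt g = q \<Longrightarrow> Restr Fib a q = src g"
  using lift_eq by auto

lemma fibre_presheaf_on: "presheaf_on (Tw P) Fib" unfolding presheaf_on_def
proof (intro conjI ballI impI)
  fix f assume "f \<in> Arr (Tw P)"
  then have f: "f \<in> P.arrs" by (simp add: Tw_def)
  show "Restr Fib f \<in> Sect Fib (Cod (Tw P) f) \<rightarrow> Sect Fib (Dom (Tw P) f)" using lift_source f by (auto simp: Tw_def)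
  fix g x assume "g \<in> Arr (Tw P)" "Dom (Tw P) g = Cod (Tw P) f" "x \<in> Sect Fib (Cod (Tw P) g)"
  then have g: "g \<in> P.arrs" "src g = P.tgt f" "x \<in> Ops Q" "P.tgt g = op_map F x" by (simp_all add: Tw_def)
  note lg = lift[OF g(3,1,4)] and sg = lift_source[OF g(3,1,4)]
  have ft: "P.tgt f = op_map F (src (lft g x))" using sg g by simp
  note lf = lift[OF sg(1) f ft]
  show "Restr Fib (Compose (Tw P) g f) x = Restr Fib f (Restr Fib g x)"
    using lift_compose[OF g(3) f g(1,2,4)] Q.tw_compose_props(2)[OF lf(1) lg(1) lf(2)[symmetric]] by (simp add: Tw_def)
next
  fix a x assume "a \<in> Obj (Tw P)" "x \<in> Sect Fib a"
  then show "Restr Fib (Ident (Tw P) a) x = x" using lift_ident[of x] by (auto simp: Tw_def tw_ident_def)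
qed

text \<open>Counting inputs, \<open>q\<close> has one input colour \<open>d\<close>, so
  \<open>q\<close> is its own composite with \<open>Unit Q d\<close>. The elementary arrow from
  \<open>Unit Q d\<close> to this composite lies over an identity, hence is an identity by
  uniqueness of lifts, and its source \<open>Unit Q d\<close> equals \<open>q\<close>.\<close>

lemma unit_over:
  assumes q: "q \<in> Ops Q" and c: "c \<in> Colours P" "op_map F q = Unit P c"
  shows "q \<in> Unit Q ` Colours Q"
proof -
  have "map (col_map F) (Q.ins q) = [c]" using F_simps(1)[OF q] c P.Unit_inputs by simp
  then obtain d where d: "Q.ins q = [d]" "col_map F d = c" by auto
  have dC: "d \<in> Colours Q" using Q.inputs_colours[OF q] d by simp
  have s: "Q.sub q [Unit Q d]" using q d dC by (simp add: substitutable_def Q.Unit_op Q.Unit_output)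
  have 1: "Q.is_arr (Q.lowarr q [Unit Q d] 0) (Unit Q d) (Q.lowctx q (map2 Q.cls [Unit Q d] (Q.ublocks q [Unit Q d])) 0 (Unit Q d))
     (map Q.var (Q.ublocks q [Unit Q d] ! 0)) q"
    using Q.lowarr[OF s, of 0] Q.Subst_Unit[OF q] d by simp
  have "tw_map F (Q.lowarr q [Unit Q d] 0) = P.lowarr (Unit P c) [Unit P c] 0" using tw_map_lowarr[OF s, of 0] d dC c by (simp add: F_simps)
  also have "\<dots> = tw_ident P (Unit P c)" using P.lowarr_Unit[of "Unit P c"] c P.Unit_op P.Unit_output by simp
  also have "\<dots> = tw_map F (tw_ident Q q)" using tw_map_ident[OF q] c by simp
  finally have "Q.lowarr q [Unit Q d] 0 = tw_ident Q q" using 1 Q.is_arr_ident[OF q] by (intro lift_unique) (simp_all add: Q.is_arr_def P.is_arr_def)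
  then have "src (Q.lowarr q [Unit Q d] 0) = src (tw_ident Q q)" by simp
  then show ?thesis using 1 dC by (simp add: Q.is_arr_def P.is_arr_def tw_ident_def)
qed

text \<open>The inverse arrow is lifted at the source of the first lift. Lifts respect composites
  and identities, so both composites are identities, the first of which also shows that the second
  lift starts at \<open>q\<close>.\<close>

lemma lift_iso:
  assumes q: "q \<in> Ops Q" and a: "iso (Tw P) a" and aq: "P.tgt a = op_map F q"
  shows "iso (Tw Q) (lft a q)"
proof -
  obtain b where a': "a \<in> P.arrs" and b: "b \<in> P.arrs" "src b = P.tgt a" "P.tgt b = src a"
    and ba: "P.cmp b a = tw_ident P (src a)" and ab: "P.cmp a b = tw_ident P (P.tgt a)" using a by (auto simp: iso_def Tw_def)
  let ?g = "lft a q"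
  note lg = lift[OF q a' aq] and sg = lift_source[OF q a' aq]
  have bt: "P.tgt b = op_map F (src ?g)" using sg b by simp
  let ?h = "lft b (src ?g)"
  note lh = lift[OF sg(1) b(1) bt] and sh = lift_source[OF sg(1) b(1) bt]
  have gh: "Q.cmp ?g ?h = tw_ident Q q" using lift_compose[OF q b(1) a' b(3)[symmetric] aq] ab lift_ident[OF q] aq by simp
  have "src (Q.cmp ?g ?h) = src ?h" using Q.tw_compose_props(2)[OF lh(1) lg(1)] lh(2) by simp
  then have hq: "src ?h = q" using gh by (simp add: tw_ident_def)
  have "lft (P.cmp b a) (src ?g) = Q.cmp ?h (lft a (src ?h))" using lift_compose[OF sg(1) a' b(1,2) bt] .
  then have hg: "Q.cmp ?h ?g = tw_ident Q (src ?g)" using ba hq lift_ident[OF sg(1)] sg(2) by simp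
  show ?thesis unfolding iso_def using lg lh gh hg hq by (auto simp: Tw_def intro!: bexI[of _ ?h])
qed

text \<open>To be upper is to have a unit as lower vertex, and by \<open>unit_over\<close> only
  units lie over units; the same applies to the upper vertices of lower arrows.\<close>

lemma lift_upper:
  assumes q: "q \<in> Ops Q" and a: "a \<in> upper_arrows P" and aq: "P.tgt a = op_map F q"
  shows "lft a q \<in> upper_arrows Q"
proof -
  have a': "a \<in> P.arrs" and u: "lower a \<in> Unit P ` Colours P" using a by (simp_all add: upper_arrows_def)
  note l = lift[OF q a' aq]
  have "op_map F (lower (lft a q)) = lower a" using arg_cong[OF l(3), of lower] by (simp add: tw_map_def)
  moreover have "lower (lft a q) \<in> Ops Q" using l(1) by (simp add: tw_arrows_def)
  ultimately have "lower (lft a q) \<in> Unit Q ` Colours Q" using u unit_over by (metis imageE)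
  then show ?thesis using l(1) by (simp add: upper_arrows_def)
qed

lemma lift_lower:
  assumes q: "q \<in> Ops Q" and a: "a \<in> lower_arrows P" and aq: "P.tgt a = op_map F q"
  shows "lft a q \<in> lower_arrows Q"
proof -
  have a': "a \<in> P.arrs" and u: "set (uppers a) \<subseteq> Unit P ` Colours P" "sorted_wrt (<) (map hd (ul a))"
    using a by (simp_all add: lower_arrows_def)
  note l = lift[OF q a' aq]
  let ?g = "lft a q"
  have m: "map (op_map F) (uppers ?g) = uppers a" "ul ?g = ul a"
    using arg_cong[OF l(3), of uppers] arg_cong[OF l(3), of upper_leaves] by (simp_all add: tw_map_def)
  have "r \<in> Unit Q ` Colours Q" if r: "r \<in> set (uppers ?g)" for r
  proof -
    have "op_map F r \<in> set (uppers a)" using r m(1) by (metis image_eqI set_map)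
    moreover have "r \<in> Ops Q" using r l(1) by (auto simp: tw_arrows_def)
    ultimately show ?thesis using u(1) unit_over by (metis imageE subsetD)
  qed
  then show ?thesis using l(1) u(2) m(2) by (auto simp: lower_arrows_def)
qed

text \<open>By induction on composites: the later factor is lifted at \<open>q\<close>, the earlier
  one at the source of that lift, and \<open>lift_compose\<close> joins them.\<close>

lemma lift_composites:
  assumes S: "\<And>a q. q \<in> Ops Q \<Longrightarrow> a \<in> S \<Longrightarrow> P.tgt a = op_map F q \<Longrightarrow> lft a q \<in> T"
    and SA: "S \<subseteq> P.arrs"
    and a: "a \<in> composites (Tw P) S"
  shows "a \<in> P.arrs" "\<And>q. q \<in> Ops Q \<Longrightarrow> P.tgt a = op_map F q \<Longrightarrow> lft a q \<in> composites (Tw Q) T"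
proof -
  have "a \<in> P.arrs \<and> (\<forall>q. q \<in> Ops Q \<longrightarrow> P.tgt a = op_map F q \<longrightarrow> lft a q \<in> composites (Tw Q) T)"
    using a
  proof (induction rule: composites.induct)
    case (base f)
    then show ?case using S SA by (auto intro: composites.base)
  next
    case (step f g)
    then have f: "f \<in> P.arrs" and g: "g \<in> P.arrs" and fg: "src g = P.tgt f" by (simp_all add: Tw_def)
    note c = P.tw_compose_props[OF f g fg]
    show ?case
    proof (intro conjI allI impI)
      show "Compose (Tw P) g f \<in> P.arrs" using c by (simp add: Tw_def)
      fix q assume q: "q \<in> Ops Q" "P.tgt (Compose (Tw P) g f) = op_map F q"
      then have gq: "P.tgt g = op_map F q" using c(5) by (simp add: Tw_def)
      note lg = lift[OF q(1) g gq] and sg = lift_source[OF q(1) g gq]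
      have ft: "P.tgt f = op_map F (src (lft g q))" using sg fg by simp
      note lf = lift[OF sg(1) f ft]
      have "Compose (Tw Q) (lft g q) (lft f (src (lft g q))) \<in> composites (Tw Q) T"
        using step.IH q(1) gq sg(1) ft lf lg by (intro composites.step) (simp_all add: Tw_def)
      then show "lft (Compose (Tw P) g f) q \<in> composites (Tw Q) T" using lift_compose[OF q(1) f g fg gq] by (simp add: Tw_def)
    qed
  qed
  then show "a \<in> P.arrs" "\<And>q. q \<in> Ops Q \<Longrightarrow> P.tgt a = op_map F q \<Longrightarrow> lft a q \<in> composites (Tw Q) T" by blast+
qed

lemma lift_active:
  assumes a: "a \<in> active_arrows P"
  shows "a \<in> P.arrs" "q \<in> Ops Q \<Longrightarrow> P.tgt a = op_map F q \<Longrightarrow> lft a q \<in> active_arrows Q"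
proof -
  let ?S = "upper_arrows P \<union> {f. iso (Tw P) f}" and ?T = "upper_arrows Q \<union> {f. iso (Tw Q) f}"
  have 1: "lft a q \<in> ?T" if "q \<in> Ops Q" "a \<in> ?S" "P.tgt a = op_map F q" for a q
    using lift_upper[OF that(1) _ that(3)] lift_iso[OF that(1) _ that(3)] that(2) by blast
  have 2: "?S \<subseteq> P.arrs" by (auto simp: upper_arrows_def iso_def Tw_def)
  note a' = a[unfolded active_arrows_def]
  show "a \<in> P.arrs" using lift_composites(1)[OF _ 2 a', of ?T] 1 by blast
  show "lft a q \<in> active_arrows Q" if "q \<in> Ops Q" "P.tgt a = op_map F q"
    unfolding active_arrows_def using lift_composites(2)[OF _ 2 a' that, of ?T] 1 by blast
qed

lemma lift_inert:
  assumes a: "a \<in> inert_arrows P"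
  shows "a \<in> P.arrs" "q \<in> Ops Q \<Longrightarrow> P.tgt a = op_map F q \<Longrightarrow> lft a q \<in> inert_arrows Q"
proof -
  let ?S = "lower_arrows P \<union> {f. iso (Tw P) f}" and ?T = "lower_arrows Q \<union> {f. iso (Tw Q) f}"
  have 1: "lft a q \<in> ?T" if "q \<in> Ops Q" "a \<in> ?S" "P.tgt a = op_map F q" for a q
    using lift_lower[OF that(1) _ that(3)] lift_iso[OF that(1) _ that(3)] that(2) by blast
  have 2: "?S \<subseteq> P.arrs" by (auto simp: lower_arrows_def iso_def Tw_def)
  note a' = a[unfolded inert_arrows_def]
  show "a \<in> P.arrs" using lift_composites(1)[OF _ 2 a', of ?T] 1 by blast
  show "lft a q \<in> inert_arrows Q" if "q \<in> Ops Q" "P.tgt a = op_map F q"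
    unfolding inert_arrows_def using lift_composites(2)[OF _ 2 a' that, of ?T] 1 by blast
qed

theorem fibre_decomposition_space: "decomposition_space P Fib" unfolding decomposition_space_def
proof (intro conjI ballI allI impI fibre_presheaf_on)
  fix f g h k assume fa: "f \<in> active_arrows P" and gi: "g \<in> inert_arrows P" and po: "pushout_square (Tw P) f g h k"
  let ?T = "{(x, y). x \<in> Sect Fib (Cod (Tw P) f) \<and> y \<in> Sect Fib (Cod (Tw P) g) \<and> Restr Fib f x = Restr Fib g y}"
  have f: "f \<in> P.arrs" and g: "g \<in> P.arrs" and h: "h \<in> P.arrs" and k: "k \<in> P.arrs"
    and fg: "src f = src g" and fh: "src h = P.tgt f" and gk: "src k = P.tgt g"
    and hk: "P.tgt h = P.tgt k" and comm: "P.cmp h f = P.cmp k g" using po by (auto simp: pushout_square_def commuting_square_def Tw_def)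
  have univ: "\<exists>!u. u \<in> P.arrs \<and> src u = P.tgt h \<and> P.tgt u = P.tgt h' \<and> P.cmp u h = h' \<and> P.cmp u k = k'"
    if "h' \<in> P.arrs" "k' \<in> P.arrs" "src h' = P.tgt f" "src k' = P.tgt g"
      "P.tgt h' = P.tgt k'" "P.cmp h' f = P.cmp k' g" for h' k'
  proof -
    have "commuting_square (Tw P) f g h' k'" using that f g fg by (simp add: commuting_square_def Tw_def)
    then have "\<exists>!u. u \<in> Arr (Tw P) \<and> Dom (Tw P) u = Cod (Tw P) h \<and> Cod (Tw P) u = Cod (Tw P) h' \<and>
        Compose (Tw P) u h = h' \<and> Compose (Tw P) u k = k'" using po unfolding pushout_square_def by blast
    then show ?thesis by (simp add: Tw_def)
  qed
  let ?r = "\<lambda>a q. src (lft a q)"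
  have rc: "?r (P.cmp b a) q = ?r a (?r b q)" if "q \<in> Ops Q" "a \<in> P.arrs" "b \<in> P.arrs" "src b = P.tgt a" "P.tgt b = op_map F q" for a b q
    using fibre_presheaf_on that unfolding presheaf_on_def by (simp add: Tw_def)
  have ex1: "\<exists>!z. z \<in> Ops Q \<and> op_map F z = P.tgt h \<and> ?r h z = x \<and> ?r k z = y"
    if x: "x \<in> Ops Q" "op_map F x = P.tgt f" and y: "y \<in> Ops Q" "op_map F y = P.tgt g" and xy: "?r f x = ?r g y" for x y
  proof -
    let ?f = "lft f x" and ?g = "lft g y"
    note lf = lift[OF x(1) f x(2)[symmetric]] and lg = lift[OF y(1) g y(2)[symmetric]]
    have "Q.active_like ?f" "Q.inert_like ?g" using lift_active(2)[OF fa x(1) x(2)[symmetric]] lift_inert(2)[OF gi y(1) y(2)[symmetric]]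
        Q.active_arrows_like Q.inert_arrows_like by simp_all
    \<comment> \<open>This pushout in \<open>Tw Q\<close> is not known to lie over the given square;
      the comparison arrow \<open>u\<close> from the given pushout makes up for it.\<close>
    then obtain h' k' where poQ: "pushout_square (Tw Q) ?f ?g h' k'" using Q.pushout_exists xy by metis
    then have h': "h' \<in> Q.arrs" and k': "k' \<in> Q.arrs" and fh': "src h' = x" and gk': "src k' = y"
      and hk': "Q.tgt h' = Q.tgt k'" and comm': "Q.cmp h' ?f = Q.cmp k' ?g" using lf lg by (auto simp: pushout_square_def commuting_square_def Tw_def)
    have univQ: "\<exists>u. u \<in> Q.arrs \<and> src u = Q.tgt h' \<and> Q.tgt u = Q.tgt h'' \<and> Q.cmp u h' = h'' \<and> Q.cmp u k' = k''"
      if "h'' \<in> Q.arrs" "k'' \<in> Q.arrs" "src h'' = x" "src k'' = y"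
        "Q.tgt h'' = Q.tgt k''" "Q.cmp h'' ?f = Q.cmp k'' ?g" for h'' k''
    proof -
      have "commuting_square (Tw Q) ?f ?g h'' k''" using that lf lg xy by (simp add: commuting_square_def Tw_def)
      then have "\<exists>!u. u \<in> Arr (Tw Q) \<and> Dom (Tw Q) u = Cod (Tw Q) h' \<and> Cod (Tw Q) u = Cod (Tw Q) h'' \<and>
        Compose (Tw Q) u h' = h'' \<and> Compose (Tw Q) u k' = k''" using poQ unfolding pushout_square_def by blast
      then show ?thesis by (auto simp: Tw_def)
    qed
    note mh = tw_map_arrow[OF h'] and mk = tw_map_arrow[OF k']
    let ?d = "Q.tgt h'"
    have d: "?d \<in> Ops Q" using Q.arrow_target(1)[OF h'] .
    have "P.cmp (tw_map F h') f = tw_map F (Q.cmp h' ?f)" using tw_map_compose[OF lf(1) h'] lf fh' by simp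
    also have "\<dots> = P.cmp (tw_map F k') g" using tw_map_compose[OF lg(1) k'] lg gk' comm' by simp
    finally have cF: "P.cmp (tw_map F h') f = P.cmp (tw_map F k') g" .
    have "\<exists>!u. u \<in> P.arrs \<and> src u = P.tgt h \<and> P.tgt u = P.tgt (tw_map F h') \<and>
        P.cmp u h = tw_map F h' \<and> P.cmp u k = tw_map F k'"
      using mh mk fh' gk' x y hk' cF by (intro univ) simp_all
    then obtain u where u: "u \<in> P.arrs" "src u = P.tgt h" "P.tgt u = op_map F ?d"
        "P.cmp u h = tw_map F h'" "P.cmp u k = tw_map F k'" using mh by auto
    \<comment> \<open>Restriction along \<open>u\<close> moves the pushout object of
      \<open>Tw Q\<close> over the target of \<open>h\<close>.\<close>
    let ?z = "?r u ?d"
    have z: "?z \<in> Ops Q" "op_map F ?z = P.tgt h" using lift_source[OF d u(1,3)] u(2) by simp_all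
    have zh: "?r h ?z = x" using rc[OF d h u(1,2,3)] u(4) fibre_restr[OF h' refl refl] fh' by simp
    have zk: "?r k ?z = y" using rc[OF d k u(1) _ u(3)] u(2,5) hk fibre_restr[OF k' refl refl] gk' hk' by simp
    have uniq: "w = ?z" if w: "w \<in> Ops Q" "op_map F w = P.tgt h" "?r h w = x" "?r k w = y" for w
    proof -
      let ?h = "lft h w" and ?k = "lft k w"
      have kw: "P.tgt k = op_map F w" using w hk by simp
      note lh = lift[OF w(1) h w(2)[symmetric]] and lk = lift[OF w(1) k kw]
      have "Q.cmp ?h ?f = Q.cmp ?k ?g" using lift_compose[OF w(1) f h fh w(2)[symmetric]] lift_compose[OF w(1) g k gk kw] w comm by simp
      \<comment> \<open>Another solution \<open>w\<close> gives a commuting square in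
        \<open>Tw Q\<close> and hence \<open>v\<close>. The image of \<open>v\<close> composed with
        \<open>u\<close> is an endomorphism of the given pushout compatible with \<open>h\<close>
        and \<open>k\<close>, hence the identity, so restricting \<open>w\<close> along it gives
        \<open>w\<close> itself.\<close>
      then obtain v where v: "v \<in> Q.arrs" "src v = ?d" "Q.tgt v = w" "Q.cmp v h' = ?h" "Q.cmp v k' = ?k" using univQ[of ?h ?k] lh lk w by auto
      note mv = tw_map_arrow[OF v(1)]
      have uv: "src (tw_map F v) = P.tgt u" using mv v u by simp
      let ?e = "P.cmp (tw_map F v) u"
      note e = P.tw_compose_props[OF u(1) mv(1) uv]
      have assoc: "P.cmp ?e a = P.cmp (tw_map F v) (P.cmp u a)" if "a \<in> P.arrs" "P.tgt a = P.tgt h" for a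
        using category.compose_assoc[OF P.tw_category, of a u "tw_map F v"] that u mv uv by (simp add: Tw_def)
      have "P.cmp ?e h = h" using assoc[OF h refl] u(4) tw_map_compose[OF h' v(1)] v(2,4) lh(3) by simp
      moreover have "P.cmp ?e k = k" using assoc[OF k hk[symmetric]] u(5) tw_map_compose[OF k' v(1)] v(2,5) lk(3) hk' by simp
      moreover have "\<exists>!u. u \<in> P.arrs \<and> src u = P.tgt h \<and> P.tgt u = P.tgt h \<and> P.cmp u h = h \<and> P.cmp u k = k"
        by (rule univ[OF h k fh gk hk comm])
      moreover have ht: "P.tgt h \<in> Ops P" using P.arrow_target(1)[OF h] .
      moreover note P.is_arr_ident[OF ht]
      moreover have "P.cmp (tw_ident P (P.tgt h)) a = a" if "a \<in> P.arrs" "P.tgt a = P.tgt h" for a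
        using category.compose_ident_left[OF P.tw_category, of a] that by (simp add: Tw_def)
      ultimately have "?e = tw_ident P (P.tgt h)" using h k hk e u mv v w(2) unfolding Q.is_arr_def P.is_arr_def by metis
      then have "w = ?r ?e w" using lift_ident[OF w(1)] w(2) by (simp add: tw_ident_def)
      also have "\<dots> = ?r u (?r (tw_map F v) w)" using rc[OF w(1) u(1) mv(1) uv] mv v by simp
      also have "?r (tw_map F v) w = ?d" using fibre_restr[OF v(1) refl v(3)] v(2) by simp
      finally show ?thesis .
    qed
    show ?thesis by (rule ex1I[of _ ?z]) (use z zh zk uniq in blast)+
  qed
  have into: "?r h z \<in> Ops Q \<and> op_map F (?r h z) = P.tgt f \<and> ?r k z \<in> Ops Q \<and> op_map F (?r k z) = P.tgt g \<and> ?r f (?r h z) = ?r g (?r k z)"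
    if z: "z \<in> Ops Q" "op_map F z = P.tgt h" for z
  proof -
    have kz: "P.tgt k = op_map F z" using z hk by simp
    show ?thesis using lift_source[OF z(1) h z(2)[symmetric]] lift_source[OF z(1) k kz] fh gk
      rc[OF z(1) f h fh z(2)[symmetric]] rc[OF z(1) g k gk kz] comm by simp
  qed
  show "sends_to_pullback (Tw P) Fib f g h k" unfolding sends_to_pullback_def bij_betw_def
  proof (intro conjI inj_onI set_eqI iffI)
    fix z w assume "z \<in> Sect Fib (Cod (Tw P) h)" "w \<in> Sect Fib (Cod (Tw P) h)" "(Restr Fib h z, Restr Fib k z) = (Restr Fib h w, Restr Fib k w)"
    then have zw: "z \<in> Ops Q" "op_map F z = P.tgt h" "w \<in> Ops Q" "op_map F w = P.tgt h" "?r h z = ?r h w" "?r k z = ?r k w"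
      by (simp_all add: Tw_def)
    then show "z = w" using into[OF zw(1,2)] ex1[of "?r h z" "?r k z"] by metis
  next
    fix xy assume "xy \<in> (\<lambda>z. (Restr Fib h z, Restr Fib k z)) ` Sect Fib (Cod (Tw P) h)"
    then show "xy \<in> ?T"
      using into by (auto simp: Tw_def)
  next
    fix xy assume "xy \<in> ?T"
    then obtain x y where xy: "xy = (x, y)" "x \<in> Ops Q" "op_map F x = P.tgt f" "y \<in> Ops Q" "op_map F y = P.tgt g" "?r f x = ?r g y"
      by (auto simp: Tw_def)
    obtain z where "z \<in> Ops Q" "op_map F z = P.tgt h" "?r h z = x" "?r k z = y" using ex1[OF xy(2-6)] by metis
    then show "xy \<in> (\<lambda>z. (Restr Fib h z, Restr Fib k z)) ` Sect Fib (Cod (Tw P) h)"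
      using xy(1) by (intro image_eqI[of _ _ z]) (simp_all add: Tw_def)
  qed
qed

end

section \<open>The Segal condition\<close>

context operad
begin

definition units :: "'o \<Rightarrow> 'o list" where
  "units p = map (Unit P) (ins p)"

text \<open>The arrow from the unit of the \<open>i\<close>-th input colour that comes from writing
  \<open>p\<close> as its composite with units. Restriction along it will be the \<open>i\<close>-th
  input colour of an element; \<open>outarr\<close>, where \<open>p\<close> is substituted in a
  unit, gives the output colour in the same way.\<close>

definition inarr :: "'o \<Rightarrow> nat \<Rightarrow> 'o tw_arr" where
  "inarr p i = lowarr p (units p) i"

definition outarr :: "'o \<Rightarrow> 'o tw_arr" where
  "outarr p = uparr (Unit P (out p)) [p]"

lemma length_units [simp]: "length (units p) = ar p" by (simp add: units_def)

lemma nth_units [simp]: "i < ar p \<Longrightarrow> units p ! i = Unit P (ins p ! i)" by (simp add: units_def)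

lemma in_colour: "p \<in> Ops P \<Longrightarrow> i < ar p \<Longrightarrow> ins p ! i \<in> Colours P" using inputs_colours nth_mem by blast

lemma units_substitutable: "p \<in> Ops P \<Longrightarrow> sub p (units p)" unfolding units_def by (rule substitutable_Units)

lemma Subst_units: "p \<in> Ops P \<Longrightarrow> Subst P p (units p) = p" unfolding units_def by (rule Subst_Unit)

lemma unit_substitutable: "p \<in> Ops P \<Longrightarrow> sub (Unit P (out p)) [p]"
  by (simp add: substitutable_def Unit_op Unit_inputs output_colour)

lemma units_Unit: "c \<in> Colours P \<Longrightarrow> units (Unit P c) = [Unit P c]" by (simp add: units_def Unit_inputs)

lemma uparr_arrow:
  assumes s: "sub p qs"
  shows "uparr p qs \<in> arrs" "src (uparr p qs) = p" "tgt (uparr p qs) = Subst P p qs" using uparr[OF s] by (simp_all add: is_arr_def)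

lemma lowarr_arrow:
  assumes s: "sub p qs" and i: "i < length qs"
  shows "lowarr p qs i \<in> arrs" "src (lowarr p qs i) = qs ! i" "tgt (lowarr p qs i) = Subst P p qs"
  using lowarr[OF s i] by (simp_all add: is_arr_def)

lemma permarr_arrow:
  assumes "p \<in> Ops P" "perm_list (ar p) xs"
  shows "permarr p xs \<in> arrs" "src (permarr p xs) = p" "tgt (permarr p xs) = Act P p xs" using permarr[OF assms] by (simp_all add: is_arr_def)

lemma inarr_arrow:
  assumes "p \<in> Ops P" "i < ar p"
  shows "inarr p i \<in> arrs" "src (inarr p i) = Unit P (ins p ! i)" "tgt (inarr p i) = p"
  using lowarr_arrow[OF units_substitutable[OF assms(1)], of i] assms by (simp_all add: inarr_def Subst_units)

lemma outarr_arrow: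
  assumes "p \<in> Ops P"
  shows "outarr p \<in> arrs" "src (outarr p) = Unit P (out p)" "tgt (outarr p) = p"
  using uparr_arrow[OF unit_substitutable[OF assms]] assms by (simp_all add: outarr_def Unit_Subst)

lemma inarr_Unit: "c \<in> Colours P \<Longrightarrow> inarr (Unit P c) 0 = tw_ident P (Unit P c)"
  using lowarr_Unit[of "Unit P c"] by (simp add: inarr_def units_Unit Unit_op Unit_output)

lemma outarr_Unit: "c \<in> Colours P \<Longrightarrow> outarr (Unit P c) = tw_ident P (Unit P c)"
  using uparr_Units[of "Unit P c"] by (simp add: outarr_def Unit_op Unit_output Unit_inputs)

lemma compose_ident_right: "f \<in> arrs \<Longrightarrow> cmp f (tw_ident P (src f)) = f"
  using category.compose_ident_right[OF tw_category, of f] by (simp add: Tw_def)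

text \<open>A one-level composite is viewed as a two-level one with units at one of the levels, here
  the upper one and in \<open>singletons_nested\<close> the middle one; relations for
  \<open>inarr\<close> and \<open>outarr\<close> thereby become instances of the general
  ones.\<close>

lemma units_nested: 
  assumes s: "sub p qs"
  shows "list_all2 sub qs (map units qs)" "map2 (Subst P) qs (map units qs) = qs"
    "concat (map units qs) = units (Subst P p qs)"
proof -
  show "list_all2 sub qs (map units qs)" using substitutableD(3)[OF s] by (simp add: list_all2_conv_all_nth units_substitutable)
  show "map2 (Subst P) qs (map units qs) = qs" using substitutableD(3)[OF s] by (intro nth_equalityI) (simp_all add: Subst_units)
  show "concat (map units qs) = units (Subst P p qs)" by (simp add: units_def[abs_def] Subst_inputs[OF s] map_concat comp_def)
qed

lemma singletons_nested:
  assumes s: "sub p qs"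
  shows "list_all2 sub (units p) (map (\<lambda>q. [q]) qs)" "map2 (Subst P) (units p) (map (\<lambda>q. [q]) qs) = qs"
    "concat (map (\<lambda>q. [q]) qs) = qs"
proof -
  note d = substitutableD[OF s]
  show "list_all2 sub (units p) (map (\<lambda>q. [q]) qs)" using d unit_substitutable by (simp add: list_all2_conv_all_nth) metis
  have "Subst P (Unit P (ins p ! i)) [qs ! i] = qs ! i" if "i < length qs" for i using Unit_Subst[OF d(3)[OF that]] d(4)[OF that] by simp
  then show "map2 (Subst P) (units p) (map (\<lambda>q. [q]) qs) = qs" using d(2) by (intro nth_equalityI) simp_all
  show "concat (map (\<lambda>q. [q]) qs) = qs" by (induction qs) auto
qed

lemma lowarr_outarr:
  assumes s: "sub p qs" and i: "i < length qs"
  shows "cmp (lowarr p qs i) (outarr (qs ! i)) = cmp (uparr p qs) (inarr p i)"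
proof -
  note d = substitutableD[OF s] and n = singletons_nested[OF s]
  show ?thesis using lowarr_uparr[OF units_substitutable[OF d(1)] n(1), of i] i d(2) d(4)[OF i]
    by (simp add: n Subst_units[OF d(1)] inarr_def outarr_def)
qed

lemma outarr_Subst:
  assumes s: "sub p qs"
  shows "outarr (Subst P p qs) = cmp (uparr p qs) (outarr p)"
proof -
  note d = substitutableD[OF s]
  have "list_all2 sub [p] [qs]" using s by simp
  from uparr_uparr[OF unit_substitutable[OF d(1)] this] show ?thesis by (simp add: outarr_def Unit_Subst[OF d(1)] Subst_output[OF s])
qed

lemma inarr_Subst:
  assumes s: "sub p qs" and i: "i < length qs" and j: "j < ar (qs ! i)"
  shows "inarr (Subst P p qs) (sum_list (map ar (take i qs)) + j) = cmp (lowarr p qs i) (inarr (qs ! i) j)"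
proof -
  note n = units_nested[OF s]
  have "map length (take i (map units qs)) = map ar (take i qs)" by (simp add: take_map)
  then show ?thesis using lowarr_lowarr[OF s n(1) i, of j] i j by (simp add: n inarr_def)
qed

lemma outarr_Act:
  assumes p: "p \<in> Ops P" and xs: "perm_list (ar p) xs"
  shows "outarr (Act P p xs) = cmp (permarr p xs) (outarr p)"
proof -
  have "list_all2 (\<lambda>q ys. perm_list (ar q) ys) [p] [xs]" using xs by simp
  moreover have "map ((+) 0) xs = xs" by (simp add: map_idI)
  ultimately show ?thesis using uparr_inner(1)[OF unit_substitutable[OF p], of "[xs]"]
    by (simp add: outarr_def Unit_Subst[OF p] Act_output[OF p xs] offset_def)
qed

text \<open>When units are substituted all blocks have length one, so the block permutation in
  \<open>lowarr_outer\<close> is \<open>xs\<close> itself.\<close>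

lemma inarr_Act:
  assumes p: "p \<in> Ops P" and xs: "perm_list (ar p) xs" and k: "k < ar p"
  shows "inarr (Act P p xs) (xs ! k) = cmp (permarr p xs) (inarr p k)"
proof -
  let ?A = "units (Act P p xs)"
  have A: "Act P p xs \<in> Ops P" "ar (Act P p xs) = ar p" using p xs Act_op Act_arity by blast+
  have u: "map ((!) ?A) xs = units p"
    using perm_list_length[OF xs] perm_list_nth_less[OF xs] Act_inputs[OF p xs] A(2) by (intro nth_equalityI) simp_all
  have o: "offset P ?A i = i" if "i \<le> ar p" for i
  proof -
    have "map ar (take i ?A) = replicate i 1" using that A in_colour[OF A(1)] by (intro nth_equalityI) (simp_all add: Unit_inputs)
    then show ?thesis by (simp add: offset_def sum_list_replicate)
  qed
  have m1: "map (\<lambda>i. [offset P ?A i ..< offset P ?A (Suc i)]) xs = map (\<lambda>i. [i]) xs"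
    using o perm_list_mem_less[OF xs] by (intro map_cong refl) (simp add: Suc_leI less_imp_le)
  have m2: "concat (map (\<lambda>i. [i]) xs) = xs" by (induction xs) auto
  have "outer_perm P ?A xs = xs" by (simp only: m1 m2)
  then show ?thesis using lowarr_outer[OF p xs units_substitutable[OF A(1)] k] by (simp add: u Subst_units[OF p] inarr_def)
qed

lemma hole_upper:
  assumes f: "f \<in> arrs" and l: "lo f = hole (src f)"
  shows "f \<in> upper_arrows P"
proof -
  let ?c = "out (src f)"
  have c: "?c \<in> Colours P" by (rule source_colour[OF f])
  have len: "length (0 # map Suc (ll f)) = ar (lower f)" "sorted_wrt (<) (0 # map Suc (ll f))"
    using f by (cases "ins (lower f)"; simp add: tw_arrows_def sorted_wrt_map)+
  have "cls (lower f) (lolab f) = cls (Unit P ?c) [(?c, 0)]" using l by (simp add: lo_def hole_def var_def)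
  then have "lower f = Unit P ?c" using cls_sorted_inj[OF arrow_basic(3)[OF f] labelled_var[of "(?c, 0)", simplified]] c len by simp
  then show ?thesis using f c by (simp add: upper_arrows_def)
qed

lemma inarr_lower:
  assumes p: "p \<in> Ops P" and i: "i < ar p"
  shows "inarr p i \<in> lower_arrows P" "up (inarr p i) = [var (stdl p ! i)]"
proof -
  let ?g = "inarr p i" and ?c = "ins p ! i"
  have c: "?c \<in> Colours P" by (rule in_colour[OF p i])
  note ga = inarr_arrow[OF p i]
  have ub: "ublocks p (units p) = map (\<lambda>x. [x]) (stdl p)"
  proof (rule ublocks_unique)
    have "concat (map (\<lambda>x. [x]) xs) = xs" for xs :: "('c \<times> nat) list" by (induction xs) auto
    then show "concat (map (\<lambda>x. [x]) (stdl p)) = stdl (Subst P p (units p))" by (simp add: Subst_units[OF p])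
    show "map length (map (\<lambda>x. [x]) (stdl p)) = map ar (units p)" using in_colour[OF p] by (intro nth_equalityI) (simp_all add: Unit_inputs)
  qed
  show u: "up ?g = [var (stdl p ! i)]" using lowarr[OF units_substitutable[OF p], of i] i by (simp add: inarr_def is_arr_def ub)
  have ar: "ar (src ?g) = 1" using ga c by (simp add: Unit_inputs)
  then have n: "0 < ar (src ?g)" by simp
  note u0 = up_nth[OF ga(1) n]
  have "cls (uppers ?g ! 0) (zip (ins (uppers ?g ! 0)) (ul ?g ! 0)) = cls (Unit P ?c) [stdl p ! i]" using u0 u i by (simp add: var_def)
  moreover have "labelled (uppers ?g ! 0, zip (ins (uppers ?g ! 0)) (ul ?g ! 0))" using u0 by (simp add: labelled_zip)
  moreover have "sorted_wrt (<) (ul ?g ! 0)" using ga(1) arrow_basic(7)[OF ga(1)] n by (simp add: tw_arrows_def)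
  ultimately have "uppers ?g ! 0 = Unit P ?c"
    using cls_sorted_inj[of "uppers ?g ! 0" _ "Unit P ?c" "[stdl p ! i]"] u0 c i labelled_var[of "stdl p ! i"] by simp
  then have "uppers ?g = [Unit P ?c]" using arrow_basic(6)[OF ga(1)] ar by (intro nth_equalityI) simp_all
  moreover obtain ls where "ul ?g = [ls]" using arrow_basic(7)[OF ga(1)] ar by (auto simp: length_Suc_conv)
  ultimately show "?g \<in> lower_arrows P" using ga(1) c by (simp add: lower_arrows_def)
qed

text \<open>Grafting \<open>q\<close> on one input of \<open>t\<close> is a pushout: the single
  upper leaf of \<open>inarr t i\<close> is input \<open>i\<close>, and at every other input the
  upper arrow into the composite has a unit, that is, a variable, as
  \<open>pushout_criterion\<close> demands.\<close>

lemma in_out_pushout: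
  assumes t: "t \<in> Ops P" and i: "i < ar t" and q: "q \<in> Ops P" "out q = ins t ! i"
  shows "sub t ((units t)[i := q])" "outarr q \<in> active_arrows P" "inarr t i \<in> inert_arrows P"
    "pushout_square (Tw P) (outarr q) (inarr t i) (lowarr t ((units t)[i := q]) i) (uparr t ((units t)[i := q]))"
proof -
  let ?ws = "(units t)[i := q]"
  note us = units_substitutable[OF t]
  show s: "sub t ?ws"
  proof -
    have "map out ?ws = ins t" using q(2) i in_colour[OF t] by (intro nth_equalityI) (auto simp: nth_list_update Unit_output)
    moreover have "set ?ws \<subseteq> Ops P" using us q(1) set_update_subset_insert[of "units t" i q] by (auto simp: substitutable_def)
    ultimately show ?thesis using t by (simp add: substitutable_def)
  qed
  have il: "i < length ?ws" "?ws ! i = q" using i by simp_all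
  note oa = outarr_arrow[OF q(1)] and ia = inarr_arrow[OF t i] and la = lowarr_arrow[OF s il(1)] and ua = uparr_arrow[OF s]
  have up_out: "outarr q \<in> upper_arrows P"
  proof (rule hole_upper[OF oa(1)])
    show "lo (outarr q) = hole (src (outarr q))" using uparr[OF unit_substitutable[OF q(1)]] oa(2) by (simp add: is_arr_def outarr_def)
  qed
  then show "outarr q \<in> active_arrows P" unfolding active_arrows_def by (auto intro: composites.base)
  show "inarr t i \<in> inert_arrows P" unfolding inert_arrows_def using inarr_lower(1)[OF t i] by (auto intro: composites.base)
  show "pushout_square (Tw P) (outarr q) (inarr t i) (lowarr t ?ws i) (uparr t ?ws)"
  proof (rule pushout_criterion)
    show "active_like (outarr q)" by (rule upper_active_like[OF up_out])
    show "inert_like (inarr t i)" by (rule lower_inert_like[OF inarr_lower(1)[OF t i]])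
    show "lowarr t ?ws i \<in> arrs" "uparr t ?ws \<in> arrs" by (rule la ua)+
    show "src (outarr q) = src (inarr t i)" using oa ia q(2) by simp
    show "src (lowarr t ?ws i) = tgt (outarr q)" "src (uparr t ?ws) = tgt (inarr t i)"
      "tgt (lowarr t ?ws i) = tgt (uparr t ?ws)" using la ua oa ia il by simp_all
    show "cmp (lowarr t ?ws i) (outarr q) = cmp (uparr t ?ws) (inarr t i)" using lowarr_outarr[OF s il(1)] il(2) by simp
    show "lo (uparr t ?ws) = hole (src (uparr t ?ws))" using uparr[OF s] by (simp add: is_arr_def)
    show "up (lowarr t ?ws i) = map var (ublocks t ?ws ! i)" using lowarr[OF s il(1)] by (simp add: is_arr_def)
    show "fst x \<in> Colours P" if "x \<in> set (ublocks t ?ws ! i)" for x using that set_ublocks[OF s il(1)] stdl_colour[OF Subst_op[OF s]] by blast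
    fix y assume y: "shiftl y \<in># clab (lo (inarr t i))"
    obtain M where M: "clab (lo (inarr t i)) = add_mset (out (src (inarr t i)), 0) (image_mset shiftl M)"
      "mset (stdl (tgt (inarr t i))) = sum_list (map clab (up (inarr t i))) + M" using arrow_clab_total[OF ia(1)] by metis
    have yM: "y \<in># M" using y M(1) by (auto simp: shiftl_inj) (simp add: shiftl_def)
    have st: "mset (stdl t) = add_mset (stdl t ! i) M" using M(2) ia(3) inarr_lower(2)[OF t i] in_colour[OF t i] i by simp
    have "y \<in># mset (stdl t)" unfolding st using yM by simp
    then have "y \<in> set (stdl t)" by simp
    then obtain j where j: "j < ar t" "y = stdl t ! j" by (metis in_set_conv_nth length_stdl)
    \<comment> \<open>Input \<open>i\<close> is already the leaf of the upper vertex of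
      \<open>inarr t i\<close>, and inputs are distinct, so a lower leaf is another input.\<close>
    have "y \<noteq> stdl t ! i"
    proof
      assume y: "y = stdl t ! i"
      have "simple_mset (mset (stdl t))" by (simp only: simple_mset_mset distinct_stdl)
      then have "count (add_mset y M) y \<le> 1" unfolding st y[symmetric] simple_mset_def by blast
      moreover have "count M y > 0" using yM by simp
      ultimately show False by simp
    qed
    then have ji: "j \<noteq> i" using j by blast
    have jl: "j < length ?ws" using j by simp
    have "graft (uparr t ?ws) y = cls (?ws ! j) (ublocks t ?ws ! j)" using uparr[OF s] j ublocks(4)[OF s] by (simp add: graft_def is_arr_def)
    moreover have wj: "?ws ! j = Unit P (ins t ! j)" using j ji by simp
    moreover have "labelled (?ws ! j, ublocks t ?ws ! j)" using ublocks(3)[OF s] jl by (simp add: list_all2_conv_all_nth)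
    moreover have cj: "ins t ! j \<in> Colours P" by (rule in_colour[OF t j(1)])
    ultimately have g: "graft (uparr t ?ws) y = cls (Unit P (ins t ! j)) (ublocks t ?ws ! j)"
      and m: "map fst (ublocks t ?ws ! j) = [ins t ! j]" by (simp_all add: labelled_def Unit_inputs)
    from m obtain z where z: "ublocks t ?ws ! j = [z]" "fst z = ins t ! j" by auto
    then show "\<exists>z. fst z \<in> Colours P \<and> graft (uparr t ?ws) y = var z" using g cj by (intro exI[of _ z]) (simp add: var_def)
  qed
qed

end

section \<open>Gluing sections of a decomposition space\<close>

locale dspace = operad P for P :: "('c, 'o) operad" +
  fixes X :: "('o, 'o tw_arr, 'u) presheaf"
  assumes ds: "decomposition_space P X"
begin

abbreviation "res \<equiv> Restr X"

lemma restr_mem: "f \<in> arrs \<Longrightarrow> x \<in> Sect X (tgt f) \<Longrightarrow> res f x \<in> Sect X (src f)"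
  using ds by (auto simp: decomposition_space_def presheaf_on_def Tw_def)

lemma restr_ident: "p \<in> Ops P \<Longrightarrow> x \<in> Sect X p \<Longrightarrow> res (tw_ident P p) x = x"
  using ds by (auto simp: decomposition_space_def presheaf_on_def Tw_def)

lemma restr_compose: "f \<in> arrs \<Longrightarrow> g \<in> arrs \<Longrightarrow> src g = tgt f \<Longrightarrow> x \<in> Sect X (tgt g) \<Longrightarrow>
    res (cmp g f) x = res f (res g x)"
  using ds by (auto simp: decomposition_space_def presheaf_on_def Tw_def)

lemma segal_one:
  assumes t: "t \<in> Ops P" and i: "i < ar t" and q: "q \<in> Ops P" "out q = ins t ! i"
    and x: "x \<in> Sect X t" and y: "y \<in> Sect X q" and xy: "res (inarr t i) x = res (outarr q) y"
  shows "\<exists>!z. z \<in> Sect X (Subst P t ((units t)[i := q])) \<and> res (uparr t ((units t)[i := q])) z = x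
    \<and> res (lowarr t ((units t)[i := q]) i) z = y"
proof -
  let ?ws = "(units t)[i := q]"
  note p = in_out_pushout[OF t i q]
  have il: "i < length ?ws" using i by simp
  have "sends_to_pullback (Tw P) X (outarr q) (inarr t i) (lowarr t ?ws i) (uparr t ?ws)" using ds p(2-4) by (auto simp: decomposition_space_def)
  then have b: "bij_betw (\<lambda>z. (res (lowarr t ?ws i) z, res (uparr t ?ws) z)) (Sect X (Subst P t ?ws))
      {(x, y). x \<in> Sect X q \<and> y \<in> Sect X t \<and> res (outarr q) x = res (inarr t i) y}"
    using lowarr_arrow(3)[OF p(1) il] outarr_arrow(3)[OF q(1)] inarr_arrow(3)[OF t i] by (simp add: sends_to_pullback_def Tw_def)
  have "(y, x) \<in> {(x, y). x \<in> Sect X q \<and> y \<in> Sect X t \<and> res (outarr q) x = res (inarr t i) y}" using x y xy by simp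
  then obtain z where z: "z \<in> Sect X (Subst P t ?ws)" "res (lowarr t ?ws i) z = y" "res (uparr t ?ws) z = x"
    unfolding bij_betw_imp_surj_on[OF b, symmetric] by auto
  show ?thesis
  proof (rule ex1I[of _ z])
    fix w assume "w \<in> Sect X (Subst P t ?ws) \<and> res (uparr t ?ws) w = x \<and> res (lowarr t ?ws i) w = y"
    then show "w = z" using z by (intro inj_onD[OF bij_betw_imp_inj_on[OF b]]) simp_all
  qed (use z in blast)
qed

text \<open>Only the first \<open>k\<close> inputs are considered, which allows induction on \<open>k\<close>.\<close>

definition glues :: "'o \<Rightarrow> 'o list \<Rightarrow> nat \<Rightarrow> 'u \<Rightarrow> 'u list \<Rightarrow> 'u \<Rightarrow> bool" where
  "glues p qs k x ys z \<longleftrightarrow> z \<in> Sect X (Subst P p qs) \<and> res (uparr p qs) z = x \<and>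
    (\<forall>i<k. res (lowarr p qs i) z = ys ! i)"

text \<open>The operations \<open>qs\<close> are grafted one after the other, each time by a pushout of \<open>outarr q\<close> along
  \<open>inarr t i\<close>.\<close>

lemma segal_partial:
  assumes s: "sub p qs" and x: "x \<in> Sect X p"
    and ys: "\<And>i. i < length qs \<Longrightarrow> ys ! i \<in> Sect X (qs ! i)"
    and xy: "\<And>i. i < length qs \<Longrightarrow> res (inarr p i) x = res (outarr (qs ! i)) (ys ! i)"
  shows "k \<le> length qs \<Longrightarrow> \<exists>!z. glues p (take k qs @ drop k (units p)) k x ys z"
proof (induction k)
  note d = substitutableD[OF s]
  case 0
  have "uparr p (units p) = tw_ident P p" unfolding units_def by (rule uparr_Units[OF d(1)])
  then show ?case using x by (auto simp: glues_def Subst_units[OF d(1)] restr_ident[OF d(1)])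
next
  note d = substitutableD[OF s]
  case (Suc k)
  then have k: "k < length qs" by simp
  \<comment> \<open>The first \<open>k\<close> operations are grafted, the remaining inputs still
    carry units.\<close>
  define qk where "qk = take k qs @ drop k (units p)"
  define qk' where "qk' = take (Suc k) qs @ drop (Suc k) (units p)"
  have lq: "length qk = length qs" "length qk' = length qs" using k d(2) by (simp_all add: qk_def qk'_def)
  have nq: "qk ! i = (if i < k then qs ! i else units p ! i)" "qk' ! i = (if i < Suc k then qs ! i else units p ! i)" if "i < length qs" for i
    using that k d(2) by (simp_all add: qk_def qk'_def nth_append min_def)
  let ?c = "ins p ! k"
  have c: "?c \<in> Colours P" using in_colour[OF d(1)] k d(2) by simp
  have ou: "units p ! i \<in> Ops P" "out (units p ! i) = ins p ! i" if "i < length qs" for i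
    using that d(2) in_colour[OF d(1)] by (simp_all add: Unit_op Unit_output)
  have sub: "sub p l" if "length l = length qs" "\<And>i. i < length qs \<Longrightarrow> l ! i = qs ! i \<or> l ! i = units p ! i" for l
  proof -
    have "map out l = ins p"
    proof (rule nth_equalityI)
      fix i assume "i < length (map out l)"
      then have i: "i < length qs" using that by simp
      then show "map out l ! i = ins p ! i" using that(2)[OF i] d(4)[OF i] ou(2)[OF i] that(1) by auto
    qed (use that d(2) in simp)
    moreover have "l ! i \<in> Ops P" if "i < length qs" for i
      using \<open>\<And>i. i < length qs \<Longrightarrow> l ! i = qs ! i \<or> l ! i = units p ! i\<close>[OF that] d(3)[OF that] ou(1)[OF that] by auto
    then have "set l \<subseteq> Ops P" using that(1) by (auto simp: in_set_conv_nth)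
    ultimately show ?thesis using d(1) by (simp add: substitutable_def)
  qed
  have sk: "sub p qk" "sub p qk'" using lq nq by (intro sub; simp)+
  note dk = substitutableD[OF sk(1)]
  \<comment> \<open>The next stage as a two-level composite over \<open>qk\<close>: the unit at
    place \<open>k\<close> receives the new operation, all others receive units.\<close>
  define rss where "rss = (map units qk)[k := [qs ! k]]"
  have lr: "length rss = length qs" by (simp add: rss_def lq)
  have nr: "rss ! i = (if i = k then [qs ! k] else units (qk ! i))" if "i < length qs" for i using that lq by (simp add: rss_def nth_list_update)
  have qkk: "qk ! k = Unit P ?c" using nq(1)[OF k] k d(2) by simp
  have r: "list_all2 sub qk rss"
  proof -
    have "sub (qk ! i) (rss ! i)" if i: "i < length qs" for i
    proof (cases "i = k")
      case True
      then show ?thesis using nr[OF i] qkk unit_substitutable[OF d(3)[OF k]] d(4)[OF k] by simp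
    next
      case False
      then show ?thesis using nr[OF i] units_substitutable[OF dk(3)] i lq by simp
    qed
    then show ?thesis using lr lq by (simp add: list_all2_conv_all_nth)
  qed
  have m2: "map2 (Subst P) qk rss = qk'"
  proof (rule nth_equalityI)
    fix i assume "i < length (map2 (Subst P) qk rss)"
    then have i: "i < length qs" using lr lq by simp
    show "map2 (Subst P) qk rss ! i = qk' ! i"
    proof (cases "i = k")
      case True
      then show ?thesis using nr[OF i] qkk lq lr i nq(2)[OF i] Unit_Subst[OF d(3)[OF k]] d(4)[OF k] by simp
    next
      case False
      then show ?thesis using nr[OF i] lq lr i nq[OF i] Subst_units[OF dk(3), of i] by simp
    qed
  qed (simp add: lq lr)
  define t where "t = Subst P p qk"
  have t: "t \<in> Ops P" unfolding t_def by (rule Subst_op[OF sk(1)])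
  \<comment> \<open>The place of input \<open>k\<close> of \<open>p\<close> among the inputs of
    \<open>t\<close>, the earlier operations having been expanded.\<close>
  define off where "off = sum_list (map length (take k (map units qk)))"
  have un: "units (qk ! k) = [Unit P ?c]" using units_Unit[OF c] qkk by simp
  have cr: "concat rss = (units t)[off := qs ! k]"
  proof -
    have "(concat (map units qk))[off + 0 := qs ! k] = concat ((map units qk)[k := ((map units qk) ! k)[0 := qs ! k]])"
      unfolding off_def using k lq un by (intro concat_list_update) simp_all
    then show ?thesis using units_nested(3)[OF sk(1)] k lq un by (simp add: rss_def t_def)
  qed
  have offl: "off < ar t" and offc: "ins t ! off = ?c"
  proof -
    have "ins t = concat (map ins qk)" unfolding t_def by (rule Subst_inputs[OF sk(1)])
    moreover have "off = sum_list (map length (take k (map ins qk)))" by (simp add: off_def take_map comp_def)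
    moreover have "map ins qk ! k = [?c]" using k lq qkk c by (simp add: Unit_inputs)
    ultimately show "ins t ! off = ?c" using nth_concat_offset[of k "map ins qk" 0] k lq by simp
    have "off + ar (qk ! k) \<le> ar t"
      using offset_le[of k qk P] k lq by (simp add: off_def offset_def take_map comp_def t_def Subst_inputs[OF sk(1)])
    then show "off < ar t" using qkk c by (simp add: Unit_inputs)
  qed
  have tt: "Subst P t ((units t)[off := qs ! k]) = Subst P p qk'" using nested_substitutable(3)[OF sk(1) r] by (simp add: m2 cr t_def)
  let ?ws = "(units t)[off := qs ! k]"
  have sw: "sub t ?ws" using nested_substitutable(1)[OF sk(1) r] by (simp add: cr t_def)
  note aw = uparr_arrow[OF sw] and ak = uparr_arrow[OF sk(1)]
  have E7: "cmp (uparr t ?ws) (uparr p qk) = uparr p qk'" using uparr_uparr[OF sk(1) r] by (simp add: m2 cr t_def)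
  \<comment> \<open>At the places glued before, only units are substituted, so the upper arrow in
    \<open>lowarr_uparr\<close> is an identity there.\<close>
  have E8: "cmp (uparr t ?ws) (lowarr p qk i) = lowarr p qk' i" if i: "i < k" for i
  proof -
    have i': "i < length qk" "i < length qk'" "i < length qs" using i k lq by simp_all
    have "rss ! i = units (qk ! i)" "qk' ! i = qk ! i" using nr nq i i' by simp_all
    then have "uparr (qk ! i) (rss ! i) = tw_ident P (src (lowarr p qk' i))"
      using uparr_Units[OF dk(3)[OF i'(1)]] lowarr_arrow(2)[OF sk(2) i'(2)] by (simp add: units_def)
    then show ?thesis using lowarr_uparr[OF sk(1) r i'(1)] compose_ident_right[OF lowarr_arrow(1)[OF sk(2) i'(2)]] by (simp add: m2 cr t_def)
  qed
  have E9: "lowarr t ?ws off = lowarr p qk' k"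
  proof -
    have kq: "k < length qk" "k < length qk'" using k lq by simp_all
    have rk: "rss ! k = [qs ! k]" using nr[OF k] by simp
    have "map length (take k rss) = map length (take k (map units qk))" by (simp add: rss_def)
    then have "lowarr t ?ws off = cmp (lowarr p qk' k) (lowarr (qk ! k) (rss ! k) 0)"
      using lowarr_lowarr[OF sk(1) r kq(1), of 0] rk by (simp add: m2 cr t_def off_def)
    also have "lowarr (qk ! k) (rss ! k) 0 = tw_ident P (src (lowarr p qk' k))"
      using lowarr_Unit[OF d(3)[OF k]] d(4)[OF k] qkk rk lowarr_arrow(2)[OF sk(2) kq(2)] nq(2)[OF k] by simp
    finally show ?thesis using compose_ident_right[OF lowarr_arrow(1)[OF sk(2) kq(2)]] by simp
  qed
  \<comment> \<open>Input \<open>k\<close> still carries a unit, where \<open>inarr\<close> and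
    \<open>outarr\<close> agree; so the colour of \<open>z\<close> at \<open>off\<close> is the
    colour of \<open>x\<close> at \<open>k\<close>, and the matching condition \<open>xy\<close>
    applies to \<open>z\<close>.\<close>
  have incoh: "res (inarr t off) z = res (inarr p k) x" if z: "z \<in> Sect X t" "res (uparr p qk) z = x" for z
  proof -
    have kq: "k < length qk" using k lq by simp
    have "inarr t off = cmp (lowarr p qk k) (inarr (qk ! k) 0)"
      using inarr_Subst[OF sk(1) kq, of 0] qkk c by (simp add: t_def off_def take_map comp_def Unit_inputs)
    also have "\<dots> = cmp (lowarr p qk k) (outarr (qk ! k))" using inarr_Unit[OF c] outarr_Unit[OF c] qkk by simp
    also have "\<dots> = cmp (uparr p qk) (inarr p k)" by (rule lowarr_outarr[OF sk(1) kq])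
    finally show ?thesis using restr_compose[of "inarr p k" "uparr p qk" z] inarr_arrow[OF d(1), of k] ak k d(2) z by (simp add: t_def)
  qed
  have IH: "\<exists>!z. glues p qk k x ys z" using Suc unfolding qk_def by simp
  have seg: "\<exists>!w. w \<in> Sect X (Subst P p qk') \<and> res (uparr t ?ws) w = z \<and> res (lowarr p qk' k) w = ys ! k"
    if z: "glues p qk k x ys z" for z
  proof -
    have "z \<in> Sect X t" "res (uparr p qk) z = x" using z by (simp_all add: glues_def t_def)
    then show ?thesis using segal_one[OF t offl d(3)[OF k], of z "ys ! k"] d(4)[OF k] offc ys[OF k] incoh xy[OF k] by (simp add: tt E9)
  qed
  \<comment> \<open>A gluing at the next stage is the same as a gluing at this stage together with a
    section over the new pushout; unique existence is thus passed on.\<close>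
  have down: "glues p qk k x ys (res (uparr t ?ws) w) \<and> res (lowarr p qk' k) w = ys ! k \<longleftrightarrow> glues p qk' (Suc k) x ys w"
    if w: "w \<in> Sect X (Subst P p qk')" for w
  proof -
    have wt: "w \<in> Sect X (tgt (uparr t ?ws))" using w aw tt by simp
    have st: "src (uparr t ?ws) = t" "tgt (uparr p qk) = t" using aw ak by (simp_all add: t_def)
    have m: "res (uparr t ?ws) w \<in> Sect X t" using restr_mem[OF aw(1) wt] aw by simp
    have 1: "res (uparr p qk') w = res (uparr p qk) (res (uparr t ?ws) w)" using restr_compose[OF ak(1) aw(1) _ wt] by (simp only: E7 st)
    have 2: "res (lowarr p qk' i) w = res (lowarr p qk i) (res (uparr t ?ws) w)" if "i < k" for i
    proof -
      have i: "i < length qk" using that k lq by simp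
      have "tgt (lowarr p qk i) = t" using lowarr_arrow(3)[OF sk(1) i] by (simp add: t_def)
      then show ?thesis using restr_compose[OF lowarr_arrow(1)[OF sk(1) i] aw(1) _ wt] by (simp only: E8[OF that] st)
    qed
    show ?thesis using w m 1 2 by (auto simp: glues_def t_def less_Suc_eq)
  qed
  obtain z where z: "glues p qk k x ys z" and zu: "\<And>z'. glues p qk k x ys z' \<Longrightarrow> z' = z" using IH by blast
  obtain w where w: "w \<in> Sect X (Subst P p qk')" "res (uparr t ?ws) w = z" "res (lowarr p qk' k) w = ys ! k"
    and wu: "\<And>w'. w' \<in> Sect X (Subst P p qk') \<Longrightarrow> res (uparr t ?ws) w' = z \<Longrightarrow> res (lowarr p qk' k) w' = ys ! k \<Longrightarrow> w' = w"
    using seg[OF z] by blast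
  have "\<exists>!w. glues p qk' (Suc k) x ys w"
  proof (rule ex1I[of _ w])
    show "glues p qk' (Suc k) x ys w" using down[OF w(1)] w z by simp
    fix w' assume w': "glues p qk' (Suc k) x ys w'"
    then have m: "w' \<in> Sect X (Subst P p qk')" by (simp add: glues_def)
    then show "w' = w" using down[OF m] w' zu wu by blast
  qed
  then show ?case unfolding qk'_def .
qed

theorem segal:
  assumes s: "sub p qs" and x: "x \<in> Sect X p"
    and ys: "\<And>i. i < length qs \<Longrightarrow> ys ! i \<in> Sect X (qs ! i)"
    and xy: "\<And>i. i < length qs \<Longrightarrow> res (inarr p i) x = res (outarr (qs ! i)) (ys ! i)"
  shows "\<exists>!z. glues p qs (length qs) x ys z" using segal_partial[OF s x ys xy, of "length qs"] substitutableD(2)[OF s] by simp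

text \<open>The restrictions of a single element match automatically, by
  \<open>lowarr_outarr\<close>, so that the uniqueness in \<open>segal\<close> applies.\<close>

lemma segal_inj:
  assumes s: "sub p qs" and z: "z \<in> Sect X (Subst P p qs)" and w: "w \<in> Sect X (Subst P p qs)"
    and u: "res (uparr p qs) z = res (uparr p qs) w"
    and l: "\<And>i. i < length qs \<Longrightarrow> res (lowarr p qs i) z = res (lowarr p qs i) w"
  shows "z = w"
proof -
  note d = substitutableD[OF s] and ua = uparr_arrow[OF s]
  let ?x = "res (uparr p qs) z" and ?ys = "map (\<lambda>i. res (lowarr p qs i) z) [0..<length qs]"
  have "\<exists>!z. glues p qs (length qs) ?x ?ys z"
  proof (rule segal[OF s])
    show "?x \<in> Sect X p" using restr_mem[OF ua(1)] ua z by simp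
    fix i assume i: "i < length qs"
    note la = lowarr_arrow[OF s i] and oa = outarr_arrow[OF d(3)[OF i]] and ia = inarr_arrow[OF d(1), of i]
    show "?ys ! i \<in> Sect X (qs ! i)" using restr_mem[OF la(1)] la z i by simp
    show "res (inarr p i) ?x = res (outarr (qs ! i)) (?ys ! i)"
      using restr_compose[of "inarr p i" "uparr p qs" z] restr_compose[of "outarr (qs ! i)" "lowarr p qs i" z]
        lowarr_outarr[OF s i] la oa ia ua z i d(2) by simp
  qed
  then show ?thesis using z w u l by (auto simp: glues_def)
qed

end

lemma perm_inverse:
  assumes "perm_list n xs"
  obtains ys where "perm_list n ys" "map ((!) ys) xs = [0..<n]" "map ((!) xs) ys = [0..<n]"
proof -
  obtain ys where ys: "perm_list n ys" "map ((!) ys) xs = [0..<n]" using perm_list_factor[OF assms perm_list_upt] .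
  have "map ((!) xs) ys = [0..<n]"
  proof (rule nth_equalityI)
    fix j assume "j < length (map ((!) xs) ys)"
    then have j: "j < n" using perm_list_length[OF ys(1)] by simp
    then obtain k where k: "k < n" "xs ! k = j" using perm_list_ex_index[OF assms] by blast
    have "ys ! (xs ! k) = k" using arg_cong[OF ys(2), of "\<lambda>zs. zs ! k"] k perm_list_length[OF assms] by simp
    then show "map ((!) xs) ys ! j = [0..<n] ! j" using j k perm_list_length[OF ys(1)] by simp
  qed (simp add: perm_list_length[OF ys(1)])
  with ys that show ?thesis by blast
qed

context dspace
begin

text \<open>\<open>permarr\<close> is an isomorphism of \<open>Tw P\<close>, inverse to the arrow of
  the inverse permutation, and functoriality turns this into inverse restrictions.\<close>

lemma restr_perm_inverse:
  assumes p: "p \<in> Ops P" and xs: "perm_list (ar p) xs"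
  obtains ys where "perm_list (ar p) ys" "perm_list (ar (Act P p xs)) ys" "Act P (Act P p xs) ys = p"
    "\<And>x. x \<in> Sect X p \<Longrightarrow> res (permarr p xs) (res (permarr (Act P p xs) ys) x) = x"
    "\<And>z. z \<in> Sect X (Act P p xs) \<Longrightarrow> res (permarr (Act P p xs) ys) (res (permarr p xs) z) = z"
proof -
  obtain ys where ys: "perm_list (ar p) ys" "map ((!) ys) xs = [0..<ar p]" "map ((!) xs) ys = [0..<ar p]" using perm_inverse[OF xs] .
  have A: "Act P p xs \<in> Ops P" "ar (Act P p xs) = ar p" using p xs Act_op Act_arity by blast+
  have ys': "perm_list (ar (Act P p xs)) ys" and xs': "perm_list (ar (Act P p xs)) xs" using ys xs A by simp_all
  have AA: "Act P (Act P p xs) ys = p" using Act_Act[OF p xs ys(1)] ys(2) Act_id[OF p] by simp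
  note a = permarr_arrow[OF p xs] and b = permarr_arrow[OF A(1) ys', unfolded AA]
  have 1: "cmp (permarr (Act P p xs) ys) (permarr p xs) = tw_ident P p" using permarr_permarr[OF p xs ys(1)] ys(2) permarr_ident[OF p] by simp
  have 2: "cmp (permarr p xs) (permarr (Act P p xs) ys) = tw_ident P (Act P p xs)"
    using permarr_permarr[OF A(1) ys' xs'] ys(3) permarr_ident[OF A(1)] AA A(2) by simp
  show ?thesis
  proof (rule that[OF ys(1) ys' AA])
    show "res (permarr p xs) (res (permarr (Act P p xs) ys) x) = x" if "x \<in> Sect X p" for x
      using restr_compose[OF a(1) b(1), of x] a b that 1 restr_ident[OF p] by simp
    show "res (permarr (Act P p xs) ys) (res (permarr p xs) z) = z" if "z \<in> Sect X (Act P p xs)" for z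
      using restr_compose[OF b(1) a(1), of z] a b that 2 restr_ident[OF A(1)] by simp
  qed
qed

lemma perm_ex1:
  assumes p: "p \<in> Ops P" and xs: "perm_list (ar p) xs" and x: "x \<in> Sect X p"
  shows "\<exists>!z. z \<in> Sect X (Act P p xs) \<and> res (permarr p xs) z = x"
proof -
  obtain ys where ys: "perm_list (ar (Act P p xs)) ys" "Act P (Act P p xs) ys = p"
    "\<And>x. x \<in> Sect X p \<Longrightarrow> res (permarr p xs) (res (permarr (Act P p xs) ys) x) = x"
    "\<And>z. z \<in> Sect X (Act P p xs) \<Longrightarrow> res (permarr (Act P p xs) ys) (res (permarr p xs) z) = z"
    using restr_perm_inverse[OF p xs] by metis
  note b = permarr_arrow[OF Act_op[OF p xs] ys(1), unfolded ys(2)]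
  show ?thesis
  proof (rule ex1I[of _ "res (permarr (Act P p xs) ys) x"])
    show "res (permarr (Act P p xs) ys) x \<in> Sect X (Act P p xs) \<and> res (permarr p xs) (res (permarr (Act P p xs) ys) x) = x"
      using ys(3)[OF x] restr_mem[OF b(1)] b x by simp
  next
    fix z assume "z \<in> Sect X (Act P p xs) \<and> res (permarr p xs) z = x"
    then show "z = res (permarr (Act P p xs) ys) x" using ys(4)[of z] by simp
  qed
qed

end

section \<open>The operad structure of \<open>Q\<close> read off from restrictions\<close>

context decomposition
begin

sublocale S: dspace P "Fib" by unfold_locales (rule fibre_decomposition_space)

lemma tw_map_outarr: "q \<in> Ops Q \<Longrightarrow> tw_map F (Q.outarr q) = P.outarr (op_map F q)"
  using tw_map_uparr[OF Q.unit_substitutable, of q] by (simp add: Q.outarr_def P.outarr_def F_simps Q.output_colour)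

lemma map_units: "q \<in> Ops Q \<Longrightarrow> map (op_map F) (Q.units q) = P.units (op_map F q)"
  using Q.inputs_colours by (auto simp: Q.units_def P.units_def F_simps subset_iff)

lemma tw_map_inarr: "q \<in> Ops Q \<Longrightarrow> i < arity Q q \<Longrightarrow> tw_map F (Q.inarr q i) = P.inarr (op_map F q) i"
  using tw_map_lowarr[OF Q.units_substitutable, of q i] by (simp add: Q.inarr_def P.inarr_def map_units)

lemma restr_out: "q \<in> Ops Q \<Longrightarrow> src (lft (P.outarr (op_map F q)) q) = Unit Q (Q.out q)"
  using fibre_restr[OF Q.outarr_arrow(1) tw_map_outarr] Q.outarr_arrow(2,3) by simp

lemma restr_in: "q \<in> Ops Q \<Longrightarrow> i < arity Q q \<Longrightarrow>
    src (lft (P.inarr (op_map F q) i) q) = Unit Q (Q.ins q ! i)"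
  using fibre_restr[OF Q.inarr_arrow(1) tw_map_inarr] Q.inarr_arrow(2,3) by simp

lemma restr_up: "Q.sub q rs \<Longrightarrow>
    src (lft (P.uparr (op_map F q) (map (op_map F) rs)) (Subst Q q rs)) = q"
  using fibre_restr[OF Q.uparr_arrow(1) tw_map_uparr] Q.uparr_arrow(2,3) by simp

lemma restr_low: "Q.sub q rs \<Longrightarrow> i < length rs \<Longrightarrow>
    src (lft (P.lowarr (op_map F q) (map (op_map F) rs) i) (Subst Q q rs)) = rs ! i"
  using fibre_restr[OF Q.lowarr_arrow(1) tw_map_lowarr] Q.lowarr_arrow(2,3) by simp

lemma restr_perm: "q \<in> Ops Q \<Longrightarrow> perm_list (arity Q q) xs \<Longrightarrow>
    src (lft (P.permarr (op_map F q) xs) (Act Q q xs)) = q"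
  using fibre_restr[OF Q.permarr_arrow(1) tw_map_permarr] Q.permarr_arrow(2,3) by simp

text \<open>The fibre presheaf is a decomposition space, so \<open>segal_inj\<close> recognises a
  composite in \<open>Q\<close> by its restrictions. This is how maps of presheaves are seen to
  preserve composition.\<close>

lemma Subst_eqI:
  assumes s: "Q.sub q rs" and z: "z \<in> Ops Q" "op_map F z = Subst P (op_map F q) (map (op_map F) rs)"
    "src (lft (P.uparr (op_map F q) (map (op_map F) rs)) z) = q"
    "\<And>i. i < length rs \<Longrightarrow> src (lft (P.lowarr (op_map F q) (map (op_map F) rs) i) z) = rs ! i"
  shows "z = Subst Q q rs"
  using S.segal_inj[OF F_substitutable[OF s], of z "Subst Q q rs"] z Q.Subst_op[OF s] F_simps(4)[OF s] restr_up[OF s] restr_low[OF s] by simp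

lemma Act_eqI:
  assumes q: "q \<in> Ops Q" and xs: "perm_list (arity Q q) xs" and z: "z \<in> Ops Q" "op_map F z = Act P (op_map F q) xs"
    "src (lft (P.permarr (op_map F q) xs) z) = q"
  shows "z = Act Q q xs"
proof -
  have xs': "perm_list (arity P (op_map F q)) xs" using xs q by (simp add: F_arity)
  have "\<exists>!z. z \<in> Sect Fib (Act P (op_map F q) xs) \<and> Restr Fib (P.permarr (op_map F q) xs) z = q"
    using q by (intro S.perm_ex1 F_Op xs') simp_all
  then show ?thesis using z q xs Q.Act_op restr_perm[OF q xs] F_simps(5)[OF q xs] by auto
qed

end

definition fibre_map :: "('c, 'o) operad \<Rightarrow> ('d, 'p) operad \<Rightarrow> ('c, 'o, 'd, 'p) operad_map \<Rightarrow> ('c, 'o, 'e, 'r) operad_map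
    \<Rightarrow> 'p \<Rightarrow> 'o \<Rightarrow> 'r" where
  "fibre_map Q P F h = (\<lambda>p \<in> Ops P. \<lambda>q \<in> {q \<in> Ops Q. op_map F q = p}. op_map h q)"

locale decomposition_pair = A: decomposition Q P F + B: decomposition R P G
  for Q :: "('c, 'u) operad" and P :: "('d, 'p) operad" and F and R :: "('e, 'u) operad" and G
begin

text \<open>A map over \<open>P\<close> sends lifts to lifts of the same arrow, by uniqueness of
  lifts; this is naturality.\<close>

lemma fibre_map_mem:
  assumes h: "h \<in> operad_maps Q R" and c: "operad_map_comp Q G h = F"
  shows "fibre_map Q P F h \<in> presheaf_maps (Tw P) A.Fib (B.Fib)"
proof -
  interpret H: operad_morphism Q R h by unfold_locales (rule h)
  have Gh: "op_map G (op_map h q) = op_map F q" if "q \<in> Ops Q" for q using that c[symmetric] by (simp add: operad_map_comp_def compose_def)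
  show ?thesis unfolding presheaf_maps_def mem_Collect_eq
  proof (intro conjI ballI)
    show "fibre_map Q P F h \<in> (\<Pi>\<^sub>E a \<in> Obj (Tw P). Sect A.Fib a \<rightarrow>\<^sub>E Sect (B.Fib) a)"
      using H.F_Op Gh by (auto simp: fibre_map_def Tw_def PiE_iff)
    fix a q assume "a \<in> Arr (Tw P)" "q \<in> Sect A.Fib (Cod (Tw P) a)"
    then have a: "a \<in> tw_arrows P" and q: "q \<in> Ops Q" "tw_target P a = op_map F q" by (simp_all add: Tw_def)
    note l = A.lift[OF q(1) a q(2)]
    have "tw_map G (tw_map h g) = tw_map F g" if g: "g \<in> tw_arrows Q" for g using g Gh by (auto simp: tw_map_def tw_arrows_def subset_iff)
    then have "tw_map G (tw_map h (lift Q P F a q)) = a" using l by simp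
    then have "src (lift R P G a (op_map h q)) = op_map h (src (lift Q P F a q))"
      using B.fibre_restr[OF H.tw_map_arrow(1)[OF l(1)], of a "op_map h q"] H.tw_map_arrow(2,5)[OF l(1)] l(2) by simp
    then show "fibre_map Q P F h (Dom (Tw P) a) (Restr A.Fib a q)
      = Restr (B.Fib) a (fibre_map Q P F h (Cod (Tw P) a) q)"
      using A.lift_source[OF q(1) a q(2)] q A.F_Op A.P.arrow_basic(1)[OF a] A.P.arrow_target(1)[OF a] by (simp add: fibre_map_def Tw_def)
  qed
qed

text \<open>The presheaf map shows the values on operations, and a colour is recovered as the output
  colour of its unit.\<close>

lemma faithful:
  assumes h: "h \<in> operad_maps Q R" and h': "h' \<in> operad_maps Q R" and e: "fibre_map Q P F h = fibre_map Q P F h'"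
  shows "h = h'"
proof -
  interpret H: operad_morphism Q R h by unfold_locales (rule h)
  interpret H': operad_morphism Q R h' by unfold_locales (rule h')
  have o: "op_map h q = op_map h' q" if q: "q \<in> Ops Q" for q
    using fun_cong[OF fun_cong[OF e], of "op_map F q" q] q A.F_Op[OF q] by (simp add: fibre_map_def)
  have c: "col_map h d = col_map h' d" if d: "d \<in> Colours Q" for d
  proof -
    have "Unit R (col_map h d) = Unit R (col_map h' d)" using o[OF A.Q.Unit_op[OF d]] H.F_simps(3)[OF d] H'.F_simps(3)[OF d] by simp
    then show ?thesis using B.Q.Unit_output H.F_Col[OF d] H'.F_Col[OF d] by metis
  qed
  have "op_map h = op_map h'" by (rule extensionalityI[of _ "Ops Q"]) (use h h' o in \<open>auto simp: operad_maps_def PiE_iff\<close>)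
  moreover have "col_map h = col_map h'" by (rule extensionalityI[of _ "Colours Q"]) (use h h' c in \<open>auto simp: operad_maps_def PiE_iff\<close>)
  ultimately show ?thesis by simp
qed

text \<open>Naturality along \<open>outarr\<close> and \<open>inarr\<close> says that output and
  input colours are respected, along \<open>uparr\<close> and \<open>lowarr\<close> that composites
  are, and along \<open>permarr\<close> that the action is; \<open>Subst_eqI\<close> and
  \<open>Act_eqI\<close> turn the latter into equations.\<close>

lemma full:
  assumes al: "\<alpha> \<in> presheaf_maps (Tw P) A.Fib (B.Fib)"
  obtains h where "h \<in> operad_maps Q R" "operad_map_comp Q G h = F" "fibre_map Q P F h = \<alpha>"
proof -
  define ho where "ho q = \<alpha> (op_map F q) q" for q
  have aE: "\<alpha> \<in> (\<Pi>\<^sub>E a \<in> Ops P. {q \<in> Ops Q. op_map F q = a} \<rightarrow>\<^sub>E {q \<in> Ops R. op_map G q = a})"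
    using al by (simp add: presheaf_maps_def Tw_def)
  have nat: "ho (src (lift Q P F a q)) = src (lift R P G a (ho q))"
    if "q \<in> Ops Q" "a \<in> tw_arrows P" "tw_target P a = op_map F q" for a q
    using al that A.lift_source[OF that] unfolding presheaf_maps_def by (simp add: Tw_def ho_def)
  have ho: "ho q \<in> Ops R" "op_map G (ho q) = op_map F q" if q: "q \<in> Ops Q" for q
    using PiE_mem[OF aE A.F_Op[OF q]] q by (auto simp: ho_def PiE_iff)
  have ar: "arity R (ho q) = arity Q q" if q: "q \<in> Ops Q" for q using A.F_arity[OF q] B.F_arity[OF ho(1)[OF q]] ho(2)[OF q] by simp
  \<comment> \<open>A colour is sent to the output colour of the image of its unit. The image of a
    unit is again a unit by naturality along \<open>outarr\<close>, see
    \<open>hounit\<close>.\<close>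
  define hc where "hc d = out_colour R (ho (Unit Q d))" for d
  have out: "ho (Unit Q (out_colour Q q)) = Unit R (out_colour R (ho q))" if q: "q \<in> Ops Q" for q
    using nat[OF q A.P.outarr_arrow(1)[OF A.F_Op[OF q]]] A.P.outarr_arrow(3)[OF A.F_Op[OF q]] A.restr_out[OF q]
      B.restr_out[OF ho(1)[OF q]] ho(2)[OF q] by simp
  have hcout: "out_colour R (ho q) = hc (out_colour Q q)" if q: "q \<in> Ops Q" for q
    using out[OF q] B.Q.Unit_output B.Q.output_colour[OF ho(1)[OF q]] by (simp add: hc_def)
  have hounit: "ho (Unit Q d) = Unit R (hc d)" if d: "d \<in> Colours Q" for d
    using out[OF A.Q.Unit_op[OF d]] A.Q.Unit_output[OF d] by (simp add: hc_def)
  have hin: "in_colours R (ho q) = map hc (in_colours Q q)" if q: "q \<in> Ops Q" for q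
  proof (rule nth_equalityI)
    fix i assume "i < length (in_colours R (ho q))"
    then have i: "i < arity Q q" using ar[OF q] by simp
    have i': "i < arity P (op_map F q)" "i < arity R (ho q)" using i q ar[OF q] by (simp_all add: A.F_arity)
    have "ho (Unit Q (in_colours Q q ! i)) = Unit R (in_colours R (ho q) ! i)"
      using nat[OF q A.P.inarr_arrow(1)[OF A.F_Op[OF q] i'(1)]] A.P.inarr_arrow(3)[OF A.F_Op[OF q] i'(1)] A.restr_in[OF q i]
        B.restr_in[OF ho(1)[OF q] i'(2)] ho(2)[OF q] by simp
    then have "hc (in_colours Q q ! i) = in_colours R (ho q) ! i" using B.Q.Unit_output B.Q.in_colour[OF ho(1)[OF q] i'(2)] by (simp add: hc_def)
    then show "in_colours R (ho q) ! i = map hc (in_colours Q q) ! i" using i by simp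
  qed (simp add: ar[OF q])
  have hsub: "substitutable R (ho q) (map ho rs)" if s: "substitutable Q q rs" for q rs
  proof -
    have "set rs \<subseteq> Ops Q" using s by (simp add: substitutable_def)
    then have "map (out_colour R) (map ho rs) = map hc (map (out_colour Q) rs)" using hcout by (auto simp: subset_iff)
    then show ?thesis using s ho(1) hin by (auto simp: substitutable_def simp del: map_map)
  qed
  have hS: "ho (Subst Q q rs) = Subst R (ho q) (map ho rs)" if s: "substitutable Q q rs" for q rs
  proof (rule B.Subst_eqI[OF hsub[OF s]])
    note d = A.Q.substitutableD[OF s] and z = A.Q.Subst_op[OF s]
    have rs: "set rs \<subseteq> Ops Q" using s by (simp add: substitutable_def)
    have m: "map (op_map G) (map ho rs) = map (op_map F) rs" using rs ho(2) by auto
    note u = A.P.uparr_arrow[OF A.F_substitutable[OF s]]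
    show "ho (Subst Q q rs) \<in> Ops R" by (rule ho(1)[OF z])
    show "op_map G (ho (Subst Q q rs)) = Subst P (op_map G (ho q)) (map (op_map G) (map ho rs))"
      unfolding m using ho(2) z d(1) A.F_simps(4)[OF s] by simp
    show "src (lift R P G (A.P.uparr (op_map G (ho q)) (map (op_map G) (map ho rs))) (ho (Subst Q q rs))) = ho q"
      unfolding m ho(2)[OF d(1)] using nat[OF z u(1)] u(3) A.F_simps(4)[OF s] A.restr_up[OF s] by simp
    fix i assume "i < length (map ho rs)"
    then have i: "i < length rs" by simp
    have i': "i < length (map (op_map F) rs)" using i by simp
    note l = A.P.lowarr_arrow[OF A.F_substitutable[OF s] i']
    show "src (lift R P G (A.P.lowarr (op_map G (ho q)) (map (op_map G) (map ho rs)) i) (ho (Subst Q q rs))) = map ho rs ! i"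
      unfolding m ho(2)[OF d(1)] using nat[OF z l(1)] l(3) A.F_simps(4)[OF s] A.restr_low[OF s i] i by simp
  qed
  have hA: "ho (Act Q q xs) = Act R (ho q) xs" if q: "q \<in> Ops Q" and xs: "perm_list (arity Q q) xs" for q xs
  proof (rule B.Act_eqI[OF ho(1)[OF q]])
    note z = A.Q.Act_op[OF q xs]
    have xs': "perm_list (arity P (op_map F q)) xs" using xs q by (simp add: A.F_arity)
    note a = A.P.permarr_arrow[OF A.F_Op[OF q] xs']
    show "perm_list (arity R (ho q)) xs" using xs ar[OF q] by simp
    show "ho (Act Q q xs) \<in> Ops R" by (rule ho(1)[OF z])
    show "op_map G (ho (Act Q q xs)) = Act P (op_map G (ho q)) xs" using ho(2) z q A.F_simps(5)[OF q xs] by simp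
    show "src (lift R P G (A.P.permarr (op_map G (ho q)) xs) (ho (Act Q q xs))) = ho q"
      unfolding ho(2)[OF q] using nat[OF z a(1)] a(3) A.F_simps(5)[OF q xs] A.restr_perm[OF q xs] by simp
  qed
  define h where "h = \<lparr>col_map = restrict hc (Colours Q), op_map = restrict ho (Ops Q)\<rparr>"
  have h: "h \<in> operad_maps Q R" unfolding operad_maps_def mem_Collect_eq
  proof (intro conjI ballI allI impI)
    show "op_map h \<in> Ops Q \<rightarrow>\<^sub>E Ops R" using ho(1) by (auto simp: h_def)
    show "col_map h \<in> Colours Q \<rightarrow>\<^sub>E Colours R" using B.Q.output_colour[OF ho(1)[OF A.Q.Unit_op]] by (auto simp: h_def hc_def)
    show "in_colours R (op_map h p) = map (col_map h) (in_colours Q p)" if "p \<in> Ops Q" for p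
      using hin[OF that] A.Q.inputs_colours[OF that] that by (auto simp: h_def subset_iff)
    show "out_colour R (op_map h p) = col_map h (out_colour Q p)" if "p \<in> Ops Q" for p
      using hcout[OF that] A.Q.output_colour[OF that] that by (simp add: h_def)
    show "op_map h (Unit Q c) = Unit R (col_map h c)" if "c \<in> Colours Q" for c
      using hounit[OF that] A.Q.Unit_op[OF that] that by (simp add: h_def)
    show "op_map h (Subst Q p qs) = Subst R (op_map h p) (map (op_map h) qs)" if s: "substitutable Q p qs" for p qs
    proof -
      have "set qs \<subseteq> Ops Q" using s by (simp add: substitutable_def)
      then have m: "map (op_map h) qs = map ho qs" by (auto simp: h_def)
      show ?thesis unfolding m using hS[OF s] A.Q.Subst_op[OF s] A.Q.substitutableD(1)[OF s] by (simp add: h_def)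
    qed
    show "op_map h (Act Q p xs) = Act R (op_map h p) xs" if "p \<in> Ops Q" "perm_list (arity Q p) xs" for p xs
      using hA[OF that] A.Q.Act_op[OF that] that by (simp add: h_def)
  qed
  have "operad_map_comp Q G h = F"
  proof -
    have "compose (Ops Q) (op_map G) (op_map h) = op_map F"
      by (rule extensionalityI[of _ "Ops Q"]) (use A.F ho(2) in \<open>auto simp: operad_maps_def PiE_iff h_def compose_def\<close>)
    moreover have "col_map G (hc d) = col_map F d" if d: "d \<in> Colours Q" for d
      using B.F_simps(2)[OF ho(1)[OF A.Q.Unit_op[OF d]]] ho(2)[OF A.Q.Unit_op[OF d]] A.F_simps(2)[OF A.Q.Unit_op[OF d]] A.Q.Unit_output[OF d]
      by (simp add: hc_def)
    then have "compose (Colours Q) (col_map G) (col_map h) = col_map F"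
      by (intro extensionalityI[of _ "Colours Q"]) (use A.F in \<open>auto simp: operad_maps_def PiE_iff h_def compose_def\<close>)
    ultimately show ?thesis by (simp add: operad_map_comp_def)
  qed
  moreover have "fibre_map Q P F h = \<alpha>"
  proof
    fix p
    show "fibre_map Q P F h p = \<alpha> p"
    proof (cases "p \<in> Ops P")
      case True
      have "\<alpha> p \<in> extensional {q \<in> Ops Q. op_map F q = p}" using PiE_mem[OF aE True] by (simp add: PiE_iff)
      then show ?thesis using True by (intro extensionalityI[of _ "{q \<in> Ops Q. op_map F q = p}"]) (auto simp: fibre_map_def h_def ho_def)
    next
      case False
      then show ?thesis using aE by (auto simp: fibre_map_def PiE_def extensional_def)
    qed
  qed
  ultimately show ?thesis using that h by blast
qed

end

section \<open>The operad of elements\<close>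

lemma concat_index:
  assumes "n < length (concat xss)"
  obtains i j where "i < length xss" "j < length (xss ! i)" "n = sum_list (map length (take i xss)) + j" using assms
proof (induction xss arbitrary: n thesis)
  case (Cons xs xss)
  show ?case
  proof (cases "n < length xs")
    case True
    then show ?thesis using Cons.prems(1)[of 0 n] by simp
  next
    case False
    then have "n - length xs < length (concat xss)" using Cons.prems(2) by simp
    then obtain i j where "i < length xss" "j < length (xss ! i)" "n - length xs = sum_list (map length (take i xss)) + j" using Cons.IH by blast
    then show ?thesis using Cons.prems(1)[of "Suc i" j] False by simp
  qed
qed simp

text \<open>Operations of an operad form one set, so sections over different operations have to be
  disjoint; \<open>pr\<close> witnesses this by returning the operation below a section.
  \<open>fibre_surjective\<close> arranges it by tagging.\<close>

locale elements = dspace P X for P :: "('c, 'o) operad" and X :: "('o, 'o tw_arr, 'u) presheaf" +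
  fixes pr :: "'u \<Rightarrow> 'o"
  assumes pr: "p \<in> Ops P \<Longrightarrow> x \<in> Sect X p \<Longrightarrow> pr x = p"
begin

definition elems :: "'u set" where
  "elems = {x. pr x \<in> Ops P \<and> x \<in> Sect X (pr x)}"

text \<open>Colours are taken to be the elements over unit operations: then input and output colours
  are simply restrictions, and each colour can serve as its own unit.\<close>

definition Q :: "('u, 'u) operad" where
  "Q = \<lparr>Colours = {x \<in> elems. pr x \<in> Unit P ` Colours P}, Ops = elems,
    in_colours = (\<lambda>x. map (\<lambda>i. res (inarr (pr x) i) x) [0..<ar (pr x)]),
    out_colour = (\<lambda>x. res (outarr (pr x)) x), Unit = id,
    Subst = (\<lambda>x ys. THE z. glues (pr x) (map pr ys) (length ys) x ys z),
    Act = (\<lambda>x xs. THE z. z \<in> Sect X (Act P (pr x) xs) \<and> res (permarr (pr x) xs) z = x)\<rparr>"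

definition F :: "('u, 'u, 'c, 'o) operad_map" where
  "F = \<lparr>col_map = (\<lambda>c \<in> Colours Q. out (pr c)), op_map = restrict pr elems\<rparr>"

lemma elemsD: "x \<in> elems \<Longrightarrow> pr x \<in> Ops P" "x \<in> elems \<Longrightarrow> x \<in> Sect X (pr x)" by (auto simp: elems_def)

lemma elemsI: "p \<in> Ops P \<Longrightarrow> x \<in> Sect X p \<Longrightarrow> x \<in> elems" by (simp add: elems_def pr)

lemma restr_el:
  assumes "f \<in> arrs" "x \<in> elems" "tgt f = pr x"
  shows "res f x \<in> elems" "pr (res f x) = src f" using restr_mem[of f x] assms elemsD(2) elemsI pr arrow_basic(1)[of f] by auto

lemma restr_comp:
  assumes "f \<in> arrs" "g \<in> arrs" "src g = tgt f" "x \<in> elems" "tgt g = pr x"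
  shows "res f (res g x) = res (cmp g f) x" using restr_compose[of f g x] assms elemsD(2) by simp

lemma Q_simps [simp]: "Ops Q = elems" "Unit Q x = x" "arity Q x = ar (pr x)"
  "Colours Q = {x \<in> elems. pr x \<in> Unit P ` Colours P}" "out_colour Q x = res (outarr (pr x)) x" by (simp_all add: Q_def)

lemma in_nth [simp]: "i < ar (pr x) \<Longrightarrow> in_colours Q x ! i = res (inarr (pr x) i) x" by (simp add: Q_def)

lemma out_el: "x \<in> elems \<Longrightarrow> res (outarr (pr x)) x \<in> elems"
  "x \<in> elems \<Longrightarrow> pr (res (outarr (pr x)) x) = Unit P (out (pr x))"
  using restr_el[OF outarr_arrow(1)] outarr_arrow elemsD(1) by simp_all

lemma in_el: "x \<in> elems \<Longrightarrow> i < ar (pr x) \<Longrightarrow> res (inarr (pr x) i) x \<in> elems"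
  "x \<in> elems \<Longrightarrow> i < ar (pr x) \<Longrightarrow> pr (res (inarr (pr x) i) x) = Unit P (ins (pr x) ! i)"
  using restr_el[OF inarr_arrow(1)] inarr_arrow elemsD(1) by simp_all

text \<open>Matching colours of elements lie over equal unit operations, and a unit operation of
  \<open>P\<close> determines its colour; hence the underlying operations can be composed.\<close>

lemma subD:
  assumes s: "substitutable Q x ys"
  shows "x \<in> elems" "length ys = ar (pr x)" "i < length ys \<Longrightarrow> ys ! i \<in> elems"
    "i < length ys \<Longrightarrow> res (inarr (pr x) i) x = res (outarr (pr (ys ! i))) (ys ! i)"
    "sub (pr x) (map pr ys)"
proof -
  from s have a: "x \<in> elems" "set ys \<subseteq> elems" "map (out_colour Q) ys = in_colours Q x" by (simp_all add: substitutable_def)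
  show x: "x \<in> elems" by (rule a)
  show l: "length ys = ar (pr x)" using arg_cong[OF a(3), of length] by simp
  have y: "ys ! i \<in> elems" if "i < length ys" for i using a(2) that nth_mem by blast
  then show "i < length ys \<Longrightarrow> ys ! i \<in> elems" .
  have e: "res (inarr (pr x) i) x = res (outarr (pr (ys ! i))) (ys ! i)" if "i < length ys" for i
    using arg_cong[OF a(3), of "\<lambda>l. l ! i"] that l by simp
  then show "i < length ys \<Longrightarrow> res (inarr (pr x) i) x = res (outarr (pr (ys ! i))) (ys ! i)" .
  have "out (pr (ys ! i)) = ins (pr x) ! i" if i: "i < length ys" for i
  proof -
    have "Unit P (out (pr (ys ! i))) = Unit P (ins (pr x) ! i)" using arg_cong[OF e[OF i], of pr] in_el(2)[OF x] out_el(2)[OF y[OF i]] i l by simp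
    then show ?thesis using Unit_output[OF output_colour] Unit_output[OF in_colour] elemsD(1)[OF x] elemsD(1)[OF y[OF i]] i l by metis
  qed
  then have "map out (map pr ys) = ins (pr x)" using l by (intro nth_equalityI) simp_all
  then show "sub (pr x) (map pr ys)" using a elemsD(1) by (auto simp: substitutable_def)
qed

lemma subI:
  assumes "x \<in> elems" "length ys = ar (pr x)" "\<And>i. i < length ys \<Longrightarrow> ys ! i \<in> elems"
    "\<And>i. i < length ys \<Longrightarrow> res (inarr (pr x) i) x = res (outarr (pr (ys ! i))) (ys ! i)"
  shows "substitutable Q x ys"
proof -
  have "map (out_colour Q) ys = in_colours Q x" using assms(2,4) by (intro nth_equalityI) simp_all
  moreover have "set ys \<subseteq> elems" using assms(3) by (metis in_set_conv_nth subsetI)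
  ultimately show ?thesis using assms(1) by (simp add: substitutable_def)
qed

lemma Subst_ex1:
  assumes s: "substitutable Q x ys"
  shows "\<exists>!z. glues (pr x) (map pr ys) (length ys) x ys z"
  using segal[OF subD(5)[OF s] elemsD(2)[OF subD(1)[OF s]], of ys] subD(3,4)[OF s] elemsD(2) by simp

lemma Q_Subst:
  assumes s: "substitutable Q x ys"
  shows "Subst Q x ys \<in> elems" "pr (Subst Q x ys) = Subst P (pr x) (map pr ys)"
    "res (uparr (pr x) (map pr ys)) (Subst Q x ys) = x"
    "i < length ys \<Longrightarrow> res (lowarr (pr x) (map pr ys) i) (Subst Q x ys) = ys ! i"
proof -
  have "glues (pr x) (map pr ys) (length ys) x ys (Subst Q x ys)" using theI'[OF Subst_ex1[OF s]] by (simp add: Q_def)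
  moreover have "Subst P (pr x) (map pr ys) \<in> Ops P" by (rule Subst_op[OF subD(5)[OF s]])
  ultimately show "Subst Q x ys \<in> elems" "pr (Subst Q x ys) = Subst P (pr x) (map pr ys)"
    "res (uparr (pr x) (map pr ys)) (Subst Q x ys) = x"
    "i < length ys \<Longrightarrow> res (lowarr (pr x) (map pr ys) i) (Subst Q x ys) = ys ! i" unfolding glues_def using elemsI pr by auto
qed

lemma Subst_eq:
  assumes s: "substitutable Q x ys" and z: "z \<in> elems" "pr z = Subst P (pr x) (map pr ys)"
    "res (uparr (pr x) (map pr ys)) z = x"
    "\<And>i. i < length ys \<Longrightarrow> res (lowarr (pr x) (map pr ys) i) z = ys ! i"
  shows "z = Subst Q x ys"
proof -
  have "glues (pr x) (map pr ys) (length ys) x ys z" using z elemsD(2)[OF z(1)] by (simp add: glues_def)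
  then have "(THE z. glues (pr x) (map pr ys) (length ys) x ys z) = z" using Subst_ex1[OF s] by (simp add: the1_equality)
  then show ?thesis by (simp add: Q_def)
qed

text \<open>The restrictions match by \<open>lowarr_outarr\<close>, and by uniqueness of gluing
  their composite is \<open>z\<close>. So elements over a composite operation can be taken apart,
  which is how arrows are lifted.\<close>

lemma decompose:
  assumes s: "sub p qs" and z: "z \<in> elems" "pr z = Subst P p qs"
    and x: "x = res (uparr p qs) z" and ys: "ys = map (\<lambda>i. res (lowarr p qs i) z) [0..<length qs]"
  shows "substitutable Q x ys" "Subst Q x ys = z" "pr x = p" "map pr ys = qs"
proof -
  note u = uparr_arrow[OF s] and l = lowarr_arrow[OF s]
  note d = substitutableD[OF s]
  have x': "x \<in> elems" "pr x = p" using restr_el[OF u(1) z(1)] u z(2) by (simp_all add: x)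
  have y: "ys ! i \<in> elems" "pr (ys ! i) = qs ! i" if "i < length qs" for i
    using restr_el[OF l(1)[OF that] z(1)] l[OF that] z(2) that by (simp_all add: ys)
  have ly: "length ys = length qs" by (simp add: ys)
  show m: "map pr ys = qs" using y ly by (intro nth_equalityI) simp_all
  show "pr x = p" by (rule x')
  show s': "substitutable Q x ys"
  proof (rule subI[OF x'(1)])
    show "length ys = ar (pr x)" using x' ly d by simp
    fix i assume "i < length ys"
    then have i: "i < length qs" using ly by simp
    show "ys ! i \<in> elems" by (rule y(1)[OF i])
    have i': "i < ar p" using i d by simp
    show "res (inarr (pr x) i) x = res (outarr (pr (ys ! i))) (ys ! i)"
      unfolding x'(2) y(2)[OF i] using restr_comp[OF inarr_arrow(1)[OF d(1) i'] u(1) _ z(1)] restr_comp[OF outarr_arrow(1)[OF d(3)[OF i]] l(1)[OF i] _ z(1)]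
        lowarr_outarr[OF s i] u l[OF i] inarr_arrow(3)[OF d(1) i'] outarr_arrow(3)[OF d(3)[OF i]] z(2) i by (simp add: x ys)
  qed
  show "Subst Q x ys = z" using Subst_eq[OF s' z(1)] z(2) m x'(2) by (simp add: x[symmetric]) (simp add: ys)
qed

lemma Q_Act:
  assumes x: "x \<in> elems" and xs: "perm_list (ar (pr x)) xs"
  shows "Act Q x xs \<in> elems" "pr (Act Q x xs) = Act P (pr x) xs" "res (permarr (pr x) xs) (Act Q x xs) = x"
proof -
  have "Act Q x xs \<in> Sect X (Act P (pr x) xs) \<and> res (permarr (pr x) xs) (Act Q x xs) = x"
    using theI'[OF perm_ex1[OF elemsD(1)[OF x] xs elemsD(2)[OF x]]] by (simp add: Q_def)
  moreover have "Act P (pr x) xs \<in> Ops P" by (rule Act_op[OF elemsD(1)[OF x] xs])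
  ultimately show "Act Q x xs \<in> elems" "pr (Act Q x xs) = Act P (pr x) xs" "res (permarr (pr x) xs) (Act Q x xs) = x" using elemsI pr by auto
qed

lemma Act_eq:
  assumes p: "p \<in> Ops P" and xs: "perm_list (ar p) xs" and z: "z \<in> elems" "pr z = Act P p xs"
    and x: "res (permarr p xs) z = x"
  shows "x \<in> elems" "pr x = p" "z = Act Q x xs"
proof -
  note a = permarr_arrow[OF p xs]
  show x': "x \<in> elems" "pr x = p" using restr_el[OF a(1) z(1)] a z(2) x by auto
  have "z \<in> Sect X (Act P p xs) \<and> res (permarr p xs) z = x" using z elemsD(2)[OF z(1)] x by simp
  then show "z = Act Q x xs" using perm_ex1[OF p xs, of x] elemsD(2)[OF x'(1)] x'(2) by (simp add: Q_def the1_equality)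
qed

section \<open>The operad axioms for elements\<close>

lemma nested_sub:
  assumes s: "substitutable Q x ys" and r: "list_all2 (substitutable Q) ys rss"
  shows "list_all2 sub (map pr ys) (map (map pr) rss)" "length rss = length ys"
    "\<And>i. i < length ys \<Longrightarrow> substitutable Q (ys ! i) (rss ! i)"
    "map pr (map2 (Subst Q) ys rss) = map2 (Subst P) (map pr ys) (map (map pr) rss)"
proof -
  show l: "length rss = length ys" using r by (simp add: list_all2_lengthD)
  show si: "substitutable Q (ys ! i) (rss ! i)" if "i < length ys" for i using r that by (simp add: list_all2_conv_all_nth)
  show "list_all2 sub (map pr ys) (map (map pr) rss)" using si l subD(5) by (simp add: list_all2_conv_all_nth)
  show "map pr (map2 (Subst Q) ys rss) = map2 (Subst P) (map pr ys) (map (map pr) rss)" using l Q_Subst(2)[OF si] by (intro nth_equalityI) simp_all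
qed

lemma Q_Subst_output:
  assumes s: "substitutable Q x ys"
  shows "out_colour Q (Subst Q x ys) = out_colour Q x"
proof -
  note q = Q_Subst[OF s] and sp = subD(5)[OF s]
  note u = uparr_arrow[OF sp] and d = substitutableD[OF sp]
  show ?thesis using restr_comp[OF outarr_arrow(1)[OF d(1)] u(1) _ q(1)] outarr_arrow(3)[OF d(1)] outarr_Subst[OF sp] u q by simp
qed

lemma Q_Subst_inputs:
  assumes s: "substitutable Q x ys"
  shows "in_colours Q (Subst Q x ys) = concat (map (in_colours Q) ys)"
proof -
  let ?A = "map (in_colours Q) ys"
  note q = Q_Subst[OF s] and sp = subD(5)[OF s]
  note d = substitutableD[OF sp]
  have len: "length (concat ?A) = ar (pr (Subst Q x ys))" by (simp add: q Subst_inputs[OF sp] length_concat comp_def)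
  show ?thesis
  proof (rule nth_equalityI)
    fix n assume "n < length (in_colours Q (Subst Q x ys))"
    then have n0: "n < length (concat ?A)" and n: "n < ar (pr (Subst Q x ys))" by (simp_all only: len Q_simps)
    from n0 obtain i j where i: "i < length ?A" and j: "j < length (map (in_colours Q) ys ! i)"
      and nij: "n = sum_list (map length (take i ?A)) + j" by (rule concat_index)
    have i': "i < length (map pr ys)" and i2: "i < length ys" and j': "j < ar (pr (ys ! i))" using i j by simp_all
    then have j2: "j < ar (map pr ys ! i)" by simp
    have n2: "n = sum_list (map ar (take i (map pr ys))) + j" by (simp add: nij take_map comp_def)
    note l = lowarr_arrow[OF sp i']
    have "res (inarr (pr (Subst Q x ys)) n) (Subst Q x ys)
        = res (inarr (map pr ys ! i) j) (res (lowarr (pr x) (map pr ys) i) (Subst Q x ys))"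
      using inarr_Subst[OF sp i' j2] restr_comp[OF inarr_arrow(1)[OF d(3)[OF i'] j2] l(1) _ q(1)] inarr_arrow(3)[OF d(3)[OF i'] j2] l q(2)
      by (simp add: n2)
    then have "in_colours Q (Subst Q x ys) ! n = in_colours Q (ys ! i) ! j" using n j' q(4)[OF i2] i2 by simp
    then show "in_colours Q (Subst Q x ys) ! n = concat ?A ! n" using nth_concat_offset[OF i j] i2 by (simp add: nij)
  qed (simp only: len Q_simps)
qed

text \<open>The left side is recognised as the composite on the right by its restrictions. Along
  \<open>uparr\<close> this is \<open>uparr_uparr\<close>; along \<open>lowarr\<close> the
  restriction has to be the composite of \<open>ys ! i\<close> with \<open>rss ! i\<close>, which is
  recognised in the same way by \<open>lowarr_uparr\<close> and
  \<open>lowarr_lowarr\<close>.\<close>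

lemma Q_Subst_assoc:
  assumes s: "substitutable Q x ys" and r: "list_all2 (substitutable Q) ys rss"
  shows "Subst Q (Subst Q x ys) (concat rss) = Subst Q x (map2 (Subst Q) ys rss)"
proof -
  let ?A = "map2 (Subst Q) ys rss"
  let ?B = "map (map pr) rss"
  let ?C = "Subst P (pr x) (map pr ys)"
  note q = Q_Subst[OF s] and sp = subD(5)[OF s] and ns = nested_sub[OF s r]
  note np = nested_substitutable[OF sp ns(1)] and e = Q_Subst[OF ns(3)]
  have m: "map pr (concat rss) = concat ?B" by (simp add: map_concat)
  have s1: "substitutable Q (Subst Q x ys) (concat rss)"
  proof -
    have "map (map (out_colour Q)) rss = map (in_colours Q) ys" using ns(2,3) by (intro nth_equalityI) (simp_all add: substitutable_def)
    moreover have "\<forall>rs \<in> set rss. set rs \<subseteq> elems" using ns(2,3) unfolding substitutable_def by (metis in_set_conv_nth Q_simps(1))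
    ultimately show ?thesis using q(1) Q_Subst_inputs[OF s] by (auto simp: substitutable_def map_concat)
  qed
  have s2: "substitutable Q x ?A"
  proof -
    have "map (out_colour Q) ?A = map (out_colour Q) ys" using ns(2) Q_Subst_output[OF ns(3)] by (intro nth_equalityI) simp_all
    moreover have "set ?A \<subseteq> elems" using e(1) ns(2) by (auto simp: set_zip)
    ultimately show ?thesis using s unfolding substitutable_def Q_simps(1) by metis
  qed
  let ?z = "Subst Q (Subst Q x ys) (concat rss)"
  note z = Q_Subst[OF s1]
  note u = uparr_arrow[OF sp] and u1 = uparr_arrow[OF np(1)]
  have zt: "tgt (uparr ?C (concat ?B)) = pr ?z" using u1(3) z(2) q(2) m by simp
  have z3: "res (uparr ?C (concat ?B)) ?z = Subst Q x ys" using z(3) by (simp only: q(2) m)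
  show ?thesis
  proof (rule Subst_eq[OF s2 z(1)])
    show "pr ?z = Subst P (pr x) (map pr ?A)" using z(2) np(3) by (simp only: ns(4) m q(2))
    show "res (uparr (pr x) (map pr ?A)) ?z = x"
      using restr_comp[OF u(1) u1(1) _ z(1) zt] u1(2) u(3) z3 q(3) by (simp only: ns(4) uparr_uparr[OF sp ns(1)])
    fix i assume "i < length ?A"
    then have i: "i < length ys" using ns(2) by simp
    have i': "i < length (map pr ys)" using i by simp
    let ?l = "lowarr (pr x) (map2 (Subst P) (map pr ys) ?B) i"
    have i2: "i < length (map2 (Subst P) (map pr ys) ?B)" using i ns(2) by simp
    have n2: "map2 (Subst P) (map pr ys) ?B ! i = Subst P (pr (ys ! i)) (map pr (rss ! i))" using i ns(2) by simp
    note l = lowarr_arrow[OF np(2) i2, unfolded n2] and l0 = lowarr_arrow[OF sp i']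
    have lt: "tgt ?l = pr ?z" using l(3) np(3) z(2) by (simp only: q(2) m)
    note si = ns(3)[OF i]
    note sip = subD(5)[OF si]
    note ui = uparr_arrow[OF sip] and w = restr_el[OF l(1) z(1) lt]
    have "res ?l ?z = Subst Q (ys ! i) (rss ! i)"
    proof (rule Subst_eq[OF si w(1)])
      show "pr (res ?l ?z) = Subst P (pr (ys ! i)) (map pr (rss ! i))" using w(2) l(2) by simp
      have "res (uparr (pr (ys ! i)) (map pr (rss ! i))) (res ?l ?z) = res (lowarr (pr x) (map pr ys) i) (Subst Q x ys)"
        using restr_comp[OF ui(1) l(1) _ z(1) lt] restr_comp[OF l0(1) u1(1) _ z(1) zt] l(2) ui(3) l0(3) u1(2) z3
          lowarr_uparr[OF sp ns(1) i'] i ns(2) by simp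
      then show "res (uparr (pr (ys ! i)) (map pr (rss ! i))) (res ?l ?z) = ys ! i" using q(4)[OF i] by simp
      fix j assume j: "j < length (rss ! i)"
      then have j': "j < length (map pr (rss ! i))" and j2: "j < length (map (map pr) rss ! i)" using i ns(2) by simp_all
      have ir: "i < length rss" using i ns(2) by simp
      note lj = lowarr_arrow[OF sip j']
      let ?n = "sum_list (map length (take i rss)) + j"
      have nn: "sum_list (map length (take i ?B)) = sum_list (map length (take i rss))" by (simp add: take_map comp_def)
      have nl: "?n < length (concat rss)"
      proof -
        have "length (concat rss) = sum_list (map length (take i rss)) + length (rss ! i) + sum_list (map length (drop (Suc i) rss))"
          using ir by (subst id_take_nth_drop[OF ir]) (simp add: length_concat)
        then show ?thesis using j by simp
      qed
      have "res (lowarr (pr (ys ! i)) (map pr (rss ! i)) j) (res ?l ?z)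
          = res (lowarr ?C (concat ?B) ?n) ?z"
        using restr_comp[OF lj(1) l(1) _ z(1) lt] l(2) lj(3) lowarr_lowarr[OF sp ns(1) i' j2] i ir nn by simp
      also have "\<dots> = concat rss ! ?n" using z(4)[OF nl] by (simp only: q(2) m)
      also have "\<dots> = rss ! i ! j" by (rule nth_concat_offset[OF ir j])
      finally show "res (lowarr (pr (ys ! i)) (map pr (rss ! i)) j) (res ?l ?z) = rss ! i ! j" .
    qed
    then show "res (lowarr (pr x) (map pr ?A) i) ?z = map2 (Subst Q) ys rss ! i" unfolding ns(4) using i ns(2) by simp
  qed
qed

lemma Q_Act_inputs:
  assumes x: "x \<in> elems" and xs: "perm_list (ar (pr x)) xs" and k: "k < ar (pr x)"
  shows "in_colours Q (Act Q x xs) ! (xs ! k) = in_colours Q x ! k"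
proof -
  note q = Q_Act[OF x xs] and p = elemsD(1)[OF x]
  note a = permarr_arrow[OF p xs]
  have "xs ! k < ar (pr (Act Q x xs))" using perm_list_nth_less[OF xs k] Act_arity[OF p xs] q(2) by simp
  then show ?thesis using restr_comp[OF inarr_arrow(1)[OF p k] a(1) _ q(1)] inarr_arrow(3)[OF p k] a q inarr_Act[OF p xs k] k by simp
qed

lemma Q_Act_output:
  assumes x: "x \<in> elems" and xs: "perm_list (ar (pr x)) xs"
  shows "out_colour Q (Act Q x xs) = out_colour Q x"
proof -
  note q = Q_Act[OF x xs] and p = elemsD(1)[OF x]
  note a = permarr_arrow[OF p xs]
  show ?thesis using restr_comp[OF outarr_arrow(1)[OF p] a(1) _ q(1)] outarr_arrow(3)[OF p] a q outarr_Act[OF p xs] by simp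
qed

lemma Q_Act_Act:
  assumes x: "x \<in> elems" and xs: "perm_list (ar (pr x)) xs" and ys: "perm_list (ar (pr x)) ys"
  shows "Act Q (Act Q x xs) ys = Act Q x (map ((!) ys) xs)"
proof -
  note q = Q_Act[OF x xs] and p = elemsD(1)[OF x]
  have ys': "perm_list (ar (pr (Act Q x xs))) ys" using ys Act_arity[OF p xs] q(2) by simp
  note q' = Q_Act[OF q(1) ys']
  note a = permarr_arrow[OF p xs] and b = permarr_arrow[OF elemsD(1)[OF q(1)] ys']
  show ?thesis
  proof (rule Act_eq(3)[OF p perm_list_comp[OF xs ys] q'(1)])
    show "pr (Act Q (Act Q x xs) ys) = Act P (pr x) (map ((!) ys) xs)" using q' q Act_Act[OF p xs ys] by simp
    show "res (permarr (pr x) (map ((!) ys) xs)) (Act Q (Act Q x xs) ys) = x"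
      using restr_comp[OF a(1) b(1) _ q'(1)] a b q q' permarr_permarr[OF p xs ys] by simp
  qed
qed

lemma offset_Q: "offset Q ys i = offset P (map pr ys) i" by (simp add: offset_def take_map comp_def)

text \<open>Restriction along the \<open>permarr\<close> of the block permutation undoes the action;
  what remains is recognised as a composite by \<open>uparr_outer\<close> and
  \<open>lowarr_outer\<close>. The inner axiom is treated alike with
  \<open>uparr_inner\<close>.\<close>

lemma Q_Subst_Act_outer:
  assumes x: "x \<in> elems" and xs: "perm_list (ar (pr x)) xs" and s: "substitutable Q (Act Q x xs) ys"
  shows "Subst Q (Act Q x xs) ys = Act Q (Subst Q x (map ((!) ys) xs)) (outer_perm Q ys xs)"
proof -
  let ?A = "map ((!) ys) xs"
  note q = Q_Act[OF x xs] and p = elemsD(1)[OF x] and z = Q_Subst[OF s] and d = subD[OF s]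
  have sp: "sub (Act P (pr x) xs) (map pr ys)" using d(5) q(2) by simp
  note o = outer[OF p xs sp]
  have ly: "length ys = ar (pr x)" using d(2) q(2) Act_arity[OF p xs] by simp
  have lx: "length xs = ar (pr x)" by (rule perm_list_length[OF xs])
  have m: "map ((!) (map pr ys)) xs = map pr ?A" using perm_list_mem_less[OF xs] ly by simp
  have op: "outer_perm Q ys xs = outer_perm P (map pr ys) xs" by (simp only: offset_Q)
  have s': "substitutable Q x ?A"
  proof (rule subI[OF x])
    fix i assume "i < length ?A"
    then have i: "i < ar (pr x)" using lx by simp
    then have xi: "xs ! i < length ys" using perm_list_nth_less[OF xs] ly by simp
    show "map ((!) ys) xs ! i \<in> elems" using d(3)[OF xi] i lx by simp
    have xi': "xs ! i < ar (pr (Act Q x xs))" using xi d(2) by simp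
    show "res (inarr (pr x) i) x = res (outarr (pr (map ((!) ys) xs ! i))) (map ((!) ys) xs ! i)"
      using Q_Act_inputs[OF x xs i] d(4)[OF xi] xi' i lx by simp
  qed (simp add: lx)
  let ?z = "Subst Q (Act Q x xs) ys" and ?g = "permarr (Subst P (pr x) (map pr ?A)) (outer_perm P (map pr ys) xs)"
  note o' = o(1-3)[unfolded m]
  note g = permarr_arrow[OF Subst_op[OF o'(1)] o'(2)] and a = permarr_arrow[OF p xs]
  have pz: "pr ?z = Act P (Subst P (pr x) (map pr ?A)) (outer_perm P (map pr ys) xs)" using z(2) q(2) o'(3) by simp
  have gz: "tgt ?g = pr ?z" using g(3) pz by simp
  note w = restr_el[OF g(1) z(1) gz]
  note u = uparr_arrow[OF o'(1)] and u0 = uparr_arrow[OF sp]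
  have "res ?g ?z = Subst Q x ?A"
  proof (rule Subst_eq[OF s' w(1)])
    show "pr (res ?g ?z) = Subst P (pr x) (map pr ?A)" using w(2) g(2) by simp
    have "res (uparr (pr x) (map pr ?A)) (res ?g ?z) = res (permarr (pr x) xs) (res (uparr (Act P (pr x) xs) (map pr ys)) ?z)"
      using restr_comp[OF u(1) g(1) _ z(1) gz] restr_comp[OF a(1) u0(1) _ z(1)] u(3) g(2) a(3) u0 uparr_outer[OF p xs sp, unfolded m] z(2) q(2) by simp
    then show "res (uparr (pr x) (map pr ?A)) (res ?g ?z) = x" using z(3) q by simp
    fix k assume "k < length ?A"
    then have k: "k < ar (pr x)" and k': "k < length (map pr ?A)" and k2: "k < length xs" using lx by simp_all
    have xk: "xs ! k < length ys" using perm_list_nth_less[OF xs k] ly by simp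
    note l = lowarr_arrow[OF o'(1) k']
    have "res (lowarr (pr x) (map pr ?A) k) (res ?g ?z) = res (lowarr (Act P (pr x) xs) (map pr ys) (xs ! k)) ?z"
      using restr_comp[OF l(1) g(1) _ z(1) gz] l(3) g(2) lowarr_outer[OF p xs sp k, unfolded m] by (simp only:)
    then show "res (lowarr (pr x) (map pr ?A) k) (res ?g ?z) = map ((!) ys) xs ! k" using z(4)[OF xk] q(2) k2 by simp
  qed
  then show ?thesis unfolding op using Act_eq(3)[OF Subst_op[OF o'(1)] o'(2) z(1) pz] by simp
qed

lemma Q_Subst_Act_inner:
  assumes s: "substitutable Q x ys" and ps: "list_all2 (\<lambda>q ys. perm_list (arity Q q) ys) ys pss"
  shows "Subst Q x (map2 (Act Q) ys pss) = Act Q (Subst Q x ys) (inner_perm Q ys pss)"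
proof -
  have l: "length pss = length ys" using ps by (simp add: list_all2_lengthD)
  have pi: "perm_list (ar (pr (ys ! i))) (pss ! i)" if "i < length ys" for i using ps that by (simp add: list_all2_conv_all_nth)
  note d = subD[OF s]
  have ps': "list_all2 (\<lambda>q ys. perm_list (ar q) ys) (map pr ys) pss" using pi l by (simp add: list_all2_conv_all_nth)
  note A = Q_Act[OF d(3) pi]
  note o = inner[OF d(5) ps']
  have m: "map2 (Act P) (map pr ys) pss = map pr (map2 (Act Q) ys pss)" using l A(2) by (intro nth_equalityI) simp_all
  have ip: "inner_perm Q ys pss = inner_perm P (map pr ys) pss" by (simp only: offset_Q length_map)
  have s': "substitutable Q x (map2 (Act Q) ys pss)"
  proof -
    have "map (out_colour Q) (map2 (Act Q) ys pss) = map (out_colour Q) ys" using l Q_Act_output[OF d(3) pi] by (intro nth_equalityI) simp_all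
    moreover have "set (map2 (Act Q) ys pss) \<subseteq> elems" using A(1) l by (auto simp: set_zip)
    ultimately show ?thesis using s unfolding substitutable_def Q_simps(1) by metis
  qed
  note z = Q_Subst[OF s'] and o' = o(1-3)[unfolded m]
  let ?z = "Subst Q x (map2 (Act Q) ys pss)" and ?g = "permarr (Subst P (pr x) (map pr ys)) (inner_perm P (map pr ys) pss)"
  note g = permarr_arrow[OF Subst_op[OF d(5)] o'(2)]
  have pz: "pr ?z = Act P (Subst P (pr x) (map pr ys)) (inner_perm P (map pr ys) pss)" using z(2) o'(3) by (simp only:)
  have gz: "tgt ?g = pr ?z" using g(3) pz by (simp only:)
  note w = restr_el[OF g(1) z(1) gz] and ui = uparr_inner[OF d(5) ps', unfolded m]
  note u = uparr_arrow[OF d(5)]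
  have "res ?g ?z = Subst Q x ys"
  proof (rule Subst_eq[OF s w(1)])
    show "pr (res ?g ?z) = Subst P (pr x) (map pr ys)" using w(2) g(2) by (simp only:)
    show "res (uparr (pr x) (map pr ys)) (res ?g ?z) = x" using restr_comp[OF u(1) g(1) _ z(1) gz] u(3) g(2) ui(1) z(3) by (simp only:)
    fix i assume i: "i < length ys"
    then have i': "i < length (map pr ys)" and i2: "i < length (map2 (Act Q) ys pss)" and i3: "i < length (map pr (map2 (Act Q) ys pss))"
      and n: "map pr ys ! i = pr (ys ! i)" "map pr (map2 (Act Q) ys pss) ! i = Act P (pr (ys ! i)) (pss ! i)" using l A(2) by simp_all
    note la = lowarr_arrow[OF d(5) i', unfolded n] and lb = lowarr_arrow[OF o'(1) i3, unfolded n] and a = permarr_arrow[OF elemsD(1)[OF d(3)[OF i]] pi[OF i]]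
    have "res (lowarr (pr x) (map pr ys) i) (res ?g ?z) = res (cmp ?g (lowarr (pr x) (map pr ys) i)) ?z"
      by (rule restr_comp[OF la(1) g(1) _ z(1) gz]) (simp only: la(3) g(2))
    also have "\<dots> = res (permarr (pr (ys ! i)) (pss ! i)) (res (lowarr (pr x) (map pr (map2 (Act Q) ys pss)) i) ?z)"
      using restr_comp[OF a(1) lb(1) _ z(1)] lb(2,3) a(3) ui(2)[OF i'] z(2) n(1) by (simp only:)
    also have "\<dots> = ys ! i" using z(4)[OF i2] A(3)[OF i i] i l by (simp only: ) simp
    finally show "res (lowarr (pr x) (map pr ys) i) (res ?g ?z) = ys ! i" .
  qed
  then show ?thesis unfolding ip using Act_eq(3)[OF Subst_op[OF d(5)] o'(2) z(1) pz] by simp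
qed

end

context elements
begin

text \<open>Over a unit operation \<open>inarr\<close> and \<open>outarr\<close> are identities, so
  an element is its own input and output colour.\<close>

lemma unit_elem:
  assumes "c \<in> Colours Q"
  obtains d where "d \<in> Colours P" "pr c = Unit P d" "c \<in> elems" "in_colours Q c = [c]" "out_colour Q c = c"
proof -
  from assms obtain d where d: "d \<in> Colours P" "pr c = Unit P d" "c \<in> elems" by auto
  have r: "res (tw_ident P (Unit P d)) c = c" using restr_ident[OF elemsD(1)[OF d(3)] elemsD(2)[OF d(3)]] d by simp
  have "in_colours Q c = [c]" using r inarr_Unit[OF d(1)] Unit_inputs[OF d(1)] d(2) by (intro nth_equalityI) simp_all
  moreover have "out_colour Q c = c" using r outarr_Unit[OF d(1)] d(2) by simp
  ultimately show ?thesis using that d by blast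
qed

lemma operad_Q: "operad Q"
proof (unfold_locales, goal_cases)
  case (1 p)
  then show ?case using in_el[of p] in_colour elemsD(1)[of p] by (auto simp: in_set_conv_nth)
next
  case (2 p)
  then show ?case using out_el[of p] output_colour elemsD(1)[of p] by auto
next
  case (3 c)
  then show ?case by simp
next
  case (4 c)
  then show ?case using unit_elem by (metis Q_simps(2))
next
  case (5 c)
  then show ?case using unit_elem by (metis Q_simps(2))
next
  case (6 p qs)
  then show ?case using Q_Subst(1) by simp
next
  case (7 p qs)
  then show ?case by (rule Q_Subst_inputs)
next
  case (8 p qs)
  then show ?case by (rule Q_Subst_output)
next
  case (9 p)
  then have x: "p \<in> elems" by simp
  note o = out_el[OF x] and q = elemsD[OF x]
  let ?u = "res (outarr (pr p)) p"
  have u: "?u \<in> Colours Q" using o output_colour[OF q(1)] by simp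
  obtain d where d: "in_colours Q ?u = [?u]" using unit_elem[OF u] by blast
  have s: "substitutable Q ?u [p]" using x o(1) d by (simp add: substitutable_def)
  have "p = Subst Q ?u [p]"
  proof (rule Subst_eq[OF s x])
    show "pr p = Subst P (pr ?u) (map pr [p])" using o(2) Unit_Subst[OF q(1)] by simp
    show "res (uparr (pr ?u) (map pr [p])) p = ?u" unfolding o(2) by (simp add: outarr_def)
    fix i assume "i < length [p]"
    then show "res (lowarr (pr ?u) (map pr [p]) i) p = [p] ! i" unfolding o(2) using lowarr_Unit[OF q(1)] restr_ident[OF q] by simp
  qed
  then show ?case by simp
next
  case (10 p)
  then have x: "p \<in> elems" by simp
  note q = elemsD[OF x]
  have m: "map (Unit Q) (in_colours Q p) = in_colours Q p" by (simp add: map_idI)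
  have u: "in_colours Q p ! i \<in> Colours Q" if "i < ar (pr p)" for i using in_el[OF x that] in_colour[OF q(1) that] that by simp
  have mp: "map pr (in_colours Q p) = units (pr p)" using in_el[OF x] by (intro nth_equalityI) simp_all
  have s: "substitutable Q p (in_colours Q p)"
  proof (rule subI[OF x])
    fix i assume "i < length (in_colours Q p)"
    then have i: "i < ar (pr p)" by simp
    show "in_colours Q p ! i \<in> elems" using u[OF i] by simp
    show "res (inarr (pr p) i) p = res (outarr (pr (in_colours Q p ! i))) (in_colours Q p ! i)"
      using unit_elem[OF u[OF i]] i by (metis Q_simps(5) in_nth)
  qed simp
  have "p = Subst Q p (in_colours Q p)"
  proof (rule Subst_eq[OF s x])
    show "pr p = Subst P (pr p) (map pr (in_colours Q p))" by (simp add: mp Subst_units[OF q(1)])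
    show "res (uparr (pr p) (map pr (in_colours Q p))) p = p" unfolding mp units_def using uparr_Units[OF q(1)] restr_ident[OF q] by simp
    show "res (lowarr (pr p) (map pr (in_colours Q p)) i) p = in_colours Q p ! i" if "i < length (in_colours Q p)" for i
      unfolding mp using that by (simp add: inarr_def)
  qed
  then show ?case by (simp only: m)
next
  case (11 p qs rss)
  then show ?case by (rule Q_Subst_assoc)
next
  case (12 p xs)
  then show ?case using Q_Act(1) by simp
next
  case (13 p xs)
  then show ?case using Q_Act(2) Act_arity elemsD(1) by simp
next
  case (14 p xs k)
  then show ?case using Q_Act_inputs[of p xs k] by (simp only: Q_simps)
next
  case (15 p xs)
  then show ?case using Q_Act_output[of p xs] by (simp only: Q_simps)
next
  case (16 p)
  then have x: "p \<in> elems" by simp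
  note q = elemsD[OF x]
  have "p = Act Q p [0..<ar (pr p)]"
    using Act_eq(3)[OF q(1) perm_list_upt x Act_id[OF q(1), symmetric]] permarr_ident[OF q(1)] restr_ident[OF q] by simp
  then show ?case by simp
next
  case (17 p xs ys)
  then show ?case by (intro Q_Act_Act) simp_all
next
  case (18 p xs qs)
  then show ?case by (intro Q_Subst_Act_outer) simp_all
next
  case (19 p qs yss)
  then show ?case by (rule Q_Subst_Act_inner)
qed

section \<open>The projection from the operad of elements is a decomposition morphism\<close>

sublocale M: operad_morphism Q P F
proof -
  have "F \<in> operad_maps Q P" unfolding operad_maps_def mem_Collect_eq
  proof (intro conjI ballI allI impI)
    show "op_map F \<in> Ops Q \<rightarrow>\<^sub>E Ops P" using elemsD(1) by (auto simp: F_def)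
    show "col_map F \<in> Colours Q \<rightarrow>\<^sub>E Colours P" using elemsD(1) output_colour by (auto simp: F_def)
    show "ins (op_map F p) = map (col_map F) (in_colours Q p)" if "p \<in> Ops Q" for p
      using that in_el[of p] in_colour elemsD(1)[of p] by (intro nth_equalityI) (simp_all add: F_def Unit_output)
    show "out (op_map F p) = col_map F (out_colour Q p)" if "p \<in> Ops Q" for p
      using that out_el[of p] output_colour elemsD(1)[of p] by (simp add: F_def Unit_output)
    show "op_map F (Unit Q c) = Unit P (col_map F c)" if "c \<in> Colours Q" for c using that by (auto simp: F_def Unit_output)
    show "op_map F (Subst Q p qs) = Subst P (op_map F p) (map (op_map F) qs)" if s: "substitutable Q p qs" for p qs
    proof -
      have m: "map (op_map F) qs = map pr qs" using s by (auto simp: F_def substitutable_def)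
      show ?thesis unfolding m using Q_Subst(1,2)[OF s] subD(1)[OF s] by (simp add: F_def)
    qed
    show "op_map F (Act Q p xs) = Act P (op_map F p) xs" if "p \<in> Ops Q" "perm_list (arity Q p) xs" for p xs
      using Q_Act(1,2)[of p xs] that by (simp add: F_def)
  qed
  then show "operad_morphism Q P F" by (intro operad_morphism.intro operad_Q operad_axioms) (simp add: operad_morphism_axioms_def)
qed

lemma op_F [simp]: "x \<in> elems \<Longrightarrow> op_map F x = pr x" by (simp add: F_def)

lemma map_F: "set ys \<subseteq> elems \<Longrightarrow> map (op_map F) ys = map pr ys" by auto

text \<open>An arrow of \<open>Tw Q\<close> is determined by its target and its image in \<open>Tw P\<close>: following the
  factorization of its image, restriction recovers its data one after the other.\<close>

lemma restr_lift:
  assumes g: "g \<in> tw_arrows Q"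
  shows "res (tw_map F g) (tw_target Q g) = src g"
    "lower g = res (uparr (lower (tw_map F g)) (arr_inner (tw_map F g)))
      (res (permarr (Subst P (lower (tw_map F g)) (arr_inner (tw_map F g))) (M.Q.arr_leaves g)) (tw_target Q g))"
    "uppers g = map (\<lambda>i. res (lowarr (src (tw_map F g)) (uppers (tw_map F g)) i)
       (res (lowarr (lower (tw_map F g)) (arr_inner (tw_map F g)) 0)
      (res (permarr (Subst P (lower (tw_map F g)) (arr_inner (tw_map F g))) (M.Q.arr_leaves g)) (tw_target Q g))))
      [0..<length (uppers (tw_map F g))]"
proof -
  let ?A = "M.Q.arr_inner g"
  let ?B = "M.Q.arr_leaves g"
  let ?f = "tw_map F g"
  note f = M.tw_map_arrow[OF g]
  note a = arr_factor[OF f(1)] and b = M.Q.arr_factor[OF g]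
  have fs: "src ?f = pr (src g)" "lower ?f = pr (lower g)" "uppers ?f = map pr (uppers g)" "ul ?f = ul g"
    "ll ?f = ll g" using b(1,2) by (auto simp: tw_map_def substitutable_def)
  note s1 = Q_Subst[OF b(1)] and s0 = Q_Subst[OF b(2)]
  \<comment> \<open>Beyond the first entry both lists consist of units; in \<open>Q\<close> these
    are the input colours of \<open>lower g\<close>, which lie over units of the corresponding
    colours of \<open>P\<close>.\<close>
  have inn: "map pr ?A = arr_inner ?f"
  proof -
    have l: "length ?A = length (arr_inner ?f)" using M.Q.substitutableD(2)[OF b(2)] substitutableD(2)[OF a(2)] fs by simp
    have h: "M.Q.arr_inner g ! 0 = Subst Q (src g) (uppers g)" "arr_inner ?f ! 0 = Subst P (pr (src g)) (map pr (uppers g))"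
      by (simp_all add: M.Q.arr_inner_def arr_inner_def fs)
    show ?thesis
    proof (rule nth_equalityI)
      fix i assume "i < length (map pr ?A)"
      then have i: "i < length ?A" by simp
      show "map pr ?A ! i = arr_inner ?f ! i"
      proof (cases i)
        case 0
        then show ?thesis using h s1(2) i by simp
      next
        case (Suc j)
        then have j: "Suc j < ar (pr (lower g))" using i M.Q.substitutableD(2)[OF b(2)] by simp
        have lg: "lower g \<in> elems" by (rule subD(1)[OF b(2)])
        have "M.Q.arr_inner g ! i = in_colours Q (lower g) ! Suc j" using j by (simp add: M.Q.arr_inner_def Suc nth_tl)
        moreover have "arr_inner ?f ! i = Unit P (ins (pr (lower g)) ! Suc j)" using j by (simp add: arr_inner_def Suc nth_tl fs)
        ultimately show ?thesis using in_el[OF lg j] j i by simp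
      qed
    qed (simp add: l)
  qed
  have nz: "0 < length ?A" by (simp add: M.Q.arr_inner_def)
  have nz': "0 < length (arr_inner ?f)" by (simp add: arr_inner_def)
  have ps: "perm_list (ar (pr (Subst Q (lower g) ?A))) ?B" using b(3) by simp
  note w = Q_Act[OF s0(1) ps]
  have S0: "pr (Subst Q (lower g) ?A) = Subst P (lower ?f) (arr_inner ?f)" using s0(2) inn fs by simp
  have w0: "res (permarr (Subst P (lower ?f) (arr_inner ?f)) ?B) (tw_target Q g) = Subst Q (lower g) ?A" using w(3) b(4) S0 by simp
  have w1: "res (lowarr (lower ?f) (arr_inner ?f) 0) (Subst Q (lower g) ?A) = Subst Q (src g) (uppers g)"
    using s0(4)[OF nz] inn fs by (simp add: M.Q.arr_inner_def)
  show "lower g = res (uparr (lower ?f) (arr_inner ?f)) (res (permarr (Subst P (lower ?f) (arr_inner ?f)) ?B) (tw_target Q g))"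
    unfolding w0 using s0(3) inn fs by simp
  show "uppers g = map (\<lambda>i. res (lowarr (src ?f) (uppers ?f) i) (res (lowarr (lower ?f) (arr_inner ?f) 0)
      (res (permarr (Subst P (lower ?f) (arr_inner ?f)) ?B) (tw_target Q g)))) [0..<length (uppers ?f)]"
    unfolding w0 w1 using s1(4) fs by (intro nth_equalityI) simp_all
  have t: "tw_target Q g \<in> elems" "tgt ?f = pr (tw_target Q g)" using w b(4) f(5) by simp_all
  have al: "arr_leaves ?f = M.Q.arr_leaves g" by (simp add: fs)
  note pa = permarr_arrow[OF Subst_op[OF a(2)] a(3)] and la = lowarr_arrow[OF a(2) nz'] and ua = uparr_arrow[OF a(1)]
  have ai: "arr_inner ?f ! 0 = Subst P (src ?f) (uppers ?f)" by (simp add: arr_inner_def)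
  have lu: "cmp (lowarr (lower ?f) (arr_inner ?f) 0) (uparr (src ?f) (uppers ?f)) \<in> arrs"
    "tgt (cmp (lowarr (lower ?f) (arr_inner ?f) 0) (uparr (src ?f) (uppers ?f))) = Subst P (lower ?f) (arr_inner ?f)"
    using tw_compose_props[OF ua(1) la(1)] ua la ai by simp_all
  have tp: "tgt (permarr (Subst P (lower ?f) (arr_inner ?f)) (arr_leaves ?f)) = pr (tw_target Q g)" using pa(3) a(4) t(2) by simp
  have "res ?f (tw_target Q g) = res (cmp (lowarr (lower ?f) (arr_inner ?f) 0) (uparr (src ?f) (uppers ?f)))
      (Subst Q (lower g) ?A)"
    using restr_comp[OF lu(1) pa(1) _ t(1) tp] pa(2) lu(2) w0 a(5) al by simp
  also have "\<dots> = res (uparr (src ?f) (uppers ?f)) (Subst Q (src g) (uppers g))"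
    using restr_comp[OF ua(1) la(1) _ s0(1)] ua(3) la(2,3) ai S0 w1 by simp
  also have "\<dots> = src g" using s1(3) fs by simp
  finally show "res ?f (tw_target Q g) = src g" .
qed

text \<open>The element \<open>z\<close> is restricted backwards along the three factors of
  \<open>arr_factor\<close>. At each stage \<open>Act_eq\<close> or \<open>decompose\<close>
  exhibits the current element as an action or a composite in \<open>Q\<close>, which provides an
  elementary arrow of \<open>Tw Q\<close>; the three of them compose to the lift.\<close>

lemma lift_exists:
  assumes f: "f \<in> arrs" and z: "z \<in> elems" "tgt f = pr z"
  shows "\<exists>g. g \<in> tw_arrows Q \<and> tw_target Q g = z \<and> tw_map F g = f"
proof -
  note a = arr_factor[OF f]
  let ?L = "arr_leaves f" and ?S = "Subst P (lower f) (arr_inner f)"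
  define w0 where "w0 = res (permarr ?S ?L) z"
  note A = Act_eq[OF Subst_op[OF a(2)] a(3) z(1) z(2)[symmetric, unfolded a(4)] w0_def[symmetric]]
  define y0 where "y0 = res (uparr (lower f) (arr_inner f)) w0"
  define vs where "vs = map (\<lambda>i. res (lowarr (lower f) (arr_inner f) i) w0) [0..<length (arr_inner f)]"
  note D0 = decompose[OF a(2) A(1,2) y0_def vs_def]
  have nz: "0 < length vs" by (simp add: vs_def arr_inner_def)
  have w1: "vs ! 0 \<in> elems" "pr (vs ! 0) = Subst P (src f) (uppers f)"
    using subD(3)[OF D0(1) nz] arg_cong[OF D0(4), of "\<lambda>l. l ! 0"] nz by (simp_all add: arr_inner_def)
  define x where "x = res (uparr (src f) (uppers f)) (vs ! 0)"
  define ys where "ys = map (\<lambda>i. res (lowarr (src f) (uppers f) i) (vs ! 0)) [0..<length (uppers f)]"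
  note D1 = decompose[OF a(1) w1 x_def ys_def]
  have sis: "set vs \<subseteq> elems" "set ys \<subseteq> elems" using D0(1) D1(1) by (simp_all add: substitutable_def)
  have pl: "perm_list (arity Q w0) ?L" using a(3) A(2) by simp
  note uq = M.Q.uparr_arrow[OF D1(1)] and lq = M.Q.lowarr_arrow[OF D0(1) nz] and pq = M.Q.permarr_arrow[OF _ pl]
  have w0Q: "w0 \<in> Ops Q" using A(1) by simp
  let ?lu = "tw_compose Q (M.Q.lowarr y0 vs 0) (M.Q.uparr x ys)"
  have j: "src (M.Q.lowarr y0 vs 0) = tw_target Q (M.Q.uparr x ys)" using lq(2) uq(3) D1(2) by simp
  note c1 = M.Q.tw_compose_props[OF uq(1) lq(1) j]
  have j2: "src (M.Q.permarr w0 ?L) = tw_target Q ?lu" using pq(2)[OF w0Q] c1(5) lq(3) D0(2) by simp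
  note c2 = M.Q.tw_compose_props[OF c1(1) pq(1)[OF w0Q] j2]
  have "tw_target Q (tw_compose Q (M.Q.permarr w0 ?L) ?lu) = z" using c2(5) pq(3)[OF w0Q] A(3) by simp
  moreover have "tw_map F (tw_compose Q (M.Q.permarr w0 ?L) ?lu) = f"
  proof -
    have "tw_map F (M.Q.permarr w0 ?L) = permarr ?S ?L" using M.tw_map_permarr[OF w0Q pl] A by simp
    moreover have "tw_map F (M.Q.uparr x ys) = uparr (src f) (uppers f)"
      using M.tw_map_uparr[OF D1(1)] map_F[OF sis(2)] D1(3,4) subD(1)[OF D1(1)] by simp
    moreover have "tw_map F (M.Q.lowarr y0 vs 0) = lowarr (lower f) (arr_inner f) 0"
      using M.tw_map_lowarr[OF D0(1) nz] map_F[OF sis(1)] D0(3,4) subD(1)[OF D0(1)] by simp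
    ultimately show ?thesis using M.tw_map_compose[OF uq(1) lq(1) j] M.tw_map_compose[OF c1(1) pq(1)[OF w0Q] j2] a(5) by simp
  qed
  ultimately show ?thesis using c2(1) by blast
qed

lemma lift_unique':
  assumes g: "g \<in> tw_arrows Q" and g': "g' \<in> tw_arrows Q" and t: "tw_target Q g = tw_target Q g'" and m: "tw_map F g = tw_map F g'"
  shows "g = g'"
proof -
  have l: "ll g = ll g'" "ul g = ul g'" using arg_cong[OF m, of lower_leaves] arg_cong[OF m, of upper_leaves] by (simp_all add: tw_map_def)
  have "src g = src g'" using restr_lift(1)[OF g] restr_lift(1)[OF g'] t m by simp
  moreover have "lower g = lower g'" by (subst restr_lift(2)[OF g], subst restr_lift(2)[OF g']) (simp only: t m l)
  moreover have "uppers g = uppers g'" by (subst restr_lift(3)[OF g], subst restr_lift(3)[OF g']) (simp only: t m l)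
  ultimately show ?thesis using l by simp
qed

sublocale D: decomposition Q P F
proof
  show "discrete_fibration (Tw Q) (Tw P) (op_map F) (tw_map F)" unfolding discrete_fibration_def
  proof (intro conjI M.tw_functor ballI impI)
    fix e f assume "e \<in> Obj (Tw Q)" "f \<in> Arr (Tw P)" "Cod (Tw P) f = op_map F e"
    then have "f \<in> arrs" "e \<in> elems" "tgt f = pr e" by (simp_all add: Tw_def)
    then obtain g where "g \<in> tw_arrows Q" "tw_target Q g = e" "tw_map F g = f" using lift_exists by blast
    then have "\<exists>!g. g \<in> tw_arrows Q \<and> tw_target Q g = e \<and> tw_map F g = f" using lift_unique' by metis
    then show "\<exists>!g. g \<in> Arr (Tw Q) \<and> Cod (Tw Q) g = e \<and> tw_map F g = f" by (simp add: Tw_def)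
  qed
qed

lemma fibre_Sect: "p \<in> Ops P \<Longrightarrow> Sect (fibre_presheaf Q P F) p = Sect X p"
  unfolding D.fibre_simps Q_simps(1) using elemsI pr elemsD(2) op_F by (intro set_eqI) (metis (mono_tags, lifting) mem_Collect_eq)

lemma fibre_Restr:
  assumes f: "f \<in> arrs" and z: "z \<in> Sect X (tgt f)"
  shows "Restr (fibre_presheaf Q P F) f z = res f z"
proof -
  have t: "tgt f \<in> Ops P" by (rule arrow_target(1)[OF f])
  have z': "z \<in> elems" "pr z = tgt f" using elemsI[OF t z] pr[OF t z] by simp_all
  then have "z \<in> Ops Q" "tgt f = op_map F z" by simp_all
  note l = D.lift[OF this(1) f this(2)]
  show ?thesis using restr_lift(1)[OF l(1)] l by simp
qed

end

section \<open>The equivalence\<close>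

lemma isoI:
  assumes "f \<in> Arr C" "g \<in> Arr C" "Dom C g = Cod C f" "Cod C g = Dom C f"
    "Compose C g f = Ident C (Dom C f)" "Compose C f g = Ident C (Cod C f)"
  shows "iso C f" using assms unfolding iso_def by blast

lemma category_full_subcategory:
  assumes "category C"
  shows "category (full_subcategory C S)"
proof -
  interpret category C by fact
  show ?thesis by unfold_locales (auto simp: full_subcategory_def dom_obj cod_obj ident_arr dom_ident cod_ident compose_arr
      dom_compose cod_compose compose_ident_right compose_ident_left intro!: compose_assoc)
qed

text \<open>Choose for each \<open>x\<close> an isomorphism \<open>e x\<close> from \<open>x\<close>
  to \<open>Go (Fo x)\<close>. Applying \<open>Gm\<close> and precomposing with \<open>e x\<close>
  identifies arrows from \<open>Fo x\<close> to \<open>b\<close> in \<open>D\<close> with arrows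
  from \<open>x\<close> to \<open>Go b\<close> in \<open>C\<close>; this determines
  \<open>Fm\<close>, and equations in \<open>D\<close> can be checked after this passage
  (\<open>cancel\<close>).\<close>

lemma equivalence_if_ff_eso:
  fixes C :: "('a, 'm) category" and D :: "('b, 'n) category"
  assumes C: "category C" and D: "category D" and G: "functor_between D C Go Gm"
    and ff: "\<And>a b m. a \<in> Obj D \<Longrightarrow> b \<in> Obj D \<Longrightarrow> m \<in> Arr C \<Longrightarrow> Dom C m = Go a \<Longrightarrow> Cod C m = Go b \<Longrightarrow>
      \<exists>!f. f \<in> Arr D \<and> Dom D f = a \<and> Cod D f = b \<and> Gm f = m"
    and eso: "\<And>x. x \<in> Obj C \<Longrightarrow> \<exists>a \<in> Obj D. \<exists>e. iso C e \<and> Dom C e = x \<and> Cod C e = Go a"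
  shows "equivalent_categories C D"
proof -
  interpret C: category C by fact
  interpret D: category D by fact
  note [simp] = C.compose_arr C.dom_compose C.cod_compose C.dom_obj C.cod_obj C.ident_arr C.dom_ident C.cod_ident
    D.compose_arr D.dom_compose D.cod_compose D.dom_obj D.cod_obj D.ident_arr D.dom_ident D.cod_ident
  have G1 [simp]: "Go a \<in> Obj C" "Gm (Ident D a) = Ident C (Go a)" if "a \<in> Obj D" for a using G that by (simp_all add: functor_between_def)
  have G2 [simp]: "Gm f \<in> Arr C" "Dom C (Gm f) = Go (Dom D f)" "Cod C (Gm f) = Go (Cod D f)" if "f \<in> Arr D" for f
    using G that by (simp_all add: functor_between_def)
  have G3: "Gm (Compose D g f) = Compose C (Gm g) (Gm f)" if "f \<in> Arr D" "g \<in> Arr D" "Dom D g = Cod D f" for f g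
    using G that by (simp add: functor_between_def)
  have faith: "f = g" if "f \<in> Arr D" "g \<in> Arr D" "Dom D f = Dom D g" "Cod D f = Cod D g" "Gm f = Gm g" for f g
    using ff[of "Dom D f" "Cod D f" "Gm f"] that G2[of f] D.dom_obj[of f] D.cod_obj[of f] by metis
  have "\<forall>x \<in> Obj C. \<exists>a. a \<in> Obj D \<and> (\<exists>e. iso C e \<and> Dom C e = x \<and> Cod C e = Go a)" using eso by blast
  from bchoice[OF this] obtain Fo where Fo: "\<forall>x \<in> Obj C. Fo x \<in> Obj D \<and> (\<exists>e. iso C e \<and> Dom C e = x \<and> Cod C e = Go (Fo x))" by blast
  then have "\<forall>x \<in> Obj C. \<exists>e. iso C e \<and> Dom C e = x \<and> Cod C e = Go (Fo x)" by blast
  from bchoice[OF this] obtain e where e: "\<forall>x \<in> Obj C. iso C (e x) \<and> Dom C (e x) = x \<and> Cod C (e x) = Go (Fo x)" by blast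
  have F [simp]: "Fo x \<in> Obj D" "iso C (e x)" "e x \<in> Arr C" "Dom C (e x) = x" "Cod C (e x) = Go (Fo x)" if x: "x \<in> Obj C" for x
  proof -
    show i: "iso C (e x)" using bspec[OF e x] by simp
    then show "e x \<in> Arr C" by (simp add: iso_def)
  qed (use bspec[OF Fo x] bspec[OF e x] in simp_all)
  have inv: "\<exists>e'. e' \<in> Arr C \<and> Dom C e' = Go (Fo x) \<and> Cod C e' = x \<and> Compose C e' (e x) = Ident C x
      \<and> Compose C (e x) e' = Ident C (Go (Fo x))" if x: "x \<in> Obj C" for x
    using F(2)[OF x] F(4,5)[OF x] unfolding iso_def by metis
  have cancel: "f = g" if x: "x \<in> Obj C" and f: "f \<in> Arr D" "Dom D f = Fo x" and g: "g \<in> Arr D" "Dom D g = Fo x" "Cod D f = Cod D g"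
    and eq: "Compose C (Gm f) (e x) = Compose C (Gm g) (e x)" for x f g
  proof (rule faith)
    obtain e' where e': "e' \<in> Arr C" "Dom C e' = Go (Fo x)" "Cod C e' = x" "Compose C (e x) e' = Ident C (Go (Fo x))" using inv[OF x] by blast
    have "Gm h = Compose C (Compose C (Gm h) (e x)) e'" if "h \<in> Arr D" "Dom D h = Fo x" for h
      using C.compose_assoc[of e' "e x" "Gm h"] C.compose_ident_right[of "Gm h"] that x e' by simp
    then show "Gm f = Gm g" using f g eq by metis
  qed (use f g in simp_all)
  \<comment> \<open>The arrow out of \<open>Fo x\<close> that corresponds to \<open>m\<close> under
    this identification; by \<open>cancel\<close> it is unique.\<close>
  define ext where "ext x b m = (SOME f. f \<in> Arr D \<and> Dom D f = Fo x \<and> Cod D f = b \<and> Compose C (Gm f) (e x) = m)" for x b m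
  have ext: "ext x b m \<in> Arr D" "Dom D (ext x b m) = Fo x" "Cod D (ext x b m) = b" "Compose C (Gm (ext x b m)) (e x) = m"
    if m: "x \<in> Obj C" "b \<in> Obj D" "m \<in> Arr C" "Dom C m = x" "Cod C m = Go b" for x b m
  proof -
    obtain e' where e': "e' \<in> Arr C" "Dom C e' = Go (Fo x)" "Cod C e' = x" "Compose C e' (e x) = Ident C x" using inv[OF m(1)] by blast
    obtain f where "f \<in> Arr D" "Dom D f = Fo x" "Cod D f = b" "Gm f = Compose C m e'" using ff[of "Fo x" b "Compose C m e'"] m e' by auto
    then have "\<exists>f. f \<in> Arr D \<and> Dom D f = Fo x \<and> Cod D f = b \<and> Compose C (Gm f) (e x) = m"
      using C.compose_assoc[of "e x" e' m] C.compose_ident_right[of m] m e' by auto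
    from someI_ex[OF this] show "ext x b m \<in> Arr D" "Dom D (ext x b m) = Fo x" "Cod D (ext x b m) = b" "Compose C (Gm (ext x b m)) (e x) = m"
      by (simp_all add: ext_def)
  qed
  define Fm where "Fm f = ext (Dom C f) (Fo (Cod C f)) (Compose C (e (Cod C f)) f)" for f
  have Fm [simp]: "Fm f \<in> Arr D" "Dom D (Fm f) = Fo (Dom C f)" "Cod D (Fm f) = Fo (Cod C f)"
    "Compose C (Gm (Fm f)) (e (Dom C f)) = Compose C (e (Cod C f)) f" if f: "f \<in> Arr C" for f
    using ext[of "Dom C f" "Fo (Cod C f)" "Compose C (e (Cod C f)) f"] f by (simp_all add: Fm_def)
  have FF: "functor_between C D Fo Fm" unfolding functor_between_def
  proof (intro conjI ballI impI)
    fix x assume x: "x \<in> Obj C"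
    show "Fm (Ident C x) = Ident D (Fo x)"
    proof (rule cancel[OF x])
      show "Compose C (Gm (Fm (Ident C x))) (e x) = Compose C (Gm (Ident D (Fo x))) (e x)"
        using Fm(4)[of "Ident C x"] C.compose_ident_left[of "e x"] C.compose_ident_right[of "e x"] x by simp
    qed (use x in simp_all)
  next
    fix f g assume f: "f \<in> Arr C" and g: "g \<in> Arr C" "Dom C g = Cod C f"
    show "Fm (Compose C g f) = Compose D (Fm g) (Fm f)"
    proof (rule cancel[of "Dom C f"])
      have "Compose C (Gm (Compose D (Fm g) (Fm f))) (e (Dom C f)) = Compose C (Compose C (Gm (Fm g)) (e (Cod C f))) f"
        using G3[of "Fm f" "Fm g"] C.compose_assoc[of "e (Dom C f)" "Gm (Fm f)" "Gm (Fm g)"] C.compose_assoc[of f "e (Cod C f)" "Gm (Fm g)"] f g by simp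
      also have "\<dots> = Compose C (e (Cod C g)) (Compose C g f)" using Fm(4)[OF g(1)] C.compose_assoc[of f g "e (Cod C g)"] f g by simp
      finally show "Compose C (Gm (Fm (Compose C g f))) (e (Dom C f)) = Compose C (Gm (Compose D (Fm g) (Fm f))) (e (Dom C f))"
        using Fm(4)[of "Compose C g f"] f g by simp
    qed (use f g in simp_all)
  qed simp_all
  have unit: "natural_iso C C id id (Go \<circ> Fo) (Gm \<circ> Fm) e" by (simp add: natural_iso_def)
  \<comment> \<open>The counit corresponds to an identity of \<open>C\<close>; its inverse is the
    arrow \<open>k\<close> whose image is \<open>e (Go a)\<close>.\<close>
  define ep where "ep a = ext (Go a) a (Ident C (Go a))" for a
  have ep [simp]: "ep a \<in> Arr D" "Dom D (ep a) = Fo (Go a)" "Cod D (ep a) = a" "Compose C (Gm (ep a)) (e (Go a)) = Ident C (Go a)"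
    if "a \<in> Obj D" for a using ext[of "Go a" a "Ident C (Go a)"] that by (simp_all add: ep_def)
  have "iso D (ep a)" if a: "a \<in> Obj D" for a
  proof -
    obtain k where k: "k \<in> Arr D" "Dom D k = a" "Cod D k = Fo (Go a)" "Gm k = e (Go a)" using ff[of a "Fo (Go a)" "e (Go a)"] a by auto
    show ?thesis
    proof (rule isoI[of _ _ k])
      show "Compose D (ep a) k = Ident D (Cod D (ep a))" by (rule faith) (use a k G3[of k "ep a"] in simp_all)
      have "Compose C (Gm (Compose D k (ep a))) (e (Go a)) = e (Go a)"
        using a k G3[of "ep a" k] C.compose_assoc[of "e (Go a)" "Gm (ep a)" "e (Go a)"] C.compose_ident_right[of "e (Go a)"] by simp
      then show "Compose D k (ep a) = Ident D (Dom D (ep a))" using a k C.compose_ident_left[of "e (Go a)"] by - (rule cancel[of "Go a"], simp_all)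
    qed (use a k in simp_all)
  qed
  moreover have "Compose D (ep (Cod D f)) (Fm (Gm f)) = Compose D f (ep (Dom D f))" if f: "f \<in> Arr D" for f
  proof (rule cancel[of "Go (Dom D f)"])
    have "Compose C (Gm (Compose D (ep (Cod D f)) (Fm (Gm f)))) (e (Go (Dom D f))) = Gm f"
      using G3[of "Fm (Gm f)" "ep (Cod D f)"] C.compose_assoc[of "e (Go (Dom D f))" "Gm (Fm (Gm f))" "Gm (ep (Cod D f))"] Fm(4)[of "Gm f"]
        C.compose_assoc[of "Gm f" "e (Go (Cod D f))" "Gm (ep (Cod D f))"] C.compose_ident_left[of "Gm f"] f by simp
    then show "Compose C (Gm (Compose D (ep (Cod D f)) (Fm (Gm f)))) (e (Go (Dom D f))) = Compose C (Gm (Compose D f (ep (Dom D f)))) (e (Go (Dom D f)))"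
      using G3[of "ep (Dom D f)" f] C.compose_assoc[of "e (Go (Dom D f))" "Gm (ep (Dom D f))" "Gm f"] C.compose_ident_right[of "Gm f"] f by simp
  qed (use f in simp_all)
  ultimately have "natural_iso D D (Fo \<circ> Go) (Fm \<circ> Gm) id id ep" by (simp add: natural_iso_def)
  then show ?thesis unfolding equivalent_categories_def using C D FF G unit by blast
qed

section \<open>The categories of presheaves and of operads over an operad\<close>

lemma presheaf_maps_ident:
  assumes "category C" "presheaf_on C X"
  shows "(\<lambda>a \<in> Obj C. \<lambda>x \<in> Sect X a. x) \<in> presheaf_maps C X X"
  using assms category.dom_obj[OF assms(1)] category.cod_obj[OF assms(1)] by (auto simp: presheaf_maps_def presheaf_on_def Pi_iff)

lemma presheaf_maps_mem: "\<alpha> \<in> presheaf_maps C X Y \<Longrightarrow> a \<in> Obj C \<Longrightarrow> x \<in> Sect X a \<Longrightarrow> \<alpha> a x \<in> Sect Y a"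
  unfolding presheaf_maps_def by blast

lemma presheaf_maps_eqI:
  assumes "\<alpha> \<in> presheaf_maps C X Y" "\<beta> \<in> presheaf_maps C X Z" "\<And>a x. a \<in> Obj C \<Longrightarrow> x \<in> Sect X a \<Longrightarrow> \<alpha> a x = \<beta> a x"
  shows "\<alpha> = \<beta>"
proof (rule extensionalityI[of _ "Obj C"])
  show "\<alpha> \<in> extensional (Obj C)" "\<beta> \<in> extensional (Obj C)" using assms(1,2) by (auto simp: presheaf_maps_def PiE_def)
  fix a assume a: "a \<in> Obj C"
  show "\<alpha> a = \<beta> a" by (rule extensionalityI[of _ "Sect X a"]) (use assms a in \<open>auto simp: presheaf_maps_def PiE_iff\<close>)
qed

lemma presheaf_maps_compose:
  assumes "category C" "presheaf_on C X" "\<alpha> \<in> presheaf_maps C X Y" "\<beta> \<in> presheaf_maps C Y Z"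
  shows "(\<lambda>a \<in> Obj C. compose (Sect X a) (\<beta> a) (\<alpha> a)) \<in> presheaf_maps C X Z"
proof -
  note m = presheaf_maps_mem[OF assms(3)] and n = presheaf_maps_mem[OF assms(4)]
  show ?thesis unfolding presheaf_maps_def mem_Collect_eq
  proof (intro conjI ballI)
    show "(\<lambda>a \<in> Obj C. compose (Sect X a) (\<beta> a) (\<alpha> a)) \<in> (\<Pi>\<^sub>E a \<in> Obj C. Sect X a \<rightarrow>\<^sub>E Sect Z a)"
      using m n by (auto simp: PiE_iff compose_def)
    fix f x assume f: "f \<in> Arr C" and x: "x \<in> Sect X (Cod C f)"
    note o = category.dom_obj[OF assms(1) f] category.cod_obj[OF assms(1) f]
    have r: "Restr X f x \<in> Sect X (Dom C f)" using assms(2) f x by (auto simp: presheaf_on_def)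
    show "(\<lambda>a \<in> Obj C. compose (Sect X a) (\<beta> a) (\<alpha> a)) (Dom C f) (Restr X f x)
      = Restr Z f ((\<lambda>a \<in> Obj C. compose (Sect X a) (\<beta> a) (\<alpha> a)) (Cod C f) x)"
      using o r x f m[OF o(2) x] assms(3,4) by (simp add: compose_eq presheaf_maps_def)
  qed
qed

lemma category_presheaf_category:
  assumes C: "category C"
  shows "category (presheaf_category C :: (('a, 'm, 'u) presheaf, _) category)"
proof (unfold_locales, goal_cases)
  case (9 f)
  then obtain X Y \<alpha> where f: "f = (X, Y, \<alpha>)" "presheaf_on C X" "\<alpha> \<in> presheaf_maps C X Y" by (auto simp: presheaf_category_def)
  have "(\<lambda>a \<in> Obj C. compose (Sect X a) (\<alpha> a) ((\<lambda>a \<in> Obj C. \<lambda>x \<in> Sect X a. x) a)) = \<alpha>"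
    by (rule presheaf_maps_eqI[OF presheaf_maps_compose[OF C f(2) presheaf_maps_ident[OF C f(2)] f(3)] f(3)])
       (simp add: compose_eq)
  then show ?case by (simp add: presheaf_category_def f)
next
  case (10 f)
  then obtain X Y \<alpha> where f: "f = (X, Y, \<alpha>)" "presheaf_on C X" "presheaf_on C Y" "\<alpha> \<in> presheaf_maps C X Y" by (auto simp: presheaf_category_def)
  have "(\<lambda>a \<in> Obj C. compose (Sect X a) ((\<lambda>a \<in> Obj C. \<lambda>x \<in> Sect Y a. x) a) (\<alpha> a)) = \<alpha>"
    by (rule presheaf_maps_eqI[OF presheaf_maps_compose[OF C f(2,4) presheaf_maps_ident[OF C f(3)]] f(4)])
       (simp add: compose_eq presheaf_maps_mem[OF f(4)])
  then show ?case by (simp add: presheaf_category_def f)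
next
  case (11 f g h)
  then obtain W X Y Z \<alpha> \<beta> \<gamma> where f: "f = (W, X, \<alpha>)" "g = (X, Y, \<beta>)" "h = (Y, Z, \<gamma>)" "presheaf_on C W" "presheaf_on C X"
    "\<alpha> \<in> presheaf_maps C W X" "\<beta> \<in> presheaf_maps C X Y" "\<gamma> \<in> presheaf_maps C Y Z" by (auto simp: presheaf_category_def)
  note m = presheaf_maps_compose[OF C f(4,6,7)] presheaf_maps_compose[OF C f(5,7,8)]
  have "(\<lambda>a \<in> Obj C. compose (Sect W a) (\<gamma> a) ((\<lambda>a \<in> Obj C. compose (Sect W a) (\<beta> a) (\<alpha> a)) a))
    = (\<lambda>a \<in> Obj C. compose (Sect W a) ((\<lambda>a \<in> Obj C. compose (Sect X a) (\<gamma> a) (\<beta> a)) a) (\<alpha> a))"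
    by (rule presheaf_maps_eqI[OF presheaf_maps_compose[OF C f(4) m(1) f(8)] presheaf_maps_compose[OF C f(4,6) m(2)]])
       (simp add: compose_eq presheaf_maps_mem[OF f(6)])
  then show ?case by (simp add: presheaf_category_def f)
qed (auto simp: presheaf_category_def presheaf_maps_ident[OF C] presheaf_maps_compose[OF C])

lemma operad_map_id_mem: "operad Q \<Longrightarrow> operad_map_id Q \<in> operad_maps Q Q"
proof -
  let ?A = "operad_map_id Q"
  assume "operad Q"
  then interpret operad Q .
  show ?thesis unfolding operad_maps_def mem_Collect_eq
  proof (intro conjI ballI allI impI)
    fix p qs assume s: "substitutable Q p qs"
    have "map (op_map ?A) qs = qs" using s by (intro map_idI) (auto simp: operad_map_id_def substitutable_def)
    then show "op_map ?A (Subst Q p qs) = Subst Q (op_map ?A p) (map (op_map ?A) qs)"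
      using Subst_op[OF s] s by (simp add: operad_map_id_def substitutable_def)
  qed (use inputs_colours output_colour Unit_op Act_op in \<open>auto simp: operad_map_id_def subset_iff intro!: map_idI[symmetric]\<close>)
qed

lemma operad_map_comp_mem:
  assumes Q: "operad Q" and R: "operad R" and S: "operad S" and f: "f \<in> operad_maps Q R" and g: "g \<in> operad_maps R S"
  shows "operad_map_comp Q g f \<in> operad_maps Q S"
proof -
  interpret f: operad_morphism Q R f by (intro operad_morphism.intro Q R) (simp add: operad_morphism_axioms_def f)
  interpret g: operad_morphism R S g by (intro operad_morphism.intro R S) (simp add: operad_morphism_axioms_def g)
  have o: "op_map (operad_map_comp Q g f) p = op_map g (op_map f p)" if "p \<in> Ops Q" for p using that by (simp add: operad_map_comp_def compose_eq)
  have c: "col_map (operad_map_comp Q g f) d = col_map g (col_map f d)" if "d \<in> Colours Q" for d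
    using that by (simp add: operad_map_comp_def compose_eq)
  show ?thesis unfolding operad_maps_def mem_Collect_eq
  proof (intro conjI ballI allI impI)
    show "col_map (operad_map_comp Q g f) \<in> Colours Q \<rightarrow>\<^sub>E Colours S" "op_map (operad_map_comp Q g f) \<in> Ops Q \<rightarrow>\<^sub>E Ops S"
      using f.F_Col g.F_Col f.F_Op g.F_Op by (auto simp: operad_map_comp_def compose_def)
    show "in_colours S (op_map (operad_map_comp Q g f) p) = map (col_map (operad_map_comp Q g f)) (in_colours Q p)" if "p \<in> Ops Q" for p
      using that f.Q.inputs_colours[OF that] by (simp add: o c f.F_simps g.F_simps f.F_Op subset_iff)
    show "op_map (operad_map_comp Q g f) (Subst Q p qs) = Subst S (op_map (operad_map_comp Q g f) p) (map (op_map (operad_map_comp Q g f)) qs)"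
      if s: "substitutable Q p qs" for p qs
    proof -
      have m: "map (op_map (operad_map_comp Q g f)) qs = map (op_map g) (map (op_map f) qs)" using s o by (auto simp: substitutable_def)
      show ?thesis unfolding m using g.F_simps(4)[OF f.F_substitutable[OF s]] f.F_simps(4)[OF s] f.Q.Subst_op[OF s] s o
        by (simp add: substitutable_def)
    qed
  qed (simp_all add: o c f.F_simps g.F_simps f.F_Op f.F_Col f.Q.output_colour f.Q.Unit_op f.Q.Act_op)
qed

lemma operad_maps_ext: "f \<in> operad_maps Q R \<Longrightarrow> col_map f \<in> extensional (Colours Q) \<and> op_map f \<in> extensional (Ops Q)"
  by (auto simp: operad_maps_def PiE_iff)

lemma operad_map_comp_id:
  assumes f: "f \<in> operad_maps Q R"
  shows "operad_map_comp Q f (operad_map_id Q) = f" "operad_map_comp Q (operad_map_id R) f = f"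
proof -
  have m: "col_map f \<in> Colours Q \<rightarrow> Colours R" "op_map f \<in> Ops Q \<rightarrow> Ops R" using f by (auto simp: operad_maps_def)
  show "operad_map_comp Q f (operad_map_id Q) = f" "operad_map_comp Q (operad_map_id R) f = f"
    using Id_compose[OF m(1)] Id_compose[OF m(2)] compose_Id[OF m(1)] compose_Id[OF m(2)] operad_maps_ext[OF f]
    by (simp_all add: operad_map_comp_def operad_map_id_def)
qed

lemma operad_map_comp_assoc: "f \<in> operad_maps Q R \<Longrightarrow> operad_map_comp Q h (operad_map_comp Q g f) = operad_map_comp Q (operad_map_comp R h g) f"
  by (auto simp: operad_map_comp_def operad_maps_def intro!: compose_assoc)

lemma category_operads_over:
  assumes "operad P"
  shows "category (operads_over P)"
proof (unfold_locales, goal_cases)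
  case (6 f g)
  then show ?case by (auto simp: operads_over_def operad_map_comp_mem) (metis operad_map_comp_assoc)
next
  case (11 f g h)
  then show ?case by (auto simp: operads_over_def) (metis operad_map_comp_assoc)
qed (auto simp: operads_over_def operad_map_id_mem operad_map_comp_id operad_map_comp_mem)

section \<open>Transport of presheaves along fibrewise bijections\<close>

locale presheaf_transport = operad P for P :: "('c, 'o) operad" +
  fixes X Y :: "('o, 'o tw_arr, 'u) presheaf" and b :: "'o \<Rightarrow> 'u \<Rightarrow> 'u"
  assumes bij: "p \<in> Ops P \<Longrightarrow> bij_betw (b p) (Sect X p) (Sect Y p)"
    and nat: "f \<in> tw_arrows P \<Longrightarrow> x \<in> Sect X (tw_target P f) \<Longrightarrow> Restr Y f (b (tw_target P f) x) = b (src f) (Restr X f x)"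
begin

lemma Y_elem:
  assumes "p \<in> Ops P" "y \<in> Sect Y p"
  obtains x where "x \<in> Sect X p" "y = b p x" using bij_betw_imp_surj_on[OF bij[OF assms(1)]] assms(2) by blast

lemma b_mem: "p \<in> Ops P \<Longrightarrow> x \<in> Sect X p \<Longrightarrow> b p x \<in> Sect Y p" using bij_betwE[OF bij] by blast

lemma b_inj: "p \<in> Ops P \<Longrightarrow> x \<in> Sect X p \<Longrightarrow> x' \<in> Sect X p \<Longrightarrow> b p x = b p x' \<Longrightarrow> x = x'"
  using bij_betw_imp_inj_on[OF bij] by (metis inj_onD)

text \<open>Every section of \<open>Y\<close> comes from one of \<open>X\<close>, so the condition
  \<open>nat\<close> carries the presheaf laws over to \<open>Y\<close>.\<close>

lemma presheaf_on_transport: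
  assumes X: "presheaf_on (Tw P) X"
  shows "presheaf_on (Tw P) Y"
proof -
  have r: "Restr X f x \<in> Sect X (src f)" if "f \<in> arrs" "x \<in> Sect X (tgt f)" for f x using X that by (auto simp: presheaf_on_def Tw_def)
  show ?thesis unfolding presheaf_on_def
  proof (intro conjI ballI impI)
    fix f assume "f \<in> Arr (Tw P)"
    then have f: "f \<in> arrs" by (simp add: Tw_def)
    note s = arrow_basic(1)[OF f] and t = arrow_target(1)[OF f]
    have "Restr Y f y \<in> Sect Y (src f)" if "y \<in> Sect Y (tgt f)" for y using Y_elem[OF t that] nat[OF f] b_mem[OF s r[OF f]] by metis
    then show "Restr Y f \<in> Sect Y (Cod (Tw P) f) \<rightarrow> Sect Y (Dom (Tw P) f)" by (simp add: Tw_def)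
    fix g y assume "g \<in> Arr (Tw P)" "Dom (Tw P) g = Cod (Tw P) f" "y \<in> Sect Y (Cod (Tw P) g)"
    then have g: "g \<in> arrs" "src g = tgt f" and y: "y \<in> Sect Y (tgt g)" by (simp_all add: Tw_def)
    obtain x where x: "x \<in> Sect X (tgt g)" "y = b (tgt g) x" using Y_elem[OF arrow_target(1)[OF g(1)] y] .
    note c = tw_compose_props[OF f g]
    have "Restr X (cmp g f) x = Restr X f (Restr X g x)" using X f g x(1) by (auto simp: presheaf_on_def Tw_def)
    then have "Restr Y (cmp g f) y = Restr Y f (Restr Y g y)"
      using nat[OF c(1)] nat[OF g(1) x(1)] nat[OF f, of "Restr X g x"] r[OF g(1) x(1)] c x g(2) by simp
    then show "Restr Y (Compose (Tw P) g f) y = Restr Y f (Restr Y g y)" by (simp add: Tw_def)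
  next
    fix p y assume "p \<in> Obj (Tw P)" "y \<in> Sect Y p"
    then have p: "p \<in> Ops P" and y: "y \<in> Sect Y p" by (simp_all add: Tw_def)
    obtain x where x: "x \<in> Sect X p" "y = b p x" using Y_elem[OF p y] .
    have i: "tw_ident P p \<in> arrs" "src (tw_ident P p) = p" "tgt (tw_ident P p) = p" using is_arr_ident[OF p] by (simp_all add: is_arr_def)
    have "Restr X (tw_ident P p) x = x" using X p x(1) by (simp add: presheaf_on_def Tw_def)
    then have "Restr Y (tw_ident P p) y = y" using nat[OF i(1), of x] i x by simp
    then show "Restr Y (Ident (Tw P) p) y = y" by (simp add: Tw_def)
  qed
qed

lemma decomposition_space_transport:
  assumes X: "decomposition_space P X"
  shows "decomposition_space P Y" unfolding decomposition_space_def
proof (intro conjI ballI allI impI)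
  have X': "presheaf_on (Tw P) X" using X by (simp add: decomposition_space_def)
  then show Y: "presheaf_on (Tw P) Y" by (rule presheaf_on_transport)
  fix f g h k assume fg: "f \<in> active_arrows P" "g \<in> inert_arrows P" and po: "pushout_square (Tw P) f g h k"
  then have pb: "sends_to_pullback (Tw P) X f g h k" using X by (auto simp: decomposition_space_def)
  have arr: "f \<in> arrs" "g \<in> arrs" "h \<in> arrs" "k \<in> arrs"
    and e: "src g = src f" "src h = tgt f" "src k = tgt g" "tgt k = tgt h"
    and c: "cmp h f = cmp k g" using po by (auto simp: pushout_square_def commuting_square_def Tw_def)
  have ob: "src f \<in> Ops P" "tgt f \<in> Ops P" "tgt g \<in> Ops P" "tgt h \<in> Ops P" using arr arrow_basic(1) arrow_target(1) by simp_all
  note n = nat[OF arr(1)] nat[OF arr(2), unfolded e] nat[OF arr(3), unfolded e] nat[OF arr(4), unfolded e]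
  have r: "Restr X f x \<in> Sect X (src f)" if "f \<in> arrs" "x \<in> Sect X (tgt f)" for f x using X' that by (auto simp: presheaf_on_def Tw_def)
  have rh: "Restr X h z \<in> Sect X (tgt f)" "Restr X k z \<in> Sect X (tgt g)" if "z \<in> Sect X (tgt h)" for z
    using r[OF arr(3)] r[OF arr(4)] that e by simp_all
  define PX where "PX = {(x, y). x \<in> Sect X (tgt f) \<and> y \<in> Sect X (tgt g) \<and> Restr X f x = Restr X g y}"
  have B: "bij_betw (\<lambda>z. (Restr X h z, Restr X k z)) (Sect X (tgt h)) PX" using pb by (simp add: sends_to_pullback_def Tw_def PX_def)
  have "bij_betw (\<lambda>z. (Restr Y h z, Restr Y k z)) (Sect Y (tgt h))
      {(x, y). x \<in> Sect Y (tgt f) \<and> y \<in> Sect Y (tgt g) \<and> Restr Y f x = Restr Y g y}" (is "bij_betw ?F ?S ?T")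
    unfolding bij_betw_def
  proof (intro conjI inj_onI)
    fix z z' assume z: "z \<in> ?S" and z': "z' \<in> ?S" and eq: "(Restr Y h z, Restr Y k z) = (Restr Y h z', Restr Y k z')"
    obtain x where x: "x \<in> Sect X (tgt h)" "z = b (tgt h) x" using Y_elem[OF ob(4) z] .
    obtain x' where x': "x' \<in> Sect X (tgt h)" "z' = b (tgt h) x'" using Y_elem[OF ob(4) z'] .
    have "Restr X h x = Restr X h x'" using eq n(3) x x' rh by - (rule b_inj[OF ob(2)], simp_all)
    moreover have "Restr X k x = Restr X k x'" using eq n(4) x x' rh by - (rule b_inj[OF ob(3)], simp_all)
    ultimately have "x = x'" using inj_onD[OF bij_betw_imp_inj_on[OF B] _ x(1) x'(1)] by simp
    then show "z = z'" using x x' by simp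
  next
    have "?F z \<in> ?T" if z: "z \<in> ?S" for z
    proof -
      obtain x where x: "x \<in> Sect X (tgt h)" "z = b (tgt h) x" using Y_elem[OF ob(4) z] .
      have "(Restr X h x, Restr X k x) \<in> PX" using bij_betwE[OF B] x(1) by blast
      then show ?thesis using n x rh b_mem ob by (simp add: PX_def)
    qed
    moreover have "\<exists>z \<in> ?S. ?F z = (y, w)" if "(y, w) \<in> ?T" for y w
    proof -
      from that have y: "y \<in> Sect Y (tgt f)" and w: "w \<in> Sect Y (tgt g)" and yw: "Restr Y f y = Restr Y g w" by auto
      obtain x where x: "x \<in> Sect X (tgt f)" "y = b (tgt f) x" using Y_elem[OF ob(2) y] .
      obtain v where v: "v \<in> Sect X (tgt g)" "w = b (tgt g) v" using Y_elem[OF ob(3) w] .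
      have "Restr X f x = Restr X g v" using yw n x v r[OF arr(1) x(1)] r[OF arr(2) v(1)] e by - (rule b_inj[OF ob(1)], simp_all)
      then have "(x, v) \<in> PX" using x v by (simp add: PX_def)
      then obtain z where z: "z \<in> Sect X (tgt h)" "Restr X h z = x" "Restr X k z = v" unfolding bij_betw_imp_surj_on[OF B, symmetric] by auto
      then show ?thesis using n x v b_mem[OF ob(4) z(1)] by (intro bexI[of _ "b (tgt h) z"]) simp_all
    qed
    ultimately show "?F ` ?S = ?T" by (auto simp del: mem_Collect_eq) blast
  qed
  then show "sends_to_pullback (Tw P) Y f g h k" by (simp add: sends_to_pullback_def Tw_def)
qed

lemma transport_map: "presheaf_on (Tw P) X \<Longrightarrow> (\<lambda>p \<in> Ops P. \<lambda>x \<in> Sect X p. b p x) \<in> presheaf_maps (Tw P) X Y"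
  unfolding presheaf_maps_def mem_Collect_eq
proof (intro conjI ballI)
  show "(\<lambda>p \<in> Ops P. \<lambda>x \<in> Sect X p. b p x) \<in> (\<Pi>\<^sub>E a \<in> Obj (Tw P). Sect X a \<rightarrow>\<^sub>E Sect Y a)"
    using b_mem by (simp add: Tw_def)
  fix f x assume X: "presheaf_on (Tw P) X" and fx: "f \<in> Arr (Tw P)" "x \<in> Sect X (Cod (Tw P) f)"
  then have f: "f \<in> arrs" "x \<in> Sect X (tgt f)" by (simp_all add: Tw_def)
  have "Restr X f x \<in> Sect X (src f)" using X f by (auto simp: presheaf_on_def Tw_def)
  then show "(\<lambda>p \<in> Ops P. \<lambda>x \<in> Sect X p. b p x) (Dom (Tw P) f) (Restr X f x) = Restr Y f ((\<lambda>p \<in> Ops P. \<lambda>x \<in> Sect X p. b p x) (Cod (Tw P) f) x)"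
    using nat[OF f] f arrow_basic(1)[OF f(1)] arrow_target(1)[OF f(1)] by (simp add: Tw_def)
qed

lemma transport_inverse: "presheaf_on (Tw P) X \<Longrightarrow> presheaf_transport P Y X (\<lambda>p. inv_into (Sect X p) (b p))"
proof unfold_locales
  assume X: "presheaf_on (Tw P) X"
  fix p assume "p \<in> Ops P"
  then show "bij_betw (inv_into (Sect X p) (b p)) (Sect Y p) (Sect X p)" by (intro bij_betw_inv_into bij)
next
  assume X: "presheaf_on (Tw P) X"
  fix f y assume f: "f \<in> arrs" and y: "y \<in> Sect Y (tgt f)"
  note s = arrow_basic(1)[OF f] and t = arrow_target(1)[OF f]
  obtain x where x: "x \<in> Sect X (tgt f)" "y = b (tgt f) x" using Y_elem[OF t y] .
  have "Restr X f x \<in> Sect X (src f)" using X f x(1) by (auto simp: presheaf_on_def Tw_def)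
  then show "Restr X f (inv_into (Sect X (tgt f)) (b (tgt f)) y) = inv_into (Sect X (src f)) (b (src f)) (Restr Y f y)"
    using nat[OF f x(1)] x bij_betw_inv_into_left[OF bij[OF s]] bij_betw_inv_into_left[OF bij[OF t] x(1)] by simp
qed

lemma transport_iso:
  assumes X: "decomposition_space P X"
  shows "iso (decomposition_spaces P) (X, Y, \<lambda>p \<in> Ops P. \<lambda>x \<in> Sect X p. b p x)"
proof -
  let ?A = "decomposition_spaces P"
  have Y: "decomposition_space P Y" by (rule decomposition_space_transport[OF X])
  have p: "presheaf_on (Tw P) X" "presheaf_on (Tw P) Y" using X Y by (simp_all add: decomposition_space_def)
  let ?c = "\<lambda>p. inv_into (Sect X p) (b p)"
  interpret I: presheaf_transport P Y X ?c by (rule transport_inverse[OF p(1)])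
  have l: "?c p (b p x) = x" if "p \<in> Ops P" "x \<in> Sect X p" for p x using bij_betw_inv_into_left[OF bij[OF that(1)] that(2)] .
  have r: "b p (?c p y) = y" if "p \<in> Ops P" "y \<in> Sect Y p" for p y using bij_betw_inv_into_right[OF bij[OF that(1)] that(2)] .
  have m: "(\<lambda>p \<in> Ops P. \<lambda>x \<in> Sect X p. b p x) \<in> presheaf_maps (Tw P) X Y" "(\<lambda>p \<in> Ops P. \<lambda>x \<in> Sect Y p. ?c p x) \<in> presheaf_maps (Tw P) Y X"
    using transport_map[OF p(1)] I.transport_map[OF p(2)] by simp_all
  show ?thesis
  proof (rule isoI[of _ _ "(Y, X, \<lambda>p \<in> Ops P. \<lambda>x \<in> Sect Y p. ?c p x)"])
    show "Compose ?A (Y, X, \<lambda>p \<in> Ops P. \<lambda>x \<in> Sect Y p. ?c p x) (X, Y, \<lambda>p \<in> Ops P. \<lambda>x \<in> Sect X p. b p x)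
      = Ident ?A (Dom ?A (X, Y, \<lambda>p \<in> Ops P. \<lambda>x \<in> Sect X p. b p x))"
      using l b_mem by (simp add: decomposition_spaces_def full_subcategory_def presheaf_category_def Tw_def compose_def fun_eq_iff restrict_def)
    show "Compose ?A (X, Y, \<lambda>p \<in> Ops P. \<lambda>x \<in> Sect X p. b p x) (Y, X, \<lambda>p \<in> Ops P. \<lambda>x \<in> Sect Y p. ?c p x)
      = Ident ?A (Cod ?A (X, Y, \<lambda>p \<in> Ops P. \<lambda>x \<in> Sect X p. b p x))"
      using r I.b_mem by (simp add: decomposition_spaces_def full_subcategory_def presheaf_category_def Tw_def compose_def fun_eq_iff restrict_def)
  qed (use X Y p m in \<open>simp_all add: decomposition_spaces_def full_subcategory_def presheaf_category_def\<close>)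
qed

end

section \<open>The fibre functor and its properties\<close>

context operad
begin

abbreviation "DS \<equiv> decomposition_spaces P"
abbreviation "DM \<equiv> decomposition_morphisms P"

lemma category_decomposition_spaces: "category DS"
  unfolding decomposition_spaces_def by (intro category_full_subcategory category_presheaf_category tw_category)

lemma category_decomposition_morphisms: "category DM"
  unfolding decomposition_morphisms_def by (intro category_full_subcategory category_operads_over operad_axioms)

lemma decompositionI: "operad Q \<Longrightarrow> F \<in> operad_maps Q P \<Longrightarrow> decomposition_morphism Q P F \<Longrightarrow> decomposition Q P F"
  by (simp add: decomposition_def decomposition_axioms_def operad_morphism_def operad_morphism_axioms_def operad_axioms decomposition_morphism_def)

lemma morphism_obj: "(Q, F) \<in> Obj DM \<longleftrightarrow> decomposition Q P F" using decompositionI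
  by (auto simp: decomposition_morphisms_def full_subcategory_def operads_over_def decomposition_morphism_def decomposition_def
      decomposition_axioms_def operad_morphism_def operad_morphism_axioms_def)

lemma morphism_arr: "((Q, F), (R, G), h) \<in> Arr DM \<longleftrightarrow>
    decomposition Q P F \<and> decomposition R P G \<and> h \<in> operad_maps Q R \<and> operad_map_comp Q G h = F"
  by (auto simp: decomposition_morphisms_def full_subcategory_def operads_over_def decomposition_morphism_def decomposition_def
      decomposition_axioms_def operad_morphism_def operad_morphism_axioms_def operad_axioms)

lemma morphism_simps: "Dom DM (A, B, h) = A" "Cod DM (A, B, h) = B"
  "Ident DM A = (A, A, operad_map_id (fst A))"
  "Compose DM (B, D, k) (A, B, h) = (A, D, operad_map_comp (fst A) k h)"
  by (simp_all add: decomposition_morphisms_def full_subcategory_def operads_over_def)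

lemma space_obj: "X \<in> Obj DS \<longleftrightarrow> decomposition_space P X"
  by (auto simp: decomposition_spaces_def full_subcategory_def presheaf_category_def decomposition_space_def)

lemma space_arr: "(X, Y, \<alpha>) \<in> Arr DS \<longleftrightarrow>
    decomposition_space P X \<and> decomposition_space P Y \<and> \<alpha> \<in> presheaf_maps (Tw P) X Y"
  by (auto simp: decomposition_spaces_def full_subcategory_def presheaf_category_def decomposition_space_def)

lemma space_simps: "Dom DS (X, Y, \<alpha>) = X" "Cod DS (X, Y, \<alpha>) = Y"
  "Ident DS X = (X, X, \<lambda>a \<in> Ops P. \<lambda>x \<in> Sect X a. x)"
  "Compose DS (Y, Z, \<beta>) (X, Y, \<alpha>) = (X, Z, \<lambda>a \<in> Ops P. compose (Sect X a) (\<beta> a) (\<alpha> a))"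
  by (simp_all add: decomposition_spaces_def full_subcategory_def presheaf_category_def Tw_def)

definition fibre_obj :: "('c, 'o, 'u) operad_over \<Rightarrow> ('o, 'o tw_arr, 'u) presheaf" where
  "fibre_obj = (\<lambda>(Q, F). fibre_presheaf Q P F)"

definition fibre_arr :: "('c, 'o, 'u) operad_over_arr \<Rightarrow> ('o, 'o tw_arr, 'u) presheaf_arr" where
  "fibre_arr = (\<lambda>((Q, F), B, h). (fibre_presheaf Q P F, fibre_obj B, fibre_map Q P F h))"

lemma fibre_functor: "functor_between DM DS fibre_obj fibre_arr" unfolding functor_between_def
proof (intro conjI ballI impI)
  fix A :: "('c, 'o, 'u) operad_over" assume A: "A \<in> Obj DM"
  obtain Q F where QF: "A = (Q, F)" by (cases A)
  then interpret decomposition Q P F using A by (simp add: morphism_obj)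
  show "fibre_obj A \<in> Obj DS" using fibre_decomposition_space by (simp add: space_obj fibre_obj_def QF)
  show "fibre_arr (Ident DM A) = Ident DS (fibre_obj A)"
    by (auto simp: fibre_arr_def fibre_obj_def morphism_simps space_simps QF fibre_map_def operad_map_id_def fun_eq_iff restrict_def)
next
  fix m :: "('c, 'o, 'u) operad_over_arr" assume m: "m \<in> Arr DM"
  obtain Q F R G h where mm: "m = ((Q, F), (R, G), h)" by (metis prod_cases3 surj_pair)
  have d: "decomposition Q P F" "decomposition R P G" "h \<in> operad_maps Q R" "operad_map_comp Q G h = F" using m by (simp_all add: morphism_arr mm)
  interpret A: decomposition_pair Q P F R G using d by (intro decomposition_pair.intro)
  show "fibre_arr m \<in> Arr DS"
    using A.fibre_map_mem[OF d(3,4)] A.A.fibre_decomposition_space A.B.fibre_decomposition_space by (simp add: fibre_arr_def fibre_obj_def mm space_arr)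
  show "Dom DS (fibre_arr m) = fibre_obj (Dom DM m)"
    "Cod DS (fibre_arr m) = fibre_obj (Cod DM m)" by (simp_all add: fibre_arr_def fibre_obj_def mm space_simps morphism_simps)
  fix n assume n: "n \<in> Arr DM" "Dom DM n = Cod DM m"
  obtain S H k where nn: "n = ((R, G), (S, H), k)" using n(2) by (metis mm morphism_simps(1,2) prod_cases3 surj_pair)
  interpret H: operad_morphism Q R h by (intro operad_morphism.intro A.A.Q.operad_axioms A.B.Q.operad_axioms) (simp add: operad_morphism_axioms_def d)
  have "op_map h q \<in> Ops R \<and> op_map G (op_map h q) = op_map F q" if "q \<in> Ops Q" for q
    using that H.F_Op d(4)[symmetric] by (simp add: operad_map_comp_def compose_def)
  then have "fibre_map Q P F (operad_map_comp Q k h)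
    = (\<lambda>a \<in> Ops P. compose {q \<in> Ops Q. op_map F q = a} (fibre_map R P G k a) (fibre_map Q P F h a))"
    by (auto simp: fibre_map_def operad_map_comp_def compose_def fun_eq_iff restrict_def)
  then show "fibre_arr (Compose DM n m) = Compose DS (fibre_arr n) (fibre_arr m)"
    by (simp add: fibre_arr_def fibre_obj_def mm nn space_simps morphism_simps)
qed

lemma fibre_full_faithful:
  fixes A B :: "('c, 'o, 'u) operad_over"
  assumes A: "A \<in> Obj DM" and B: "B \<in> Obj DM"
    and m: "m \<in> Arr DS" "Dom DS m = fibre_obj A" "Cod DS m = fibre_obj B"
  shows "\<exists>!f. f \<in> Arr DM \<and> Dom DM f = A \<and> Cod DM f = B \<and> fibre_arr f = m"
proof -
  obtain Q F R G where AB: "A = (Q, F)" "B = (R, G)" by (metis surj_pair)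
  have d: "decomposition Q P F" "decomposition R P G" using A B by (simp_all add: AB morphism_obj)
  interpret D: decomposition_pair Q P F R G using d by (intro decomposition_pair.intro)
  obtain \<alpha> where \<alpha>: "m = (fibre_presheaf Q P F, fibre_presheaf R P G, \<alpha>)"
    using m(2,3) by (metis AB fibre_obj_def case_prod_conv prod_cases3 space_simps(1,2))
  have "\<alpha> \<in> presheaf_maps (Tw P) (fibre_presheaf Q P F) (fibre_presheaf R P G)" using m(1) by (simp add: \<alpha> space_arr)
  then obtain h where h: "h \<in> operad_maps Q R" "operad_map_comp Q G h = F" "fibre_map Q P F h = \<alpha>" by (rule D.full)
  show ?thesis
  proof (rule ex1I[of _ "(A, B, h)"])
    show "(A, B, h) \<in> Arr DM \<and> Dom DM (A, B, h) = A \<and>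
        Cod DM (A, B, h) = B \<and> fibre_arr (A, B, h) = m"
      using d h by (simp add: AB morphism_arr morphism_simps fibre_arr_def fibre_obj_def \<alpha>)
    fix f assume f: "f \<in> Arr DM \<and> Dom DM f = A \<and>
        Cod DM f = B \<and> fibre_arr f = m"
    obtain h' where h': "f = ((Q, F), (R, G), h')" using f by (metis AB morphism_simps(1,2) prod_cases3)
    have "h' \<in> operad_maps Q R" "fibre_map Q P F h' = \<alpha>" using f by (simp_all add: h' morphism_arr fibre_arr_def \<alpha>)
    then have "h' = h" using D.faithful[OF _ h(1)] h(3) by simp
    then show "f = (A, B, h)" by (simp add: h' AB)
  qed
qed

text \<open>\<open>X\<close> is replaced by an isomorphic presheaf \<open>Y\<close> with disjoint
  sections, to which the operad of elements applies. The tagging uses a pairing on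
  \<open>'u\<close>, available because \<open>'u\<close> is infinite, and the names that
  \<open>e\<close> gives to operations.\<close>

lemma fibre_surjective:
  fixes X :: "('o, 'o tw_arr, 'u) presheaf" and e :: "'o \<Rightarrow> 'u"
  assumes inf: "infinite (UNIV :: 'u set)" and e: "inj_on e (Ops P)" and X: "decomposition_space P X"
  shows "\<exists>A \<in> Obj DM. \<exists>i. iso DS i \<and>
    Dom DS i = X \<and> Cod DS i = fibre_obj A"
proof -
  have "\<exists>c. bij_betw c ((UNIV :: 'u set) \<times> (UNIV :: 'u set)) (UNIV :: 'u set)"
    using card_of_Times_same_infinite[OF inf] unfolding card_of_ordIso .
  then obtain c :: "'u \<times> 'u \<Rightarrow> 'u" where c: "inj c" by (auto simp: bij_betw_def)
  \<comment> \<open>make the sections over different operations disjoint\<close>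
  define code where "code p x = c (e p, x)" for p x
  have inj: "p = p' \<and> x = x'" if "code p x = code p' x'" "p \<in> Ops P" "p' \<in> Ops P" for p x p' x'
    using injD[OF c that(1)[unfolded code_def]] inj_onD[OF e _ that(2,3)] by simp
  define pr where "pr u = (THE p. p \<in> Ops P \<and> (\<exists>x. u = code p x))" for u
  define va where "va u = (THE x. u = code (pr u) x)" for u
  have pr: "pr (code p x) = p" if "p \<in> Ops P" for p x unfolding pr_def by (rule the_equality) (use inj that in blast)+
  have va: "va (code p x) = x" if "p \<in> Ops P" for p x unfolding va_def pr[OF that] by (rule the_equality) (use inj that in blast)+
  define Y where "Y = \<lparr>Sect = (\<lambda>p. code p ` Sect X p), Restr = (\<lambda>f u. code (src f) (Restr X f (va u)))\<rparr>"
  interpret T: presheaf_transport P X Y code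
  proof unfold_locales
    show "bij_betw (code p) (Sect X p) (Sect Y p)" if "p \<in> Ops P" for p
      unfolding bij_betw_def using inj[OF _ that that] by (simp add: Y_def) (blast intro: inj_onI)
    show "Restr Y f (code (tgt f) x) = code (src f) (Restr X f x)"
      if "f \<in> arrs" "x \<in> Sect X (tgt f)" for f x using va[OF arrow_target(1)[OF that(1)]] by (simp add: Y_def)
  qed
  interpret E: elements P Y pr
  proof unfold_locales
    show "decomposition_space P Y" by (rule T.decomposition_space_transport[OF X])
    show "pr u = p" if "p \<in> Ops P" "u \<in> Sect Y p" for p u using that pr by (auto simp: Y_def)
  qed
  let ?Z = "fibre_presheaf E.Q P E.F"
  \<comment> \<open>The fibre presheaf of the operad of elements has the sections and restrictions
    of \<open>Y\<close>, so the tagging itself is the isomorphism from \<open>X\<close>.\<close>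
  interpret Z: presheaf_transport P X ?Z code
  proof unfold_locales
    show "bij_betw (code p) (Sect X p) (Sect ?Z p)" if "p \<in> Ops P" for p unfolding E.fibre_Sect[OF that] by (rule T.bij[OF that])
    show "Restr ?Z f (code (tgt f) x) = code (src f) (Restr X f x)"
      if f: "f \<in> arrs" "x \<in> Sect X (tgt f)" for f x using E.fibre_Restr[OF f(1) T.b_mem[OF arrow_target(1)[OF f(1)] f(2)]] T.nat[OF f] by simp
  qed
  have "(E.Q, E.F) \<in> Obj DM" using E.D.decomposition_axioms by (simp add: morphism_obj)
  moreover have "Dom DS (X, ?Z, \<lambda>p \<in> Ops P. \<lambda>x \<in> Sect X p. code p x) = X"
    "Cod DS (X, ?Z, \<lambda>p \<in> Ops P. \<lambda>x \<in> Sect X p. code p x) = fibre_obj (E.Q, E.F)" by (simp_all add: space_simps fibre_obj_def)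
  ultimately show ?thesis using Z.transport_iso[OF X] by blast
qed

end

text \<open>The assumptions on \<open>'u\<close> say that the universe is infinite and has room for
  the operations of \<open>P\<close>; together they ensure that all elements of a presheaf, over all
  operations at once, fit into \<open>'u\<close>. The fibre functor itself runs from decomposition
  morphisms to decomposition spaces.\<close>

theorem corollary3p36:
  fixes P :: "('c, 'o) operad"
  assumes "operad P"
    and "infinite (UNIV :: 'u set)"
    and "\<exists>e :: 'o \<Rightarrow> 'u. inj_on e (Ops P)"
  shows "equivalent_categories
    (decomposition_spaces P ::
      (('o, 'o tw_arr, 'u) presheaf, ('o, 'o tw_arr, 'u) presheaf_arr) category)
    (decomposition_morphisms P ::
      (('c, 'o, 'u) operad_over, ('c, 'o, 'u) operad_over_arr) category)"
proof -
  interpret operad P by fact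
  obtain e :: "'o \<Rightarrow> 'u" where e: "inj_on e (Ops P)" using assms(3) by blast
  show ?thesis
  proof (rule equivalence_if_ff_eso[OF category_decomposition_spaces category_decomposition_morphisms fibre_functor])
    fix X :: "('o, 'o tw_arr, 'u) presheaf" assume "X \<in> Obj (decomposition_spaces P)"
    then show "\<exists>A \<in> Obj (decomposition_morphisms P). \<exists>i. iso (decomposition_spaces P) i \<and>
      Dom (decomposition_spaces P) i = X \<and> Cod (decomposition_spaces P) i = fibre_obj A"
      using fibre_surjective[OF assms(2) e] by (simp add: space_obj)
  qed (rule fibre_full_faithful)
qed

end
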